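(* Let $n,k$ be positive integers and $\epsilon\in(0,1)$ with $k/\epsilon \le n/16$, and let $C_L > 1$ be a fixed constant. There exists a randomized construction of a matrix $\Phi \in \mathbb{R}^{m \times n}$ with $m = O(\epsilon^{-1}k \log(\epsilon n/k))$ and column sparsity $O(\log(\epsilon n/k))$ such that, for every fixed $x\in\mathbb{R}^n$, given $y = \Phi x$ one can find in time $O(m \log( n/k) )$ a set $L \subseteq [n]$ of size $C_L \cdot k/\epsilon$ such that, with probability $9/10$, \[ \exists\, T \subset L,\ |T| \leq k:\quad \|x - x_T \|_2 \leq ( 1+\epsilon) \|x_{-k}\|_2 . \]
   Context: For $x\in\mathbb{R}^n$, $H(x,k)$ denotes the set of indices of the $k$ largest-magnitude coordinates of $x$; for $S\subseteq[n]$, $x_S$ is the vector obtained from $x$ by zeroing out all coordinates outside $S$; $x_{-k} = x_{[n]\setminus H(x,k)}$. Column sparsity is the maximum number of nonzero entries in a column. *)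

theory Defs
  imports "HOL-Probability.Probability"
begin

section \<open>Vectors and best sparse approximation\<close>

text \<open>
  A vector of length \<open>n\<close> is a function \<open>nat \<Rightarrow> real\<close> of which only the values on \<open>{..<n}\<close> matter;
  its Euclidean norm is \<^term>\<open>L2_set x {..<n}\<close>.
\<close>

definition zero_outside :: "nat set \<Rightarrow> (nat \<Rightarrow> real) \<Rightarrow> nat \<Rightarrow> real" where
  "zero_outside S x = (\<lambda>i. if i \<in> S then x i else 0)"

text \<open>
  The sort is stable, so ties in magnitude are broken in favour of the smaller index.
\<close>

definition head :: "nat \<Rightarrow> (nat \<Rightarrow> real) \<Rightarrow> nat \<Rightarrow> nat set" where
  "head n x k = set (take k (sort_key (\<lambda>i. - \<bar>x i\<bar>) [0..<n]))"

definition tail :: "nat \<Rightarrow> (nat \<Rightarrow> real) \<Rightarrow> nat \<Rightarrow> nat \<Rightarrow> real" where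
  "tail n x k = zero_outside ({..<n} - head n x k) x"

section \<open>Random matrices\<close>

text \<open>
  An \<open>m \<times> n\<close> matrix is a function on pairs \<open>(row, column)\<close>, and a random matrix is given by its law,
  a probability measure on the Borel sets of the \<open>m \<times> n\<close> matrices.
\<close>

type_synonym matrix = "nat \<times> nat \<Rightarrow> real"

definition random_matrix :: "nat \<Rightarrow> nat \<Rightarrow> matrix measure \<Rightarrow> bool" where
  "random_matrix m n D \<longleftrightarrow>
     prob_space D \<and> sets D = sets (Pi\<^sub>M ({..<m} \<times> {..<n}) (\<lambda>_. borel :: real measure))"

definition matvec :: "nat \<Rightarrow> matrix \<Rightarrow> (nat \<Rightarrow> real) \<Rightarrow> nat \<Rightarrow> real" where
  "matvec n \<Phi> x = (\<lambda>i. \<Sum>j<n. \<Phi> (i, j) * x j)"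

definition column_sparsity :: "nat \<Rightarrow> nat \<Rightarrow> matrix \<Rightarrow> nat" where
  "column_sparsity m n \<Phi> = Max ((\<lambda>j. card {i. i < m \<and> \<Phi> (i, j) \<noteq> 0}) ` {..<n})"

text \<open>
  As for \<^term>\<open>AE \<omega> in D. Q \<omega>\<close>, the predicate \<open>Q\<close> itself need not define a measurable set: it has
  to hold throughout some event of probability at least \<open>p\<close>.
\<close>

definition holds_with_prob :: "'a measure \<Rightarrow> real \<Rightarrow> ('a \<Rightarrow> bool) \<Rightarrow> bool" where
  "holds_with_prob D p Q \<longleftrightarrow> (\<exists>E\<in>sets D. p \<le> measure D E \<and> (\<forall>\<omega>\<in>E. Q \<omega>))"

section \<open>Machine model and running time\<close>

text \<open>
  Running time is measured on a real RAM with word-sized integers. The memory consists of arrays of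
  natural numbers and arrays of reals, both indexed by natural numbers. Array names are literals of
  the program; a scalar variable is an array used at index 0 only. On naturals the machine
  has the usual word operations (subtraction is truncated), on reals the field operations and
  comparison. There are no real literals and no conversion from reals to naturals (no rounding);
  the latter would let exact real arithmetic simulate unbounded parallelism.

  Every assignment and every evaluation of a branching condition costs one time unit. Since
  expressions are part of the fixed program, this agrees up to a constant factor with
  counting individual operations. The parameter \<open>W\<close> of the semantics bounds the naturals that may
  be stored: a program that tries to store a larger one is stuck. With \<open>W\<close> polynomial in the
  input size this is the usual word length \<open>O(log n)\<close>; the values arising inside an
  expression are then polynomially bounded as well.
\<close>

datatype nexp =
    NLit nat
  | NGet nat nexp
  | NAdd nexp nexp | NSub nexp nexp | NMul nexp nexp | NDiv nexp nexp | NMod nexp nexp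

datatype rexp =
    OfNat nexp
  | RGet nat nexp
  | RAdd rexp rexp | RSub rexp rexp | RMul rexp rexp | RDiv rexp rexp

datatype bexp =
    NLess nexp nexp
  | RLess rexp rexp
  | BNot bexp
  | BAnd bexp bexp

datatype com =
    Skip
  | NPut nat nexp nexp  \<comment> \<open>array, index, new content\<close>
  | RPut nat nexp rexp
  | Seq com com
  | Cond bexp com com
  | While bexp com

record memory =
  nmem :: "nat \<Rightarrow> nat \<Rightarrow> nat"
  rmem :: "nat \<Rightarrow> nat \<Rightarrow> real"

primrec nval :: "nexp \<Rightarrow> memory \<Rightarrow> nat" where
  "nval (NLit v) s = v"
| "nval (NGet a i) s = nmem s a (nval i s)"
| "nval (NAdd e f) s = nval e s + nval f s"
| "nval (NSub e f) s = nval e s - nval f s"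
| "nval (NMul e f) s = nval e s * nval f s"
| "nval (NDiv e f) s = nval e s div nval f s"
| "nval (NMod e f) s = nval e s mod nval f s"

primrec rval :: "rexp \<Rightarrow> memory \<Rightarrow> real" where
  "rval (OfNat e) s = real (nval e s)"
| "rval (RGet a i) s = rmem s a (nval i s)"
| "rval (RAdd e f) s = rval e s + rval f s"
| "rval (RSub e f) s = rval e s - rval f s"
| "rval (RMul e f) s = rval e s * rval f s"
| "rval (RDiv e f) s = rval e s / rval f s"

primrec bval :: "bexp \<Rightarrow> memory \<Rightarrow> bool" where
  "bval (NLess e f) s \<longleftrightarrow> nval e s < nval f s"
| "bval (RLess e f) s \<longleftrightarrow> rval e s < rval f s"
| "bval (BNot b) s \<longleftrightarrow> \<not> bval b s"
| "bval (BAnd b d) s \<longleftrightarrow> bval b s \<and> bval d s"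

definition nput :: "nat \<Rightarrow> nat \<Rightarrow> nat \<Rightarrow> memory \<Rightarrow> memory" where
  "nput a i v s = s\<lparr>nmem := (nmem s)(a := (nmem s a)(i := v))\<rparr>"

definition rput :: "nat \<Rightarrow> nat \<Rightarrow> real \<Rightarrow> memory \<Rightarrow> memory" where
  "rput a i v s = s\<lparr>rmem := (rmem s)(a := (rmem s a)(i := v))\<rparr>"

text \<open>\<open>exec W c s t s'\<close>: started in memory \<open>s\<close>, \<open>c\<close> halts after \<open>t\<close> time units in memory \<open>s'\<close>.\<close>

inductive exec :: "nat \<Rightarrow> com \<Rightarrow> memory \<Rightarrow> nat \<Rightarrow> memory \<Rightarrow> bool" for W where
  Skip: "exec W Skip s 1 s"
| NPut: "nval e s \<le> W \<Longrightarrow> exec W (NPut a i e) s 1 (nput a (nval i s) (nval e s) s)"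
| RPut: "exec W (RPut a i e) s 1 (rput a (nval i s) (rval e s) s)"
| Seq: "exec W c s t s' \<Longrightarrow> exec W d s' t' s'' \<Longrightarrow> exec W (Seq c d) s (t + t') s''"
| CondTrue: "bval b s \<Longrightarrow> exec W c s t s' \<Longrightarrow> exec W (Cond b c d) s (Suc t) s'"
| CondFalse: "\<not> bval b s \<Longrightarrow> exec W d s t s' \<Longrightarrow> exec W (Cond b c d) s (Suc t) s'"
| WhileFalse: "\<not> bval b s \<Longrightarrow> exec W (While b c) s 1 s"
| WhileTrue: "bval b s \<Longrightarrow> exec W c s t s' \<Longrightarrow> exec W (While b c) s' t' s'' \<Longrightarrow>
    exec W (While b c) s (Suc (t + t')) s''"

inductive_cases SkipE: "exec W Skip s t s'"
inductive_cases NPutE: "exec W (NPut a i e) s t s'"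
inductive_cases RPutE: "exec W (RPut a i e) s t s'"
inductive_cases SeqE: "exec W (Seq c d) s t s'"
inductive_cases CondE: "exec W (Cond b c d) s t s'"
inductive_cases WhileE: "exec W (While b c) s t s'"

lemma exec_deterministic:
  "exec W c s t s' \<Longrightarrow> exec W c s u r \<Longrightarrow> u = t \<and> r = s'"
proof (induction arbitrary: u r rule: exec.induct)
  case Skip
  then show ?case by (auto elim: SkipE)
next
  case NPut
  from NPut.prems show ?case by (auto elim: NPutE)
next
  case RPut
  then show ?case by (auto elim: RPutE)
next
  case Seq
  from Seq.prems show ?case by (rule SeqE) (use Seq.IH in blast)
next
  case CondTrue
  from CondTrue.prems show ?case by (rule CondE) (use CondTrue in blast)+
next
  case CondFalse
  from CondFalse.prems show ?case by (rule CondE) (use CondFalse in blast)+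
next
  case WhileFalse
  from WhileFalse.prems show ?case by (rule WhileE) (use WhileFalse.hyps in auto)
next
  case WhileTrue
  from WhileTrue.prems show ?case by (rule WhileE) (use WhileTrue.hyps WhileTrue.IH in blast)+
qed

section \<open>The recovery problem on the machine\<close>

text \<open>
  The decoder knows the parameters, the measurement vector and the matrix. The matrix is stored
  in compressed sparse column format: the positions of its nonzero entries are
  enumerated column by column, with increasing row index inside each column.
\<close>

definition column_nonzeros :: "nat \<Rightarrow> matrix \<Rightarrow> nat \<Rightarrow> (nat \<times> nat) list" where
  "column_nonzeros m \<Phi> j = [(i, j). i \<leftarrow> [0..<m], \<Phi> (i, j) \<noteq> 0]"

definition nonzeros :: "nat \<Rightarrow> nat \<Rightarrow> matrix \<Rightarrow> (nat \<times> nat) list" where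
  "nonzeros m n \<Phi> = concat (map (column_nonzeros m \<Phi>) [0..<n])"

definition array_of :: "'a::zero list \<Rightarrow> nat \<Rightarrow> 'a" where
  "array_of xs = (\<lambda>i. if i < length xs then xs ! i else 0)"

text \<open>
  Layout of the input. In natural array 1, cells \<open>j\<close> and \<open>j + 1\<close> delimit the part of the arrays of
  row indices and of entries that belongs to column \<open>j\<close>. All other cells are 0.
\<close>

definition input :: "nat \<Rightarrow> nat \<Rightarrow> nat \<Rightarrow> real \<Rightarrow> real \<Rightarrow> matrix \<Rightarrow> (nat \<Rightarrow> real) \<Rightarrow> memory" where
  "input n k m \<epsilon> C \<Phi> y =
    \<lparr>nmem = (\<lambda>_ _. 0)
       (0 := array_of [n, k, m],
        1 := array_of (map (\<lambda>j. length (nonzeros m j \<Phi>)) [0..<Suc n]),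
        2 := array_of (map fst (nonzeros m n \<Phi>))),
     rmem = (\<lambda>_ _. 0)
       (0 := array_of [\<epsilon>, C],
        1 := array_of (map y [0..<m]),
        2 := array_of (map \<Phi> (nonzeros m n \<Phi>)))\<rparr>"

text \<open>The result is a list of indices in natural array 4, whose length is in cell 0 of array 3.\<close>

definition output_set :: "memory \<Rightarrow> nat set" where
  "output_set s = nmem s 4 ` {..<nmem s 3 0}"

definition finds ::
  "nat \<Rightarrow> com \<Rightarrow> memory \<Rightarrow> nat \<Rightarrow> nat set \<Rightarrow> bool" where
  "finds W P s t L \<longleftrightarrow> (\<exists>s'. exec W P s t s' \<and> output_set s' = L)"

end

(*
  Put K = k/eps and E = |tail x|^2 = K th^2. The coordinates are searched through a tree of depth D
  and branching 2^a, whose nodes at level l are residue classes modulo B b^l, B = O(K). At every level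
  the nodes are hashed 2a times into B buckets, and a coordinate enters a bucket with a random sign and
  a random factor from a fine grid on [1,2). The noise in a bucket is typically O(th), while the random
  factors spread the sum of a node with a coordinate far above th, so that it rarely cancels
  (small-ball estimate). A threshold is obtained by probing bucket 0 of u further hashings: nodes whose
  median measurement exceeds the median probe survive. The number of survivors stays below 2B, whereas
  the head coordinates that get lost carry energy only O(k th^2) in expectation. Taking the median of
  2a repetitions makes the failure probability exponential in a, which pays for the branching and
  for the D levels; since 2^a a = O(lg) and D a = O(lg), where lg = log(n/K), the running time
  is O(m lg).

  Among the survivors those with the largest scores are returned. Sorting would be too slow, so a
  constant number of random pivots is stored in the matrix and the best admissible one is used; it
  is close to the desired rank with high probability because C_L > 1 leaves a gap of order K.

  A missed head entry is charged to an element of L outside the head: L has at least c K of these,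
  so one of them is O(th); since its score is at least that of the missed entry, exchanging the two
  changes the squared error by a small multiple of th^2, hence by at most k th^2 = eps E in total.
*)
theory Submission
  imports Defs
begin

section \<open>Finitely supported distributions\<close>

text \<open>The decoder does not know \<open>\<theta>\<close>, hence the probes. If \<open>q\<close>
  is an upper quantile of the content of a bucket, then only \<open>B\<close> nodes can exceed
  \<open>q\<close> often by themselves, since otherwise the bucket would exceed it too often. A
  threshold read off from the buckets therefore limits the survivors for every signal; the tail
  enters only in bounding that threshold by a multiple of \<open>\<theta>\<close>. A head entry of
  size r \<theta> dies at one level with probability about (c/r)^a. As \<open>a\<close> \<ge> 4,
  this decays faster than 1/r^2, so the expected lost energy does not grow with r. The finite grid
  spoils this for r beyond the order of \<open>M\<close>; such entries are covered by a union bound,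
  with \<open>M\<close> a large multiple of \<open>n\<close>. All random choices have finite
  support, so means are finite sums and every set of possible matrices is measurable. Candidate
  lists are cut off at 2 B, so the time bound holds for every outcome. The exponent \<open>a\<close>
  is about the base-4 logarithm of lg: then \<open>D\<close> \<le> 4^a, and a union bound over the
  levels multiplies the base of an a-th power by only 4, the branching by only 2.\<close>

definition Pr :: "'a pmf \<Rightarrow> ('a \<Rightarrow> bool) \<Rightarrow> real" where
  "Pr p Q = measure_pmf.prob p {x. Q x}"

text \<open>A finite sum, so linearity and exchange of sums need no integrability. It is the
  expectation only for finite support, hence the finiteness premises below.\<close>

definition Mean :: "'a pmf \<Rightarrow> ('a \<Rightarrow> real) \<Rightarrow> real" where
  "Mean p f = (\<Sum>x\<in>set_pmf p. pmf p x * f x)"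

lemma Pr_nonneg [simp]: "0 \<le> Pr p Q"
  by (simp add: Pr_def)

lemma Pr_mono: "(\<And>x. x \<in> set_pmf p \<Longrightarrow> Q x \<Longrightarrow> S x) \<Longrightarrow> Pr p Q \<le> Pr p S"
  unfolding Pr_def by (rule measure_pmf.finite_measure_mono_AE) (auto simp: AE_measure_pmf_iff)

lemma Pr_cong: "(\<And>x. x \<in> set_pmf p \<Longrightarrow> Q x = S x) \<Longrightarrow> Pr p Q = Pr p S"
  by (intro antisym Pr_mono) auto

lemma Pr_True: "(\<And>x. x \<in> set_pmf p \<Longrightarrow> Q x) \<Longrightarrow> Pr p Q = 1"
  unfolding Pr_def by (rule measure_pmf.prob_eq_1[THEN iffD2]) (auto simp: AE_measure_pmf_iff)

lemma Pr_False: "(\<And>x. x \<in> set_pmf p \<Longrightarrow> \<not> Q x) \<Longrightarrow> Pr p Q = 0"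
  using Pr_mono[of p Q "\<lambda>_. False"] Pr_nonneg[of p Q] by (simp add: Pr_def order_antisym)

lemma Pr_disj_le: "Pr p (\<lambda>x. Q x \<or> S x) \<le> Pr p Q + Pr p S"
  unfolding Pr_def Collect_disj_eq by (rule measure_Un_le) auto

lemma Pr_bex_le: "finite I \<Longrightarrow> Pr p (\<lambda>x. \<exists>i\<in>I. Q i x) \<le> (\<Sum>i\<in>I. Pr p (Q i))"
proof (induction I rule: finite_induct)
  case empty
  then show ?case by (simp add: Pr_def)
next
  case (insert i I)
  have "Pr p (\<lambda>x. \<exists>j\<in>insert i I. Q j x) = Pr p (\<lambda>x. Q i x \<or> (\<exists>j\<in>I. Q j x))" by simp
  also have "\<dots> \<le> Pr p (Q i) + Pr p (\<lambda>x. \<exists>j\<in>I. Q j x)" by (rule Pr_disj_le)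
  finally show ?case using insert by simp
qed

lemma Pr_bex_le_const:
  assumes "finite I" "\<And>i. i \<in> I \<Longrightarrow> Pr p (Q i) \<le> c"
  shows "Pr p (\<lambda>x. \<exists>i\<in>I. Q i x) \<le> real (card I) * c"
  using Pr_bex_le[OF assms(1), of p Q] sum_bounded_above[of I "\<lambda>i. Pr p (Q i)" c] assms(2) by auto

lemma Pr_disjoint_sum:
  assumes "finite I" "\<And>i j x. i \<in> I \<Longrightarrow> j \<in> I \<Longrightarrow> Q i x \<Longrightarrow> Q j x \<Longrightarrow> i = j"
  shows "Pr p (\<lambda>x. \<exists>i\<in>I. Q i x) = (\<Sum>i\<in>I. Pr p (Q i))"
proof -
  have "measure_pmf.prob p (\<Union>i\<in>I. {x. Q i x}) = (\<Sum>i\<in>I. measure_pmf.prob p {x. Q i x})"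
    using assms by (intro measure_pmf.finite_measure_finite_Union) (auto simp: disjoint_family_on_def)
  moreover have "(\<Union>i\<in>I. {x. Q i x}) = {x. \<exists>i\<in>I. Q i x}" by auto
  ultimately show ?thesis by (simp add: Pr_def)
qed

lemma Pr_not: "Pr p (\<lambda>x. \<not> Q x) = 1 - Pr p Q"
proof -
  have "measure_pmf.prob p (UNIV - {x. Q x}) = 1 - measure_pmf.prob p {x. Q x}"
    using measure_pmf.prob_compl[of "{x. Q x}" p] by simp
  then show ?thesis by (simp add: Pr_def set_diff_eq)
qed

lemma Pr_map: "Pr (map_pmf f p) Q = Pr p (\<lambda>x. Q (f x))"
  by (simp add: Pr_def vimage_def)

lemma Pr_of_set: "finite A \<Longrightarrow> A \<noteq> {} \<Longrightarrow> Pr (pmf_of_set A) Q = real (card {x\<in>A. Q x}) / real (card A)"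
  by (simp add: Pr_def measure_pmf_of_set Int_def)

lemma Mean_eq_expectation: "finite (set_pmf p) \<Longrightarrow> Mean p f = measure_pmf.expectation p f"
  unfolding Mean_def by (subst integral_measure_pmf[of "set_pmf p"]) auto

lemma Pr_eq_Mean: "finite (set_pmf p) \<Longrightarrow> Pr p Q = Mean p (\<lambda>x. of_bool (Q x))"
proof -
  assume f: "finite (set_pmf p)"
  have "(\<lambda>x. of_bool (Q x)) = indicat_real {x. Q x}" by (auto simp: indicator_def)
  then have "Mean p (\<lambda>x. of_bool (Q x)) = measure_pmf.expectation p (indicat_real {x. Q x})"
    by (simp only: Mean_eq_expectation f)
  then show ?thesis by (simp add: Pr_def)
qed

lemma Mean_mono: "(\<And>x. x \<in> set_pmf p \<Longrightarrow> f x \<le> g x) \<Longrightarrow> Mean p f \<le> Mean p g"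
  unfolding Mean_def by (intro sum_mono mult_left_mono) auto

lemma Mean_cong: "(\<And>x. x \<in> set_pmf p \<Longrightarrow> f x = g x) \<Longrightarrow> Mean p f = Mean p g"
  unfolding Mean_def by (intro sum.cong) auto

lemma Mean_const: "finite (set_pmf p) \<Longrightarrow> Mean p (\<lambda>_. c) = c"
  unfolding Mean_def by (simp add: sum_distrib_right[symmetric] sum_pmf_eq_1)

lemma Mean_cmult: "Mean p (\<lambda>x. c * f x) = c * Mean p f"
  unfolding Mean_def by (simp add: sum_distrib_left mult_ac)

lemma Mean_sum: "Mean p (\<lambda>x. \<Sum>i\<in>I. f i x) = (\<Sum>i\<in>I. Mean p (f i))"
  unfolding Mean_def by (simp add: sum_distrib_left sum.swap[of _ _ I])

lemma Mean_nonneg: "(\<And>x. x \<in> set_pmf p \<Longrightarrow> 0 \<le> f x) \<Longrightarrow> 0 \<le> Mean p f"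
  unfolding Mean_def by (intro sum_nonneg) auto

lemma Pr_markov:
  assumes "finite (set_pmf p)" "\<And>x. x \<in> set_pmf p \<Longrightarrow> 0 \<le> f x" "Mean p f \<le> e" "0 < t"
  shows "Pr p (\<lambda>x. t \<le> f x) \<le> e / t"
proof -
  have "t * Pr p (\<lambda>x. t \<le> f x) = Mean p (\<lambda>x. t * of_bool (t \<le> f x))"
    by (simp add: Pr_eq_Mean assms(1) Mean_cmult)
  also have "\<dots> \<le> Mean p f" using assms by (intro Mean_mono) auto
  finally have "t * Pr p (\<lambda>x. t \<le> f x) \<le> e" using assms by simp
  then show ?thesis using assms(4) by (simp add: field_simps)
qed

lemma Mean_bind:
  "finite (set_pmf p) \<Longrightarrow> (\<And>x. x \<in> set_pmf p \<Longrightarrow> finite (set_pmf (f x))) \<Longrightarrow>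
    Mean (bind_pmf p f) h = Mean p (\<lambda>x. Mean (f x) h)"
  by (subst Mean_eq_expectation, force, subst pmf_expectation_bind[of "set_pmf p"])
     (auto simp: Mean_eq_expectation[symmetric] Mean_def)

lemma Mean_map: "finite (set_pmf p) \<Longrightarrow> Mean (map_pmf f p) h = Mean p (\<lambda>x. h (f x))"
  by (simp add: Mean_eq_expectation)

lemma Mean_of_set: "finite A \<Longrightarrow> A \<noteq> {} \<Longrightarrow> Mean (pmf_of_set A) f = sum f A / real (card A)"
  by (simp add: Mean_def sum_divide_distrib pmf_of_set)

lemma Pr_bind:
  "finite (set_pmf p) \<Longrightarrow> (\<And>x. x \<in> set_pmf p \<Longrightarrow> finite (set_pmf (f x))) \<Longrightarrow>
    Pr (bind_pmf p f) Q = Mean p (\<lambda>x. Pr (f x) Q)"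
  by (subst Pr_eq_Mean, force, subst Mean_bind) (auto intro!: Mean_cong simp: Pr_eq_Mean)

lemma finite_set_Pi_pmf:
  "finite A \<Longrightarrow> (\<And>x. x \<in> A \<Longrightarrow> finite (set_pmf (p x))) \<Longrightarrow> finite (set_pmf (Pi_pmf A d p))"
  by (auto simp: set_Pi_pmf)

text \<open>Redrawing one coordinate does not change a product law. Most conditioning arguments
  below have this form: all coordinates but one are frozen, and that one is averaged first.\<close>

lemma Pi_pmf_resample:
  assumes "finite A" "x \<in> A"
  shows "Pi_pmf A d p = bind_pmf (Pi_pmf A d p) (\<lambda>f. map_pmf (\<lambda>y. f(x := y)) (p x))"
proof -
  define A' where "A' = A - {x}"
  have A': "finite A'" "x \<notin> A'" "A = insert x A'" using assms by (auto simp: A'_def)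
  have 1: "Pi_pmf A d p = bind_pmf (Pi_pmf A' d p) (\<lambda>f. map_pmf (\<lambda>y. f(x := y)) (p x))"
    unfolding A'(3) Pi_pmf_insert'[OF A'(1,2)]
    by (subst bind_commute_pmf) (simp add: map_pmf_def)
  have upd: "fun_upd (f(x := y)) x = fun_upd f x" for f :: "'a \<Rightarrow> 'b" and y
    by (rule ext) simp
  show ?thesis
    by (subst (2) 1, subst 1) (simp add: bind_assoc_pmf bind_map_pmf upd)
qed

lemma Mean_Pi_resample:
  assumes "finite A" "x \<in> A" "\<And>y. y \<in> A \<Longrightarrow> finite (set_pmf (p y))"
  shows "Mean (Pi_pmf A d p) h = Mean (Pi_pmf A d p) (\<lambda>f. Mean (p x) (\<lambda>y. h (f(x := y))))"
proof -
  have "Mean (Pi_pmf A d p) h = Mean (bind_pmf (Pi_pmf A d p) (\<lambda>f. map_pmf (\<lambda>y. f(x := y)) (p x))) h"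
    using Pi_pmf_resample[OF assms(1,2)] by metis
  then show ?thesis using assms by (simp add: Mean_bind Mean_map finite_set_Pi_pmf)
qed

lemma Pr_Pi_resample:
  assumes "finite A" "x \<in> A" "\<And>y. y \<in> A \<Longrightarrow> finite (set_pmf (p y))"
  shows "Pr (Pi_pmf A d p) Q = Mean (Pi_pmf A d p) (\<lambda>f. Pr (p x) (\<lambda>y. Q (f(x := y))))"
proof -
  have "Pr (Pi_pmf A d p) Q = Pr (bind_pmf (Pi_pmf A d p) (\<lambda>f. map_pmf (\<lambda>y. f(x := y)) (p x))) Q"
    using Pi_pmf_resample[OF assms(1,2)] by metis
  then show ?thesis using assms by (simp add: Pr_bind Pr_map finite_set_Pi_pmf)
qed

lemma Pr_Pi_resample_le:
  assumes "finite A" "x \<in> A" "\<And>y. y \<in> A \<Longrightarrow> finite (set_pmf (p y))"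
    "\<And>f. f \<in> set_pmf (Pi_pmf A d p) \<Longrightarrow> Pr (p x) (\<lambda>y. Q (f(x := y))) \<le> c"
  shows "Pr (Pi_pmf A d p) Q \<le> c"
proof -
  have "Pr (Pi_pmf A d p) Q \<le> Mean (Pi_pmf A d p) (\<lambda>_. c)"
    using assms by (subst Pr_Pi_resample) (auto intro!: Mean_mono)
  then show ?thesis using assms by (simp add: Mean_const finite_set_Pi_pmf)
qed

lemma Pr_Pi_component:
  assumes "finite A" "x \<in> A"
  shows "Pr (Pi_pmf A d p) (\<lambda>f. Q (f x)) = Pr (p x) Q"
  using Pr_map[of "\<lambda>f. f x" "Pi_pmf A d p" Q] Pi_pmf_component[OF assms(1), of x d p] assms by simp

lemma Pr_Pi_ball:
  assumes "finite A" "S \<subseteq> A"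
  shows "Pr (Pi_pmf A d p) (\<lambda>f. \<forall>x\<in>S. Q x (f x)) = (\<Prod>x\<in>S. Pr (p x) (Q x))"
proof -
  have "Pr (Pi_pmf A d p) (\<lambda>f. \<forall>x\<in>S. Q x (f x)) =
     measure_pmf.prob (Pi_pmf A d p) (PiE_dflt A d (\<lambda>x. if x \<in> S then {y. Q x y} else UNIV))"
    unfolding Pr_def using assms
    by (intro measure_pmf.finite_measure_eq_AE)
       (auto simp: AE_measure_pmf_iff PiE_dflt_def set_Pi_pmf split: if_splits)
  also have "\<dots> = (\<Prod>x\<in>A. measure_pmf.prob (p x) (if x \<in> S then {y. Q x y} else UNIV))"
    using assms by (intro measure_Pi_pmf_PiE_dflt) auto
  also have "\<dots> = (\<Prod>x\<in>A. if x \<in> S then Pr (p x) (Q x) else 1)"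
    by (intro prod.cong) (auto simp: Pr_def)
  also have "\<dots> = (\<Prod>x\<in>S. Pr (p x) (Q x))"
    using assms by (subst prod.inter_restrict[symmetric]) (auto simp: Int_absorb1)
  finally show ?thesis .
qed

text \<open>If at least \<open>a\<close> of the \<open>2 * a\<close> independent trials are bad,
  some set of exactly \<open>a\<close> trials is entirely bad. The union bound over at most 4^a such
  sets costs the factor 4 in the base.\<close>

lemma Pr_half_bad:
  assumes "Pr p Q \<le> c"
  shows "Pr (Pi_pmf {..<2 * a} d (\<lambda>_. p)) (\<lambda>f. a \<le> card {r. r < 2 * a \<and> Q (f r)}) \<le> (4 * c) ^ a"
proof -
  have c: "0 \<le> c" using Pr_nonneg[of p Q] assms by linarith
  let ?P = "Pi_pmf {..<2 * a} d (\<lambda>_. p)"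
  let ?I = "{S. S \<subseteq> {..<2 * a} \<and> card S = a}"
  have "Pr ?P (\<lambda>f. a \<le> card {r. r < 2 * a \<and> Q (f r)}) \<le> Pr ?P (\<lambda>f. \<exists>S\<in>?I. \<forall>r\<in>S. Q (f r))"
  proof (intro Pr_mono)
    fix f assume "a \<le> card {r. r < 2 * a \<and> Q (f r)}"
    then obtain S where "S \<subseteq> {r. r < 2 * a \<and> Q (f r)}" "card S = a"
      by (meson obtain_subset_with_card_n)
    then show "\<exists>S\<in>?I. \<forall>r\<in>S. Q (f r)" by (intro bexI[of _ S]) auto
  qed
  also have "\<dots> \<le> real (card ?I) * c ^ a"
  proof (rule Pr_bex_le_const)
    fix S assume S: "S \<in> ?I"
    have "Pr ?P (\<lambda>f. \<forall>r\<in>S. Q (f r)) = (\<Prod>r\<in>S. Pr p Q)" using S by (intro Pr_Pi_ball) auto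
    also have "\<dots> \<le> c ^ a" using S assms by (auto intro: power_mono)
    finally show "Pr ?P (\<lambda>f. \<forall>r\<in>S. Q (f r)) \<le> c ^ a" .
  qed auto
  also have "card ?I = (2 * a) choose a" using n_subsets[of "{..<2 * a}" a] by simp
  also have "real ((2 * a) choose a) * c ^ a \<le> 4 ^ a * c ^ a"
  proof (intro mult_right_mono)
    have "(2 * a) choose a \<le> 2 ^ (2 * a)" by (rule binomial_le_pow2)
    also have "(2::nat) ^ (2 * a) = 4 ^ a" by (simp add: power_mult)
    finally show "real ((2 * a) choose a) \<le> 4 ^ a" by (metis of_nat_le_iff of_nat_numeral of_nat_power)
  qed (use c in auto)
  finally show ?thesis by (simp add: power_mult_distrib)
qed

section \<open>Majority order statistic\<close>

text \<open>For \<open>R = 2 * a\<close> with \<open>a\<close> positive and for nonnegative values,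
  this is the (a+1)-st largest value, a lower median. Being specified by counts, it can be computed
  without sorting, and a value that is too large or too small forces \<open>a\<close> of the
  \<open>2 * a\<close> inputs to be wrong on the same side. The inserted 0 covers
  \<open>R = 0\<close>.\<close>

definition med :: "nat \<Rightarrow> (nat \<Rightarrow> real) \<Rightarrow> real" where
  "med R f = Max (insert 0 (f ` {r. r < R \<and> R < 2 * card {q. q < R \<and> f r \<le> f q}}))"

lemma med_nonneg: "0 \<le> med R f"
  unfolding med_def by (intro Max_ge) auto

lemma le_med_iff:
  assumes "0 < t"
  shows "t \<le> med R f \<longleftrightarrow> R < 2 * card {r. r < R \<and> t \<le> f r}"
proof
  assume "t \<le> med R f"
  moreover have "med R f \<in> insert 0 (f ` {r. r < R \<and> R < 2 * card {q. q < R \<and> f r \<le> f q}})"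
    unfolding med_def by (intro Max_in) auto
  ultimately obtain r where r: "r < R" "R < 2 * card {q. q < R \<and> f r \<le> f q}" "t \<le> f r"
    using assms by auto
  have "card {q. q < R \<and> f r \<le> f q} \<le> card {r. r < R \<and> t \<le> f r}"
    using r by (intro card_mono) auto
  then show "R < 2 * card {r. r < R \<and> t \<le> f r}" using r by linarith
next
  let ?A = "{r. r < R \<and> t \<le> f r}"
  assume *: "R < 2 * card ?A"
  have ne: "?A \<noteq> {}" using * by (metis card.empty mult_0_right not_less0)
  have "Min (f ` ?A) \<in> f ` ?A" using ne by (intro Min_in) auto
  then obtain r where r: "r \<in> ?A" "f r = Min (f ` ?A)" by auto
  have "card ?A \<le> card {q. q < R \<and> f r \<le> f q}"
    using r(2) by (intro card_mono) auto
  then have "R < 2 * card {q. q < R \<and> f r \<le> f q}" using * by linarith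
  moreover have "r < R" using r(1) by auto
  ultimately have "f r \<le> med R f" unfolding med_def by (intro Max_ge) (auto simp del: Max_ge_iff)
  then show "t \<le> med R f" using r by auto
qed

lemma less_med_iff:
  assumes "0 \<le> t"
  shows "t < med R f \<longleftrightarrow> R < 2 * card {r. r < R \<and> t < f r}"
proof
  assume "t < med R f"
  then have "R < 2 * card {r. r < R \<and> med R f \<le> f r}" using le_med_iff[of "med R f" R f] assms by auto
  moreover have "card {r. r < R \<and> med R f \<le> f r} \<le> card {r. r < R \<and> t < f r}"
    using \<open>t < med R f\<close> by (intro card_mono) auto
  ultimately show "R < 2 * card {r. r < R \<and> t < f r}" by linarith
next
  let ?A = "{r. r < R \<and> t < f r}"
  assume *: "R < 2 * card ?A"
  have ne: "?A \<noteq> {}" using * by (metis card.empty mult_0_right not_less0)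
  let ?m = "Min (f ` ?A)"
  have m: "?m \<in> f ` ?A" using ne by (intro Min_in) auto
  then have "t < ?m" by auto
  have "?A \<subseteq> {r. r < R \<and> ?m \<le> f r}" by auto
  then have "card ?A \<le> card {r. r < R \<and> ?m \<le> f r}" by (intro card_mono) auto
  then have "?m \<le> med R f" using le_med_iff[of ?m R f] * \<open>t < ?m\<close> assms by auto
  then show "t < med R f" using \<open>t < ?m\<close> by simp
qed

lemma not_less_medD:
  assumes "\<not> t < med (2 * a) f" "0 \<le> t"
  shows "a \<le> card {r. r < 2 * a \<and> f r \<le> t}"
proof -
  have 1: "card {r. r < 2 * a \<and> t < f r} \<le> a" using assms less_med_iff[of t "2 * a" f] by auto
  have "{..<2 * a} = {r. r < 2 * a \<and> t < f r} \<union> {r. r < 2 * a \<and> f r \<le> t}" by auto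
  then have "2 * a \<le> card {r. r < 2 * a \<and> t < f r} + card {r. r < 2 * a \<and> f r \<le> t}"
    by (metis card_Un_le card_lessThan)
  then show ?thesis using 1 by linarith
qed

lemma less_medD: "t < med (2 * a) f \<Longrightarrow> 0 \<le> t \<Longrightarrow> a \<le> card {r. r < 2 * a \<and> t < f r}"
  using less_med_iff[of t "2 * a" f] by auto

lemma not_le_medD:
  assumes "\<not> t \<le> med (2 * a) f" "0 < t"
  shows "a \<le> card {r. r < 2 * a \<and> f r < t}"
proof -
  have 1: "card {r. r < 2 * a \<and> t \<le> f r} \<le> a" using assms le_med_iff[of t "2 * a" f] by auto
  have "{..<2 * a} = {r. r < 2 * a \<and> t \<le> f r} \<union> {r. r < 2 * a \<and> f r < t}" by auto
  then have "2 * a \<le> card {r. r < 2 * a \<and> t \<le> f r} + card {r. r < 2 * a \<and> f r < t}"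
    by (metis card_Un_le card_lessThan)
  then show ?thesis using 1 by linarith
qed


section \<open>Tails, small-ball estimates and quantiles of the content of a bucket\<close>

section \<open>One hashed measurement block\<close>

text \<open>Multiples of 1/M in [1,2) and their negatives: the random sign and the random magnitude
  are drawn together. Magnitudes of at least 1 allow division without enlarging noise, and a spread
  over constant length gives the small-ball estimate.\<close>

definition grid :: "nat \<Rightarrow> real set" where
  "grid M = (\<lambda>j::int. real_of_int j / real M) ` ({int M..<2 * int M} \<union> {-(2 * int M)<..-(int M)})"

lemma finite_grid [simp]: "finite (grid M)"
  by (simp add: grid_def)

lemma grid_uminus: "g \<in> grid M \<Longrightarrow> - g \<in> grid M"
  unfolding grid_def
proof (elim imageE)
  fix j assume "g = real_of_int j / real M" "j \<in> {int M..<2 * int M} \<union> {-(2 * int M)<..-(int M)}"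
  then show "- g \<in> (\<lambda>j::int. real_of_int j / real M) ` ({int M..<2 * int M} \<union> {-(2 * int M)<..-(int M)})"
    by (intro image_eqI[of _ _ "- j"]) auto
qed

lemma grid_abs:
  assumes "g \<in> grid M" "0 < M"
  shows "1 \<le> \<bar>g\<bar>" "\<bar>g\<bar> \<le> 2" "g \<noteq> 0"
proof -
  obtain j where j: "g = real_of_int j / real M" "j \<in> {int M..<2 * int M} \<union> {-(2 * int M)<..-(int M)}"
    using assms(1) by (auto simp: grid_def)
  have "int M \<le> \<bar>j\<bar>" "\<bar>j\<bar> \<le> 2 * int M" using j(2) by auto
  then have "real M \<le> \<bar>real_of_int j\<bar>" "\<bar>real_of_int j\<bar> \<le> 2 * real M" by linarith+
  then show "1 \<le> \<bar>g\<bar>" "\<bar>g\<bar> \<le> 2" using assms(2) by (auto simp: j(1) field_simps)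
  then show "g \<noteq> 0" by auto
qed

lemma card_grid:
  assumes "0 < M"
  shows "card (grid M) = 2 * M"
proof -
  have "card (grid M) = card ({int M..<2 * int M} \<union> {-(2 * int M)<..-(int M)})"
    unfolding grid_def using assms by (intro card_image inj_onI) auto
  also have "\<dots> = card {int M..<2 * int M} + card {-(2 * int M)<..-(int M)}"
    using assms by (intro card_Un_disjoint) auto
  finally show ?thesis by simp
qed

lemma grid_nonempty: "0 < M \<Longrightarrow> grid M \<noteq> {}"
  using card_grid[of M] by auto

lemma card_int_interval_le:
  fixes l u :: real
  assumes "l \<le> u"
  shows "real (card {j::int. l \<le> of_int j \<and> of_int j \<le> u}) \<le> u - l + 1"
proof -
  have "{j::int. l \<le> of_int j \<and> of_int j \<le> u} = {\<lceil>l\<rceil>..\<lfloor>u\<rfloor>}" by (auto simp: le_floor_iff ceiling_le_iff)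
  then show ?thesis using assms by simp linarith
qed

text \<open>The favourable \<open>g\<close> lie in an interval of length
  \<open>2 * t / \<bar>x\<bar>\<close>, which contains at most
  \<open>2 * M * t / \<bar>x\<bar> + 1\<close> of the \<open>2 * M\<close> grid points. The extra
  point is the price of discretization.\<close>

lemma grid_small_ball:
  assumes "0 < M" "x \<noteq> 0" "0 \<le> t"
  shows "Pr (pmf_of_set (grid M)) (\<lambda>g. \<bar>g * x + z\<bar> \<le> t) \<le> t / \<bar>x\<bar> + 1 / (2 * real M)"
proof -
  let ?c = "- z / x" and ?\<rho> = "t / \<bar>x\<bar>"
  let ?J = "{j::int. real M * (?c - ?\<rho>) \<le> of_int j \<and> of_int j \<le> real M * (?c + ?\<rho>)}"
  have \<rho>: "0 \<le> ?\<rho>" using assms by simp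
  have le: "real M * (?c - ?\<rho>) \<le> real M * (?c + ?\<rho>)" using \<rho> by (intro mult_left_mono) linarith+
  have sub: "{g\<in>grid M. \<bar>g * x + z\<bar> \<le> t} \<subseteq> (\<lambda>j. real_of_int j / real M) ` ?J"
  proof
    fix g assume g: "g \<in> {g\<in>grid M. \<bar>g * x + z\<bar> \<le> t}"
    then obtain j :: int where j: "g = j / real M" by (auto simp: grid_def)
    have "(g - ?c) * x = g * x + z" using assms(2) by (simp add: field_simps)
    then have "\<bar>g - ?c\<bar> * \<bar>x\<bar> \<le> t" using g by (simp only: abs_mult[symmetric]) simp
    then have "\<bar>g - ?c\<bar> \<le> ?\<rho>" using assms(2) by (simp add: field_simps)
    then have "?c - ?\<rho> \<le> g" "g \<le> ?c + ?\<rho>" by linarith+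
    then have "real M * (?c - ?\<rho>) \<le> real M * g" "real M * g \<le> real M * (?c + ?\<rho>)"
      by (intro mult_left_mono; simp)+
    moreover have "real M * g = j" using j assms(1) by simp
    ultimately show "g \<in> (\<lambda>j. real_of_int j / real M) ` ?J" using j by auto
  qed
  have finJ: "finite ?J"
  proof -
    have "?J = {\<lceil>real M * (?c - ?\<rho>)\<rceil>..\<lfloor>real M * (?c + ?\<rho>)\<rfloor>}" by (auto simp: le_floor_iff ceiling_le_iff)
    then show ?thesis by (metis finite_atLeastAtMost_int)
  qed
  have "card {g\<in>grid M. \<bar>g * x + z\<bar> \<le> t} \<le> card ?J"
    using card_mono[OF finite_imageI[OF finJ] sub] card_image_le[OF finJ, of "\<lambda>j. real_of_int j / real M"] by linarith
  then have "real (card {g\<in>grid M. \<bar>g * x + z\<bar> \<le> t}) \<le> real M * (?c + ?\<rho>) - real M * (?c - ?\<rho>) + 1"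
    using card_int_interval_le[OF le] by linarith
  also have "\<dots> = 2 * real M * ?\<rho> + 1" by (simp add: algebra_simps)
  finally have "real (card {g\<in>grid M. \<bar>g * x + z\<bar> \<le> t}) / (2 * real M) \<le> (2 * real M * ?\<rho> + 1) / (2 * real M)"
    by (intro divide_right_mono) auto
  also have "\<dots> = ?\<rho> + 1 / (2 * real M)" using assms(1) by (simp add: add_divide_distrib)
  finally show ?thesis
    by (simp add: Pr_of_set grid_nonempty[OF assms(1)] card_grid[OF assms(1)])
qed

lemma Pr_of_set_involution:
  assumes "finite S" "S \<noteq> {}" "\<And>x. x \<in> S \<Longrightarrow> \<phi> x \<in> S \<and> \<phi> (\<phi> x) = x"
  shows "Pr (pmf_of_set S) (\<lambda>x. Q (\<phi> x)) = Pr (pmf_of_set S) Q"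
proof -
  have "bij_betw \<phi> {x\<in>S. Q (\<phi> x)} {x\<in>S. Q x}"
    by (rule bij_betwI[where g = \<phi>]) (use assms(3) in auto)
  then have "card {x\<in>S. Q (\<phi> x)} = card {x\<in>S. Q x}" by (rule bij_betw_same_card)
  then show ?thesis using assms by (simp add: Pr_of_set)
qed

lemma Pr_eq_const: "finite A \<Longrightarrow> c \<in> A \<Longrightarrow> Pr (pmf_of_set A) (\<lambda>y. y = c) = 1 / real (card A)"
proof -
  assume "finite A" "c \<in> A"
  moreover from this have "{y\<in>A. y = c} = {c}" "A \<noteq> {}" by auto
  ultimately show ?thesis by (simp add: Pr_of_set)
qed

lemma Mean_pair:
  assumes "finite (set_pmf p)" "finite (set_pmf q)"
  shows "Mean (pair_pmf p q) f = Mean p (\<lambda>x. Mean q (\<lambda>y. f (x, y)))"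
  using assms unfolding pair_pmf_def
  by (simp add: Mean_bind) (simp add: Mean_def)

lemma Pr_pair:
  assumes "finite (set_pmf p)" "finite (set_pmf q)"
  shows "Pr (pair_pmf p q) Q = Mean p (\<lambda>x. Pr q (\<lambda>y. Q (x, y)))"
  using assms by (simp add: Pr_eq_Mean Mean_pair)

lemma Mean_swap: "Mean p (\<lambda>x. Mean q (\<lambda>y. f x y)) = Mean q (\<lambda>y. Mean p (\<lambda>x. f x y))"
  unfolding Mean_def by (simp add: sum_distrib_left mult_ac sum.swap[of _ "set_pmf p"])

lemma Pr_pair_swap:
  assumes "finite (set_pmf p)" "finite (set_pmf q)"
  shows "Pr (pair_pmf p q) Q = Mean q (\<lambda>y. Pr p (\<lambda>x. Q (x, y)))"
  using assms by (simp add: Pr_eq_Mean Mean_pair Mean_swap[of p q])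

lemma Mean_le_const:
  assumes "finite (set_pmf p)" "\<And>x. x \<in> set_pmf p \<Longrightarrow> f x \<le> c"
  shows "Mean p f \<le> c"
  using Mean_mono[of p f "\<lambda>_. c"] assms by (simp add: Mean_const)

lemma Pr_pair_le:
  assumes "finite (set_pmf p)" "finite (set_pmf q)" "\<And>x. x \<in> set_pmf p \<Longrightarrow> Pr q (\<lambda>y. Q (x, y)) \<le> c"
  shows "Pr (pair_pmf p q) Q \<le> c"
  using assms by (simp add: Pr_pair Mean_le_const)

lemma Pr_pair_fst:
  "finite (set_pmf p) \<Longrightarrow> finite (set_pmf q) \<Longrightarrow> Pr (pair_pmf p q) (\<lambda>\<rho>. Q (fst \<rho>)) = Pr p Q"
  using Pr_map[of fst "pair_pmf p q" Q] by (simp add: map_fst_pair_pmf)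

lemma Pr_pair_snd:
  "finite (set_pmf p) \<Longrightarrow> finite (set_pmf q) \<Longrightarrow> Pr (pair_pmf p q) (\<lambda>\<rho>. Q (snd \<rho>)) = Pr q Q"
  using Pr_map[of snd "pair_pmf p q" Q] by (simp add: map_snd_pair_pmf)

text \<open>A hash of the nodes into buckets, and a coefficient for every coordinate. Nodes and
  coordinates share one index range, because a residue of a number below \<open>n\<close> is again
  below \<open>n\<close>.\<close>

type_synonym block = "(nat \<Rightarrow> nat) \<times> (nat \<Rightarrow> real)"

locale hashing =
  fixes n B M :: nat
  assumes n_pos: "0 < n" and B_ge_2: "2 \<le> B" and M_pos: "0 < M"
begin

definition hash_pmf :: "(nat \<Rightarrow> nat) pmf" where
  "hash_pmf = Pi_pmf {..<n} 0 (\<lambda>_. pmf_of_set {..<B})"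

definition coef_pmf :: "(nat \<Rightarrow> real) pmf" where
  "coef_pmf = Pi_pmf {..<n} 0 (\<lambda>_. pmf_of_set (grid M))"

definition block_pmf :: "block pmf" where
  "block_pmf = pair_pmf hash_pmf coef_pmf"

lemma B_ne: "{..<B} \<noteq> {}"
  using B_ge_2 by (simp add: lessThan_empty_iff)

lemma grid_ne: "grid M \<noteq> {}"
  using grid_nonempty M_pos .

lemma finite_set_hash [simp]: "finite (set_pmf hash_pmf)"
  unfolding hash_pmf_def using B_ne by (intro finite_set_Pi_pmf) auto

lemma finite_set_coef [simp]: "finite (set_pmf coef_pmf)"
  unfolding coef_pmf_def using grid_ne by (intro finite_set_Pi_pmf) auto

lemma finite_set_block [simp]: "finite (set_pmf block_pmf)"
  unfolding block_pmf_def by simp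

lemma set_hash: "h \<in> set_pmf hash_pmf \<Longrightarrow> v < n \<Longrightarrow> h v < B"
  unfolding hash_pmf_def using B_ne by (auto simp: set_Pi_pmf PiE_dflt_def)

lemma set_coef: "g \<in> set_pmf coef_pmf \<Longrightarrow> i < n \<Longrightarrow> g i \<in> grid M"
  unfolding coef_pmf_def using grid_ne by (auto simp: set_Pi_pmf PiE_dflt_def)

lemma set_block:
  assumes "\<rho> \<in> set_pmf block_pmf" "i < n"
  shows "fst \<rho> i < B" "snd \<rho> i \<in> grid M" "1 \<le> \<bar>snd \<rho> i\<bar>" "\<bar>snd \<rho> i\<bar> \<le> 2"
  using assms set_hash[of "fst \<rho>" i] set_coef[of "snd \<rho>" i] grid_abs[OF _ M_pos, of "snd \<rho> i"]
  by (auto simp: block_pmf_def)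

lemma Pr_hash_eq: "v < n \<Longrightarrow> \<beta> < B \<Longrightarrow> Pr hash_pmf (\<lambda>h. h v = \<beta>) = 1 / B"
  unfolding hash_pmf_def
  by (subst Pr_Pi_component[where Q = "\<lambda>y. y = \<beta>"]) (auto simp: Pr_eq_const)

lemma Pr_hash_coll:
  assumes "v < n" "w < n" "v \<noteq> w"
  shows "Pr hash_pmf (\<lambda>h. h v = h w) \<le> 1 / B"
  unfolding hash_pmf_def
proof (rule Pr_Pi_resample_le[where x = v])
  fix f assume "f \<in> set_pmf (Pi_pmf {..<n} 0 (\<lambda>_. pmf_of_set {..<B}))"
  then have "f w < B" using set_hash[of f w] assms by (simp add: hash_pmf_def)
  then show "Pr (pmf_of_set {..<B}) (\<lambda>y. (f(v := y)) v = (f(v := y)) w) \<le> 1 / real B"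
    using assms Pr_eq_const[of "{..<B}" "f w"] by simp
qed (use assms B_ne in auto)

text \<open>A coordinate is hashed through its node \<open>i mod Md\<close>. Once
  \<open>n \<le> Md\<close>, every node consists of a single coordinate, and the bucket contents
  become estimates of single entries.\<close>

definition bsum :: "nat \<Rightarrow> (nat \<Rightarrow> real) \<Rightarrow> block \<Rightarrow> nat \<Rightarrow> real" where
  "bsum Md x \<rho> \<beta> = (\<Sum>i<n. if fst \<rho> (i mod Md) = \<beta> then snd \<rho> i * x i else 0)"

definition own :: "nat \<Rightarrow> (nat \<Rightarrow> real) \<Rightarrow> nat \<Rightarrow> (nat \<Rightarrow> real) \<Rightarrow> real" where
  "own Md x v g = (\<Sum>i<n. if i mod Md = v then g i * x i else 0)"

subsection \<open>Second moments\<close>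

lemma Mean_coef_prod:
  assumes "i < n" "j < n" "i \<noteq> j"
  shows "Mean coef_pmf (\<lambda>g. g i * g j) = 0"
proof -
  have s: "(\<Sum>y\<in>grid M. y) = 0"
  proof -
    have "(\<Sum>y\<in>grid M. y) = (\<Sum>y\<in>grid M. - y)"
      by (rule sum.reindex_bij_witness[of _ uminus uminus]) (auto simp: grid_uminus)
    then show ?thesis by (simp add: sum_negf)
  qed
  have "Mean coef_pmf (\<lambda>g. g i * g j) = Mean coef_pmf (\<lambda>f. Mean (pmf_of_set (grid M)) (\<lambda>y. y * f j))"
    unfolding coef_pmf_def using assms grid_ne by (subst Mean_Pi_resample[where x = i]) auto
  also have "\<dots> = Mean coef_pmf (\<lambda>f. 0)"
    using grid_ne s by (intro Mean_cong) (auto simp: Mean_of_set sum_distrib_right[symmetric])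
  finally show ?thesis by (simp add: Mean_const)
qed

text \<open>The coefficients are independent and symmetric, so the cross terms vanish; 4 bounds the
  square of a coefficient.\<close>

lemma Mean_coef_sq:
  assumes "S \<subseteq> {..<n}"
  shows "Mean coef_pmf (\<lambda>g. (\<Sum>i\<in>S. g i * c i)\<^sup>2) \<le> 4 * (\<Sum>i\<in>S. (c i)\<^sup>2)"
proof -
  have fin: "finite S" using assms finite_subset by blast
  have "Mean coef_pmf (\<lambda>g. (\<Sum>i\<in>S. g i * c i)\<^sup>2) =
      Mean coef_pmf (\<lambda>g. \<Sum>i\<in>S. \<Sum>j\<in>S. c i * c j * (g i * g j))"
    by (intro Mean_cong) (simp add: power2_eq_square sum_product mult_ac)
  also have "\<dots> = (\<Sum>i\<in>S. \<Sum>j\<in>S. c i * c j * Mean coef_pmf (\<lambda>g. g i * g j))"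
    by (simp add: Mean_sum Mean_cmult)
  also have "\<dots> = (\<Sum>i\<in>S. \<Sum>j\<in>S. if j = i then (c i)\<^sup>2 * Mean coef_pmf (\<lambda>g. (g i)\<^sup>2) else 0)"
    using assms Mean_coef_prod by (intro sum.cong) (auto simp: power2_eq_square subset_iff)
  also have "\<dots> = (\<Sum>i\<in>S. (c i)\<^sup>2 * Mean coef_pmf (\<lambda>g. (g i)\<^sup>2))"
    using fin by simp
  also have "\<dots> \<le> (\<Sum>i\<in>S. (c i)\<^sup>2 * 4)"
  proof (intro sum_mono mult_left_mono Mean_le_const)
    fix i g assume "i \<in> S" "g \<in> set_pmf coef_pmf"
    then have "\<bar>g i\<bar> \<le> 2" using set_coef assms grid_abs(2)[OF _ M_pos] by blast
    then show "(g i)\<^sup>2 \<le> 4" using abs_le_square_iff[of "g i" 2] by simp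
  qed auto
  finally show ?thesis by (simp add: sum_distrib_left mult_ac)
qed

text \<open>Chebyshev's inequality: every entry is present with probability at most 1/B, so the
  second moment is at most 4/B times the energy. Measuring the deviation in units of
  \<open>\<theta>\<close> makes the bound independent of the signal.\<close>

lemma noise_tail:
  fixes \<delta> \<theta> K :: real
  assumes S: "S \<subseteq> {..<n}" and A: "\<And>i. i \<in> S \<Longrightarrow> Pr hash_pmf (A i) \<le> 1 / B"
    and e: "(\<Sum>i\<in>S. (x i)\<^sup>2) \<le> K * \<theta>\<^sup>2" and "0 < \<delta>" "0 \<le> \<theta>" "0 \<le> K"
  shows "Pr block_pmf (\<lambda>\<rho>. \<delta> * \<theta> < \<bar>\<Sum>i\<in>S. if A i (fst \<rho>) then snd \<rho> i * x i else 0\<bar>)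
    \<le> 4 * K / (B * \<delta>\<^sup>2)"
proof (cases "\<theta> = 0")
  case True
  have fin: "finite S" using S finite_subset by blast
  \<comment> \<open>Markov's inequality has no positive threshold here, but without energy the sum
    vanishes identically.\<close>
  have "(\<Sum>i\<in>S. (x i)\<^sup>2) = 0" using e True sum_nonneg[of S "\<lambda>i. (x i)\<^sup>2"] by auto
  then have "\<And>i. i \<in> S \<Longrightarrow> x i = 0" using fin by (simp add: sum_nonneg_eq_0_iff)
  then have "(\<Sum>i\<in>S. if A i (fst \<rho>) then snd \<rho> i * x i else 0) = 0" for \<rho> :: block
    by (intro sum.neutral) auto
  then show ?thesis using True assms B_ge_2 by (simp add: Pr_False)
next
  case False
  let ?Z = "\<lambda>\<rho>. \<Sum>i\<in>S. if A i (fst \<rho>) then snd \<rho> i * x i else 0"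
  have pos: "0 < (\<delta> * \<theta>)\<^sup>2" using False assms by simp
  have "Mean block_pmf (\<lambda>\<rho>. (?Z \<rho>)\<^sup>2) = Mean hash_pmf (\<lambda>h. Mean coef_pmf (\<lambda>g. (\<Sum>i\<in>S. g i * (of_bool (A i h) * x i))\<^sup>2))"
    unfolding block_pmf_def by (subst Mean_pair) (auto intro!: Mean_cong arg_cong[of _ _ "\<lambda>x. x\<^sup>2"] sum.cong)
  also have "\<dots> \<le> Mean hash_pmf (\<lambda>h. 4 * (\<Sum>i\<in>S. (of_bool (A i h) * x i)\<^sup>2))"
    by (intro Mean_mono Mean_coef_sq S)
  also have "\<dots> = Mean hash_pmf (\<lambda>h. 4 * (\<Sum>i\<in>S. (x i)\<^sup>2 * of_bool (A i h)))"
    by (intro Mean_cong arg_cong[of _ _ "\<lambda>x. 4 * x"] sum.cong) (auto simp: of_bool_def)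
  also have "\<dots> = 4 * (\<Sum>i\<in>S. (x i)\<^sup>2 * Pr hash_pmf (A i))"
    by (simp add: Mean_cmult Mean_sum Pr_eq_Mean)
  also have "\<dots> \<le> 4 * (\<Sum>i\<in>S. (x i)\<^sup>2 * (1 / B))"
    using A by (intro mult_left_mono sum_mono) auto
  also have "\<dots> = 4 / B * (\<Sum>i\<in>S. (x i)\<^sup>2)" by (simp add: sum_divide_distrib[symmetric])
  also have "\<dots> \<le> 4 / B * (K * \<theta>\<^sup>2)" using e by (intro mult_left_mono) auto
  finally have "Pr block_pmf (\<lambda>\<rho>. (\<delta> * \<theta>)\<^sup>2 \<le> (?Z \<rho>)\<^sup>2) \<le> 4 / B * (K * \<theta>\<^sup>2) / (\<delta> * \<theta>)\<^sup>2"
    using pos by (intro Pr_markov) auto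
  also have "\<dots> = 4 * K / (B * \<delta>\<^sup>2)" using False by (simp add: power_mult_distrib)
  finally have "Pr block_pmf (\<lambda>\<rho>. (\<delta> * \<theta>)\<^sup>2 \<le> (?Z \<rho>)\<^sup>2) \<le> 4 * K / (B * \<delta>\<^sup>2)" .
  moreover have "Pr block_pmf (\<lambda>\<rho>. \<delta> * \<theta> < \<bar>?Z \<rho>\<bar>) \<le> Pr block_pmf (\<lambda>\<rho>. (\<delta> * \<theta>)\<^sup>2 \<le> (?Z \<rho>)\<^sup>2)"
  proof (rule Pr_mono)
    fix \<rho> assume "\<delta> * \<theta> < \<bar>?Z \<rho>\<bar>"
    then have "(\<delta> * \<theta>)\<^sup>2 \<le> \<bar>?Z \<rho>\<bar>\<^sup>2" using assms by (intro power_mono) auto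
    then show "(\<delta> * \<theta>)\<^sup>2 \<le> (?Z \<rho>)\<^sup>2" by simp
  qed
  ultimately show ?thesis by linarith
qed

text \<open>Bucket 0 receives some head coordinate with probability at most
  \<open>card H / B\<close>; in the other case it holds tail noise only.\<close>

lemma probe_tail:
  fixes \<delta> \<theta> K :: real
  assumes H: "H \<subseteq> {..<n}" and e: "(\<Sum>i\<in>{..<n} - H. (x i)\<^sup>2) \<le> K * \<theta>\<^sup>2"
    and "0 < \<delta>" "0 \<le> \<theta>" "0 \<le> K"
  shows "Pr block_pmf (\<lambda>\<rho>. \<delta> * \<theta> < \<bar>bsum Md x \<rho> 0\<bar>) \<le> card H / B + 4 * K / (B * \<delta>\<^sup>2)"
proof -
  have fin: "finite H" using H finite_subset by blast
  let ?A = "\<lambda>i h. h (i mod Md) = (0::nat)"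
  let ?Z = "\<lambda>\<rho>. \<Sum>i\<in>{..<n} - H. if ?A i (fst \<rho>) then snd \<rho> i * x i else 0"
  have md: "i mod Md < n" if "i < n" for i using that by (meson mod_less_eq_dividend le_less_trans)
  have "Pr block_pmf (\<lambda>\<rho>. \<delta> * \<theta> < \<bar>bsum Md x \<rho> 0\<bar>)
      \<le> Pr block_pmf (\<lambda>\<rho>. (\<exists>i\<in>H. ?A i (fst \<rho>)) \<or> \<delta> * \<theta> < \<bar>?Z \<rho>\<bar>)"
  proof (rule Pr_mono)
    fix \<rho> assume *: "\<delta> * \<theta> < \<bar>bsum Md x \<rho> 0\<bar>"
    show "(\<exists>i\<in>H. ?A i (fst \<rho>)) \<or> \<delta> * \<theta> < \<bar>?Z \<rho>\<bar>"
    proof (cases "\<exists>i\<in>H. ?A i (fst \<rho>)")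
      case False
      then have "bsum Md x \<rho> 0 = ?Z \<rho>" unfolding bsum_def using H
        by (intro sum.mono_neutral_right) auto
      then show ?thesis using * by simp
    qed simp
  qed
  also have "\<dots> \<le> Pr block_pmf (\<lambda>\<rho>. \<exists>i\<in>H. ?A i (fst \<rho>)) + Pr block_pmf (\<lambda>\<rho>. \<delta> * \<theta> < \<bar>?Z \<rho>\<bar>)"
    by (rule Pr_disj_le)
  also have "Pr block_pmf (\<lambda>\<rho>. \<exists>i\<in>H. ?A i (fst \<rho>)) \<le> card H * (1 / B)"
  proof (rule Pr_bex_le_const[OF fin])
    fix i assume "i \<in> H"
    then show "Pr block_pmf (\<lambda>\<rho>. ?A i (fst \<rho>)) \<le> 1 / B"
      using H md B_ge_2 unfolding block_pmf_def
      by (subst Pr_pair_fst[where Q = "?A i"]) (auto simp: Pr_hash_eq)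
  qed
  also have "Pr block_pmf (\<lambda>\<rho>. \<delta> * \<theta> < \<bar>?Z \<rho>\<bar>) \<le> 4 * K / (B * \<delta>\<^sup>2)"
  proof (rule noise_tail)
    fix i assume "i \<in> {..<n} - H"
    then have "Pr hash_pmf (\<lambda>h. h (i mod Md) = 0) = 1 / B"
      using md[of i] B_ge_2 by (intro Pr_hash_eq) auto
    then show "Pr hash_pmf (?A i) \<le> 1 / B" by simp
  qed (use assms in auto)
  finally show ?thesis by simp
qed

text \<open>With modulus at least \<open>n\<close> the coordinate is alone in its node. Unless
  another head coordinate collides with it, dividing by its coefficient returns \<open>x i\<close>
  up to tail noise, and a divisor of modulus at least 1 does not enlarge that noise.\<close>

lemma estimate_tail:
  fixes \<delta> \<theta> K :: real
  assumes H: "H \<subseteq> {..<n}" and e: "(\<Sum>i\<in>{..<n} - H. (x i)\<^sup>2) \<le> K * \<theta>\<^sup>2"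
    and "0 < \<delta>" "0 \<le> \<theta>" "0 \<le> K" and i: "i < n" and Md: "n \<le> Md"
  shows "Pr block_pmf (\<lambda>\<rho>. \<delta> * \<theta> < \<bar>\<bar>bsum Md x \<rho> (fst \<rho> i) / snd \<rho> i\<bar> - \<bar>x i\<bar>\<bar>)
    \<le> card H / B + 4 * K / (B * \<delta>\<^sup>2)"
proof -
  have fin: "finite H" using H finite_subset by blast
  let ?A = "\<lambda>j h. h j = (h i :: nat)"
  let ?S = "{..<n} - (H \<union> {i})"
  let ?Z = "\<lambda>\<rho>. \<Sum>j\<in>?S. if ?A j (fst \<rho>) then snd \<rho> j * x j else 0"
  have "Pr block_pmf (\<lambda>\<rho>. \<delta> * \<theta> < \<bar>\<bar>bsum Md x \<rho> (fst \<rho> i) / snd \<rho> i\<bar> - \<bar>x i\<bar>\<bar>)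
      \<le> Pr block_pmf (\<lambda>\<rho>. (\<exists>j\<in>H - {i}. ?A j (fst \<rho>)) \<or> \<delta> * \<theta> < \<bar>?Z \<rho>\<bar>)"
  proof (rule Pr_mono)
    fix \<rho> assume \<rho>: "\<rho> \<in> set_pmf block_pmf"
      and *: "\<delta> * \<theta> < \<bar>\<bar>bsum Md x \<rho> (fst \<rho> i) / snd \<rho> i\<bar> - \<bar>x i\<bar>\<bar>"
    show "(\<exists>j\<in>H - {i}. ?A j (fst \<rho>)) \<or> \<delta> * \<theta> < \<bar>?Z \<rho>\<bar>"
    proof (cases "\<exists>j\<in>H - {i}. ?A j (fst \<rho>)")
      case False
      have "bsum Md x \<rho> (fst \<rho> i) = (\<Sum>j<n. if fst \<rho> j = fst \<rho> i then snd \<rho> j * x j else 0)"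
        unfolding bsum_def using Md by (intro sum.cong) auto
      also have "\<dots> = (\<Sum>j\<in>insert i ?S. if fst \<rho> j = fst \<rho> i then snd \<rho> j * x j else 0)"
        using i False by (intro sum.mono_neutral_right) auto
      also have "\<dots> = snd \<rho> i * x i + ?Z \<rho>" by (subst sum.insert) auto
      finally have eq: "bsum Md x \<rho> (fst \<rho> i) = snd \<rho> i * x i + ?Z \<rho>" .
      have g: "1 \<le> \<bar>snd \<rho> i\<bar>" using set_block(3)[OF \<rho> i] .
      then have "bsum Md x \<rho> (fst \<rho> i) / snd \<rho> i = x i + ?Z \<rho> / snd \<rho> i"
        unfolding eq by (auto simp: add_divide_distrib)
      then have "\<bar>\<bar>bsum Md x \<rho> (fst \<rho> i) / snd \<rho> i\<bar> - \<bar>x i\<bar>\<bar> \<le> \<bar>?Z \<rho> / snd \<rho> i\<bar>" by linarith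
      also have "\<dots> \<le> \<bar>?Z \<rho>\<bar>" using g mult_left_mono[OF g, of "\<bar>?Z \<rho>\<bar>"] by (auto simp: abs_divide divide_le_eq)
      finally show ?thesis using * by linarith
    qed simp
  qed
  also have "\<dots> \<le> Pr block_pmf (\<lambda>\<rho>. \<exists>j\<in>H - {i}. ?A j (fst \<rho>)) + Pr block_pmf (\<lambda>\<rho>. \<delta> * \<theta> < \<bar>?Z \<rho>\<bar>)"
    by (rule Pr_disj_le)
  also have "Pr block_pmf (\<lambda>\<rho>. \<exists>j\<in>H - {i}. ?A j (fst \<rho>)) \<le> card (H - {i}) * (1 / B)"
  proof (rule Pr_bex_le_const)
    fix j assume "j \<in> H - {i}"
    then show "Pr block_pmf (\<lambda>\<rho>. ?A j (fst \<rho>)) \<le> 1 / B"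
      using H i Pr_hash_coll[of j i] unfolding block_pmf_def
      by (subst Pr_pair_fst[where Q = "?A j"]) auto
  qed (use fin in auto)
  also have "\<dots> \<le> card H * (1 / B)"
    using fin by (intro mult_right_mono) (auto intro: card_mono)
  also have "Pr block_pmf (\<lambda>\<rho>. \<delta> * \<theta> < \<bar>?Z \<rho>\<bar>) \<le> 4 * K / (B * \<delta>\<^sup>2)"
  proof (rule noise_tail)
    have "(\<Sum>i\<in>?S. (x i)\<^sup>2) \<le> (\<Sum>i\<in>{..<n} - H. (x i)\<^sup>2)" by (intro sum_mono2) auto
    then show "(\<Sum>i\<in>?S. (x i)\<^sup>2) \<le> K * \<theta>\<^sup>2" using e by linarith
    fix j assume "j \<in> ?S"
    then show "Pr hash_pmf (?A j) \<le> 1 / B" using i by (intro Pr_hash_coll) auto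
  qed (use assms in auto)
  finally show ?thesis by simp
qed

subsection \<open>Anti-concentration\<close>

text \<open>Given the hash and all other coefficients, the content is affine in the coefficient of
  \<open>i\<close> with slope \<open>x i\<close>. Hence nothing else in the node or in the bucket,
  however large, is likely to cancel \<open>i\<close>.\<close>

lemma bsum_small_ball:
  assumes i: "i < n" and x: "x i \<noteq> 0" and t: "0 \<le> t"
  shows "Pr block_pmf (\<lambda>\<rho>. \<bar>bsum Md x \<rho> (fst \<rho> (i mod Md)) / snd \<rho> (i mod Md)\<bar> \<le> t)
    \<le> 2 * t / \<bar>x i\<bar> + 1 / (2 * real M)"
proof -
  have v: "i mod Md < n" using i by (meson mod_less_eq_dividend le_less_trans)
  \<comment> \<open>The divisor belongs to the coordinate \<open>i mod Md\<close>, which may be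
    \<open>i\<close> itself. Replacing it by its bound 2 first keeps the event affine in the
    coefficient that is redrawn.\<close>
  have "Pr block_pmf (\<lambda>\<rho>. \<bar>bsum Md x \<rho> (fst \<rho> (i mod Md)) / snd \<rho> (i mod Md)\<bar> \<le> t)
     \<le> Pr block_pmf (\<lambda>\<rho>. \<bar>bsum Md x \<rho> (fst \<rho> (i mod Md))\<bar> \<le> 2 * t)"
  proof (rule Pr_mono)
    fix \<rho> assume \<rho>: "\<rho> \<in> set_pmf block_pmf" and *: "\<bar>bsum Md x \<rho> (fst \<rho> (i mod Md)) / snd \<rho> (i mod Md)\<bar> \<le> t"
    have g: "1 \<le> \<bar>snd \<rho> (i mod Md)\<bar>" "\<bar>snd \<rho> (i mod Md)\<bar> \<le> 2" using set_block[OF \<rho> v] by auto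
    have "\<bar>bsum Md x \<rho> (fst \<rho> (i mod Md))\<bar> \<le> t * \<bar>snd \<rho> (i mod Md)\<bar>"
      using * g by (auto simp: abs_divide divide_le_eq split: if_splits)
    also have "\<dots> \<le> t * 2" using g t by (intro mult_left_mono) auto
    finally show "\<bar>bsum Md x \<rho> (fst \<rho> (i mod Md))\<bar> \<le> 2 * t" by simp
  qed
  also have "\<dots> \<le> 2 * t / \<bar>x i\<bar> + 1 / (2 * real M)"
    unfolding block_pmf_def
  proof (rule Pr_pair_le)
    fix h
    show "Pr coef_pmf (\<lambda>g. \<bar>bsum Md x (h, g) (fst (h, g) (i mod Md))\<bar> \<le> 2 * t)
      \<le> 2 * t / \<bar>x i\<bar> + 1 / (2 * real M)"
      unfolding coef_pmf_def
    proof (rule Pr_Pi_resample_le[where x = i])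
      fix f :: "nat \<Rightarrow> real"
      let ?z = "\<Sum>j\<in>{..<n} - {i}. if h (j mod Md) = h (i mod Md) then f j * x j else 0"
      have "bsum Md x (h, f(i := y)) (h (i mod Md)) = y * x i + ?z" for y
        unfolding bsum_def fst_conv snd_conv using i
        by (subst sum.remove[of _ i]) (auto intro!: sum.cong cong: if_cong)
      then show "Pr (pmf_of_set (grid M)) (\<lambda>y. \<bar>bsum Md x (h, f(i := y)) (fst (h, f(i := y)) (i mod Md))\<bar> \<le> 2 * t)
        \<le> 2 * t / \<bar>x i\<bar> + 1 / (2 * real M)"
        using grid_small_ball[OF M_pos x, of "2 * t" ?z] t by simp
    qed (use i grid_ne in auto)
  qed auto
  finally show ?thesis .
qed

subsection \<open>Comparison with the probes\<close>

lemma bsum_own: "bsum Md x (h, g) \<beta> = (\<Sum>v<n. if h v = \<beta> then own Md x v g else 0)"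
proof -
  have md: "i mod Md < n" if "i < n" for i using that by (meson mod_less_eq_dividend le_less_trans)
  have "(\<Sum>v<n. if h v = \<beta> then own Md x v g else 0) =
     (\<Sum>v<n. \<Sum>i<n. if h v = \<beta> \<and> i mod Md = v then g i * x i else 0)"
    unfolding own_def by (intro sum.cong refl) (auto intro!: sum.cong)
  also have "\<dots> = (\<Sum>i<n. \<Sum>v<n. if h v = \<beta> \<and> i mod Md = v then g i * x i else 0)"
    by (rule sum.swap)
  also have "\<dots> = (\<Sum>i<n. \<Sum>v<n. if v = i mod Md then (if h v = \<beta> then g i * x i else 0) else 0)"
    by (intro sum.cong refl) auto
  also have "\<dots> = (\<Sum>i<n. if h (i mod Md) = \<beta> then g i * x i else 0)"
    by (intro sum.cong refl) (simp add: md)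
  finally show ?thesis unfolding bsum_def fst_conv snd_conv by simp
qed

text \<open>Relabelling the buckets preserves the uniform law of the hash. Arguments outside the
  domain keep the default 0, so that the relabelled hash stays in the support.\<close>

lemma Pr_hash_involution:
  assumes "\<And>b. b < B \<Longrightarrow> \<tau> b < B \<and> \<tau> (\<tau> b) = b"
  shows "Pr hash_pmf (\<lambda>h. Q (\<lambda>i. if i < n then \<tau> (h i) else 0)) = Pr hash_pmf Q"
proof -
  have eq: "hash_pmf = pmf_of_set (PiE_dflt {..<n} 0 (\<lambda>_. {..<B}))"
    unfolding hash_pmf_def using B_ne by (intro Pi_pmf_of_set) auto
  show ?thesis
    unfolding eq
  proof (rule Pr_of_set_involution)
    show "PiE_dflt {..<n} 0 (\<lambda>_. {..<B}) \<noteq> {}" using B_ne by simp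
    show "finite (PiE_dflt {..<n} (0::nat) (\<lambda>_. {..<B}))" by (rule finite_PiE_dflt) auto
  qed (use assms in \<open>auto simp: PiE_dflt_def fun_eq_iff\<close>)
qed

lemma Pr_coef_flip:
  "Pr coef_pmf (\<lambda>g. Q (\<lambda>i. if i mod Md = v then - g i else g i)) = Pr coef_pmf Q"
proof -
  have eq: "coef_pmf = pmf_of_set (PiE_dflt {..<n} 0 (\<lambda>_. grid M))"
    unfolding coef_pmf_def using grid_ne by (intro Pi_pmf_of_set) auto
  show ?thesis
    unfolding eq
  proof (rule Pr_of_set_involution)
    show "PiE_dflt {..<n} 0 (\<lambda>_. grid M) \<noteq> {}" using grid_ne by simp
    show "finite (PiE_dflt {..<n} (0::real) (\<lambda>_. grid M))" by (rule finite_PiE_dflt) auto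
  qed (auto simp: PiE_dflt_def fun_eq_iff grid_uminus)
qed

lemma own_flip: "own Md x w (\<lambda>i. if i mod Md = v then - g i else g i) = (if w = v then - 1 else 1) * own Md x w g"
  unfolding own_def sum_distrib_left by (intro sum.cong refl) auto

text \<open>Symmetrization: flipping all signs inside the node preserves the law and changes own +
  rest to -own + rest. If the own part exceeds \<open>q\<close> in modulus, one of these two does so
  as well.\<close>

lemma own_le_bsum:
  assumes "v < n" "h v = \<beta>"
  shows "Pr coef_pmf (\<lambda>g. q < \<bar>own Md x v g\<bar>) \<le> 2 * Pr coef_pmf (\<lambda>g. q < \<bar>bsum Md x (h, g) \<beta>\<bar>)"
proof -
  let ?f = "\<lambda>g i. if i mod Md = v then - g i else g i"
  let ?Z = "\<lambda>g. \<Sum>w\<in>{..<n} - {v}. if h w = \<beta> then own Md x w g else 0"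
  have eq: "bsum Md x (h, g) \<beta> = own Md x v g + ?Z g" for g
    unfolding bsum_own using assms by (subst sum.remove[of _ v]) auto
  have Z: "?Z (?f g) = ?Z g" for g by (intro sum.cong refl) (auto simp: own_flip)
  have eq': "bsum Md x (h, ?f g) \<beta> = - own Md x v g + ?Z g" for g
    by (subst eq, subst Z) (simp add: own_flip)
  have "Pr coef_pmf (\<lambda>g. q < \<bar>own Md x v g\<bar>)
     \<le> Pr coef_pmf (\<lambda>g. q < \<bar>bsum Md x (h, g) \<beta>\<bar> \<or> q < \<bar>bsum Md x (h, ?f g) \<beta>\<bar>)"
    by (rule Pr_mono) (unfold eq', unfold eq, linarith)
  also have "\<dots> \<le> Pr coef_pmf (\<lambda>g. q < \<bar>bsum Md x (h, g) \<beta>\<bar>) + Pr coef_pmf (\<lambda>g. q < \<bar>bsum Md x (h, ?f g) \<beta>\<bar>)"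
    by (rule Pr_disj_le)
  also have "Pr coef_pmf (\<lambda>g. q < \<bar>bsum Md x (h, ?f g) \<beta>\<bar>) = Pr coef_pmf (\<lambda>g. q < \<bar>bsum Md x (h, g) \<beta>\<bar>)"
    by (rule Pr_coef_flip)
  finally show ?thesis by simp
qed

text \<open>Suppose more than \<open>B\<close> nodes are heavy and take about B/2 of them. Each is
  the only one of these in bucket 0 with probability at least 1/(2B), and then, by symmetrization,
  the bucket exceeds \<open>q\<close> with probability more than half of 8 p1. These disjoint events
  would add up to more than \<open>p1\<close>.\<close>

lemma card_heavy_le:
  assumes p: "Pr block_pmf (\<lambda>\<rho>. q < \<bar>bsum Md x \<rho> 0\<bar>) \<le> p1"
  shows "card {v. v < n \<and> 8 * p1 < Pr coef_pmf (\<lambda>g. q < \<bar>own Md x v g\<bar>)} \<le> B" (is "card ?H \<le> B")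
proof (rule ccontr)
  assume "\<not> card ?H \<le> B"
  \<comment> \<open>Half of \<open>B\<close>, rounded up: few enough for Bernoulli's inequality to
    give an isolation factor of 1/2, many enough for the disjoint events to sum to c/8.\<close>
  then have "(B + 1) div 2 \<le> card ?H" using B_ge_2 by linarith
  then obtain S where S: "S \<subseteq> ?H" "card S = (B + 1) div 2" by (meson obtain_subset_with_card_n)
  have fin: "finite S" using S(1) by (rule finite_subset) auto
  have p1: "0 \<le> p1" using p Pr_nonneg[of block_pmf] order_trans by blast
  let ?A = "\<lambda>v h. h v = 0 \<and> (\<forall>w\<in>S - {v}. h w \<noteq> (0::nat))"
  have PA: "1 / (2 * real B) \<le> Pr hash_pmf (?A v)" if "v \<in> S" for v
  proof -
    have sub: "S \<subseteq> {..<n}" using S(1) by auto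
    have q: "Pr (pmf_of_set {..<B}) (\<lambda>y. y \<noteq> 0) = 1 - 1 / B"
      using B_ge_2 by (subst Pr_not) (simp add: Pr_eq_const)
    have "Pr hash_pmf (?A v) = Pr hash_pmf (\<lambda>h. \<forall>w\<in>S. (if w = v then h w = 0 else h w \<noteq> 0))"
      using that by (intro Pr_cong) auto
    also have "\<dots> = (\<Prod>w\<in>S. Pr (pmf_of_set {..<B}) (\<lambda>y. if w = v then y = 0 else y \<noteq> 0))"
      unfolding hash_pmf_def by (rule Pr_Pi_ball[OF _ sub, where Q = "\<lambda>w y. if w = v then y = 0 else y \<noteq> 0"]) auto
    also have "\<dots> = (\<Prod>w\<in>S. if w = v then 1 / B else 1 - 1 / B)"
      using B_ge_2 q by (intro prod.cong refl) (auto simp: Pr_eq_const)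
    also have "\<dots> = 1 / B * (1 - 1 / B) ^ (card S - 1)"
      using that fin by (subst prod.remove[of _ v]) (auto simp: card_Diff_singleton)
    finally have eq: "Pr hash_pmf (?A v) = 1 / B * (1 - 1 / B) ^ (card S - 1)" .
    have "1 / 2 \<le> 1 + real (card S - 1) * (- (1 / B))"
    proof -
      have "2 * (card S - 1) \<le> B" using S(2) by linarith
      then have "2 * real (card S - 1) \<le> real B" by linarith
      then show ?thesis using B_ge_2 by (simp add: field_simps)
    qed
    also have "\<dots> \<le> (1 + (- (1 / B))) ^ (card S - 1)"
      using B_ge_2 by (intro Bernoulli_inequality) (simp add: field_simps)
    finally have "1 / 2 \<le> (1 - 1 / B) ^ (card S - 1)" by simp
    then have "1 / B * (1 / 2) \<le> 1 / B * (1 - 1 / B) ^ (card S - 1)" by (intro mult_left_mono) auto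
    then show ?thesis unfolding eq by simp
  qed
  let ?E = "\<lambda>v \<rho>. ?A v (fst \<rho>) \<and> q < \<bar>bsum Md x \<rho> 0\<bar>"
  define c where "c = Min ((\<lambda>v. Pr coef_pmf (\<lambda>g. q < \<bar>own Md x v g\<bar>)) ` S)"
  have Sne: "S \<noteq> {}" using S(2) B_ge_2 by auto
  have "c \<in> (\<lambda>v. Pr coef_pmf (\<lambda>g. q < \<bar>own Md x v g\<bar>)) ` S" unfolding c_def
    using fin Sne by (intro Min_in) auto
  then have c: "8 * p1 < c" using S(1) by auto
  have PE: "c / (4 * B) \<le> Pr block_pmf (?E v)" if v: "v \<in> S" for v
  proof -
    have vn: "v < n" using S(1) v by auto
    have cv: "c \<le> Pr coef_pmf (\<lambda>g. q < \<bar>own Md x v g\<bar>)" unfolding c_def using fin v by (intro Min_le) auto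
    have "c / 2 * (1 / (2 * real B)) \<le> c / 2 * Pr hash_pmf (?A v)"
      using PA[OF v] c p1 by (intro mult_left_mono) auto
    also have "\<dots> = Mean hash_pmf (\<lambda>h. c / 2 * of_bool (?A v h))" by (simp only: Mean_cmult Pr_eq_Mean finite_set_hash)
    also have "\<dots> \<le> Mean hash_pmf (\<lambda>h. Pr coef_pmf (\<lambda>g. ?E v (h, g)))"
    proof (rule Mean_mono)
      fix h
      show "c / 2 * of_bool (?A v h) \<le> Pr coef_pmf (\<lambda>g. ?E v (h, g))"
      proof (cases "?A v h")
        case True
        then have "c \<le> 2 * Pr coef_pmf (\<lambda>g. q < \<bar>bsum Md x (h, g) 0\<bar>)"
          using own_le_bsum[OF vn, of h 0 q Md x] cv by linarith
        moreover have "Pr coef_pmf (\<lambda>g. ?E v (h, g)) = Pr coef_pmf (\<lambda>g. q < \<bar>bsum Md x (h, g) 0\<bar>)"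
          by (rule Pr_cong) (use True in simp)
        moreover have "of_bool (?A v h) = (1::real)" using True by simp
        ultimately show ?thesis by (simp only:)
      next
        case False
        then have "of_bool (?A v h) = (0::real)" by (simp only: of_bool_def if_False)
        then show ?thesis by (simp only:) simp
      qed
    qed
    also have "\<dots> = Pr block_pmf (?E v)" unfolding block_pmf_def by (simp add: Pr_pair)
    finally show ?thesis by simp
  qed
  have "real (card S) * (c / (4 * B)) \<le> (\<Sum>v\<in>S. Pr block_pmf (?E v))"
    using PE sum_bounded_below[of S "c / (4 * B)"] by auto
  \<comment> \<open>In the event for \<open>v\<close> no other element of \<open>S\<close> is in
    bucket 0, so the events for different elements exclude each other.\<close>
  also have "\<dots> = Pr block_pmf (\<lambda>\<rho>. \<exists>v\<in>S. ?E v \<rho>)"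
    by (rule Pr_disjoint_sum[symmetric, OF fin]) blast
  also have "\<dots> \<le> p1" using p by (rule order_trans[rotated]) (rule Pr_mono, auto)
  finally have le: "real (card S) * (c / (4 * B)) \<le> p1" .
  have "B \<le> 2 * card S" using S(2) by linarith
  then have "real B \<le> 2 * real (card S)" by linarith
  then have "real B / 2 * (c / (4 * B)) \<le> real (card S) * (c / (4 * B))"
    using c p1 by (intro mult_right_mono) auto
  also note le
  also have "real B / 2 * (c / (4 * B)) = c / 8" using B_ge_2 by simp
  finally have "c / 8 \<le> p1" .
  then show False using c by simp
qed

text \<open>The own part exceeds \<open>q\<close> with probability at most 8 p1, the rest of the
  bucket with at most 2 p1. If neither does, the sum is at most 2 q, and dividing by a coefficient
  of modulus at least 1 keeps it so.\<close>

lemma light_tail: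
  assumes p: "Pr block_pmf (\<lambda>\<rho>. q < \<bar>bsum Md x \<rho> 0\<bar>) \<le> p1" and q: "0 \<le> q"
    and v: "v < n" and light: "Pr coef_pmf (\<lambda>g. q < \<bar>own Md x v g\<bar>) \<le> 8 * p1"
  shows "Pr block_pmf (\<lambda>\<rho>. 2 * q < \<bar>bsum Md x \<rho> (fst \<rho> v) / snd \<rho> v\<bar>) \<le> 10 * p1"
proof -
  let ?Z = "\<lambda>\<rho> \<beta>. \<Sum>w\<in>{..<n} - {v}. if fst \<rho> w = \<beta> then own Md x w (snd \<rho>) else 0"
  have eq: "bsum Md x \<rho> \<beta> = (if fst \<rho> v = \<beta> then own Md x v (snd \<rho>) else 0) + ?Z \<rho> \<beta>" for \<rho> \<beta>
    using bsum_own[of Md x "fst \<rho>" "snd \<rho>" \<beta>] v by (subst (asm) sum.remove[of _ v]) auto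
  define f where "f \<beta> = Pr block_pmf (\<lambda>\<rho>. q < \<bar>?Z \<rho> \<beta>\<bar>)" for \<beta>
  \<comment> \<open>The content of a bucket without node \<open>v\<close> does not involve the hash
    value of \<open>v\<close>.\<close>
  have indep: "Pr block_pmf (\<lambda>\<rho>. R (fst \<rho> v) \<and> q < \<bar>?Z \<rho> \<beta>\<bar>) = Pr (pmf_of_set {..<B}) R * f \<beta>" for R \<beta>
  proof -
    have "Pr hash_pmf (\<lambda>h. R (h v) \<and> q < \<bar>?Z (h, g) \<beta>\<bar>) = Pr (pmf_of_set {..<B}) R * Pr hash_pmf (\<lambda>h. q < \<bar>?Z (h, g) \<beta>\<bar>)" for g
    proof -
      have Zu: "?Z (h(v := y), g) \<beta> = ?Z (h, g) \<beta>" for h y by (intro sum.cong) auto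
      have "Pr hash_pmf (\<lambda>h. R (h v) \<and> q < \<bar>?Z (h, g) \<beta>\<bar>) =
        Mean hash_pmf (\<lambda>h. Pr (pmf_of_set {..<B}) (\<lambda>y. R y \<and> q < \<bar>?Z (h, g) \<beta>\<bar>))"
        unfolding hash_pmf_def
        by (subst Pr_Pi_resample[where x = v]) (use v B_ne in \<open>auto simp: Zu simp del: fst_conv snd_conv\<close>)
      also have "\<dots> = Mean hash_pmf (\<lambda>h. Pr (pmf_of_set {..<B}) R * of_bool (q < \<bar>?Z (h, g) \<beta>\<bar>))"
        by (intro Mean_cong) (auto simp: Pr_False)
      finally show ?thesis by (simp add: Mean_cmult Pr_eq_Mean)
    qed
    then show ?thesis unfolding f_def block_pmf_def by (simp add: Pr_pair_swap Mean_cmult)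
  qed
  have sym: "f \<beta> = f 0" if "\<beta> < B" for \<beta>
  proof -
    let ?\<tau> = "\<lambda>b. if b = 0 then \<beta> else if b = \<beta> then 0 else b"
    have "Pr hash_pmf (\<lambda>h. q < \<bar>?Z (h, g) \<beta>\<bar>) = Pr hash_pmf (\<lambda>h. q < \<bar>?Z (h, g) 0\<bar>)" for g
    proof -
      have "Pr hash_pmf (\<lambda>h. q < \<bar>?Z (h, g) \<beta>\<bar>) = Pr hash_pmf (\<lambda>h. q < \<bar>?Z ((\<lambda>i. if i < n then ?\<tau> (h i) else 0), g) \<beta>\<bar>)"
        by (rule Pr_hash_involution[symmetric, where Q = "\<lambda>h. q < \<bar>?Z (h, g) \<beta>\<bar>"]) (use that B_ge_2 in auto)
      also have "\<dots> = Pr hash_pmf (\<lambda>h. q < \<bar>?Z (h, g) 0\<bar>)"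
        by (intro Pr_cong arg_cong[of _ _ "\<lambda>z. q < \<bar>z\<bar>"] sum.cong) auto
      finally show ?thesis .
    qed
    then show ?thesis unfolding f_def block_pmf_def by (simp add: Pr_pair_swap)
  qed
  \<comment> \<open>With probability 1 - 1/B, which is at least 1/2, node \<open>v\<close> misses
    bucket 0; then the whole bucket is the rest, and the assumption on bucket 0 applies to
    it.\<close>
  have f0: "f 0 \<le> 2 * p1"
  proof -
    have "(1 - 1 / B) * f 0 = Pr block_pmf (\<lambda>\<rho>. fst \<rho> v \<noteq> 0 \<and> q < \<bar>?Z \<rho> 0\<bar>)"
      using indep[of "\<lambda>b. b \<noteq> 0" 0] Pr_not[of "pmf_of_set {..<B}" "\<lambda>b. b = 0"]
        Pr_eq_const[of "{..<B}" 0] B_ge_2 by (simp only:) simp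
    also have "\<dots> \<le> Pr block_pmf (\<lambda>\<rho>. q < \<bar>bsum Md x \<rho> 0\<bar>)"
      by (rule Pr_mono) (simp add: eq)
    also have "\<dots> \<le> p1" by (rule p)
    finally have 1: "(1 - 1 / B) * f 0 \<le> p1" .
    have "1 / 2 * f 0 \<le> (1 - 1 / B) * f 0"
      using B_ge_2 by (intro mult_right_mono) (auto simp: f_def field_simps)
    then show ?thesis using 1 by linarith
  qed
  have Zv: "Pr block_pmf (\<lambda>\<rho>. q < \<bar>?Z \<rho> (fst \<rho> v)\<bar>) \<le> 2 * p1"
  proof -
    have "Pr block_pmf (\<lambda>\<rho>. q < \<bar>?Z \<rho> (fst \<rho> v)\<bar>)
       = Pr block_pmf (\<lambda>\<rho>. \<exists>\<beta>\<in>{..<B}. fst \<rho> v = \<beta> \<and> q < \<bar>?Z \<rho> \<beta>\<bar>)"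
      using set_block(1) v by (intro Pr_cong) auto
    also have "\<dots> \<le> (\<Sum>\<beta><B. Pr block_pmf (\<lambda>\<rho>. fst \<rho> v = \<beta> \<and> q < \<bar>?Z \<rho> \<beta>\<bar>))"
      by (rule Pr_bex_le) auto
    also have "\<dots> = (\<Sum>\<beta><B. 1 / B * f 0)"
    proof (intro sum.cong refl)
      fix \<beta> assume "\<beta> \<in> {..<B}"
      then show "Pr block_pmf (\<lambda>\<rho>. fst \<rho> v = \<beta> \<and> q < \<bar>?Z \<rho> \<beta>\<bar>) = 1 / B * f 0"
        using indep[of "\<lambda>b. b = \<beta>" \<beta>] sym[of \<beta>] Pr_eq_const[of "{..<B}" \<beta>] by (simp only:) simp
    qed
    also have "\<dots> = f 0" using B_ge_2 by simp
    finally show ?thesis using f0 by linarith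
  qed
  have "Pr block_pmf (\<lambda>\<rho>. 2 * q < \<bar>bsum Md x \<rho> (fst \<rho> v) / snd \<rho> v\<bar>)
    \<le> Pr block_pmf (\<lambda>\<rho>. q < \<bar>own Md x v (snd \<rho>)\<bar> \<or> q < \<bar>?Z \<rho> (fst \<rho> v)\<bar>)"
  proof (rule Pr_mono)
    fix \<rho> assume \<rho>: "\<rho> \<in> set_pmf block_pmf" and *: "2 * q < \<bar>bsum Md x \<rho> (fst \<rho> v) / snd \<rho> v\<bar>"
    have g: "1 \<le> \<bar>snd \<rho> v\<bar>" using set_block(3)[OF \<rho> v] .
    have "\<bar>bsum Md x \<rho> (fst \<rho> v) / snd \<rho> v\<bar> \<le> \<bar>bsum Md x \<rho> (fst \<rho> v)\<bar>"
      using g mult_left_mono[OF g, of "\<bar>bsum Md x \<rho> (fst \<rho> v)\<bar>"] by (auto simp: abs_divide divide_le_eq)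
    then have "2 * q < \<bar>own Md x v (snd \<rho>) + ?Z \<rho> (fst \<rho> v)\<bar>" using * by (simp add: eq)
    then show "q < \<bar>own Md x v (snd \<rho>)\<bar> \<or> q < \<bar>?Z \<rho> (fst \<rho> v)\<bar>" by linarith
  qed
  also have "\<dots> \<le> Pr block_pmf (\<lambda>\<rho>. q < \<bar>own Md x v (snd \<rho>)\<bar>) + Pr block_pmf (\<lambda>\<rho>. q < \<bar>?Z \<rho> (fst \<rho> v)\<bar>)"
    by (rule Pr_disj_le)
  also have "Pr block_pmf (\<lambda>\<rho>. q < \<bar>own Md x v (snd \<rho>)\<bar>) = Pr coef_pmf (\<lambda>g. q < \<bar>own Md x v g\<bar>)"
    unfolding block_pmf_def by (rule Pr_pair_snd) auto
  finally show ?thesis using light Zv by linarith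
qed

text \<open>The law has atoms, so the quantile is described by a strict and a non-strict tail: the
  first limits the nodes that exceed it, the second makes the probes reach it.\<close>

lemma probe_quantile:
  assumes "0 < p1" "p1 \<le> 1"
  obtains q where "0 \<le> q" "Pr block_pmf (\<lambda>\<rho>. q < \<bar>bsum Md x \<rho> 0\<bar>) \<le> p1"
    "p1 \<le> Pr block_pmf (\<lambda>\<rho>. q \<le> \<bar>bsum Md x \<rho> 0\<bar>)"
proof -
  let ?F = "\<lambda>t. Pr block_pmf (\<lambda>\<rho>. t < \<bar>bsum Md x \<rho> 0\<bar>)"
  \<comment> \<open>Including 0 makes \<open>q\<close> nonnegative and gives every positive
    \<open>q\<close> a predecessor, at which the first inequality fails.\<close>
  define V where "V = insert 0 ((\<lambda>\<rho>. \<bar>bsum Md x \<rho> 0\<bar>) ` set_pmf block_pmf)"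
  have V: "finite V" "V \<noteq> {}" by (auto simp: V_def)
  have "?F (Max V) = 0"
    by (rule Pr_False) (use V in \<open>auto simp: V_def not_less\<close>)
  then have "Max V \<in> {t\<in>V. ?F t \<le> p1}" using assms Max_in[OF V] by (simp del: Max_in)
  then have ne: "{t\<in>V. ?F t \<le> p1} \<noteq> {}" by blast
  define q where "q = Min {t\<in>V. ?F t \<le> p1}"
  have fin: "finite {t\<in>V. ?F t \<le> p1}" using V by auto
  have q: "q \<in> V" "?F q \<le> p1" using Min_in[OF fin ne] by (auto simp: q_def)
  have "0 \<le> q" using q(1) by (auto simp: V_def)
  moreover have "p1 \<le> Pr block_pmf (\<lambda>\<rho>. q \<le> \<bar>bsum Md x \<rho> 0\<bar>)"
  proof (cases "q = 0")
    case True
    then show ?thesis using assms by (simp add: Pr_True)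
  next
    case False
    then have "0 \<in> {t\<in>V. t < q}" using \<open>0 \<le> q\<close> by (auto simp: V_def)
    then have ne': "{t\<in>V. t < q} \<noteq> {}" by blast
    have fin': "finite {t\<in>V. t < q}" using V by auto
    obtain s where s: "s \<in> V" "s < q" "\<And>t. t \<in> V \<Longrightarrow> t < q \<Longrightarrow> t \<le> s"
    proof
      show "Max {t\<in>V. t < q} \<in> V" "Max {t\<in>V. t < q} < q" using Max_in[OF fin' ne'] by simp_all
    qed (rule Max_ge[OF fin'], simp)
    have "\<not> ?F s \<le> p1"
    proof
      assume "?F s \<le> p1"
      then have "q \<le> s" unfolding q_def using s(1) fin by (intro Min_le) simp_all
      then show False using s by simp
    qed
    moreover have "?F s \<le> Pr block_pmf (\<lambda>\<rho>. q \<le> \<bar>bsum Md x \<rho> 0\<bar>)"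
    proof (rule Pr_mono, rule ccontr)
      fix \<rho> assume *: "\<rho> \<in> set_pmf block_pmf" "s < \<bar>bsum Md x \<rho> 0\<bar>" "\<not> q \<le> \<bar>bsum Md x \<rho> 0\<bar>"
      then have "\<bar>bsum Md x \<rho> 0\<bar> \<le> s" by (intro s(3)) (auto simp: V_def)
      then show False using * by simp
    qed
    ultimately show ?thesis by linarith
  qed
  ultimately show ?thesis using that q by blast
qed

end


section \<open>Levels of the search tree\<close>

text \<open>Indexed by the repetition and by the block within it: block 0 measures the nodes, blocks
  1 to \<open>u\<close> serve as probes.\<close>

type_synonym level = "nat \<Rightarrow> nat \<Rightarrow> block"

definition no_block :: block where
  "no_block = (\<lambda>_. 0, \<lambda>_. 0)"

definition children :: "nat \<Rightarrow> nat \<Rightarrow> nat \<Rightarrow> nat \<Rightarrow> nat list" where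
  "children n b Md v = filter (\<lambda>w. w < n) (map (\<lambda>j. v + j * Md) [0..<b])"

lemma children_props:
  "distinct (children n b Md v)" if "0 < Md"
  using that by (auto simp: children_def distinct_map inj_on_def intro!: distinct_filter)

lemma length_children: "length (children n b Md v) \<le> b"
  unfolding children_def by (rule order_trans[OF length_filter_le]) simp

lemma set_children: "set (children n b Md v) = {w. w < n \<and> (\<exists>j<b. w = v + j * Md)}"
  unfolding children_def by auto

locale scheme = hashing n B M for n B M :: nat +
  fixes a u b D :: nat and x :: "nat \<Rightarrow> real"
  assumes a_pos: "0 < a" and u_pos: "0 < u" and b_pos: "0 < b"
begin

definition group_pmf :: "(nat \<Rightarrow> block) pmf" where
  "group_pmf = Pi_pmf {..u} no_block (\<lambda>_. block_pmf)"

definition level_pmf :: "level pmf" where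
  "level_pmf = Pi_pmf {..<2 * a} (\<lambda>_. no_block) (\<lambda>_. group_pmf)"

definition all_pmf :: "(nat \<Rightarrow> level) pmf" where
  "all_pmf = Pi_pmf {..<D} (\<lambda>_ _. no_block) (\<lambda>_. level_pmf)"

text \<open>A single bucket is guaranteed to reach the quantile only with the small probability
  \<open>p1\<close>; the largest of \<open>u\<close> buckets misses it with probability at most
  \<open>(1 - p1) ^ u\<close>. Squares replace absolute values.\<close>

definition probe :: "nat \<Rightarrow> (nat \<Rightarrow> block) \<Rightarrow> real" where
  "probe Md \<gamma> = Max ((\<lambda>c. (bsum Md x (\<gamma> c) 0)\<^sup>2) ` {1..u})"

text \<open>The factor 4 is the square of the 2 in \<open>light_tail\<close>: a light node may reach
  twice the quantile.\<close>

definition thr :: "nat \<Rightarrow> level \<Rightarrow> real" where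
  "thr Md \<Lambda> = 4 * med (2 * a) (\<lambda>r. probe Md (\<Lambda> r))"

text \<open>Node \<open>v\<close> is normalized by the coefficient of the coordinate with the same
  number, which the decoder finds in column \<open>v\<close>. For a node of several coordinates this
  changes the size by a factor of at most 2.\<close>

definition ratio :: "nat \<Rightarrow> nat \<Rightarrow> block \<Rightarrow> real" where
  "ratio Md v \<rho> = bsum Md x \<rho> (fst \<rho> v) / snd \<rho> v"

definition score :: "nat \<Rightarrow> level \<Rightarrow> nat \<Rightarrow> real" where
  "score Md \<Lambda> v = med (2 * a) (\<lambda>r. (ratio Md v (\<Lambda> r 0))\<^sup>2)"

lemma finite_set_group [simp]: "finite (set_pmf group_pmf)"
  unfolding group_pmf_def by (intro finite_set_Pi_pmf) auto

lemma finite_set_level [simp]: "finite (set_pmf level_pmf)"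
  unfolding level_pmf_def by (intro finite_set_Pi_pmf) auto

lemma finite_set_all [simp]: "finite (set_pmf all_pmf)"
  unfolding all_pmf_def by (intro finite_set_Pi_pmf) auto

lemma Pr_level_half:
  assumes "Pr group_pmf Q \<le> c" "\<And>\<Lambda>. Bad \<Lambda> \<Longrightarrow> a \<le> card {r. r < 2 * a \<and> Q (\<Lambda> r)}"
  shows "Pr level_pmf Bad \<le> (4 * c) ^ a"
proof -
  have "Pr level_pmf Bad \<le> Pr level_pmf (\<lambda>\<Lambda>. a \<le> card {r. r < 2 * a \<and> Q (\<Lambda> r)})"
    using assms(2) by (intro Pr_mono)
  also have "\<dots> \<le> (4 * c) ^ a"
    unfolding level_pmf_def by (rule Pr_half_bad[OF assms(1)])
  finally show ?thesis .
qed

lemma Pr_level_half_block: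
  assumes "Pr block_pmf Q \<le> c" "\<And>\<Lambda>. Bad \<Lambda> \<Longrightarrow> a \<le> card {r. r < 2 * a \<and> Q (\<Lambda> r 0)}"
  shows "Pr level_pmf Bad \<le> (4 * c) ^ a"
proof (rule Pr_level_half[OF _ assms(2)])
  show "Pr group_pmf (\<lambda>\<gamma>. Q (\<gamma> 0)) \<le> c"
    using assms(1) unfolding group_pmf_def by (subst Pr_Pi_component) auto
qed

lemma score_nonneg: "0 \<le> score Md \<Lambda> v"
  by (simp add: score_def med_nonneg)

lemma thr_nonneg: "0 \<le> thr Md \<Lambda>"
  by (simp add: thr_def med_nonneg)

lemma card_le_cardI: "a \<le> card {r. r < m \<and> Q r} \<Longrightarrow> (\<And>r. Q r \<Longrightarrow> S r) \<Longrightarrow> a \<le> card {r. r < (m::nat) \<and> S r}"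
  by (erule order_trans) (intro card_mono, auto)

lemma Pr_score_light:
  assumes "Pr block_pmf (\<lambda>\<rho>. q < \<bar>bsum Md x \<rho> 0\<bar>) \<le> p1" "0 \<le> q"
    "v < n" "Pr coef_pmf (\<lambda>g. q < \<bar>own Md x v g\<bar>) \<le> 8 * p1"
  shows "Pr level_pmf (\<lambda>\<Lambda>. 4 * q\<^sup>2 < score Md \<Lambda> v) \<le> (40 * p1) ^ a"
proof -
  have "Pr level_pmf (\<lambda>\<Lambda>. 4 * q\<^sup>2 < score Md \<Lambda> v) \<le> (4 * (10 * p1)) ^ a"
  proof (rule Pr_level_half_block)
    show "Pr block_pmf (\<lambda>\<rho>. 2 * q < \<bar>ratio Md v \<rho>\<bar>) \<le> 10 * p1"
      unfolding ratio_def by (rule light_tail[OF assms])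
    fix \<Lambda> assume "4 * q\<^sup>2 < score Md \<Lambda> v"
    then have "a \<le> card {r. r < 2 * a \<and> 4 * q\<^sup>2 < (ratio Md v (\<Lambda> r 0))\<^sup>2}"
      unfolding score_def by (rule less_medD) simp
    then show "a \<le> card {r. r < 2 * a \<and> 2 * q < \<bar>ratio Md v (\<Lambda> r 0)\<bar>}"
    proof (rule card_le_cardI)
      fix r assume "4 * q\<^sup>2 < (ratio Md v (\<Lambda> r 0))\<^sup>2"
      then have "(2 * q)\<^sup>2 < \<bar>ratio Md v (\<Lambda> r 0)\<bar>\<^sup>2" by (simp add: power_mult_distrib)
      then show "2 * q < \<bar>ratio Md v (\<Lambda> r 0)\<bar>" by (rule power2_less_imp_less) simp
    qed
  qed
  then show ?thesis by simp
qed

lemma Pr_thr_low: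
  assumes "0 \<le> p1" "p1 \<le> Pr block_pmf (\<lambda>\<rho>. q \<le> \<bar>bsum Md x \<rho> 0\<bar>)" "0 \<le> q"
  shows "Pr level_pmf (\<lambda>\<Lambda>. thr Md \<Lambda> < 4 * q\<^sup>2) \<le> (4 * (1 - p1) ^ u) ^ a"
proof (rule Pr_level_half)
  let ?Q = "\<lambda>\<gamma>. \<forall>c\<in>{1..u}. \<bar>bsum Md x (\<gamma> c) 0\<bar> < q"
  have "Pr group_pmf ?Q = (\<Prod>c\<in>{1..u}. Pr block_pmf (\<lambda>\<rho>. \<bar>bsum Md x \<rho> 0\<bar> < q))"
    unfolding group_pmf_def by (rule Pr_Pi_ball) auto
  also have "\<dots> \<le> (1 - p1) ^ u"
  proof -
    have "Pr block_pmf (\<lambda>\<rho>. \<bar>bsum Md x \<rho> 0\<bar> < q) = 1 - Pr block_pmf (\<lambda>\<rho>. q \<le> \<bar>bsum Md x \<rho> 0\<bar>)"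
      by (subst Pr_not[symmetric]) (simp add: not_le)
    then have "Pr block_pmf (\<lambda>\<rho>. \<bar>bsum Md x \<rho> 0\<bar> < q) \<le> 1 - p1" using assms by simp
    then show ?thesis by (simp add: power_mono)
  qed
  finally show "Pr group_pmf ?Q \<le> (1 - p1) ^ u" .
  fix \<Lambda> assume *: "thr Md \<Lambda> < 4 * q\<^sup>2"
  then have "\<not> q\<^sup>2 \<le> med (2 * a) (\<lambda>r. probe Md (\<Lambda> r))" "0 < q\<^sup>2"
    using thr_nonneg[of Md \<Lambda>] by (auto simp: thr_def)
  then have "a \<le> card {r. r < 2 * a \<and> probe Md (\<Lambda> r) < q\<^sup>2}" by (rule not_le_medD)
  then show "a \<le> card {r. r < 2 * a \<and> ?Q (\<Lambda> r)}"
  proof (rule card_le_cardI, intro ballI)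
    fix r c assume "probe Md (\<Lambda> r) < q\<^sup>2" "c \<in> {1..u}"
    then have "(bsum Md x (\<Lambda> r c) 0)\<^sup>2 < q\<^sup>2" unfolding probe_def
      by (subst (asm) Max_less_iff) auto
    then have "\<bar>bsum Md x (\<Lambda> r c) 0\<bar>\<^sup>2 < q\<^sup>2" by simp
    then show "\<bar>bsum Md x (\<Lambda> r c) 0\<bar> < q" using assms(3) by (rule power2_less_imp_less)
  qed
qed

lemma Pr_thr_high:
  assumes "Pr block_pmf (\<lambda>\<rho>. q < \<bar>bsum Md x \<rho> 0\<bar>) \<le> p" "0 \<le> q"
  shows "Pr level_pmf (\<lambda>\<Lambda>. 4 * q\<^sup>2 < thr Md \<Lambda>) \<le> (4 * (real u * p)) ^ a"
proof (rule Pr_level_half)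
  let ?Q = "\<lambda>\<gamma>. \<exists>c\<in>{1..u}. q < \<bar>bsum Md x (\<gamma> c) 0\<bar>"
  have "Pr group_pmf ?Q \<le> card {1..u} * p"
  proof (rule Pr_bex_le_const)
    fix c assume "c \<in> {1..u}"
    then show "Pr group_pmf (\<lambda>\<gamma>. q < \<bar>bsum Md x (\<gamma> c) 0\<bar>) \<le> p"
      using assms(1) Pr_Pi_component[of "{..u}" c no_block "\<lambda>_. block_pmf" "\<lambda>\<rho>. q < \<bar>bsum Md x \<rho> 0\<bar>"]
      unfolding group_pmf_def by simp
  qed auto
  then show "Pr group_pmf ?Q \<le> real u * p" by simp
  fix \<Lambda> assume *: "4 * q\<^sup>2 < thr Md \<Lambda>"
  then have "q\<^sup>2 < med (2 * a) (\<lambda>r. probe Md (\<Lambda> r))" by (simp add: thr_def)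
  then have "a \<le> card {r. r < 2 * a \<and> q\<^sup>2 < probe Md (\<Lambda> r)}" by (rule less_medD) simp
  then show "a \<le> card {r. r < 2 * a \<and> ?Q (\<Lambda> r)}"
  proof (rule card_le_cardI)
    fix r assume "q\<^sup>2 < probe Md (\<Lambda> r)"
    then obtain c where c: "c \<in> {1..u}" "q\<^sup>2 < (bsum Md x (\<Lambda> r c) 0)\<^sup>2" unfolding probe_def
      using u_pos by (subst (asm) Max_gr_iff) auto
    from c(2) have "q\<^sup>2 < \<bar>bsum Md x (\<Lambda> r c) 0\<bar>\<^sup>2" by simp
    then have "q < \<bar>bsum Md x (\<Lambda> r c) 0\<bar>" by (rule power2_less_imp_less) simp
    then show "?Q (\<Lambda> r)" using c(1) by blast
  qed
qed

lemma Pr_score_small: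
  assumes "i < n" "x i \<noteq> 0" "0 \<le> t"
  shows "Pr level_pmf (\<lambda>\<Lambda>. score Md \<Lambda> (i mod Md) \<le> t\<^sup>2) \<le> (8 * t / \<bar>x i\<bar> + 2 / real M) ^ a"
proof -
  have "Pr level_pmf (\<lambda>\<Lambda>. score Md \<Lambda> (i mod Md) \<le> t\<^sup>2) \<le> (4 * (2 * t / \<bar>x i\<bar> + 1 / (2 * real M))) ^ a"
  proof (rule Pr_level_half_block)
    show "Pr block_pmf (\<lambda>\<rho>. \<bar>ratio Md (i mod Md) \<rho>\<bar> \<le> t) \<le> 2 * t / \<bar>x i\<bar> + 1 / (2 * real M)"
      unfolding ratio_def by (rule bsum_small_ball[where x = x, OF assms])
    fix \<Lambda> assume "score Md \<Lambda> (i mod Md) \<le> t\<^sup>2"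
    then have "a \<le> card {r. r < 2 * a \<and> (ratio Md (i mod Md) (\<Lambda> r 0))\<^sup>2 \<le> t\<^sup>2}"
      unfolding score_def by (intro not_less_medD) auto
    then show "a \<le> card {r. r < 2 * a \<and> \<bar>ratio Md (i mod Md) (\<Lambda> r 0)\<bar> \<le> t}"
    proof (rule card_le_cardI)
      fix r assume "(ratio Md (i mod Md) (\<Lambda> r 0))\<^sup>2 \<le> t\<^sup>2"
      then show "\<bar>ratio Md (i mod Md) (\<Lambda> r 0)\<bar> \<le> t"
        using assms(3) abs_le_square_iff[of "ratio Md (i mod Md) (\<Lambda> r 0)" t] by simp
    qed
  qed
  then show ?thesis by (simp add: algebra_simps)
qed

text \<open>A median of squares outside the allowed range forces \<open>a\<close> of the squares to
  leave it on the same side, and taking roots preserves the order.\<close>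

lemma Pr_score_inaccurate:
  assumes p: "Pr block_pmf (\<lambda>\<rho>. \<gamma> < \<bar>\<bar>ratio Md i \<rho>\<bar> - \<bar>x i\<bar>\<bar>) \<le> p" and "0 \<le> \<gamma>"
  shows "Pr level_pmf (\<lambda>\<Lambda>. \<gamma> < \<bar>sqrt (score Md \<Lambda> i) - \<bar>x i\<bar>\<bar>) \<le> (4 * p) ^ a"
proof (rule Pr_level_half_block[OF p])
  fix \<Lambda> assume *: "\<gamma> < \<bar>sqrt (score Md \<Lambda> i) - \<bar>x i\<bar>\<bar>"
  consider "\<bar>x i\<bar> + \<gamma> < sqrt (score Md \<Lambda> i)" | "sqrt (score Md \<Lambda> i) < \<bar>x i\<bar> - \<gamma>"
    using * by linarith
  then show "a \<le> card {r. r < 2 * a \<and> \<gamma> < \<bar>\<bar>ratio Md i (\<Lambda> r 0)\<bar> - \<bar>x i\<bar>\<bar>}"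
  proof cases
    case 1
    then have "(\<bar>x i\<bar> + \<gamma>)\<^sup>2 < (sqrt (score Md \<Lambda> i))\<^sup>2"
      using assms(2) by (intro power_strict_mono) auto
    then have "(\<bar>x i\<bar> + \<gamma>)\<^sup>2 < score Md \<Lambda> i" using score_nonneg[of Md \<Lambda> i] by simp
    then have "a \<le> card {r. r < 2 * a \<and> (\<bar>x i\<bar> + \<gamma>)\<^sup>2 < (ratio Md i (\<Lambda> r 0))\<^sup>2}"
      unfolding score_def by (rule less_medD) simp
    then show ?thesis
    proof (rule card_le_cardI)
      fix r assume "(\<bar>x i\<bar> + \<gamma>)\<^sup>2 < (ratio Md i (\<Lambda> r 0))\<^sup>2"
      then have "(\<bar>x i\<bar> + \<gamma>)\<^sup>2 < \<bar>ratio Md i (\<Lambda> r 0)\<bar>\<^sup>2" by simp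
      then have "\<bar>x i\<bar> + \<gamma> < \<bar>ratio Md i (\<Lambda> r 0)\<bar>"
        by (rule power2_less_imp_less[OF _ abs_ge_zero])
      then show "\<gamma> < \<bar>\<bar>ratio Md i (\<Lambda> r 0)\<bar> - \<bar>x i\<bar>\<bar>" by linarith
    qed
  next
    case 2
    have nn: "0 \<le> sqrt (score Md \<Lambda> i)" using score_nonneg[of Md \<Lambda> i] by simp
    then have pos: "0 < \<bar>x i\<bar> - \<gamma>" using 2 by linarith
    have "(sqrt (score Md \<Lambda> i))\<^sup>2 < (\<bar>x i\<bar> - \<gamma>)\<^sup>2"
      using 2 nn by (intro power_strict_mono) auto
    then have "score Md \<Lambda> i < (\<bar>x i\<bar> - \<gamma>)\<^sup>2" using score_nonneg[of Md \<Lambda> i] by simp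
    then have "\<not> (\<bar>x i\<bar> - \<gamma>)\<^sup>2 \<le> med (2 * a) (\<lambda>r. (ratio Md i (\<Lambda> r 0))\<^sup>2)"
      by (simp add: score_def)
    moreover have "0 < (\<bar>x i\<bar> - \<gamma>)\<^sup>2" using pos by (rule zero_less_power)
    ultimately have "a \<le> card {r. r < 2 * a \<and> (ratio Md i (\<Lambda> r 0))\<^sup>2 < (\<bar>x i\<bar> - \<gamma>)\<^sup>2}"
      by (rule not_le_medD)
    then show ?thesis
    proof (rule card_le_cardI)
      fix r assume "(ratio Md i (\<Lambda> r 0))\<^sup>2 < (\<bar>x i\<bar> - \<gamma>)\<^sup>2"
      then have "\<bar>ratio Md i (\<Lambda> r 0)\<bar>\<^sup>2 < (\<bar>x i\<bar> - \<gamma>)\<^sup>2" by simp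
      then have "\<bar>ratio Md i (\<Lambda> r 0)\<bar> < \<bar>x i\<bar> - \<gamma>"
        by (rule power2_less_imp_less[OF _ less_imp_le[OF pos]])
      then show "\<gamma> < \<bar>\<bar>ratio Md i (\<Lambda> r 0)\<bar> - \<bar>x i\<bar>\<bar>" by linarith
    qed
  qed
qed

text \<open>At most \<open>B\<close> nodes are heavy, so a survivor count above 2 B requires either
  a threshold below 4 q^2 or at least \<open>B\<close> light nodes scoring above 4 q^2. Markov's
  inequality over the at most 2 b B nodes of \<open>W\<close> bounds the latter. The set
  \<open>W\<close> is fixed before the level is drawn.\<close>

lemma Pr_level_overflow:
  assumes p1: "0 < p1" "p1 \<le> 1" "(1 - p1) ^ u \<le> p1" and W: "W \<subseteq> {..<n}" "card W \<le> b * (2 * B)"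
  shows "Pr level_pmf (\<lambda>\<Lambda>. 2 * B < card {v\<in>W. thr Md \<Lambda> < score Md \<Lambda> v}) \<le> real (3 * b) * (40 * p1) ^ a"
proof -
  obtain q where q: "0 \<le> q" "Pr block_pmf (\<lambda>\<rho>. q < \<bar>bsum Md x \<rho> 0\<bar>) \<le> p1"
    "p1 \<le> Pr block_pmf (\<lambda>\<rho>. q \<le> \<bar>bsum Md x \<rho> 0\<bar>)"
    using probe_quantile[OF p1(1,2)] by metis
  let ?Hv = "{v. v < n \<and> 8 * p1 < Pr coef_pmf (\<lambda>g. q < \<bar>own Md x v g\<bar>)}"
  let ?W = "W - ?Hv"
  have finW: "finite W" using W(1) finite_subset by blast
  have Hv: "card ?Hv \<le> B" by (rule card_heavy_le[OF q(2)])
  let ?N = "\<lambda>\<Lambda>. \<Sum>v\<in>?W. of_bool (4 * q\<^sup>2 < score Md \<Lambda> v)"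
  have "Pr level_pmf (\<lambda>\<Lambda>. 2 * B < card {v\<in>W. thr Md \<Lambda> < score Md \<Lambda> v})
     \<le> Pr level_pmf (\<lambda>\<Lambda>. thr Md \<Lambda> < 4 * q\<^sup>2 \<or> real B \<le> ?N \<Lambda>)"
  proof (rule Pr_mono)
    fix \<Lambda> assume *: "2 * B < card {v\<in>W. thr Md \<Lambda> < score Md \<Lambda> v}"
    show "thr Md \<Lambda> < 4 * q\<^sup>2 \<or> real B \<le> ?N \<Lambda>"
    proof (cases "thr Md \<Lambda> < 4 * q\<^sup>2")
      case False
      have "{v\<in>W. thr Md \<Lambda> < score Md \<Lambda> v} \<subseteq> ?Hv \<union> {v\<in>?W. 4 * q\<^sup>2 < score Md \<Lambda> v}"
        using False W(1) by auto
      then have "card {v\<in>W. thr Md \<Lambda> < score Md \<Lambda> v} \<le> card (?Hv \<union> {v\<in>?W. 4 * q\<^sup>2 < score Md \<Lambda> v})"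
        using finW by (intro card_mono) auto
      also have "\<dots> \<le> card ?Hv + card {v\<in>?W. 4 * q\<^sup>2 < score Md \<Lambda> v}" by (rule card_Un_le)
      finally have "B \<le> card {v\<in>?W. 4 * q\<^sup>2 < score Md \<Lambda> v}" using * Hv by linarith
      moreover have "real (card {v\<in>?W. 4 * q\<^sup>2 < score Md \<Lambda> v}) = ?N \<Lambda>"
        using finW by (simp add: of_bool_def sum.If_cases Int_def)
      ultimately show ?thesis by linarith
    qed simp
  qed
  also have "\<dots> \<le> Pr level_pmf (\<lambda>\<Lambda>. thr Md \<Lambda> < 4 * q\<^sup>2) + Pr level_pmf (\<lambda>\<Lambda>. real B \<le> ?N \<Lambda>)"
    by (rule Pr_disj_le)
  also have "Pr level_pmf (\<lambda>\<Lambda>. thr Md \<Lambda> < 4 * q\<^sup>2) \<le> (4 * (1 - p1) ^ u) ^ a"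
    using p1 q by (intro Pr_thr_low) auto
  also have "\<dots> \<le> (40 * p1) ^ a" using p1 by (intro power_mono) auto
  also have "Pr level_pmf (\<lambda>\<Lambda>. real B \<le> ?N \<Lambda>) \<le> (real (b * (2 * B)) * (40 * p1) ^ a) / B"
  proof (rule Pr_markov)
    have "Mean level_pmf ?N = (\<Sum>v\<in>?W. Pr level_pmf (\<lambda>\<Lambda>. 4 * q\<^sup>2 < score Md \<Lambda> v))"
      by (simp add: Mean_sum Pr_eq_Mean)
    also have "\<dots> \<le> (\<Sum>v\<in>?W. (40 * p1) ^ a)"
      using W(1) by (intro sum_mono Pr_score_light[OF q(2,1)]) (auto simp: not_less)
    also have "\<dots> = real (card ?W) * (40 * p1) ^ a" by simp
    also have "\<dots> \<le> real (b * (2 * B)) * (40 * p1) ^ a"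
    proof -
      have "card ?W \<le> card W" using finW by (intro card_mono) auto
      then have "card ?W \<le> b * (2 * B)" using W(2) by linarith
      then have "real (card ?W) \<le> real (b * (2 * B))" by (rule of_nat_mono)
      then show ?thesis using p1 by (intro mult_right_mono) auto
    qed
    finally show "Mean level_pmf ?N \<le> real (b * (2 * B)) * (40 * p1) ^ a" .
  qed (use B_ge_2 in \<open>auto intro!: sum_nonneg\<close>)
  also have "\<dots> = real (2 * b) * (40 * p1) ^ a" using B_ge_2 by simp
  finally have "Pr level_pmf (\<lambda>\<Lambda>. 2 * B < card {v\<in>W. thr Md \<Lambda> < score Md \<Lambda> v})
     \<le> (1 + real (2 * b)) * (40 * p1) ^ a" by (simp add: algebra_simps)
  also have "\<dots> \<le> real (3 * b) * (40 * p1) ^ a" using b_pos p1 by (intro mult_right_mono) auto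
  finally show ?thesis .
qed

subsection \<open>Candidates\<close>

definition Mod :: "nat \<Rightarrow> nat" where
  "Mod l = B * b ^ l"

definition survives :: "nat \<Rightarrow> level \<Rightarrow> nat \<Rightarrow> bool" where
  "survives l \<Lambda> v \<longleftrightarrow> thr (Mod (Suc l)) \<Lambda> < score (Mod (Suc l)) \<Lambda> v"

text \<open>Only an overflow makes the cut-off at 2 B effective. It turns the bound on the work per
  level into one that holds for every outcome.\<close>

primrec cands :: "(nat \<Rightarrow> level) \<Rightarrow> nat \<Rightarrow> nat list" where
  "cands \<omega> 0 = [0..<min B n]"
| "cands \<omega> (Suc l) = take (2 * B) (filter (survives l (\<omega> l)) (concat (map (children n b (Mod l)) (cands \<omega> l))))"

lemma Mod_pos: "0 < Mod l"
  using B_ge_2 b_pos by (simp add: Mod_def)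

lemma length_cands: "length (cands \<omega> l) \<le> 2 * B"
  by (cases l) auto

lemma cands_props: "distinct (cands \<omega> l) \<and> set (cands \<omega> l) \<subseteq> {v. v < n \<and> v < Mod l}"
proof (induction l)
  case 0
  then show ?case by (auto simp: Mod_def)
next
  case (Suc l)
  have lt: "w < Mod (Suc l)" if "v < Mod l" "w = v + j * Mod l" "j < b" for v w j
  proof -
    have "w < (1 + j) * Mod l" using that by simp
    also have "\<dots> \<le> b * Mod l" using that by (intro mult_right_mono) auto
    finally show ?thesis by (simp add: Mod_def mult_ac)
  qed
  have "distinct (concat (map (children n b (Mod l)) (cands \<omega> l)))"
  proof (intro distinct_concat)
    have ne: "children n b (Mod l) v \<noteq> []" if "v < n" for v
    proof -
      have "v \<in> set (children n b (Mod l) v)" unfolding set_children using that b_pos by (auto intro!: exI[of _ 0])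
      then show ?thesis by auto
    qed
    have dj: "v = v'" if "v < Mod l" "v' < Mod l" "w \<in> set (children n b (Mod l) v)" "w \<in> set (children n b (Mod l) v')" for v v' w
    proof -
      from that(3,4) obtain j j' where j: "w = v + j * Mod l" "w = v' + j' * Mod l"
        by (auto simp: set_children)
      have "w mod Mod l = v" using that(1) by (subst j(1)) simp
      moreover have "w mod Mod l = v'" using that(2) by (subst j(2)) simp
      ultimately show ?thesis by simp
    qed
    show "distinct (map (children n b (Mod l)) (cands \<omega> l))"
    proof (subst distinct_map, intro conjI inj_onI)
      fix v v' assume v: "v \<in> set (cands \<omega> l)" "v' \<in> set (cands \<omega> l)" "children n b (Mod l) v = children n b (Mod l) v'"
      then have "children n b (Mod l) v \<noteq> []" using Suc by (intro ne) auto
      then obtain w where "w \<in> set (children n b (Mod l) v)" by (meson last_in_set)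
      then show "v = v'" using v Suc by (intro dj[of v v' w]) auto
    qed (use Suc in auto)
    fix ys zs assume "ys \<in> set (map (children n b (Mod l)) (cands \<omega> l))" "zs \<in> set (map (children n b (Mod l)) (cands \<omega> l))" "ys \<noteq> zs"
    then obtain v v' where v: "v \<in> set (cands \<omega> l)" "v' \<in> set (cands \<omega> l)"
      "ys = children n b (Mod l) v" "zs = children n b (Mod l) v'" by auto
    have "v < Mod l" "v' < Mod l" using v Suc by auto
    then show "set ys \<inter> set zs = {}"
      using dj[of v v'] \<open>ys \<noteq> zs\<close> unfolding v(3,4) by (metis disjoint_iff)
  qed (use children_props[OF Mod_pos] in auto)
  moreover have "set (concat (map (children n b (Mod l)) (cands \<omega> l))) \<subseteq> {v. v < n \<and> v < Mod (Suc l)}"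
    using Suc lt by (force simp: set_children)
  ultimately show ?case
    unfolding cands.simps
    by (intro conjI distinct_take distinct_filter order_trans[OF set_take_subset] order_trans[OF filter_is_subset])
qed

lemma cands_upd: "l \<le> m \<Longrightarrow> cands (fun_upd \<omega> m y) l = cands \<omega> l"
  by (induction l) auto

definition tested :: "(nat \<Rightarrow> level) \<Rightarrow> nat \<Rightarrow> nat set" where
  "tested \<omega> l = set (concat (map (children n b (Mod l)) (cands \<omega> l)))"

lemma card_tested: "card (tested \<omega> l) \<le> b * (2 * B)"
proof -
  have "length (concat (map (children n b (Mod l)) vs)) \<le> length vs * b" for vs
    using length_children[of n b "Mod l"] by (induction vs) (auto intro!: add_mono)
  then have "length (concat (map (children n b (Mod l)) (cands \<omega> l))) \<le> length (cands \<omega> l) * b" .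
  also have "\<dots> \<le> 2 * B * b" using length_cands[of \<omega> l] by (rule mult_le_mono1)
  finally have "length (concat (map (children n b (Mod l)) (cands \<omega> l))) \<le> b * (2 * B)"
    by (simp only: mult_ac)
  then show ?thesis unfolding tested_def by (rule order_trans[OF card_length])
qed

lemma tested_subset: "tested \<omega> l \<subseteq> {..<n}"
  by (auto simp: tested_def set_children)

lemma cands_subset_tested: "set (cands \<omega> (Suc l)) \<subseteq> tested \<omega> l"
  by (auto simp: tested_def dest!: in_set_takeD)

definition overflow :: "(nat \<Rightarrow> level) \<Rightarrow> nat \<Rightarrow> bool" where
  "overflow \<omega> l \<longleftrightarrow> 2 * B < card {v\<in>tested \<omega> l. survives l (\<omega> l) v}"

lemma tested_upd: "l \<le> m \<Longrightarrow> tested (fun_upd \<omega> m y) l = tested \<omega> l"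
  by (simp add: tested_def cands_upd)

text \<open>The nodes tested at level \<open>l\<close> are determined by earlier levels, so
  redrawing level \<open>l\<close> leaves them fixed and the bound for a fixed set applies.\<close>

lemma Pr_overflow:
  assumes "0 < p1" "p1 \<le> 1" "(1 - p1) ^ u \<le> p1" "l < D"
  shows "Pr all_pmf (\<lambda>\<omega>. overflow \<omega> l) \<le> real (3 * b) * (40 * p1) ^ a"
  unfolding all_pmf_def
proof (rule Pr_Pi_resample_le[where x = l])
  fix f :: "nat \<Rightarrow> level"
  show "Pr level_pmf (\<lambda>y. overflow (f(l := y)) l) \<le> real (3 * b) * (40 * p1) ^ a"
    unfolding overflow_def survives_def tested_upd[OF order_refl]
    unfolding fun_upd_same by (rule Pr_level_overflow[OF assms(1-3) tested_subset card_tested])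
qed (use assms in auto)

lemma Pr_all_component: "l < D \<Longrightarrow> Pr all_pmf (\<lambda>\<omega>. Q (\<omega> l)) = Pr level_pmf Q"
  unfolding all_pmf_def by (subst Pr_Pi_component) auto

lemma distinct_tested_list:
  "\<not> overflow \<omega> l \<Longrightarrow> set (cands \<omega> (Suc l)) = {v\<in>tested \<omega> l. survives l (\<omega> l) v}"
proof -
  assume no: "\<not> overflow \<omega> l"
  let ?F = "filter (survives l (\<omega> l)) (concat (map (children n b (Mod l)) (cands \<omega> l)))"
  have setF: "set ?F = {v\<in>tested \<omega> l. survives l (\<omega> l) v}" by (auto simp: tested_def)
  show ?thesis
  proof (cases "length ?F \<le> 2 * B")
    case True
    then have "cands \<omega> (Suc l) = ?F" by (simp only: cands.simps take_all)
    then show ?thesis using setF by (simp only:)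
  next
    case False
    \<comment> \<open>The first 2 B entries are distinct, while the filtered list has at most 2 B
      different ones; hence cutting off loses no node.\<close>
    have "distinct (cands \<omega> (Suc l))" using cands_props by blast
    moreover have "length (cands \<omega> (Suc l)) = 2 * B" using False by simp
    ultimately have c: "card (set (cands \<omega> (Suc l))) = 2 * B" using distinct_card by metis
    have "set (cands \<omega> (Suc l)) \<subseteq> set ?F" by (simp add: set_take_subset del: set_filter)
    moreover have "card (set ?F) \<le> 2 * B" using no unfolding overflow_def setF by simp
    ultimately have "set (cands \<omega> (Suc l)) = set ?F" using c by (intro card_seteq) auto
    then show ?thesis using setF by (simp only:)
  qed
qed

text \<open>The residue of \<open>i\<close> at the next level is the present residue plus one digit
  in base \<open>b\<close> times the present modulus, so it is among the children of the present
  node.\<close>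

lemma cands_track:
  assumes "i < n" "\<And>l'. l' < l \<Longrightarrow> \<not> overflow \<omega> l'" "\<And>l'. l' < l \<Longrightarrow> survives l' (\<omega> l') (i mod Mod (Suc l'))"
  shows "i mod Mod l \<in> set (cands \<omega> l)"
  using assms(2,3)
proof (induction l)
  case 0
  have "i mod B < n" using assms(1) by (meson mod_less_eq_dividend le_less_trans)
  then show ?case using B_ge_2 by (simp add: Mod_def)
next
  case (Suc l)
  then have IH: "i mod Mod l \<in> set (cands \<omega> l)" by simp
  have lt: "i mod Mod (Suc l) < n" using assms(1) by (meson mod_less_eq_dividend le_less_trans)
  have "Mod (Suc l) = Mod l * b" by (simp add: Mod_def)
  then have "i mod Mod (Suc l) = i mod Mod l + ((i div Mod l) mod b) * Mod l"
    using mod_mult2_eq[of i "Mod l" b] by (simp only: mult.commute[of "Mod l" "i div Mod l mod b"] add.commute)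
  moreover have "(i div Mod l) mod b < b" using b_pos by simp
  ultimately have "i mod Mod (Suc l) \<in> set (children n b (Mod l) (i mod Mod l))"
    unfolding set_children using lt by blast
  then have "i mod Mod (Suc l) \<in> tested \<omega> l" using IH by (auto simp: tested_def)
  moreover have "survives l (\<omega> l) (i mod Mod (Suc l))" using Suc.prems(2)[of l] by simp
  ultimately show ?case using distinct_tested_list[of \<omega> l] Suc.prems(1)[of l] by blast
qed

end


section \<open>Selecting the largest scores with random pivots\<close>

text \<open>Decreasing scores, ties in favour of the smaller position: a total order. It is phrased
  with negations of \<open><\<close> because this is the comparison that the machine offers.\<close>

definition beats :: "(nat \<Rightarrow> real) \<Rightarrow> nat \<Rightarrow> nat \<Rightarrow> bool" where
  "beats f j p \<longleftrightarrow> \<not> f j < f p \<and> \<not> (\<not> f p < f j \<and> p < j)"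

definition rnk :: "(nat \<Rightarrow> real) \<Rightarrow> nat \<Rightarrow> nat \<Rightarrow> nat" where
  "rnk f m p = card {j. j < m \<and> beats f j p}"

lemma beats_refl [simp]: "beats f p p"
  by (simp add: beats_def)

lemma beats_trans: "beats f i j \<Longrightarrow> beats f j k \<Longrightarrow> beats f i k"
  by (auto simp: beats_def)

lemma beats_total: "beats f i j \<or> beats f j i"
  by (auto simp: beats_def)

lemma beats_antisym: "beats f i j \<Longrightarrow> beats f j i \<Longrightarrow> i = j"
  by (auto simp: beats_def)

lemma rnk_mono:
  assumes "beats f p q" "p \<noteq> q" "q < m"
  shows "rnk f m p < rnk f m q"
  unfolding rnk_def
proof (rule psubset_card_mono)
  have "q \<in> {j. j < m \<and> beats f j q}" "q \<notin> {j. j < m \<and> beats f j p}"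
    using assms beats_antisym by auto
  moreover have "{j. j < m \<and> beats f j p} \<subseteq> {j. j < m \<and> beats f j q}"
    using assms(1) beats_trans by blast
  ultimately show "{j. j < m \<and> beats f j p} \<subset> {j. j < m \<and> beats f j q}" by blast
qed auto

lemma rnk_bij: "bij_betw (rnk f m) {..<m} {1..m}"
proof -
  have inj: "inj_on (rnk f m) {..<m}"
  proof (rule inj_onI, rule ccontr)
    fix p q assume pq: "p \<in> {..<m}" "q \<in> {..<m}" "rnk f m p = rnk f m q" "p \<noteq> q"
    then show False using beats_total[of f p q] rnk_mono[of f p q m] rnk_mono[of f q p m] by auto
  qed
  have sub: "rnk f m ` {..<m} \<subseteq> {1..m}"
  proof
    fix y assume "y \<in> rnk f m ` {..<m}"
    then obtain p where p: "p < m" "y = rnk f m p" by auto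
    have "{p} \<subseteq> {j. j < m \<and> beats f j p}" using p by auto
    then have "card {p} \<le> rnk f m p" unfolding rnk_def by (intro card_mono) auto
    moreover have "rnk f m p \<le> card {..<m}" unfolding rnk_def by (intro card_mono) auto
    ultimately show "y \<in> {1..m}" using p by simp
  qed
  have "rnk f m ` {..<m} = {1..m}"
    using sub inj by (intro card_subset_eq) (auto simp: card_image)
  then show ?thesis using inj by (simp add: bij_betw_def)
qed

lemma card_rnk_between:
  assumes "1 \<le> lo" "lo \<le> N" "N \<le> m"
  shows "card {p. p < m \<and> lo \<le> rnk f m p \<and> rnk f m p \<le> N} = N - lo + 1"
proof -
  let ?S = "{p. p < m \<and> lo \<le> rnk f m p \<and> rnk f m p \<le> N}"
  have "rnk f m ` ?S = {lo..N}"
  proof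
    show "{lo..N} \<subseteq> rnk f m ` ?S"
    proof
      fix y assume y: "y \<in> {lo..N}"
      then have "y \<in> rnk f m ` {..<m}" using rnk_bij[of f m] assms by (auto simp: bij_betw_def)
      then show "y \<in> rnk f m ` ?S" using y by auto
    qed
  qed auto
  moreover have "inj_on (rnk f m) ?S"
    using rnk_bij[of f m] by (auto simp: bij_betw_def intro: inj_on_subset)
  ultimately show ?thesis using card_image[of "rnk f m" ?S] assms by auto
qed

text \<open>The pivots are positions drawn together with the matrix, before the number of candidates
  is known. They range over all possible positions, and those beyond the actual list are
  discarded.\<close>

definition pivot_pmf :: "nat \<Rightarrow> nat \<Rightarrow> (nat \<Rightarrow> nat) pmf" where
  "pivot_pmf s N1 = Pi_pmf {..<s} 0 (\<lambda>_. pmf_of_set {..<N1})"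

lemma finite_set_pivot [simp]: "0 < N1 \<Longrightarrow> finite (set_pmf (pivot_pmf s N1))"
  unfolding pivot_pmf_def by (intro finite_set_Pi_pmf) (auto simp: lessThan_empty_iff)

lemma Pr_pivot_miss:
  assumes "1 \<le> lo" "lo \<le> N" "N \<le> m" "m \<le> N1"
  shows "Pr (pivot_pmf s N1) (\<lambda>\<pi>. \<forall>t\<in>{..<s}. \<not> (\<pi> t < m \<and> lo \<le> rnk f m (\<pi> t) \<and> rnk f m (\<pi> t) \<le> N))
    \<le> (1 - real (N - lo + 1) / real N1) ^ s"
proof -
  let ?Q = "\<lambda>p. p < m \<and> lo \<le> rnk f m p \<and> rnk f m p \<le> N"
  have ne: "{..<N1} \<noteq> {}" using assms by (auto simp: lessThan_empty_iff)
  have "{p \<in> {..<N1}. ?Q p} = {p. ?Q p}" using assms by auto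
  then have "Pr (pmf_of_set {..<N1}) ?Q = real (N - lo + 1) / real N1"
    using assms by (simp only: Pr_of_set[OF _ ne] finite_lessThan card_lessThan card_rnk_between)
  then have "Pr (pmf_of_set {..<N1}) (\<lambda>p. \<not> ?Q p) = 1 - real (N - lo + 1) / real N1"
    by (simp only: Pr_not)
  moreover have "Pr (pivot_pmf s N1) (\<lambda>\<pi>. \<forall>t\<in>{..<s}. \<not> ?Q (\<pi> t)) = (\<Prod>t\<in>{..<s}. Pr (pmf_of_set {..<N1}) (\<lambda>p. \<not> ?Q p))"
    unfolding pivot_pmf_def by (rule Pr_Pi_ball) auto
  ultimately show ?thesis by simp
qed

text \<open>The interface between the probabilistic analysis and the program. It records that no
  pivot of rank at most \<open>N\<close> beats the chosen cut in rank, so one pivot with rank just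
  below \<open>N\<close> already guarantees an almost full output.\<close>

definition selects :: "(nat \<Rightarrow> real) \<Rightarrow> nat \<Rightarrow> nat \<Rightarrow> nat set \<Rightarrow> nat set \<Rightarrow> bool" where
  "selects f m N P J \<longleftrightarrow>
    (if m \<le> N then J = {..<m}
     else (J = {} \<and> (\<forall>q\<in>P. q < m \<longrightarrow> N < rnk f m q)) \<or>
       (\<exists>p<m. rnk f m p \<le> N \<and> (\<forall>q\<in>P. q < m \<and> rnk f m q \<le> N \<longrightarrow> rnk f m q \<le> rnk f m p) \<and>
         J = {j. j < m \<and> beats f j p}))"

lemma selects_card: "selects f m N P J \<Longrightarrow> card J \<le> N \<and> J \<subseteq> {..<m}"
  by (auto simp: selects_def rnk_def split: if_splits)

lemma selects_good:
  assumes "selects f m N P J" "N < m \<Longrightarrow> \<exists>q\<in>P. q < m \<and> lo \<le> rnk f m q \<and> rnk f m q \<le> N"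
  shows "J = {..<m} \<or> (lo \<le> card J \<and> (\<forall>i<m. i \<notin> J \<longrightarrow> (\<forall>j\<in>J. f i \<le> f j)))"
proof (cases "m \<le> N")
  case True
  then show ?thesis using assms(1) by (simp add: selects_def)
next
  case False
  then obtain q where q: "q \<in> P" "q < m" "lo \<le> rnk f m q" "rnk f m q \<le> N" using assms(2) by auto
  then obtain p where p: "p < m" "\<forall>q\<in>P. q < m \<and> rnk f m q \<le> N \<longrightarrow> rnk f m q \<le> rnk f m p"
    "J = {j. j < m \<and> beats f j p}"
    using assms(1) False by (auto simp: selects_def not_less)
  have "rnk f m q \<le> rnk f m p" using p(2) q by blast
  then have "lo \<le> card J" using q(3) unfolding p(3) rnk_def by linarith
  moreover have "f i \<le> f j" if "i < m" "i \<notin> J" "j \<in> J" for i j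
  proof -
    have "\<not> beats f i p" "beats f j p" using that p(3) by auto
    then have "beats f p i" "beats f j p" using beats_total by blast+
    then have "beats f j i" using beats_trans by blast
    then show ?thesis by (simp add: beats_def not_less)
  qed
  ultimately show ?thesis by blast
qed

section \<open>Exchanging missed head entries\<close>

text \<open>If a candidate from the head is missing in \<open>L\<close>, then \<open>L\<close>
  contains at least c2 K accurately estimated indices outside the head; the least modulus \<mu>
  among them satisfies c2 K \<mu>^2 \<le> K \<theta>^2. Its estimate caps the estimates of all
  candidates left out. A missed head entry is therefore negligible, lost earlier, badly estimated
  with a small estimate, or at most \<mu> + 2 \<gamma> in modulus; entries of the last kind are
  exchanged for indices of modulus at least \<mu>.\<close>

lemma exchange:
  fixes x :: "nat \<Rightarrow> real" and est :: "nat \<Rightarrow> real"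
  assumes H: "H \<subseteq> {..<n}" "card H \<le> k" and C: "C \<subseteq> {..<n}" and L: "L \<subseteq> C"
    and E: "(\<Sum>i\<in>{..<n} - H. (x i)\<^sup>2) = K * \<theta>\<^sup>2" and K: "0 < K" "0 \<le> \<theta>" and c2: "0 < c2" and \<gamma>: "0 \<le> \<gamma>"
    and est: "\<And>i. 0 \<le> est i"
    and top: "L = C \<or> (N - w \<le> card L \<and> (\<forall>i\<in>C - L. \<forall>j\<in>L. est i \<le> est j))"
    and G: "G = {i. i < n \<and> \<bar>sqrt (est i) - \<bar>x i\<bar>\<bar> \<le> \<gamma>}" and bad: "card (C - G) \<le> w"
    and N: "k + 2 * w \<le> N" "c2 * K \<le> real (N - 2 * w - k) + 1"
    and e2: "(\<Sum>i\<in>{i\<in>H. d * \<theta> < \<bar>x i\<bar> \<and> i \<notin> C}. (x i)\<^sup>2) \<le> e2"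
    and e1: "(\<Sum>i\<in>{i\<in>H. i \<notin> G \<and> est i \<le> (\<theta> / sqrt c2 + \<gamma>)\<^sup>2}. (x i)\<^sup>2) \<le> e1"
  shows "\<exists>T\<subseteq>L. card T \<le> k \<and>
    (\<Sum>i\<in>{..<n} - T. (x i)\<^sup>2) \<le> K * \<theta>\<^sup>2 + k * (d * \<theta>)\<^sup>2 + e1 + e2 + k * (4 * \<gamma> * (\<theta> / sqrt c2) + 4 * \<gamma>\<^sup>2)"
proof -
  have finH: "finite H" and finC: "finite C" using H C finite_subset by blast+
  then have finL: "finite L" using L finite_subset by blast
  let ?sq = "\<lambda>S. \<Sum>i\<in>S. (x i)\<^sup>2"
  have sq_nonneg: "0 \<le> ?sq S" for S by (intro sum_nonneg) auto
  define U where "U = H - L"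
  define U1 where "U1 = {i\<in>U. \<bar>x i\<bar> \<le> d * \<theta>}"
  define U2 where "U2 = {i\<in>U. d * \<theta> < \<bar>x i\<bar> \<and> i \<notin> C}"
  define U3 where "U3 = {i\<in>U. d * \<theta> < \<bar>x i\<bar> \<and> i \<in> C \<and> i \<notin> G}"
  define U4 where "U4 = {i\<in>U. d * \<theta> < \<bar>x i\<bar> \<and> i \<in> C \<and> i \<in> G}"
  have fins: "finite U" "finite U1" "finite U2" "finite U3" "finite U4"
    using finH by (auto simp: U_def U1_def U2_def U3_def U4_def)
  have sqU: "?sq U = ?sq U1 + ?sq U2 + ?sq U3 + ?sq U4"
  proof -
    have "U = U1 \<union> (U2 \<union> (U3 \<union> U4))" by (auto simp: U1_def U2_def U3_def U4_def)
    moreover have "U1 \<inter> (U2 \<union> (U3 \<union> U4)) = {}" "U2 \<inter> (U3 \<union> U4) = {}" "U3 \<inter> U4 = {}"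
      by (auto simp: U1_def U2_def U3_def U4_def)
    ultimately show ?thesis using fins by (simp add: sum.union_disjoint)
  qed
  have s1: "?sq U1 \<le> k * (d * \<theta>)\<^sup>2"
  proof -
    have "?sq U1 \<le> (\<Sum>i\<in>U1. (d * \<theta>)\<^sup>2)"
    proof (rule sum_mono)
      fix i assume "i \<in> U1"
      then have "\<bar>x i\<bar> \<le> d * \<theta>" by (simp add: U1_def)
      then show "(x i)\<^sup>2 \<le> (d * \<theta>)\<^sup>2" by (simp add: abs_le_square_iff[symmetric])
    qed
    also have "\<dots> = real (card U1) * (d * \<theta>)\<^sup>2" by simp
    also have "\<dots> \<le> k * (d * \<theta>)\<^sup>2"
    proof -
      have "card U1 \<le> card H" using finH by (intro card_mono) (auto simp: U1_def U_def)
      then show ?thesis using H(2) by (intro mult_right_mono) auto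
    qed
    finally show ?thesis .
  qed
  have s2: "?sq U2 \<le> e2"
  proof -
    have "?sq U2 \<le> ?sq {i\<in>H. d * \<theta> < \<bar>x i\<bar> \<and> i \<notin> C}"
      using finH by (intro sum_mono2) (auto simp: U2_def U_def)
    then show ?thesis using e2 by linarith
  qed
  have e1nn: "0 \<le> e1" using e1 sq_nonneg order_trans by blast
  have cardHL: "card (H \<inter> L) + card U = card H"
  proof -
    have "H = (H \<inter> L) \<union> U" "(H \<inter> L) \<inter> U = {}" by (auto simp: U_def)
    moreover have "card ((H \<inter> L) \<union> U) = card (H \<inter> L) + card U"
      by (rule card_Un_disjoint) (use finH fins in \<open>auto simp: U_def\<close>)
    ultimately show ?thesis by (simp only:)
  qed
  have final: "\<exists>T\<subseteq>L. card T \<le> k \<and>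
    ?sq ({..<n} - T) \<le> K * \<theta>\<^sup>2 + k * (d * \<theta>)\<^sup>2 + e1 + e2 + k * (4 * \<gamma> * (\<theta> / sqrt c2) + 4 * \<gamma>\<^sup>2)"
    if V: "V \<subseteq> L - H" "card V \<le> card U" and s3: "?sq U3 \<le> e1"
      and s4: "?sq U4 - ?sq V \<le> k * (4 * \<gamma> * (\<theta> / sqrt c2) + 4 * \<gamma>\<^sup>2)" for V
  proof (intro exI conjI)
    let ?T = "(H \<inter> L) \<union> V"
    show "?T \<subseteq> L" using V(1) by auto
    have finV: "finite V" using V(1) finL finite_subset by blast
    have "card ?T \<le> card (H \<inter> L) + card V" by (rule card_Un_le)
    then show "card ?T \<le> k" using V(2) cardHL H(2) by linarith
    have "?sq ({..<n} - ?T) + ?sq V = ?sq ({..<n} - H) + ?sq U"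
    proof -
      have Vn: "V \<subseteq> {..<n} - H" using V(1) L C by auto
      have "({..<n} - ?T) \<union> V = ({..<n} - H) \<union> U" "({..<n} - ?T) \<inter> V = {}" "({..<n} - H) \<inter> U = {}"
        using Vn H(1) V(1) by (auto simp: U_def)
      moreover have "?sq (({..<n} - ?T) \<union> V) = ?sq ({..<n} - ?T) + ?sq V"
        by (rule sum.union_disjoint) (use finV in auto)
      moreover have "?sq (({..<n} - H) \<union> U) = ?sq ({..<n} - H) + ?sq U"
        by (rule sum.union_disjoint) (use fins in \<open>auto simp: U_def\<close>)
      ultimately show ?thesis by (simp only:)
    qed
    then show "?sq ({..<n} - ?T) \<le> K * \<theta>\<^sup>2 + k * (d * \<theta>)\<^sup>2 + e1 + e2 + k * (4 * \<gamma> * (\<theta> / sqrt c2) + 4 * \<gamma>\<^sup>2)"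
      using E sqU s1 s2 s3 s4 by linarith
  qed
  have rhs_nn: "0 \<le> k * (4 * \<gamma> * (\<theta> / sqrt c2) + 4 * \<gamma>\<^sup>2)" using K c2 \<gamma> by simp
  show ?thesis
  proof (cases "U3 \<union> U4 = {}")
    case True
    then have U34: "U3 = {}" "U4 = {}" by auto
    show ?thesis
    proof (rule final)
      show "?sq U3 \<le> e1" unfolding U34 using e1nn by simp
      show "?sq U4 - ?sq {} \<le> k * (4 * \<gamma> * (\<theta> / sqrt c2) + 4 * \<gamma>\<^sup>2)"
        unfolding U34 using rhs_nn by (simp only: sum.empty diff_self)
    qed simp_all
  next
    case False
    then have "L \<noteq> C" by (auto simp: U3_def U4_def U_def)
    then have cL: "N - w \<le> card L" and tp: "\<And>i j. i \<in> C - L \<Longrightarrow> j \<in> L \<Longrightarrow> est i \<le> est j" using top by auto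
    define GL where "GL = (L \<inter> G) - H"
    have finGL: "finite GL" using finL by (simp add: GL_def)
    have "L \<subseteq> GL \<union> (C - G) \<union> (H \<inter> L)" using L by (auto simp: GL_def)
    then have "card L \<le> card (GL \<union> (C - G) \<union> (H \<inter> L))" using finGL finC finH by (intro card_mono) auto
    also have "\<dots> \<le> card GL + card (C - G) + card (H \<inter> L)"
      using card_Un_le[of "GL \<union> (C - G)" "H \<inter> L"] card_Un_le[of GL "C - G"] by linarith
    finally have cGL: "N - 2 * w - k + card U \<le> card GL" using cL bad cardHL H(2) N(1) by linarith
    have "U \<noteq> {}" using False by (auto simp: U3_def U4_def)
    then have "1 \<le> card U" using fins by (simp add: Suc_le_eq card_gt_0_iff)
    then have "real (N - 2 * w - k) + 1 \<le> real (card GL)" using cGL by linarith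
    then have cGLr: "c2 * K \<le> real (card GL)" using N(2) by linarith
    then have "0 < real (card GL)" using K c2 mult_pos_pos[of c2 K] by linarith
    then have GLne: "GL \<noteq> {}" by auto
    define \<mu> where "\<mu> = Min ((\<lambda>j. \<bar>x j\<bar>) ` GL)"
    have "\<mu> \<in> (\<lambda>j. \<bar>x j\<bar>) ` GL" unfolding \<mu>_def using finGL GLne by (intro Min_in) auto
    then obtain j0 where j0: "j0 \<in> GL" "\<bar>x j0\<bar> = \<mu>" by auto
    have \<mu>_le: "\<mu> \<le> \<bar>x j\<bar>" if "j \<in> GL" for j unfolding \<mu>_def using finGL that by (intro Min_le) auto
    have \<mu>0: "0 \<le> \<mu>" using j0 by auto
    have \<mu>sq: "\<mu>\<^sup>2 \<le> (x j)\<^sup>2" if "j \<in> GL" for j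
      using power_mono[OF \<mu>_le[OF that] \<mu>0, of 2] by simp
    have "c2 * K * \<mu>\<^sup>2 \<le> real (card GL) * \<mu>\<^sup>2" using cGLr by (intro mult_right_mono) auto
    also have "\<dots> \<le> ?sq GL" using \<mu>sq sum_bounded_below[of GL "\<mu>\<^sup>2" "\<lambda>j. (x j)\<^sup>2"] by simp
    also have "\<dots> \<le> ?sq ({..<n} - H)" using L C by (intro sum_mono2) (auto simp: GL_def)
    also have "\<dots> = K * \<theta>\<^sup>2" by (rule E)
    finally have "K * (c2 * \<mu>\<^sup>2) \<le> K * \<theta>\<^sup>2" by (simp only: mult_ac)
    then have "\<mu>\<^sup>2 * c2 \<le> \<theta>\<^sup>2" using K(1) by (simp only: mult_le_cancel_left_pos mult.commute)
    then have "\<mu>\<^sup>2 \<le> \<theta>\<^sup>2 / c2" using c2 by (simp only: pos_le_divide_eq)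
    also have "\<dots> = (\<theta> / sqrt c2)\<^sup>2" using c2 by (simp add: power_divide)
    finally have "\<mu>\<^sup>2 \<le> (\<theta> / sqrt c2)\<^sup>2" .
    moreover have "0 \<le> \<theta> / sqrt c2" using K c2 by simp
    ultimately have \<mu>\<theta>: "\<mu> \<le> \<theta> / sqrt c2" by (rule power2_le_imp_le)
    have low: "sqrt (est i) \<le> \<mu> + \<gamma>" if "i \<in> C" "i \<notin> L" for i
    proof -
      have "i \<in> C - L" "j0 \<in> L" "j0 \<in> G" using that j0(1) by (simp_all add: GL_def)
      then have "est i \<le> est j0" by (intro tp)
      have "\<bar>sqrt (est j0) - \<bar>x j0\<bar>\<bar> \<le> \<gamma>" using \<open>j0 \<in> G\<close> unfolding G by simp
      then have "sqrt (est j0) \<le> \<bar>x j0\<bar> + \<gamma>" by linarith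
      moreover have "sqrt (est i) \<le> sqrt (est j0)" using \<open>est i \<le> est j0\<close> by (rule real_sqrt_le_mono)
      ultimately show ?thesis using j0(2) by linarith
    qed
    have s3: "?sq U3 \<le> e1"
    proof -
      have "U3 \<subseteq> {i\<in>H. i \<notin> G \<and> est i \<le> (\<theta> / sqrt c2 + \<gamma>)\<^sup>2}"
      proof
        fix i assume i: "i \<in> U3"
        then have "sqrt (est i) \<le> \<theta> / sqrt c2 + \<gamma>" using low[of i] \<mu>\<theta> by (auto simp: U3_def U_def)
        then have "(sqrt (est i))\<^sup>2 \<le> (\<theta> / sqrt c2 + \<gamma>)\<^sup>2" using est by (intro power_mono) auto
        then show "i \<in> {i\<in>H. i \<notin> G \<and> est i \<le> (\<theta> / sqrt c2 + \<gamma>)\<^sup>2}" using i est by (auto simp: U3_def U_def)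
      qed
      then have "?sq U3 \<le> ?sq {i\<in>H. i \<notin> G \<and> est i \<le> (\<theta> / sqrt c2 + \<gamma>)\<^sup>2}"
        using finH by (intro sum_mono2) auto
      then show ?thesis using e1 by linarith
    qed
    have U4U: "card U4 \<le> card U" using fins by (intro card_mono) (auto simp: U4_def)
    then have "card U4 \<le> card GL" using cGL by linarith
    then obtain V where V: "V \<subseteq> GL" "card V = card U4" by (meson obtain_subset_with_card_n)
    have "?sq U4 \<le> (\<Sum>i\<in>U4. (\<mu> + 2 * \<gamma>)\<^sup>2)"
    proof (rule sum_mono)
      fix i assume i: "i \<in> U4"
      then have "\<bar>x i\<bar> \<le> sqrt (est i) + \<gamma>" by (auto simp: U4_def G)
      also have "\<dots> \<le> \<mu> + 2 * \<gamma>" using low[of i] i by (auto simp: U4_def U_def)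
      finally have "\<bar>x i\<bar>\<^sup>2 \<le> (\<mu> + 2 * \<gamma>)\<^sup>2" by (intro power_mono) auto
      then show "(x i)\<^sup>2 \<le> (\<mu> + 2 * \<gamma>)\<^sup>2" by simp
    qed
    then have a: "?sq U4 \<le> real (card U4) * (\<mu> + 2 * \<gamma>)\<^sup>2" by simp
    have "(\<Sum>i\<in>V. \<mu>\<^sup>2) \<le> ?sq V" using \<mu>sq V(1) by (intro sum_mono) auto
    then have "real (card U4) * \<mu>\<^sup>2 \<le> ?sq V" using V(2) by simp
    with a have "?sq U4 - ?sq V \<le> real (card U4) * ((\<mu> + 2 * \<gamma>)\<^sup>2 - \<mu>\<^sup>2)" by (simp add: right_diff_distrib)
    also have "(\<mu> + 2 * \<gamma>)\<^sup>2 - \<mu>\<^sup>2 = 4 * \<gamma> * \<mu> + 4 * \<gamma>\<^sup>2" by (simp add: power2_eq_square algebra_simps)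
    also have "real (card U4) * (4 * \<gamma> * \<mu> + 4 * \<gamma>\<^sup>2) \<le> k * (4 * \<gamma> * (\<theta> / sqrt c2) + 4 * \<gamma>\<^sup>2)"
    proof (rule mult_mono)
      show "real (card U4) \<le> real k" using U4U cardHL H(2) by linarith
      show "4 * \<gamma> * \<mu> + 4 * \<gamma>\<^sup>2 \<le> 4 * \<gamma> * (\<theta> / sqrt c2) + 4 * \<gamma>\<^sup>2"
        using \<mu>\<theta> \<gamma> by (intro add_right_mono mult_left_mono) simp_all
      show "0 \<le> 4 * \<gamma> * \<mu> + 4 * \<gamma>\<^sup>2" using \<mu>0 \<gamma> by (intro add_nonneg_nonneg mult_nonneg_nonneg) simp_all
    qed simp
    finally have s4: "?sq U4 - ?sq V \<le> k * (4 * \<gamma> * (\<theta> / sqrt c2) + 4 * \<gamma>\<^sup>2)" .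
    have VL: "V \<subseteq> L - H" using V(1) by (auto simp: GL_def)
    have "card V \<le> card U" using V(2) U4U by simp
    from VL this s3 s4 show ?thesis by (rule final)
  qed
qed


section \<open>Failure probability of the search\<close>

text \<open>The strict event lets the inequality hold for threshold 0 as well, as it occurs when the
  tail of the signal vanishes.\<close>

lemma Pr_markov_strict:
  assumes "finite (set_pmf p)" "\<And>x. x \<in> set_pmf p \<Longrightarrow> 0 \<le> f x" "Mean p f \<le> c * t" "0 \<le> t" "0 \<le> c"
  shows "Pr p (\<lambda>x. t < f x) \<le> c"
proof (cases "t = 0")
  case False
  then have "Pr p (\<lambda>x. t \<le> f x) \<le> c * t / t" using assms by (intro Pr_markov) auto
  moreover have "Pr p (\<lambda>x. t < f x) \<le> Pr p (\<lambda>x. t \<le> f x)" by (rule Pr_mono) simp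
  ultimately show ?thesis using False by simp
next
  case True
  then have "Mean p f \<le> 0" using assms(3) by simp
  moreover have "0 \<le> Mean p f" using assms(2) by (rule Mean_nonneg)
  ultimately have "(\<Sum>x\<in>set_pmf p. pmf p x * f x) = 0" unfolding Mean_def by linarith
  then have "\<forall>x\<in>set_pmf p. pmf p x * f x = 0"
    using assms(1,2) by (subst (asm) sum_nonneg_eq_0_iff) auto
  then have "Pr p (\<lambda>x. t < f x) = 0" using True by (intro Pr_False) (auto simp: set_pmf_iff)
  then show ?thesis using assms(5) by simp
qed

text \<open>The geometric mean of the two bounds, after reducing the exponent to 4. It provides
  smallness through \<open>p\<close> and, at the same time, the quadratic decay in \<open>s\<close>
  that cancels the square of an entry.\<close>

lemma min_power_bound:
  fixes P p s :: real
  assumes "0 \<le> P" "P \<le> p ^ a" "P \<le> s ^ a" "0 \<le> p" "p \<le> 1" "0 \<le> s" "4 \<le> a"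
  shows "P \<le> p\<^sup>2 * s\<^sup>2"
proof -
  have p4: "P \<le> p ^ 4" using assms power_decreasing[of 4 a p] by linarith
  show ?thesis
  proof (cases "s \<le> 1")
    case True
    have "P \<le> s ^ 4" using assms True power_decreasing[of 4 a s] by linarith
    then have "P * P \<le> p ^ 4 * s ^ 4" using p4 assms by (intro mult_mono) auto
    then have "P\<^sup>2 \<le> (p\<^sup>2 * s\<^sup>2)\<^sup>2" by (simp add: power_mult_distrib power2_eq_square[of P])
    then show ?thesis by (rule power2_le_imp_le) simp
  next
    case False
    have "p ^ 4 \<le> p\<^sup>2" using assms by (intro power_decreasing) auto
    also have "p\<^sup>2 * 1 \<le> p\<^sup>2 * s\<^sup>2" using False by (intro mult_left_mono) auto
    then have "p\<^sup>2 \<le> p\<^sup>2 * s\<^sup>2" by simp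
    finally show ?thesis using p4 by linarith
  qed
qed

text \<open>In units of \<open>\<theta>\<close>: \<open>\<delta>\<close> is the level that the
  probes should not exceed, \<open>d\<close> the size below which a lost entry is ignored,
  \<open>g\<close> the accuracy of the final estimates. The number \<open>w\<close> bounds the
  inaccurate candidates and the slack in the rank of the pivot. Beyond
  \<open>\<kappa> * M * \<theta>\<close> the spacing of the grid is felt.\<close>

locale recovery = scheme n B M a u b D x
  for n B M a u b D :: nat and x :: "nat \<Rightarrow> real" +
  fixes H :: "nat set" and k N w s :: nat and K \<theta> \<delta> \<kappa> d g c2 p1 :: real
  assumes H: "H \<subseteq> {..<n}" "card H \<le> k"
    and E: "(\<Sum>i\<in>{..<n} - H. (x i)\<^sup>2) = K * \<theta>\<^sup>2"
    and pos: "0 < K" "0 \<le> \<theta>" "0 < \<delta>" "0 < \<kappa>" "0 < d" "0 < g" "0 < c2" "0 < k"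
    and D: "0 < D" "n \<le> B * b ^ D" and a4: "4 \<le> a"
    and p1: "0 < p1" "p1 \<le> 1" "(1 - p1) ^ u \<le> p1"
    and p0_le: "4 * (k / B + 4 * K / (B * g\<^sup>2)) \<le> 1"
    and N: "k + 2 * w \<le> N" "c2 * K \<le> real (N - 2 * w - k) + 1"
    and wB: "w + 1 \<le> 2 * B"
begin

text \<open>Failure probabilities of one block: \<open>p0\<close> for an estimate with accuracy
  \<open>g\<close>, \<open>pt\<close> for a probe with level \<open>\<delta>\<close>. Candidates
  left out will have estimates of at most \<open>(\<tau> * \<theta>)\<^sup>2\<close>;
  \<open>\<sigma>\<close> and \<open>\<rho>\<close> are the small-ball constants after the grid term
  has been absorbed.\<close>

definition p0 where "p0 = k / B + 4 * K / (B * g\<^sup>2)"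
definition pt where "pt = k / B + 4 * K / (B * \<delta>\<^sup>2)"
definition \<tau> where "\<tau> = 1 / sqrt c2 + g"
definition \<sigma> where "\<sigma> = 8 * \<tau> + 2 * \<kappa>"
definition \<rho> where "\<rho> = (16 * \<delta> + 2 * \<kappa>) / d"

definition est where "est \<omega> i = score (Mod D) (\<omega> (D - 1)) i"
text \<open>Uses the deterministic value that the thresholds should not exceed instead of the random
  thresholds, so low scores and high thresholds can be bounded separately.\<close>

definition dies where "dies \<omega> i \<longleftrightarrow> (\<exists>l\<in>{..<D}. score (Mod (Suc l)) (\<omega> l) (i mod Mod (Suc l)) \<le> (2 * (\<delta> * \<theta>))\<^sup>2)"
definition poor where "poor \<omega> i \<longleftrightarrow> g * \<theta> < \<bar>sqrt (est \<omega> i) - \<bar>x i\<bar>\<bar>"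
text \<open>For these entries the grid term \<open>2 / M\<close> is no longer dominated by a
  multiple of \<open>\<theta> / \<bar>x i\<bar>\<close>. Their energy is unbounded in units of
  \<open>\<theta>\<close>, so none of them may be lost.\<close>

definition huge where "huge = {i\<in>H. \<kappa> * real M * \<theta> < \<bar>x i\<bar>}"
definition W2 where "W2 \<omega> = (\<Sum>i\<in>{i\<in>H - huge. d * \<theta> < \<bar>x i\<bar>}. (x i)\<^sup>2 * of_bool (dies \<omega> i))"
definition W1 where "W1 \<omega> = (\<Sum>i\<in>H - huge. (x i)\<^sup>2 * of_bool (poor \<omega> i \<and> est \<omega> i \<le> (\<tau> * \<theta>)\<^sup>2))"

lemma finH: "finite H"
  using H(1) finite_subset by blast

lemma M_real: "0 < real M"
  using M_pos by simp

lemma p0_nonneg: "0 \<le> p0"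
  using pos by (simp add: p0_def)

lemma pt_nonneg: "0 \<le> pt"
  using pos by (simp add: pt_def)

lemma \<tau>_pos: "0 < \<tau>"
  using pos by (simp add: \<tau>_def add_pos_pos)

lemma cardH_B: "card H / real B \<le> k / B"
  using H(2) by (intro divide_right_mono) auto

lemma ModD: "Mod (Suc (D - 1)) = Mod D" "n \<le> Mod D"
  using D by (simp_all add: Mod_def)

lemma Pr_fail1: "Pr all_pmf (\<lambda>\<omega>. \<exists>l\<in>{..<D}. overflow \<omega> l) \<le> D * (real (3 * b) * (40 * p1) ^ a)"
proof -
  have "Pr all_pmf (\<lambda>\<omega>. \<exists>l\<in>{..<D}. overflow \<omega> l) \<le> card {..<D} * (real (3 * b) * (40 * p1) ^ a)"
    using p1 by (intro Pr_bex_le_const Pr_overflow) auto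
  then show ?thesis by simp
qed

lemma Pr_fail2: "Pr all_pmf (\<lambda>\<omega>. \<exists>l\<in>{..<D}. 4 * (\<delta> * \<theta>)\<^sup>2 < thr (Mod (Suc l)) (\<omega> l)) \<le> D * (4 * (real u * pt)) ^ a"
proof -
  have e: "(\<Sum>i\<in>{..<n} - H. (x i)\<^sup>2) \<le> K * \<theta>\<^sup>2" using E by simp
  have "Pr all_pmf (\<lambda>\<omega>. \<exists>l\<in>{..<D}. 4 * (\<delta> * \<theta>)\<^sup>2 < thr (Mod (Suc l)) (\<omega> l)) \<le> card {..<D} * (4 * (real u * pt)) ^ a"
  proof (rule Pr_bex_le_const)
    fix l assume l: "l \<in> {..<D}"
    have "Pr block_pmf (\<lambda>\<rho>. \<delta> * \<theta> < \<bar>bsum (Mod (Suc l)) x \<rho> 0\<bar>) \<le> card H / B + 4 * K / (B * \<delta>\<^sup>2)"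
      using pos by (intro probe_tail[OF H(1) e]) auto
    also have "\<dots> \<le> pt" using cardH_B by (simp add: pt_def)
    finally have 1: "Pr block_pmf (\<lambda>\<rho>. \<delta> * \<theta> < \<bar>bsum (Mod (Suc l)) x \<rho> 0\<bar>) \<le> pt" .
    have "Pr all_pmf (\<lambda>\<omega>. 4 * (\<delta> * \<theta>)\<^sup>2 < thr (Mod (Suc l)) (\<omega> l)) = Pr level_pmf (\<lambda>\<Lambda>. 4 * (\<delta> * \<theta>)\<^sup>2 < thr (Mod (Suc l)) \<Lambda>)"
      using l by (intro Pr_all_component) auto
    also have "\<dots> \<le> (4 * (real u * pt)) ^ a" using 1 pos by (intro Pr_thr_high) auto
    finally show "Pr all_pmf (\<lambda>\<omega>. 4 * (\<delta> * \<theta>)\<^sup>2 < thr (Mod (Suc l)) (\<omega> l)) \<le> (4 * (real u * pt)) ^ a" .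
  qed simp
  then show ?thesis by simp
qed

lemma Pr_dies:
  fixes c :: real
  assumes i: "i < n" "x i \<noteq> 0" and c: "8 * (2 * (\<delta> * \<theta>)) / \<bar>x i\<bar> + 2 / real M \<le> c"
  shows "Pr all_pmf (\<lambda>\<omega>. dies \<omega> i) \<le> D * c ^ a"
proof -
  have nn: "0 \<le> 8 * (2 * (\<delta> * \<theta>)) / \<bar>x i\<bar> + 2 / real M" using pos by simp
  have "Pr all_pmf (\<lambda>\<omega>. dies \<omega> i) \<le> real (card {..<D}) * c ^ a"
    unfolding dies_def
  proof (rule Pr_bex_le_const)
    fix l assume l: "l \<in> {..<D}"
    have "Pr all_pmf (\<lambda>\<omega>. score (Mod (Suc l)) (\<omega> l) (i mod Mod (Suc l)) \<le> (2 * (\<delta> * \<theta>))\<^sup>2)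
      = Pr level_pmf (\<lambda>\<Lambda>. score (Mod (Suc l)) \<Lambda> (i mod Mod (Suc l)) \<le> (2 * (\<delta> * \<theta>))\<^sup>2)"
      using l by (intro Pr_all_component) auto
    also have "\<dots> \<le> (8 * (2 * (\<delta> * \<theta>)) / \<bar>x i\<bar> + 2 / real M) ^ a"
      using i pos by (intro Pr_score_small) auto
    also have "\<dots> \<le> c ^ a" using c nn by (intro power_mono)
    finally show "Pr all_pmf (\<lambda>\<omega>. score (Mod (Suc l)) (\<omega> l) (i mod Mod (Suc l)) \<le> (2 * (\<delta> * \<theta>))\<^sup>2) \<le> c ^ a" .
  qed simp
  then show ?thesis by simp
qed

lemma Pr_est_small:
  fixes c :: real
  assumes i: "i < n" "x i \<noteq> 0" and c: "8 * (\<tau> * \<theta>) / \<bar>x i\<bar> + 2 / real M \<le> c"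
  shows "Pr all_pmf (\<lambda>\<omega>. est \<omega> i \<le> (\<tau> * \<theta>)\<^sup>2) \<le> c ^ a"
proof -
  have t: "0 \<le> \<tau> * \<theta>" using pos \<tau>_pos by simp
  have nn: "0 \<le> 8 * (\<tau> * \<theta>) / \<bar>x i\<bar> + 2 / real M" using t by simp
  have im: "i mod Mod D = i" using i(1) ModD(2) by simp
  have "Pr all_pmf (\<lambda>\<omega>. est \<omega> i \<le> (\<tau> * \<theta>)\<^sup>2) = Pr level_pmf (\<lambda>\<Lambda>. score (Mod D) \<Lambda> (i mod Mod D) \<le> (\<tau> * \<theta>)\<^sup>2)"
    unfolding est_def im using D(1) by (intro Pr_all_component) auto
  also have "\<dots> \<le> (8 * (\<tau> * \<theta>) / \<bar>x i\<bar> + 2 / real M) ^ a"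
    using i t by (intro Pr_score_small) auto
  also have "\<dots> \<le> c ^ a" using c nn by (intro power_mono)
  finally show ?thesis .
qed

lemma Pr_level_poor: "i < n \<Longrightarrow> Pr level_pmf (\<lambda>\<Lambda>. g * \<theta> < \<bar>sqrt (score (Mod D) \<Lambda> i) - \<bar>x i\<bar>\<bar>) \<le> (4 * p0) ^ a"
proof (rule Pr_score_inaccurate)
  assume i: "i < n"
  have e: "(\<Sum>i\<in>{..<n} - H. (x i)\<^sup>2) \<le> K * \<theta>\<^sup>2" using E by simp
  have "Pr block_pmf (\<lambda>\<rho>. g * \<theta> < \<bar>\<bar>ratio (Mod D) i \<rho>\<bar> - \<bar>x i\<bar>\<bar>) \<le> card H / B + 4 * K / (B * g\<^sup>2)"
    unfolding ratio_def using pos i ModD(2) by (intro estimate_tail[OF H(1) e]) auto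
  also have "\<dots> \<le> p0" using cardH_B by (simp add: p0_def)
  finally show "Pr block_pmf (\<lambda>\<rho>. g * \<theta> < \<bar>\<bar>ratio (Mod D) i \<rho>\<bar> - \<bar>x i\<bar>\<bar>) \<le> p0" .
qed (use pos in simp)

lemma Pr_poor: "i < n \<Longrightarrow> Pr all_pmf (\<lambda>\<omega>. poor \<omega> i) \<le> (4 * p0) ^ a"
  unfolding poor_def est_def using D(1) Pr_level_poor[of i]
  by (subst Pr_all_component[where Q = "\<lambda>\<Lambda>. g * \<theta> < \<bar>sqrt (score (Mod D) \<Lambda> i) - \<bar>x i\<bar>\<bar>"]) auto

lemma huge_ratio: "i \<in> huge \<Longrightarrow> \<theta> / \<bar>x i\<bar> \<le> 1 / (\<kappa> * M) \<and> x i \<noteq> 0 \<and> i < n"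
proof -
  assume i: "i \<in> huge"
  have l: "\<kappa> * real M * \<theta> < \<bar>x i\<bar>" using i by (simp add: huge_def)
  have km: "0 < \<kappa> * real M" using pos M_real by simp
  have "0 \<le> \<kappa> * real M * \<theta>" using km pos by simp
  then have xi: "0 < \<bar>x i\<bar>" using l by linarith
  have "\<theta> * (\<kappa> * real M) \<le> 1 * \<bar>x i\<bar>" using l by (simp add: mult.commute)
  then have "\<theta> / \<bar>x i\<bar> \<le> 1 / (\<kappa> * M)" using km xi
    by (simp only: pos_divide_le_eq pos_le_divide_eq times_divide_eq_left)
  then show ?thesis using xi i H(1) by (auto simp: huge_def)
qed

text \<open>For a huge entry both small-ball terms are of order 1/M; the union bound over at most
  \<open>n\<close> entries is affordable because \<open>M\<close> will be a large multiple of
  \<open>n\<close>.\<close>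

lemma Pr_fail3: "Pr all_pmf (\<lambda>\<omega>. \<exists>i\<in>huge. dies \<omega> i \<or> est \<omega> i \<le> (\<tau> * \<theta>)\<^sup>2)
   \<le> n * (D * ((16 * \<delta> / \<kappa> + 2) / M) ^ a + ((8 * \<tau> / \<kappa> + 2) / M) ^ a)" (is "_ \<le> real n * ?c")
proof -
  have fin: "finite huge" using finH by (simp add: huge_def)
  have "Pr all_pmf (\<lambda>\<omega>. \<exists>i\<in>huge. dies \<omega> i \<or> est \<omega> i \<le> (\<tau> * \<theta>)\<^sup>2) \<le> card huge * ?c"
  proof (rule Pr_bex_le_const[OF fin])
    fix i assume i: "i \<in> huge"
    note hr = huge_ratio[OF i]
    have r: "C * (\<theta> / \<bar>x i\<bar>) \<le> C / \<kappa> / M" if "0 \<le> C" for C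
      using mult_left_mono[of "\<theta> / \<bar>x i\<bar>" "1 / (\<kappa> * M)" C] hr that by simp
    have "Pr all_pmf (\<lambda>\<omega>. dies \<omega> i \<or> est \<omega> i \<le> (\<tau> * \<theta>)\<^sup>2)
       \<le> Pr all_pmf (\<lambda>\<omega>. dies \<omega> i) + Pr all_pmf (\<lambda>\<omega>. est \<omega> i \<le> (\<tau> * \<theta>)\<^sup>2)"
      by (rule Pr_disj_le)
    also have "Pr all_pmf (\<lambda>\<omega>. dies \<omega> i) \<le> D * ((16 * \<delta> / \<kappa> + 2) / M) ^ a"
    proof (rule Pr_dies)
      show "8 * (2 * (\<delta> * \<theta>)) / \<bar>x i\<bar> + 2 / real M \<le> (16 * \<delta> / \<kappa> + 2) / real M"
        using r[of "16 * \<delta>"] pos by (simp add: add_divide_distrib)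
    qed (use hr in auto)
    also have "Pr all_pmf (\<lambda>\<omega>. est \<omega> i \<le> (\<tau> * \<theta>)\<^sup>2) \<le> ((8 * \<tau> / \<kappa> + 2) / M) ^ a"
    proof (rule Pr_est_small)
      show "8 * (\<tau> * \<theta>) / \<bar>x i\<bar> + 2 / real M \<le> (8 * \<tau> / \<kappa> + 2) / real M"
        using r[of "8 * \<tau>"] \<tau>_pos by (simp add: add_divide_distrib)
    qed (use hr in auto)
    finally show "Pr all_pmf (\<lambda>\<omega>. dies \<omega> i \<or> est \<omega> i \<le> (\<tau> * \<theta>)\<^sup>2) \<le> ?c" by simp
  qed
  also have "\<dots> \<le> n * ?c"
  proof (rule mult_right_mono)
    have "card huge \<le> card {..<n}" using H(1) by (intro card_mono) (auto simp: huge_def)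
    then show "real (card huge) \<le> real n" by simp
    show "0 \<le> ?c" using pos \<tau>_pos by (intro add_nonneg_nonneg mult_nonneg_nonneg zero_le_power divide_nonneg_nonneg) simp_all
  qed
  finally show ?thesis .
qed

lemma small_ratio:
  assumes "i \<in> H - huge" "x i \<noteq> 0"
  shows "2 / real M \<le> 2 * \<kappa> * (\<theta> / \<bar>x i\<bar>)"
proof -
  have "\<bar>x i\<bar> \<le> \<kappa> * real M * \<theta>" using assms by (auto simp: huge_def not_less)
  then have "\<bar>x i\<bar> / (\<bar>x i\<bar> * M) \<le> \<kappa> * real M * \<theta> / (\<bar>x i\<bar> * M)"
    by (intro divide_right_mono) auto
  then have "1 / real M \<le> \<kappa> * (\<theta> / \<bar>x i\<bar>)" using assms(2) M_real by simp
  then show ?thesis by linarith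
qed

text \<open>With r = d \<theta> / |x_i|, at most 1 for the entries that count, the death probability
  is at most D \<rho>^a r^a, and r^a \<le> r^2 cancels the energy of the entry. Every head entry
  then contributes at most the same multiple of (d \<theta>)^2 to the mean.\<close>

lemma Pr_fail4: "Pr all_pmf (\<lambda>\<omega>. k * (d * \<theta>)\<^sup>2 < W2 \<omega>) \<le> D * \<rho> ^ a"
proof (rule Pr_markov_strict)
  let ?S = "{i\<in>H - huge. d * \<theta> < \<bar>x i\<bar>}"
  have \<rho>0: "0 \<le> \<rho>" using pos by (simp add: \<rho>_def)
  have "Mean all_pmf W2 = (\<Sum>i\<in>?S. (x i)\<^sup>2 * Pr all_pmf (\<lambda>\<omega>. dies \<omega> i))"
    unfolding W2_def by (simp add: Mean_sum Mean_cmult Pr_eq_Mean)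
  also have "\<dots> \<le> (\<Sum>i\<in>?S. D * \<rho> ^ a * (d * \<theta>)\<^sup>2)"
  proof (rule sum_mono)
    fix i assume i: "i \<in> ?S"
    have dt: "0 \<le> d * \<theta>" using pos by simp
    have xi: "0 < \<bar>x i\<bar>" using i dt by auto
    define r where "r = d * \<theta> / \<bar>x i\<bar>"
    have r: "0 \<le> r" "r \<le> 1" using i dt xi by (auto simp: r_def)
    have "Pr all_pmf (\<lambda>\<omega>. dies \<omega> i) \<le> D * (\<rho> * r) ^ a"
    proof (rule Pr_dies)
      have "8 * (2 * (\<delta> * \<theta>)) / \<bar>x i\<bar> + 2 / real M \<le> 16 * \<delta> * (\<theta> / \<bar>x i\<bar>) + 2 * \<kappa> * (\<theta> / \<bar>x i\<bar>)"
        using small_ratio[of i] i xi by simp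
      also have "\<dots> = \<rho> * r" using pos(5) by (simp add: \<rho>_def r_def distrib_right add_divide_distrib)
      finally show "8 * (2 * (\<delta> * \<theta>)) / \<bar>x i\<bar> + 2 / real M \<le> \<rho> * r" .
    qed (use i H(1) xi in auto)
    then have "(x i)\<^sup>2 * Pr all_pmf (\<lambda>\<omega>. dies \<omega> i) \<le> (x i)\<^sup>2 * (D * (\<rho> * r) ^ a)"
      by (intro mult_left_mono) auto
    also have "\<dots> = D * \<rho> ^ a * ((x i)\<^sup>2 * r ^ a)" by (simp add: power_mult_distrib)
    also have "\<dots> \<le> D * \<rho> ^ a * (d * \<theta>)\<^sup>2"
    proof (rule mult_left_mono)
      have "r ^ a \<le> r\<^sup>2" using r a4 by (intro power_decreasing) auto
      then have "(x i)\<^sup>2 * r ^ a \<le> (x i)\<^sup>2 * r\<^sup>2" by (intro mult_left_mono) auto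
      also have "\<dots> = (d * \<theta>)\<^sup>2" using xi by (simp add: r_def power_divide power_mult_distrib)
      finally show "(x i)\<^sup>2 * r ^ a \<le> (d * \<theta>)\<^sup>2" .
    qed (use \<rho>0 in auto)
    finally show "(x i)\<^sup>2 * Pr all_pmf (\<lambda>\<omega>. dies \<omega> i) \<le> D * \<rho> ^ a * (d * \<theta>)\<^sup>2" .
  qed
  also have "\<dots> = real (card ?S) * (D * \<rho> ^ a * (d * \<theta>)\<^sup>2)" by simp
  also have "\<dots> \<le> k * (D * \<rho> ^ a * (d * \<theta>)\<^sup>2)"
  proof (rule mult_right_mono)
    have "card ?S \<le> card H" using finH by (intro card_mono) auto
    then show "real (card ?S) \<le> real k" using H(2) by simp
  qed (use \<rho>0 in auto)
  finally show "Mean all_pmf W2 \<le> D * \<rho> ^ a * (k * (d * \<theta>)\<^sup>2)" by (simp only: mult_ac)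
qed (use pos in \<open>auto simp: W2_def \<rho>_def intro!: sum_nonneg\<close>)

text \<open>A badly estimated entry does harm only if its estimate is also small. The first
  condition yields the small factor \<open>p0\<close>, the second the decay in the size of the
  entry.\<close>

lemma Pr_fail5: "Pr all_pmf (\<lambda>\<omega>. k * (d * \<theta>)\<^sup>2 < W1 \<omega>) \<le> (4 * p0 * \<sigma> / d)\<^sup>2"
proof (rule Pr_markov_strict)
  let ?Q = "\<lambda>i \<omega>. poor \<omega> i \<and> est \<omega> i \<le> (\<tau> * \<theta>)\<^sup>2"
  have "Mean all_pmf W1 = (\<Sum>i\<in>H - huge. (x i)\<^sup>2 * Pr all_pmf (?Q i))"
    unfolding W1_def by (simp add: Mean_sum Mean_cmult Pr_eq_Mean)
  also have "\<dots> \<le> (\<Sum>i\<in>H - huge. (4 * p0 * \<sigma> * \<theta>)\<^sup>2)"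
  proof (rule sum_mono)
    fix i assume i: "i \<in> H - huge"
    show "(x i)\<^sup>2 * Pr all_pmf (?Q i) \<le> (4 * p0 * \<sigma> * \<theta>)\<^sup>2"
    proof (cases "x i = 0")
      case False
      have iN: "i < n" using i H(1) by auto
      define r where "r = \<sigma> * \<theta> / \<bar>x i\<bar>"
      have r0: "0 \<le> r" using pos \<tau>_pos by (simp add: r_def \<sigma>_def)
      have "Pr all_pmf (?Q i) \<le> Pr all_pmf (\<lambda>\<omega>. poor \<omega> i)" by (rule Pr_mono) simp
      also have "\<dots> \<le> (4 * p0) ^ a" by (rule Pr_poor[OF iN])
      finally have A: "Pr all_pmf (?Q i) \<le> (4 * p0) ^ a" .
      have "Pr all_pmf (?Q i) \<le> Pr all_pmf (\<lambda>\<omega>. est \<omega> i \<le> (\<tau> * \<theta>)\<^sup>2)" by (rule Pr_mono) simp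
      also have "\<dots> \<le> r ^ a"
      proof (rule Pr_est_small[OF iN False])
        have "8 * (\<tau> * \<theta>) / \<bar>x i\<bar> + 2 / real M \<le> 8 * \<tau> * (\<theta> / \<bar>x i\<bar>) + 2 * \<kappa> * (\<theta> / \<bar>x i\<bar>)"
          using small_ratio[OF i False] by simp
        also have "\<dots> = r" by (simp add: r_def \<sigma>_def distrib_right add_divide_distrib)
        finally show "8 * (\<tau> * \<theta>) / \<bar>x i\<bar> + 2 / real M \<le> r" .
      qed
      finally have "Pr all_pmf (?Q i) \<le> (4 * p0)\<^sup>2 * r\<^sup>2"
        using A p0_nonneg p0_le r0 a4 by (intro min_power_bound[where a = a]) (auto simp: p0_def)
      then have "(x i)\<^sup>2 * Pr all_pmf (?Q i) \<le> (x i)\<^sup>2 * ((4 * p0)\<^sup>2 * r\<^sup>2)" by (intro mult_left_mono) auto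
      also have "\<dots> = (4 * p0 * \<sigma> * \<theta>)\<^sup>2" using False by (simp add: r_def power_divide power_mult_distrib)
      finally show ?thesis .
    qed simp
  qed
  also have "\<dots> = real (card (H - huge)) * (4 * p0 * \<sigma> * \<theta>)\<^sup>2" by simp
  also have "\<dots> \<le> k * (4 * p0 * \<sigma> * \<theta>)\<^sup>2"
  proof (rule mult_right_mono)
    have "card (H - huge) \<le> card H" using finH by (intro card_mono) auto
    then show "real (card (H - huge)) \<le> real k" using H(2) by simp
  qed auto
  also have "\<dots> = (4 * p0 * \<sigma> / d)\<^sup>2 * (k * (d * \<theta>)\<^sup>2)"
    using pos(5) by (simp add: power_divide power_mult_distrib)
  finally show "Mean all_pmf W1 \<le> (4 * p0 * \<sigma> / d)\<^sup>2 * (k * (d * \<theta>)\<^sup>2)" .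
qed (use pos in \<open>auto simp: W1_def intro!: sum_nonneg\<close>)

text \<open>The nodes tested last are determined by the earlier levels; their estimates come from
  the last level, which is redrawn independently.\<close>

lemma Pr_fail6: "Pr all_pmf (\<lambda>\<omega>. w < card {i\<in>tested \<omega> (D - 1). poor \<omega> i}) \<le> real (b * (2 * B)) * (4 * p0) ^ a / (real w + 1)"
  unfolding all_pmf_def
proof (rule Pr_Pi_resample_le[where x = "D - 1"])
  fix f :: "nat \<Rightarrow> level"
  let ?W = "tested f (D - 1)"
  let ?Q = "\<lambda>i \<Lambda>. g * \<theta> < \<bar>sqrt (score (Mod D) \<Lambda> i) - \<bar>x i\<bar>\<bar>"
  have finW: "finite ?W" using tested_subset finite_subset by blast
  have "Pr level_pmf (\<lambda>y. w < card {i\<in>tested (fun_upd f (D - 1) y) (D - 1). poor (fun_upd f (D - 1) y) i})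
    = Pr level_pmf (\<lambda>y. w < card {i\<in>?W. ?Q i y})"
    by (simp add: tested_upd poor_def est_def)
  also have "\<dots> \<le> Pr level_pmf (\<lambda>y. real w + 1 \<le> (\<Sum>i\<in>?W. of_bool (?Q i y)))"
  proof (rule Pr_mono)
    fix y assume "w < card {i\<in>?W. ?Q i y}"
    then have "real w + 1 \<le> real (card {i\<in>?W. ?Q i y})" by linarith
    also have "\<dots> = (\<Sum>i\<in>?W. of_bool (?Q i y))"
      using finW by (simp add: of_bool_def sum.If_cases Int_def)
    finally show "real w + 1 \<le> (\<Sum>i\<in>?W. of_bool (?Q i y))" .
  qed
  also have "\<dots> \<le> real (b * (2 * B)) * (4 * p0) ^ a / (real w + 1)"
  proof (rule Pr_markov)
    have "Mean level_pmf (\<lambda>y. \<Sum>i\<in>?W. of_bool (?Q i y)) = (\<Sum>i\<in>?W. Pr level_pmf (?Q i))"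
      by (simp add: Mean_sum Pr_eq_Mean)
    also have "\<dots> \<le> (\<Sum>i\<in>?W. (4 * p0) ^ a)"
      using tested_subset by (intro sum_mono Pr_level_poor) auto
    also have "\<dots> = real (card ?W) * (4 * p0) ^ a" by simp
    also have "\<dots> \<le> real (b * (2 * B)) * (4 * p0) ^ a"
    proof (rule mult_right_mono)
      show "real (card ?W) \<le> real (b * (2 * B))" using card_tested by (rule of_nat_mono)
    qed (use p0_nonneg in auto)
    finally show "Mean level_pmf (\<lambda>y. \<Sum>i\<in>?W. of_bool (?Q i y)) \<le> real (b * (2 * B)) * (4 * p0) ^ a" .
  qed (auto intro!: sum_nonneg)
  finally show "Pr level_pmf (\<lambda>y. w < card {i\<in>tested (fun_upd f (D - 1) y) (D - 1). poor (fun_upd f (D - 1) y) i})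
    \<le> real (b * (2 * B)) * (4 * p0) ^ a / (real w + 1)" .
qed (use D in auto)

definition fails where
  "fails \<omega> \<longleftrightarrow> (\<exists>l\<in>{..<D}. overflow \<omega> l) \<or> (\<exists>l\<in>{..<D}. 4 * (\<delta> * \<theta>)\<^sup>2 < thr (Mod (Suc l)) (\<omega> l)) \<or>
    (\<exists>i\<in>huge. dies \<omega> i \<or> est \<omega> i \<le> (\<tau> * \<theta>)\<^sup>2) \<or> k * (d * \<theta>)\<^sup>2 < W2 \<omega> \<or> k * (d * \<theta>)\<^sup>2 < W1 \<omega> \<or>
    w < card {i\<in>tested \<omega> (D - 1). poor \<omega> i}"

definition fail_bound where
  "fail_bound = D * (real (3 * b) * (40 * p1) ^ a) + D * (4 * (real u * pt)) ^ a +
    n * (D * ((16 * \<delta> / \<kappa> + 2) / M) ^ a + ((8 * \<tau> / \<kappa> + 2) / M) ^ a) +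
    D * \<rho> ^ a + (4 * p0 * \<sigma> / d)\<^sup>2 + real (b * (2 * B)) * (4 * p0) ^ a / (real w + 1)"

lemma Pr_fails: "Pr all_pmf fails \<le> fail_bound"
proof -
  have "Pr all_pmf fails \<le> Pr all_pmf (\<lambda>\<omega>. \<exists>l\<in>{..<D}. overflow \<omega> l) +
     (Pr all_pmf (\<lambda>\<omega>. \<exists>l\<in>{..<D}. 4 * (\<delta> * \<theta>)\<^sup>2 < thr (Mod (Suc l)) (\<omega> l)) +
     (Pr all_pmf (\<lambda>\<omega>. \<exists>i\<in>huge. dies \<omega> i \<or> est \<omega> i \<le> (\<tau> * \<theta>)\<^sup>2) +
     (Pr all_pmf (\<lambda>\<omega>. k * (d * \<theta>)\<^sup>2 < W2 \<omega>) + (Pr all_pmf (\<lambda>\<omega>. k * (d * \<theta>)\<^sup>2 < W1 \<omega>) +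
      Pr all_pmf (\<lambda>\<omega>. w < card {i\<in>tested \<omega> (D - 1). poor \<omega> i})))))"
    unfolding fails_def by (rule order_trans[OF Pr_disj_le] add_left_mono order_refl)+
  then show ?thesis
    using Pr_fail1 Pr_fail2 Pr_fail3 Pr_fail4 Pr_fail5 Pr_fail6 unfolding fail_bound_def by linarith
qed

definition hit where
  "hit \<omega> \<pi> \<longleftrightarrow> (N < length (cands \<omega> D) \<longrightarrow> (\<exists>q\<in>\<pi> ` {..<s}. q < length (cands \<omega> D) \<and>
    N - w \<le> rnk (\<lambda>j. est \<omega> (cands \<omega> D ! j)) (length (cands \<omega> D)) q \<and>
    rnk (\<lambda>j. est \<omega> (cands \<omega> D ! j)) (length (cands \<omega> D)) q \<le> N))"

text \<open>The pivots are independent of the search, so its outcome can be held fixed. The window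
  of admissible ranks contains \<open>w + 1\<close> of at most \<open>2 * B\<close>
  positions.\<close>

lemma Pr_not_hit: "Pr (pivot_pmf s (2 * B)) (\<lambda>\<pi>. \<not> hit \<omega> \<pi>) \<le> (1 - (real w + 1) / real (2 * B)) ^ s"
proof (cases "N < length (cands \<omega> D)")
  case True
  have w: "w \<le> N" "1 \<le> N - w" using N(1) pos(8) by linarith+
  let ?f = "\<lambda>j. est \<omega> (cands \<omega> D ! j)" and ?m = "length (cands \<omega> D)"
  have "Pr (pivot_pmf s (2 * B)) (\<lambda>\<pi>. \<not> hit \<omega> \<pi>) \<le>
     Pr (pivot_pmf s (2 * B)) (\<lambda>\<pi>. \<forall>t\<in>{..<s}. \<not> (\<pi> t < ?m \<and> N - w \<le> rnk ?f ?m (\<pi> t) \<and> rnk ?f ?m (\<pi> t) \<le> N))"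
    by (rule Pr_mono) (auto simp: hit_def)
  also have "\<dots> \<le> (1 - real (N - (N - w) + 1) / real (2 * B)) ^ s"
    using w True length_cands by (intro Pr_pivot_miss) auto
  also have "real (N - (N - w) + 1) = real w + 1" using w by simp
  finally show ?thesis .
next
  case False
  have "Pr (pivot_pmf s (2 * B)) (\<lambda>\<pi>. \<not> hit \<omega> \<pi>) = 0"
    using False by (intro Pr_False) (simp add: hit_def)
  moreover have "(real w + 1) / real (2 * B) \<le> 1" using wB B_ge_2 by simp
  ultimately show ?thesis by simp
qed

lemma not_fails_correct:
  assumes nf: "\<not> fails \<omega>" and h: "hit \<omega> \<pi>"
    and sel: "selects (\<lambda>j. est \<omega> (cands \<omega> D ! j)) (length (cands \<omega> D)) N (\<pi> ` {..<s}) J"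
  shows "\<exists>T\<subseteq>(!) (cands \<omega> D) ` J. card T \<le> k \<and>
    (\<Sum>i\<in>{..<n} - T. (x i)\<^sup>2) \<le> K * \<theta>\<^sup>2 + k * \<theta>\<^sup>2 * (3 * d\<^sup>2 + 4 * g / sqrt c2 + 4 * g\<^sup>2)"
proof -
  let ?c = "cands \<omega> D" and ?m = "length (cands \<omega> D)"
  let ?C = "set (cands \<omega> D)" and ?L = "(!) (cands \<omega> D) ` J"
  have Csub: "?C \<subseteq> {..<n}" and dist: "distinct ?c" using cands_props[of \<omega> D] by auto
  have Jm: "J \<subseteq> {..<?m}" using selects_card[OF sel] by simp
  have Call: "?C = (!) ?c ` {..<?m}" by (auto simp: set_conv_nth)
  have LC: "?L \<subseteq> ?C" using Jm by (auto simp: Call)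
  have inj: "inj_on ((!) ?c) {..<?m}" using dist by (auto simp: inj_on_def nth_eq_iff_index_eq)
  have cardL: "card ?L = card J" using inj Jm by (intro card_image) (auto intro: inj_on_subset)
  have disj: "J = {..<?m} \<or> (N - w \<le> card J \<and> (\<forall>i<?m. i \<notin> J \<longrightarrow> (\<forall>j\<in>J. est \<omega> (?c ! i) \<le> est \<omega> (?c ! j))))"
    using selects_good[OF sel, of "N - w"] h by (auto simp: hit_def)
  have top: "?L = ?C \<or> (N - w \<le> card ?L \<and> (\<forall>i\<in>?C - ?L. \<forall>j\<in>?L. est \<omega> i \<le> est \<omega> j))"
    using disj
  proof
    assume "J = {..<?m}"
    then show ?thesis using Call by simp
  next
    assume *: "N - w \<le> card J \<and> (\<forall>i<?m. i \<notin> J \<longrightarrow> (\<forall>j\<in>J. est \<omega> (?c ! i) \<le> est \<omega> (?c ! j)))"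
    have "est \<omega> i \<le> est \<omega> j" if i: "i \<in> ?C - ?L" and j: "j \<in> ?L" for i j
    proof -
      obtain p where p: "p < ?m" "i = ?c ! p" using i by (auto simp: in_set_conv_nth)
      then have "p \<notin> J" using i by auto
      then show ?thesis using * p j by auto
    qed
    then show ?thesis using * cardL by simp
  qed
  define G where "G = {i. i < n \<and> \<bar>sqrt (est \<omega> i) - \<bar>x i\<bar>\<bar> \<le> g * \<theta>}"
  have notG: "i \<notin> G \<longleftrightarrow> poor \<omega> i" if "i < n" for i using that by (auto simp: G_def poor_def not_le)
  have bad: "card (?C - G) \<le> w"
  proof -
    have "?C \<subseteq> tested \<omega> (D - 1)" using cands_subset_tested[of \<omega> "D - 1"] D(1) by simp
    then have "?C - G \<subseteq> {i\<in>tested \<omega> (D - 1). poor \<omega> i}" using notG Csub by auto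
    then have "card (?C - G) \<le> card {i\<in>tested \<omega> (D - 1). poor \<omega> i}"
      using finite_subset[OF tested_subset finite_lessThan] by (intro card_mono) simp_all
    then show ?thesis using nf by (auto simp: fails_def)
  qed
  \<comment> \<open>A head entry that never scores low passes all thresholds. Without overflow it is
    followed to the last level, where its residue is the entry itself since
    \<open>n \<le> Mod D\<close>.\<close>
  have dead: "dies \<omega> i" if "i \<in> H" "i \<notin> ?C" for i
  proof (rule ccontr)
    assume nd: "\<not> dies \<omega> i"
    have iN: "i < n" using that H(1) by auto
    have "i mod Mod D \<in> ?C"
    proof (rule cands_track[OF iN])
      fix l assume l: "l < D"
      show "\<not> overflow \<omega> l" using nf l by (auto simp: fails_def)
      have "thr (Mod (Suc l)) (\<omega> l) \<le> 4 * (\<delta> * \<theta>)\<^sup>2" using nf l by (auto simp: fails_def not_less)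
      moreover have "(2 * (\<delta> * \<theta>))\<^sup>2 < score (Mod (Suc l)) (\<omega> l) (i mod Mod (Suc l))"
        using nd l by (auto simp: dies_def not_le)
      moreover have "(2 * (\<delta> * \<theta>))\<^sup>2 = 4 * (\<delta> * \<theta>)\<^sup>2" by (simp add: power_mult_distrib)
      ultimately show "survives l (\<omega> l) (i mod Mod (Suc l))" unfolding survives_def by linarith
    qed
    then show False using that iN ModD(2) by simp
  qed
  have tt: "\<theta> / sqrt c2 + g * \<theta> = \<tau> * \<theta>" by (simp add: \<tau>_def distrib_right)
  have nohuge: "\<not> dies \<omega> i" "\<not> est \<omega> i \<le> (\<tau> * \<theta>)\<^sup>2" if "i \<in> huge" for i
    using nf that by (auto simp: fails_def)
  have e2: "(\<Sum>i\<in>{i\<in>H. d * \<theta> < \<bar>x i\<bar> \<and> i \<notin> ?C}. (x i)\<^sup>2) \<le> k * (d * \<theta>)\<^sup>2"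
  proof -
    have "(\<Sum>i\<in>{i\<in>H. d * \<theta> < \<bar>x i\<bar> \<and> i \<notin> ?C}. (x i)\<^sup>2) = (\<Sum>i\<in>{i\<in>H. d * \<theta> < \<bar>x i\<bar> \<and> i \<notin> ?C}. (x i)\<^sup>2 * of_bool (dies \<omega> i))"
      using dead by (intro sum.cong) auto
    also have "\<dots> \<le> W2 \<omega>"
      unfolding W2_def using finH dead nohuge by (intro sum_mono2) auto
    finally show ?thesis using nf by (auto simp: fails_def not_less)
  qed
  have e1: "(\<Sum>i\<in>{i\<in>H. i \<notin> G \<and> est \<omega> i \<le> (\<theta> / sqrt c2 + g * \<theta>)\<^sup>2}. (x i)\<^sup>2) \<le> k * (d * \<theta>)\<^sup>2"
  proof -
    let ?S = "{i\<in>H. i \<notin> G \<and> est \<omega> i \<le> (\<tau> * \<theta>)\<^sup>2}"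
    have Hn: "i < n" if "i \<in> H" for i using H(1) that by auto
    have "(\<Sum>i\<in>?S. (x i)\<^sup>2) = (\<Sum>i\<in>?S. (x i)\<^sup>2 * of_bool (poor \<omega> i \<and> est \<omega> i \<le> (\<tau> * \<theta>)\<^sup>2))"
      using notG Hn by (intro sum.cong) auto
    also have "\<dots> \<le> W1 \<omega>"
      unfolding W1_def using finH nohuge by (intro sum_mono2) auto
    finally show ?thesis using nf unfolding tt by (auto simp: fails_def not_less)
  qed
  have "\<exists>T\<subseteq>?L. card T \<le> k \<and> (\<Sum>i\<in>{..<n} - T. (x i)\<^sup>2) \<le> K * \<theta>\<^sup>2 + k * (d * \<theta>)\<^sup>2 + k * (d * \<theta>)\<^sup>2 + k * (d * \<theta>)\<^sup>2
      + k * (4 * (g * \<theta>) * (\<theta> / sqrt c2) + 4 * (g * \<theta>)\<^sup>2)"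
    by (rule exchange[OF H Csub LC E pos(1,2,7) _ _ top G_def bad N e2 e1])
       (use pos in \<open>auto simp: est_def score_nonneg\<close>)
  moreover have "K * \<theta>\<^sup>2 + k * (d * \<theta>)\<^sup>2 + k * (d * \<theta>)\<^sup>2 + k * (d * \<theta>)\<^sup>2
      + k * (4 * (g * \<theta>) * (\<theta> / sqrt c2) + 4 * (g * \<theta>)\<^sup>2)
     = K * \<theta>\<^sup>2 + k * \<theta>\<^sup>2 * (3 * d\<^sup>2 + 4 * g / sqrt c2 + 4 * g\<^sup>2)"
    by (simp add: power_mult_distrib power2_eq_square algebra_simps)
  ultimately show ?thesis by (simp only:)
qed

text \<open>Quantifying over all selections \<open>J\<close> inside the event decouples the
  probability from the way in which the program selects.\<close>

lemma recovery_probability: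
  "1 - fail_bound - (1 - (real w + 1) / real (2 * B)) ^ s
    \<le> Pr (pair_pmf all_pmf (pivot_pmf s (2 * B))) (\<lambda>\<omega>\<pi>. \<forall>J.
      selects (\<lambda>j. est (fst \<omega>\<pi>) (cands (fst \<omega>\<pi>) D ! j)) (length (cands (fst \<omega>\<pi>) D)) N (snd \<omega>\<pi> ` {..<s}) J \<longrightarrow>
      (\<exists>T\<subseteq>(!) (cands (fst \<omega>\<pi>) D) ` J. card T \<le> k \<and>
      (\<Sum>i\<in>{..<n} - T. (x i)\<^sup>2) \<le> K * \<theta>\<^sup>2 + k * \<theta>\<^sup>2 * (3 * d\<^sup>2 + 4 * g / sqrt c2 + 4 * g\<^sup>2)))"
    (is "_ \<le> Pr ?p ?good")
proof -
  have fin: "finite (set_pmf (pivot_pmf s (2 * B)))" using B_ge_2 by simp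
  have "1 - Pr ?p ?good = Pr ?p (\<lambda>z. \<not> ?good z)" by (simp only: Pr_not)
  also have "\<dots> \<le> Pr ?p (\<lambda>z. fails (fst z) \<or> \<not> hit (fst z) (snd z))"
    by (rule Pr_mono) (use not_fails_correct in blast)
  also have "\<dots> \<le> Pr ?p (\<lambda>z. fails (fst z)) + Pr ?p (\<lambda>z. \<not> hit (fst z) (snd z))"
    by (rule Pr_disj_le)
  also have "Pr ?p (\<lambda>z. fails (fst z)) = Pr all_pmf fails"
    using fin by (intro Pr_pair_fst) auto
  also have "Pr ?p (\<lambda>z. \<not> hit (fst z) (snd z)) \<le> (1 - (real w + 1) / real (2 * B)) ^ s"
    by (rule Pr_pair_le) (use fin Pr_not_hit in auto)
  finally show ?thesis using Pr_fails by linarith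
qed

end


section \<open>Timed total correctness\<close>

text \<open>Total correctness with a time bound; since execution is deterministic, one good run
  describes all runs.\<close>

definition runs :: "nat \<Rightarrow> com \<Rightarrow> memory \<Rightarrow> nat \<Rightarrow> (memory \<Rightarrow> bool) \<Rightarrow> bool" where
  "runs W c s T Q \<longleftrightarrow> (\<exists>t s'. exec W c s t s' \<and> t \<le> T \<and> Q s')"

lemma nmem_nput [simp]: "nmem (nput a i v s) = (nmem s)(a := (nmem s a)(i := v))"
  by (simp add: nput_def)

lemma rmem_nput [simp]: "rmem (nput a i v s) = rmem s"
  by (simp add: nput_def)

lemma nmem_rput [simp]: "nmem (rput a i v s) = nmem s"
  by (simp add: rput_def)

lemma rmem_rput [simp]: "rmem (rput a i v s) = (rmem s)(a := (rmem s a)(i := v))"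
  by (simp add: rput_def)

lemma runs_conseq: "runs W c s T Q \<Longrightarrow> T \<le> T' \<Longrightarrow> (\<And>s'. Q s' \<Longrightarrow> Q' s') \<Longrightarrow> runs W c s T' Q'"
  unfolding runs_def by (meson order_trans)

lemma runs_post: "runs W c s T Q \<Longrightarrow> (\<And>s'. Q s' \<Longrightarrow> Q' s') \<Longrightarrow> runs W c s T Q'"
  by (rule runs_conseq[OF _ order_refl])

lemma runs_Skip: "Q s \<Longrightarrow> 1 \<le> T \<Longrightarrow> runs W Skip s T Q"
  unfolding runs_def using exec.Skip by blast

lemma runs_NPut: "nval e s \<le> W \<Longrightarrow> Q (nput a (nval i s) (nval e s) s) \<Longrightarrow> 1 \<le> T \<Longrightarrow> runs W (NPut a i e) s T Q"
  unfolding runs_def using exec.NPut by blast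

lemma runs_RPut: "Q (rput a (nval i s) (rval e s) s) \<Longrightarrow> 1 \<le> T \<Longrightarrow> runs W (RPut a i e) s T Q"
  unfolding runs_def using exec.RPut by blast

lemma runs_Seq: "runs W c s T Q \<Longrightarrow> (\<And>s'. Q s' \<Longrightarrow> runs W d s' U R) \<Longrightarrow> T + U \<le> V \<Longrightarrow> runs W (Seq c d) s V R"
  unfolding runs_def by (meson exec.Seq add_mono order_trans)

lemma runs_Seq_NPut: "nval e s \<le> W \<Longrightarrow> runs W d (nput a (nval i s) (nval e s) s) T Q \<Longrightarrow>
    runs W (Seq (NPut a i e) d) s (Suc T) Q"
  by (rule runs_Seq[where T = 1 and Q = "\<lambda>s'. s' = nput a (nval i s) (nval e s) s"]) (auto intro: runs_NPut)

lemma runs_Seq_RPut: "runs W d (rput a (nval i s) (rval e s) s) T Q \<Longrightarrow>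
    runs W (Seq (RPut a i e) d) s (Suc T) Q"
  by (rule runs_Seq[where T = 1 and Q = "\<lambda>s'. s' = rput a (nval i s) (rval e s) s"]) (auto intro: runs_RPut)

lemma runs_Cond:
  "(bval b s \<Longrightarrow> runs W c s T Q) \<Longrightarrow> (\<not> bval b s \<Longrightarrow> runs W d s T Q) \<Longrightarrow> Suc T \<le> U \<Longrightarrow> runs W (Cond b c d) s U Q"
  unfolding runs_def by (cases "bval b s") (meson exec.CondTrue exec.CondFalse Suc_le_mono order_trans)+

abbreviation Var :: "nat \<Rightarrow> nexp" where "Var a \<equiv> NGet a (NLit 0)"
abbreviation Set :: "nat \<Rightarrow> nexp \<Rightarrow> com" where "Set a e \<equiv> NPut a (NLit 0) e"

definition For :: "nat \<Rightarrow> nexp \<Rightarrow> nexp \<Rightarrow> com \<Rightarrow> com" where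
  "For v lo hi c = Seq (Set v lo) (While (NLess (Var v) hi) (Seq c (Set v (NAdd (Var v) (NLit 1)))))"

text \<open>Each round pays for the test and the increment besides the body; the initial assignment
  and the last test account for the other 2. The upper bound is evaluated again in every round, so
  the invariant must determine its value, and the invariant refers to the memory after the counter
  has been updated.\<close>

lemma runs_For:
  assumes lo: "nval lo s = l" "l \<le> h" "h \<le> W"
    and init: "I l (nput v 0 l s)"
    and hi: "\<And>j s. I j s \<Longrightarrow> nval hi s = h"
    and step: "\<And>j s. l \<le> j \<Longrightarrow> j < h \<Longrightarrow> I j s \<Longrightarrow> nmem s v 0 = j \<Longrightarrow>
      runs W c s T (\<lambda>s'. nmem s' v 0 = j \<and> I (Suc j) (nput v 0 (Suc j) s'))"
    and post: "\<And>s. I h s \<Longrightarrow> Q s" and time: "(h - l) * (T + 2) + 2 \<le> U"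
  shows "runs W (For v lo hi c) s U Q"
proof -
  let ?w = "While (NLess (Var v) hi) (Seq c (Set v (NAdd (Var v) (NLit 1))))"
  have loop: "runs W ?w s ((h - j) * (T + 2) + 1) Q" if "l \<le> j" "j \<le> h" "I j s" "nmem s v 0 = j" for j s
    using that
  proof (induction "h - j" arbitrary: j s)
    case 0
    then have j: "j = h" by simp
    have "\<not> bval (NLess (Var v) hi) s" using hi[OF \<open>I j s\<close>] 0 j by simp
    then have "exec W ?w s 1 s" by (rule exec.WhileFalse)
    then show ?case using post[of s] 0 j unfolding runs_def by (intro exI[of _ 1] exI[of _ s]) simp
  next
    case (Suc m)
    then have jh: "j < h" by linarith
    have b: "bval (NLess (Var v) hi) s" using hi[OF \<open>I j s\<close>] Suc jh by simp
    obtain t s1 where s1: "exec W c s t s1" "t \<le> T" "nmem s1 v 0 = j" "I (Suc j) (nput v 0 (Suc j) s1)"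
      using step[OF Suc.prems(1) jh Suc.prems(3,4)] unfolding runs_def by blast
    let ?s2 = "nput v 0 (Suc j) s1"
    have "exec W (Set v (NAdd (Var v) (NLit 1))) s1 1 (nput v (nval (NLit 0) s1) (nval (NAdd (Var v) (NLit 1)) s1) s1)"
      using s1(3) jh lo by (intro exec.NPut) simp
    then have "exec W (Set v (NAdd (Var v) (NLit 1))) s1 1 ?s2" using s1(3) by simp
    with s1(1) have body: "exec W (Seq c (Set v (NAdd (Var v) (NLit 1)))) s (t + 1) ?s2" by (rule exec.Seq)
    have "runs W ?w ?s2 ((h - Suc j) * (T + 2) + 1) Q"
      using Suc.hyps(2) Suc.prems(1) jh s1(4) by (intro Suc.hyps(1)) auto
    then obtain t' s3 where s3: "exec W ?w ?s2 t' s3" "t' \<le> (h - Suc j) * (T + 2) + 1" "Q s3"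
      unfolding runs_def by blast
    have "exec W ?w s (Suc (t + 1 + t')) s3" using b body s3(1) by (rule exec.WhileTrue)
    moreover have "Suc (t + 1 + t') \<le> (h - j) * (T + 2) + 1"
    proof -
      have "h - j = Suc (h - Suc j)" using jh by simp
      then show ?thesis using s1(2) s3(2) by simp
    qed
    ultimately show ?case using s3(3) unfolding runs_def by blast
  qed
  show ?thesis unfolding For_def
  proof (rule runs_Seq)
    show "runs W (Set v lo) s 1 (\<lambda>s'. I l s' \<and> nmem s' v 0 = l)"
      using lo init by (intro runs_NPut) auto
    show "runs W ?w s' ((h - l) * (T + 2) + 1) Q" if "I l s' \<and> nmem s' v 0 = l" for s'
      using loop[of l s'] that lo by auto
  qed (use time in simp)
qed

text \<open>The frame condition: only the natural arrays in \<open>A\<close> and the real arrays in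
  \<open>R\<close> may differ.\<close>

definition same :: "nat set \<Rightarrow> nat set \<Rightarrow> memory \<Rightarrow> memory \<Rightarrow> bool" where
  "same A R s s' \<longleftrightarrow> (\<forall>a. a \<notin> A \<longrightarrow> nmem s' a = nmem s a) \<and> (\<forall>a. a \<notin> R \<longrightarrow> rmem s' a = rmem s a)"

lemma same_refl [simp]: "same A R s s"
  by (simp add: same_def)

lemma same_trans: "same A R s s' \<Longrightarrow> same A R s' s'' \<Longrightarrow> same A R s s''"
  by (simp add: same_def)

lemma same_mono: "same A R s s' \<Longrightarrow> A \<subseteq> A' \<Longrightarrow> R \<subseteq> R' \<Longrightarrow> same A' R' s s'"
  by (auto simp: same_def)

lemma same_nput [simp]: "a \<in> A \<Longrightarrow> same A R s (nput a i v s') = same A R s s'"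
  by (auto simp: same_def)

lemma same_rput [simp]: "a \<in> R \<Longrightarrow> same A R s (rput a i v s') = same A R s s'"
  by (auto simp: same_def)

lemma same_nput' [simp]: "a \<in> A \<Longrightarrow> same A R (nput a i v s) s' = same A R s s'"
  by (auto simp: same_def)

lemma same_nD: "same A R s s' \<Longrightarrow> a \<notin> A \<Longrightarrow> nmem s' a = nmem s a"
  by (simp add: same_def)

lemma same_rD: "same A R s s' \<Longrightarrow> a \<notin> R \<Longrightarrow> rmem s' a = rmem s a"
  by (simp add: same_def)

section \<open>The decoder\<close>

lemma med_cong: "(\<And>r. r < R \<Longrightarrow> f r = f' r) \<Longrightarrow> med R f = med R f'"
proof -
  assume eq: "\<And>r. r < R \<Longrightarrow> f r = f' r"
  have "{q. q < R \<and> f r \<le> f q} = {q. q < R \<and> f' r \<le> f' q}" if "r < R" for r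
    using eq that by auto
  then have "f ` {r. r < R \<and> R < 2 * card {q. q < R \<and> f r \<le> f q}} = f' ` {r. r < R \<and> R < 2 * card {q. q < R \<and> f' r \<le> f' q}}"
    using eq by (intro image_cong) auto
  then show ?thesis by (simp add: med_def)
qed

abbreviation rzero :: rexp where "rzero \<equiv> OfNat (NLit 0)"

text \<open>
  Scalars: 30 block size of the parameter rows, 31 \<open>b\<close>, 32 \<open>D\<close>, 33 \<open>R\<close>, 34 \<open>B\<close>, 35 capacity of a
  candidate list, 36 output size, 37 nonzeros per column, 38 \<open>n\<close>; 15 level, 19 end of the queue,
  20 and 21 delimit the current candidates, 22 current modulus. Real array 5 holds the scores
  of the candidates in the queue.
\<close>

definition Med_prog :: com where
  "Med_prog =
    Seq (RPut 4 (NLit 0) rzero)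
    (For 12 (NLit 0) (Var 33)
      (Seq (Set 13 (NLit 0))
      (Seq (For 11 (NLit 0) (Var 33)
              (Cond (RLess (RGet 3 (Var 11)) (RGet 3 (Var 12))) Skip (Set 13 (NAdd (Var 13) (NLit 1)))))
           (Cond (BAnd (NLess (Var 33) (NMul (NLit 2) (Var 13))) (RLess (RGet 4 (NLit 0)) (RGet 3 (Var 12))))
              (RPut 4 (NLit 0) (RGet 3 (Var 12))) Skip))))"

definition T_med :: "nat \<Rightarrow> nat" where
  "T_med R = R * (4 * R + 7) + 3"

text \<open>The inner loop counts the values that are at least as large as the current one; the
  outer loop keeps the maximum of those supported by a strict majority. The quadratic time is
  affordable because \<open>R\<close> is only \<open>2 * a\<close>.\<close>

lemma runs_Med:
  assumes R: "nmem s 33 0 = R" and W: "R \<le> W"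
  shows "runs W Med_prog s (T_med R) (\<lambda>s'. rmem s' 4 0 = med R (rmem s 3) \<and> same {11, 12, 13} {4} s s')"
proof -
  let ?f = "rmem s 3"
  let ?c = "\<lambda>r. card {q. q < R \<and> ?f r \<le> ?f q}"
  define mm where "mm j = Max (insert 0 (?f ` {r. r < j \<and> R < 2 * ?c r}))" for j
  define I where "I j s' \<longleftrightarrow> rmem s' 4 0 = mm j \<and> same {11, 12, 13} {4} s s'" for j s'
  have I_R: "nmem s' 33 0 = R" "rmem s' 3 = ?f" if "same {11, 12, 13} {4} s s'" for s'
    using that R by (auto simp: same_def)
  have m_Suc: "mm (Suc j) = (if R < 2 * ?c j \<and> mm j < ?f j then ?f j else mm j)" for j
  proof (cases "R < 2 * ?c j")
    case True
    have "{r. r < Suc j \<and> R < 2 * ?c r} = insert j {r. r < j \<and> R < 2 * ?c r}"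
      using True by (auto simp: less_Suc_eq)
    then have "insert 0 (?f ` {r. r < Suc j \<and> R < 2 * ?c r}) = insert (?f j) (insert 0 (?f ` {r. r < j \<and> R < 2 * ?c r}))"
      by auto
    then have "mm (Suc j) = max (?f j) (mm j)" unfolding mm_def by (simp only:) (rule Max_insert; simp)
    then show ?thesis using True by (auto simp: max_def)
  next
    case False
    then have "{r. r < Suc j \<and> R < 2 * ?c r} = {r. r < j \<and> R < 2 * ?c r}"
      by (auto simp: less_Suc_eq)
    then show ?thesis using False by (simp add: mm_def)
  qed
  show ?thesis
    unfolding Med_prog_def
  proof (rule runs_Seq[where T = 1 and U = "R * (4 * R + 7) + 2" and Q = "\<lambda>s'. I 0 s'"])
    show "runs W (RPut 4 (NLit 0) rzero) s 1 (I 0)" by (rule runs_RPut) (simp_all add: I_def mm_def)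
    fix s0 assume s0: "I 0 s0"
    show "runs W (For 12 (NLit 0) (Var 33)
      (Seq (Set 13 (NLit 0))
      (Seq (For 11 (NLit 0) (Var 33)
              (Cond (RLess (RGet 3 (Var 11)) (RGet 3 (Var 12))) Skip (Set 13 (NAdd (Var 13) (NLit 1)))))
           (Cond (BAnd (NLess (Var 33) (NMul (NLit 2) (Var 13))) (RLess (RGet 4 (NLit 0)) (RGet 3 (Var 12))))
              (RPut 4 (NLit 0) (RGet 3 (Var 12))) Skip))))
       s0 (R * (4 * R + 7) + 2) (\<lambda>s'. rmem s' 4 0 = med R (rmem s 3) \<and> same {11, 12, 13} {4} s s')"
    proof (rule runs_For[where I = I and l = 0 and h = R and T = "4 * R + 5"])
      show "I 0 (nput 12 0 0 s0)" using s0 by (simp add: I_def)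
      show "nval (Var 33) s' = R" if "I j s'" for j s' using I_R(1)[of s'] that by (simp add: I_def)
      fix j s1 assume j: "j < R" and I: "I j s1" and v: "nmem s1 12 0 = j"
      let ?s2 = "nput 13 0 0 s1"
      define I2 where "I2 q s' \<longleftrightarrow> nmem s' 13 0 = card {p. p < q \<and> ?f j \<le> ?f p} \<and> nmem s' 12 0 = j \<and>
        rmem s' 4 0 = mm j \<and> same {11, 12, 13} {4} s s'" for q s'
      have "runs W (Seq (For 11 (NLit 0) (Var 33)
              (Cond (RLess (RGet 3 (Var 11)) (RGet 3 (Var 12))) Skip (Set 13 (NAdd (Var 13) (NLit 1)))))
           (Cond (BAnd (NLess (Var 33) (NMul (NLit 2) (Var 13))) (RLess (RGet 4 (NLit 0)) (RGet 3 (Var 12))))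
              (RPut 4 (NLit 0) (RGet 3 (Var 12))) Skip)) ?s2 (R * 4 + 4)
          (\<lambda>s'. nmem s' 12 0 = j \<and> I (Suc j) (nput 12 0 (Suc j) s'))"
      proof (rule runs_Seq[where T = "R * 4 + 2" and U = 2 and Q = "I2 R"])
        show "runs W (For 11 (NLit 0) (Var 33)
              (Cond (RLess (RGet 3 (Var 11)) (RGet 3 (Var 12))) Skip (Set 13 (NAdd (Var 13) (NLit 1))))) ?s2 (R * 4 + 2) (I2 R)"
        proof (rule runs_For[where I = I2 and l = 0 and h = R and T = 2])
          show "I2 0 (nput 11 0 0 ?s2)" using I v by (simp add: I2_def I_def)
          show "nval (Var 33) s' = R" if "I2 j s'" for j s' using I_R(1)[of s'] that by (simp add: I2_def)
          fix q s3 assume q: "q < R" "I2 q s3" "nmem s3 11 0 = q"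
          have f3: "rmem s3 3 = ?f" using q(2) by (intro I_R(2)) (simp add: I2_def)
          have cle: "card {p. p < q \<and> ?f j \<le> ?f p} \<le> q"
            using card_mono[of "{..<q}" "{p. p < q \<and> ?f j \<le> ?f p}"] by auto
          have set: "{p. p < Suc q \<and> ?f j \<le> ?f p} =
             (if ?f q < ?f j then {p. p < q \<and> ?f j \<le> ?f p} else insert q {p. p < q \<and> ?f j \<le> ?f p})"
            by (auto simp: less_Suc_eq)
          show "runs W (Cond (RLess (RGet 3 (Var 11)) (RGet 3 (Var 12))) Skip (Set 13 (NAdd (Var 13) (NLit 1)))) s3 2
             (\<lambda>s'. nmem s' 11 0 = q \<and> I2 (Suc q) (nput 11 0 (Suc q) s'))"
            by (rule runs_Cond[where T = 1]; (rule runs_Skip | rule runs_NPut)?)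
               (use q f3 cle W in \<open>simp_all add: I2_def set\<close>)
        qed (use W in auto)
        fix s3 assume s3: "I2 R s3"
        have "same {11, 12, 13} {4} s s3" using s3 by (simp add: I2_def)
        then have f3: "rmem s3 3 = ?f" "nmem s3 33 0 = R" by (rule I_R(2), intro I_R(1))
        show "runs W (Cond (BAnd (NLess (Var 33) (NMul (NLit 2) (Var 13))) (RLess (RGet 4 (NLit 0)) (RGet 3 (Var 12))))
              (RPut 4 (NLit 0) (RGet 3 (Var 12))) Skip) s3 2 (\<lambda>s'. nmem s' 12 0 = j \<and> I (Suc j) (nput 12 0 (Suc j) s'))"
          by (rule runs_Cond[where T = 1]; (rule runs_RPut | rule runs_Skip)?)
             (use s3 f3 in \<open>auto simp: I2_def I_def m_Suc\<close>)
      qed simp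
      then have "runs W (Seq (Set 13 (NLit 0)) (Seq (For 11 (NLit 0) (Var 33)
              (Cond (RLess (RGet 3 (Var 11)) (RGet 3 (Var 12))) Skip (Set 13 (NAdd (Var 13) (NLit 1)))))
           (Cond (BAnd (NLess (Var 33) (NMul (NLit 2) (Var 13))) (RLess (RGet 4 (NLit 0)) (RGet 3 (Var 12))))
              (RPut 4 (NLit 0) (RGet 3 (Var 12))) Skip))) s1 (Suc (R * 4 + 4))
          (\<lambda>s'. nmem s' 12 0 = j \<and> I (Suc j) (nput 12 0 (Suc j) s'))"
        by (intro runs_Seq_NPut) simp_all
      then show "runs W (Seq (Set 13 (NLit 0)) (Seq (For 11 (NLit 0) (Var 33)
              (Cond (RLess (RGet 3 (Var 11)) (RGet 3 (Var 12))) Skip (Set 13 (NAdd (Var 13) (NLit 1)))))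
           (Cond (BAnd (NLess (Var 33) (NMul (NLit 2) (Var 13))) (RLess (RGet 4 (NLit 0)) (RGet 3 (Var 12))))
              (RPut 4 (NLit 0) (RGet 3 (Var 12))) Skip))) s1 (4 * R + 5)
          (\<lambda>s'. nmem s' 12 0 = j \<and> I (Suc j) (nput 12 0 (Suc j) s'))"
        by (rule runs_conseq) auto
    qed (use W in \<open>auto simp: I_def med_def mm_def\<close>)
  qed (simp add: T_med_def)
qed


section \<open>Programs for scores, thresholds and one level of the search\<close>

definition Est_prog :: "nat \<Rightarrow> nat \<Rightarrow> com" where
  "Est_prog u npb =
    (let pos = NAdd (NAdd (NMul (Var 18) (Var 37)) (NLit npb)) (NMul (NAdd (NMul (Var 15) (Var 33)) (Var 10)) (NLit (u + 1)));
         e = RDiv (RGet 1 (NGet 2 pos)) (RGet 2 pos)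
     in Seq (For 10 (NLit 0) (Var 33) (RPut 3 (Var 10) (RMul e e))) Med_prog)"

definition Probe_prog :: "nat \<Rightarrow> nat \<Rightarrow> com" where
  "Probe_prog u npb =
    (let e = RGet 1 (NAdd (NMul (NLit npb) (Var 30)) (NMul (NAdd (NMul (NAdd (NMul (Var 15) (Var 33)) (Var 10)) (NLit (u + 1))) (Var 14)) (Var 34)))
     in Seq (For 10 (NLit 0) (Var 33)
          (Seq (RPut 3 (Var 10) rzero)
            (For 14 (NLit 1) (NLit (u + 1))
              (Cond (RLess (RGet 3 (Var 10)) (RMul e e)) (RPut 3 (Var 10) (RMul e e)) Skip))))
        (Seq Med_prog (RPut 6 (NLit 0) (RMul (OfNat (NLit 4)) (RGet 4 (NLit 0))))))"

text \<open>Comparing the number of children accepted so far with the capacity realizes the cut-off.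
  A child and its score are stored at the same position, so the scores of the last level can be
  reused for the selection.\<close>

definition Cell_prog :: "nat \<Rightarrow> nat \<Rightarrow> com" where
  "Cell_prog u npb =
    Seq (Set 18 (NAdd (NGet 5 (Var 16)) (NMul (Var 17) (Var 22))))
    (Cond (NLess (Var 18) (Var 38))
      (Seq (Est_prog u npb)
        (Cond (BAnd (RLess (RGet 6 (NLit 0)) (RGet 4 (NLit 0))) (NLess (NSub (Var 19) (Var 21)) (Var 35)))
          (Seq (NPut 5 (Var 19) (Var 18)) (Seq (RPut 5 (Var 19) (RGet 4 (NLit 0))) (Set 19 (NAdd (Var 19) (NLit 1)))))
          Skip))
      Skip)"

definition Level_prog :: "nat \<Rightarrow> nat \<Rightarrow> com" where
  "Level_prog u npb =
    Seq (Probe_prog u npb)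
    (Seq (For 16 (Var 20) (Var 21) (For 17 (NLit 0) (Var 31) (Cell_prog u npb)))
    (Seq (Set 20 (Var 21)) (Seq (Set 21 (Var 19)) (Set 22 (NMul (Var 22) (Var 31))))))"

lemma take_filter_snoc:
  "take N (filter P (xs @ [v])) =
    (if P v \<and> length (take N (filter P xs)) < N then take N (filter P xs) @ [v] else take N (filter P xs))"
  by auto

text \<open>The program is analysed for arbitrary arrays of rows, measurements and entries. The last
  word bound covers the number of a child, which is stored before it is compared with
  \<open>n\<close>.\<close>

locale machine =
  fixes W n b R B N1 S P u D s :: nat and rowf :: "nat \<Rightarrow> nat" and yf entf :: "nat \<Rightarrow> real"
  assumes u_pos: "0 < u" and BN1: "B \<le> N1"
    and W_bounds: "R \<le> W" "b \<le> W" "u + 1 \<le> W" "(D + 1) * N1 \<le> W" "n + b * (B * b ^ D) \<le> W"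
    and b_pos: "0 < b"
begin

definition npb where "npb = 8 + s"
definition rp where "rp l r c = (l * R + r) * (u + 1) + c"
definition val where "val l v r =
  (yf (rowf (v * S + npb + rp l r 0)) / entf (v * S + npb + rp l r 0))\<^sup>2"
definition scr where "scr l v = med R (val l v)"
definition prb where "prb l r = Max ((\<lambda>c. (yf (npb * P + rp l r c * B))\<^sup>2) ` {1..u})"
definition thd where "thd l = 4 * med R (prb l)"

definition ctx where
  "ctx t \<longleftrightarrow> nmem t 2 = rowf \<and> rmem t 1 = yf \<and> rmem t 2 = entf \<and> nmem t 30 0 = P \<and> nmem t 31 0 = b \<and>
    nmem t 33 0 = R \<and> nmem t 34 0 = B \<and> nmem t 35 0 = N1 \<and> nmem t 37 0 = S \<and> nmem t 38 0 = n"

lemma ctx_same: "ctx t \<Longrightarrow> same A A' t t' \<Longrightarrow> A \<inter> {2, 30, 31, 33, 34, 35, 37, 38} = {} \<Longrightarrow> A' \<inter> {1, 2} = {} \<Longrightarrow> ctx t'"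
  unfolding ctx_def same_def by auto

definition T_est where "T_est = R * 3 + 2 + T_med R"

text \<open>Column \<open>v\<close> records the row to which each block sends coordinate
  \<open>v\<close>. For \<open>v\<close> below the modulus this is the bucket of node
  \<open>v\<close>, so row and coefficient are found at the same offset and no hash function has to
  be evaluated.\<close>

lemma runs_Est:
  assumes ctx: "ctx t" and l: "nmem t 15 0 = l" and v: "nmem t 18 0 = v"
  shows "runs W (Est_prog u npb) t T_est (\<lambda>t'. rmem t' 4 0 = scr l v \<and> same {10, 11, 12, 13} {3, 4} t t')"
  unfolding Est_prog_def Let_def
proof (rule runs_Seq)
  let ?I = "\<lambda>j t'. (\<forall>r<j. rmem t' 3 r = val l v r) \<and> same {10} {3} t t'"
  show "runs W (For 10 (NLit 0) (Var 33) (RPut 3 (Var 10)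
      (RMul (RDiv (RGet 1 (NGet 2 (NAdd (NAdd (NMul (Var 18) (Var 37)) (NLit npb)) (NMul (NAdd (NMul (Var 15) (Var 33)) (Var 10)) (NLit (u + 1))))))
          (RGet 2 (NAdd (NAdd (NMul (Var 18) (Var 37)) (NLit npb)) (NMul (NAdd (NMul (Var 15) (Var 33)) (Var 10)) (NLit (u + 1))))))
        (RDiv (RGet 1 (NGet 2 (NAdd (NAdd (NMul (Var 18) (Var 37)) (NLit npb)) (NMul (NAdd (NMul (Var 15) (Var 33)) (Var 10)) (NLit (u + 1))))))
          (RGet 2 (NAdd (NAdd (NMul (Var 18) (Var 37)) (NLit npb)) (NMul (NAdd (NMul (Var 15) (Var 33)) (Var 10)) (NLit (u + 1))))))))) t (R * 3 + 2) (?I R)"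
  proof (rule runs_For[where I = ?I and l = 0 and h = R and T = 1])
    fix j t' assume I: "?I j t'"
    have c: "ctx t'" by (rule ctx_same[OF ctx conjunct2[OF I]]) auto
    show "nval (Var 33) t' = R" using c by (simp add: ctx_def)
    assume j: "j < R" "nmem t' 10 0 = j"
    have lv: "nmem t' 15 0 = l" "nmem t' 18 0 = v" using same_nD[OF conjunct2[OF I]] l v by simp_all
    show "runs W (RPut 3 (Var 10)
      (RMul (RDiv (RGet 1 (NGet 2 (NAdd (NAdd (NMul (Var 18) (Var 37)) (NLit npb)) (NMul (NAdd (NMul (Var 15) (Var 33)) (Var 10)) (NLit (u + 1))))))
          (RGet 2 (NAdd (NAdd (NMul (Var 18) (Var 37)) (NLit npb)) (NMul (NAdd (NMul (Var 15) (Var 33)) (Var 10)) (NLit (u + 1))))))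
        (RDiv (RGet 1 (NGet 2 (NAdd (NAdd (NMul (Var 18) (Var 37)) (NLit npb)) (NMul (NAdd (NMul (Var 15) (Var 33)) (Var 10)) (NLit (u + 1))))))
          (RGet 2 (NAdd (NAdd (NMul (Var 18) (Var 37)) (NLit npb)) (NMul (NAdd (NMul (Var 15) (Var 33)) (Var 10)) (NLit (u + 1)))))))) t' 1
       (\<lambda>s'. nmem s' 10 0 = j \<and> ?I (Suc j) (nput 10 0 (Suc j) s'))"
      by (rule runs_RPut) (use c j lv I in \<open>simp_all add: ctx_def val_def rp_def power2_eq_square less_Suc_eq\<close>)
  qed (use ctx W_bounds in \<open>simp_all add: ctx_def\<close>)
  fix t' assume I: "?I R t'"
  have c: "ctx t'" by (rule ctx_same[OF ctx conjunct2[OF I]]) auto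
  show "runs W Med_prog t' (T_med R) (\<lambda>t'. rmem t' 4 0 = scr l v \<and> same {10, 11, 12, 13} {3, 4} t t')"
  proof (rule runs_post)
    show "runs W Med_prog t' (T_med R) (\<lambda>s'. rmem s' 4 0 = med R (rmem t' 3) \<and> same {11, 12, 13} {4} t' s')"
      using c W_bounds by (intro runs_Med) (simp_all add: ctx_def)
    fix s' assume s': "rmem s' 4 0 = med R (rmem t' 3) \<and> same {11, 12, 13} {4} t' s'"
    have "med R (rmem t' 3) = scr l v" unfolding scr_def using I by (intro med_cong) simp
    moreover have "same {10, 11, 12, 13} {3, 4} t s'"
      by (rule same_trans[OF same_mono[OF conjunct2[OF I]] same_mono[OF conjunct2[OF s']]]) auto
    ultimately show "rmem s' 4 0 = scr l v \<and> same {10, 11, 12, 13} {3, 4} t s'" using s' by simp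
  qed
qed (simp add: T_est_def)

definition T_probe where "T_probe = R * (u * 4 + 5) + 3 + T_med R"

lemma runs_Probe:
  assumes ctx: "ctx t" and l: "nmem t 15 0 = l"
  shows "runs W (Probe_prog u npb) t T_probe (\<lambda>t'. rmem t' 6 0 = thd l \<and> same {10, 11, 12, 13, 14} {3, 4, 6} t t')"
proof -
  define e where "e = RGet 1 (NAdd (NMul (NLit npb) (Var 30)) (NMul (NAdd (NMul (NAdd (NMul (Var 15) (Var 33)) (Var 10)) (NLit (u + 1))) (Var 14)) (Var 34)))"
  let ?g = "\<lambda>r c. (yf (npb * P + rp l r c * B))\<^sup>2"
  have prb: "prb l r = Max (insert 0 (?g r ` {1..<u + 1}))" for r
  proof -
    have "Max (insert 0 (?g r ` {1..u})) = max 0 (Max (?g r ` {1..u}))" using u_pos by (intro Max_insert) auto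
    also have "\<dots> = Max (?g r ` {1..u})"
    proof (rule max_absorb2)
      have "0 \<le> ?g r 1" by simp
      also have "\<dots> \<le> Max (?g r ` {1..u})" using u_pos by (intro Max_ge) auto
      finally show "0 \<le> Max (?g r ` {1..u})" .
    qed
    finally show ?thesis by (simp add: prb_def atLeastLessThanSuc_atLeastAtMost)
  qed
  define mx where "mx r c = Max (insert 0 (?g r ` {1..<c}))" for r c
  have mx1: "mx r 1 = 0" for r by (simp add: mx_def)
  have mxS: "mx r (Suc c) = (if mx r c < ?g r c then ?g r c else mx r c)" if "1 \<le> c" for r c
  proof -
    have "insert 0 (?g r ` {1..<Suc c}) = insert (?g r c) (insert 0 (?g r ` {1..<c}))"
      using that by (auto simp: less_Suc_eq)
    then have "mx r (Suc c) = max (?g r c) (mx r c)" unfolding mx_def by (simp only:) (rule Max_insert; simp)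
    then show ?thesis by (auto simp: max_def)
  qed
  let ?I = "\<lambda>j t'. (\<forall>r<j. rmem t' 3 r = prb l r) \<and> same {10, 14} {3} t t'"
  have "runs W (Seq (For 10 (NLit 0) (Var 33)
          (Seq (RPut 3 (Var 10) rzero)
            (For 14 (NLit 1) (NLit (u + 1))
              (Cond (RLess (RGet 3 (Var 10)) (RMul e e)) (RPut 3 (Var 10) (RMul e e)) Skip))))
        (Seq Med_prog (RPut 6 (NLit 0) (RMul (OfNat (NLit 4)) (RGet 4 (NLit 0)))))) t T_probe
        (\<lambda>t'. rmem t' 6 0 = thd l \<and> same {10, 11, 12, 13, 14} {3, 4, 6} t t')"
  proof (rule runs_Seq)
    show "runs W (For 10 (NLit 0) (Var 33)
          (Seq (RPut 3 (Var 10) rzero)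
            (For 14 (NLit 1) (NLit (u + 1))
              (Cond (RLess (RGet 3 (Var 10)) (RMul e e)) (RPut 3 (Var 10) (RMul e e)) Skip)))) t (R * (u * 4 + 5) + 2) (?I R)"
    proof (rule runs_For[where I = ?I and l = 0 and h = R and T = "u * 4 + 3"])
      fix j t' assume I: "?I j t'"
      have c: "ctx t'" by (rule ctx_same[OF ctx conjunct2[OF I]]) auto
      show "nval (Var 33) t' = R" using c by (simp add: ctx_def)
      assume j: "j < R" "nmem t' 10 0 = j"
      have lv: "nmem t' 15 0 = l" using same_nD[OF conjunct2[OF I]] l by simp
      let ?J = "\<lambda>c s'. rmem s' 3 j = mx j c \<and> (\<forall>r<j. rmem s' 3 r = prb l r) \<and> nmem s' 10 0 = j \<and> same {10, 14} {3} t s'"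
      have "runs W (Seq (RPut 3 (Var 10) rzero)
            (For 14 (NLit 1) (NLit (u + 1))
              (Cond (RLess (RGet 3 (Var 10)) (RMul e e)) (RPut 3 (Var 10) (RMul e e)) Skip))) t' (Suc (u * 4 + 2))
            (\<lambda>s'. nmem s' 10 0 = j \<and> ?I (Suc j) (nput 10 0 (Suc j) s'))"
      proof (rule runs_Seq_RPut, rule runs_For[where I = ?J and l = 1 and h = "u + 1" and T = 2])
        show "?J 1 (nput 14 0 1 (rput 3 (nval (Var 10) t') (rval rzero t') t'))"
          using I j by (simp add: mx1[unfolded One_nat_def])
        fix c s' assume cc: "1 \<le> c" "c < u + 1" and J: "?J c s'" and v14: "nmem s' 14 0 = c"
        have sm: "same {10, 14} {3} t s'" using J by blast
        have ct: "ctx s'" by (rule ctx_same[OF ctx sm]) auto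
        have l': "nmem s' 15 0 = l" using same_nD[OF sm] l by simp
        have ev: "rval (RMul e e) s' = ?g j c"
          using ct J v14 l' by (simp add: e_def ctx_def rp_def power2_eq_square)
        show "runs W (Cond (RLess (RGet 3 (Var 10)) (RMul e e)) (RPut 3 (Var 10) (RMul e e)) Skip) s' 2
           (\<lambda>s''. nmem s'' 14 0 = c \<and> ?J (Suc c) (nput 14 0 (Suc c) s''))"
          by (rule runs_Cond[where T = 1]; (rule runs_RPut | rule runs_Skip)?)
             (use J v14 cc ev in \<open>simp_all add: mxS del: rval.simps(5)\<close>)
      next
        fix s' assume J: "?J (u + 1) s'"
        then have "rmem s' 3 j = prb l j" by (simp add: mx_def prb)
        then show "nmem s' 10 0 = j \<and> ?I (Suc j) (nput 10 0 (Suc j) s')"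
          using J by (simp add: less_Suc_eq)
      qed (use W_bounds u_pos in simp_all)
      then show "runs W (Seq (RPut 3 (Var 10) rzero)
            (For 14 (NLit 1) (NLit (u + 1))
              (Cond (RLess (RGet 3 (Var 10)) (RMul e e)) (RPut 3 (Var 10) (RMul e e)) Skip))) t' (u * 4 + 3)
            (\<lambda>s'. nmem s' 10 0 = j \<and> ?I (Suc j) (nput 10 0 (Suc j) s'))"
        by (rule runs_conseq) auto
    qed (use ctx W_bounds in \<open>simp_all add: ctx_def\<close>)
    fix t' assume I: "?I R t'"
    have c: "ctx t'" by (rule ctx_same[OF ctx conjunct2[OF I]]) auto
    have m: "med R (rmem t' 3) = med R (prb l)" using I by (intro med_cong) simp
    show "runs W (Seq Med_prog (RPut 6 (NLit 0) (RMul (OfNat (NLit 4)) (RGet 4 (NLit 0))))) t' (T_med R + 1)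
        (\<lambda>t'. rmem t' 6 0 = thd l \<and> same {10, 11, 12, 13, 14} {3, 4, 6} t t')"
    proof (rule runs_Seq)
      show "runs W Med_prog t' (T_med R) (\<lambda>s'. rmem s' 4 0 = med R (rmem t' 3) \<and> same {11, 12, 13} {4} t' s')"
        using c W_bounds by (intro runs_Med) (simp_all add: ctx_def)
      fix s' assume s': "rmem s' 4 0 = med R (rmem t' 3) \<and> same {11, 12, 13} {4} t' s'"
      have "same {10, 11, 12, 13, 14} {3, 4, 6} t s'"
        by (rule same_trans[OF same_mono[OF conjunct2[OF I]] same_mono[OF conjunct2[OF s']]]) auto
      then show "runs W (RPut 6 (NLit 0) (RMul (OfNat (NLit 4)) (RGet 4 (NLit 0)))) s' 1
         (\<lambda>t'. rmem t' 6 0 = thd l \<and> same {10, 11, 12, 13, 14} {3, 4, 6} t t')"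
        using s' m by (intro runs_RPut) (simp_all add: thd_def)
    qed simp
  qed (simp add: T_probe_def)
  then show ?thesis by (simp add: Probe_prog_def Let_def e_def)
qed

primrec cnd :: "nat \<Rightarrow> nat list" where
  "cnd 0 = [0..<min B n]"
| "cnd (Suc l) = take N1 (filter (\<lambda>v. thd l < scr l v) (concat (map (children n b (B * b ^ l)) (cnd l))))"

lemma length_cnd: "length (cnd l) \<le> N1"
  using BN1 by (cases l) auto

lemma cnd_less: "v \<in> set (cnd l) \<Longrightarrow> v < n"
  by (cases l) (auto dest!: in_set_takeD simp: set_children)

definition queue where
  "queue l h acc t0 t \<longleftrightarrow> nmem t 19 0 = h + length acc \<and>
    (\<forall>i<length acc. nmem t 5 (h + i) = acc ! i \<and> rmem t 5 (h + i) = scr l (acc ! i)) \<and>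
    (\<forall>i<h. nmem t 5 i = nmem t0 5 i) \<and> same {5, 10, 11, 12, 13, 16, 17, 18, 19} {3, 4, 5} t0 t"

lemma queue_nput [simp]:
  assumes "a \<in> {10, 11, 12, 13, 16, 17, 18}"
  shows "queue l h acc t0 (nput a i v t) = queue l h acc t0 t"
proof -
  have "19 \<noteq> a" "5 \<noteq> a" "a \<in> {5, 10, 11, 12, 13, 16, 17, 18, 19}" using assms by auto
  then show ?thesis
    unfolding queue_def nmem_nput rmem_nput by (simp only: fun_upd_other same_nput simp_thms)
qed

lemma queue_same: "queue l h acc t0 t \<Longrightarrow> same {5, 10, 11, 12, 13, 16, 17, 18, 19} {3, 4, 5} t0 t"
  by (simp add: queue_def)

definition T_cell where "T_cell = T_est + 8"

lemma runs_Cell: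
  assumes q: "queue l h acc t0 t" and ctx: "ctx t0" and t0: "nmem t0 15 0 = l" "nmem t0 21 0 = h" "rmem t0 6 0 = thd l" "nmem t0 22 0 = Md"
    and acc: "length acc \<le> N1" "h + N1 \<le> W" and p: "nmem t 16 0 = p" "p < h" "nmem t0 5 p = w" and j: "nmem t 17 0 = j"
    and w: "w + j * Md \<le> W"
  shows "runs W (Cell_prog u npb) t T_cell (\<lambda>t'. nmem t' 16 0 = p \<and> nmem t' 17 0 = j \<and>
    queue l h (if w + j * Md < n \<and> thd l < scr l (w + j * Md) \<and> length acc < N1 then acc @ [w + j * Md] else acc) t0 t')"
proof -
  let ?v = "w + j * Md"
  have sm: "same {5, 10, 11, 12, 13, 16, 17, 18, 19} {3, 4, 5} t0 t" using q by (simp add: queue_def)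
  have c: "ctx t" by (rule ctx_same[OF ctx sm]) auto
  have t: "nmem t 15 0 = l" "nmem t 21 0 = h" "rmem t 6 0 = thd l" "nmem t 22 0 = Md"
    using same_nD[OF sm] same_rD[OF sm] t0 by simp_all
  have vp: "nmem t 5 p = w" using q p by (simp add: queue_def)
  let ?t1 = "nput 18 0 ?v t"
  have q1: "queue l h acc t0 ?t1" using q by (simp add: queue_def)
  have c1: "ctx ?t1" using c by (simp add: ctx_def)
  have "runs W (Cell_prog u npb) t (Suc (T_est + 7)) (\<lambda>t'. nmem t' 16 0 = p \<and> nmem t' 17 0 = j \<and>
    queue l h (if ?v < n \<and> thd l < scr l ?v \<and> length acc < N1 then acc @ [?v] else acc) t0 t')"
    unfolding Cell_prog_def
  proof (rule runs_Seq_NPut)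
    show "nval (NAdd (NGet 5 (Var 16)) (NMul (Var 17) (Var 22))) t \<le> W" using w p vp t j by simp
    have eq: "nput 18 (nval (NLit 0) t) (nval (NAdd (NGet 5 (Var 16)) (NMul (Var 17) (Var 22))) t) t = ?t1"
      using p vp t j by simp
    show "runs W (Cond (NLess (Var 18) (Var 38))
      (Seq (Est_prog u npb)
        (Cond (BAnd (RLess (RGet 6 (NLit 0)) (RGet 4 (NLit 0))) (NLess (NSub (Var 19) (Var 21)) (Var 35)))
          (Seq (NPut 5 (Var 19) (Var 18)) (Seq (RPut 5 (Var 19) (RGet 4 (NLit 0))) (Set 19 (NAdd (Var 19) (NLit 1)))))
          Skip))
      Skip) (nput 18 (nval (NLit 0) t) (nval (NAdd (NGet 5 (Var 16)) (NMul (Var 17) (Var 22))) t) t) (T_est + 7)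
      (\<lambda>t'. nmem t' 16 0 = p \<and> nmem t' 17 0 = j \<and>
    queue l h (if ?v < n \<and> thd l < scr l ?v \<and> length acc < N1 then acc @ [?v] else acc) t0 t')"
      unfolding eq
    proof (rule runs_Cond[where T = "T_est + 5"])
      assume "\<not> bval (NLess (Var 18) (Var 38)) ?t1"
      then have "\<not> ?v < n" using c by (simp add: ctx_def)
      then show "runs W Skip ?t1 (T_est + 5) (\<lambda>t'. nmem t' 16 0 = p \<and> nmem t' 17 0 = j \<and>
         queue l h (if ?v < n \<and> thd l < scr l ?v \<and> length acc < N1 then acc @ [?v] else acc) t0 t')"
        using p j q1 by (intro runs_Skip) simp_all
    next
      assume "bval (NLess (Var 18) (Var 38)) ?t1"
      then have vn: "?v < n" using c by (simp add: ctx_def)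
      show "runs W (Seq (Est_prog u npb)
        (Cond (BAnd (RLess (RGet 6 (NLit 0)) (RGet 4 (NLit 0))) (NLess (NSub (Var 19) (Var 21)) (Var 35)))
          (Seq (NPut 5 (Var 19) (Var 18)) (Seq (RPut 5 (Var 19) (RGet 4 (NLit 0))) (Set 19 (NAdd (Var 19) (NLit 1)))))
          Skip)) ?t1 (T_est + 5) (\<lambda>t'. nmem t' 16 0 = p \<and> nmem t' 17 0 = j \<and>
         queue l h (if ?v < n \<and> thd l < scr l ?v \<and> length acc < N1 then acc @ [?v] else acc) t0 t')"
      proof (rule runs_Seq)
        show "runs W (Est_prog u npb) ?t1 T_est (\<lambda>t'. rmem t' 4 0 = scr l ?v \<and> same {10, 11, 12, 13} {3, 4} ?t1 t')"
          using c1 t by (intro runs_Est) simp_all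
        fix t2 assume t2: "rmem t2 4 0 = scr l ?v \<and> same {10, 11, 12, 13} {3, 4} ?t1 t2"
        note sm2 = conjunct2[OF t2]
        have n2: "nmem t2 16 0 = p" "nmem t2 17 0 = j" "nmem t2 18 0 = ?v" "nmem t2 21 0 = h" "nmem t2 19 0 = h + length acc"
          "nmem t2 35 0 = N1" "nmem t2 5 = nmem t 5" "rmem t2 5 = rmem t 5" "rmem t2 6 0 = thd l"
          using same_nD[OF sm2] same_rD[OF sm2] p j t c q by (simp_all add: ctx_def queue_def)
        have sm02: "same {5, 10, 11, 12, 13, 16, 17, 18, 19} {3, 4, 5} t0 t2"
        proof -
          have "same {5, 10, 11, 12, 13, 16, 17, 18, 19} {3, 4, 5} ?t1 t2" by (rule same_mono[OF sm2]) auto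
          then have "same {5, 10, 11, 12, 13, 16, 17, 18, 19} {3, 4, 5} t t2" by simp
          then show ?thesis by (rule same_trans[OF sm])
        qed
        have q2: "queue l h acc t0 t2" using q n2 sm02 by (simp add: queue_def)
        have q3: "queue l h (acc @ [?v]) t0 (nput 19 0 (Suc (h + length acc)) (rput 5 (h + length acc) (scr l ?v) (nput 5 (h + length acc) ?v t2)))"
          using q2 by (auto simp: queue_def nth_append less_Suc_eq)
        show "runs W (Cond (BAnd (RLess (RGet 6 (NLit 0)) (RGet 4 (NLit 0))) (NLess (NSub (Var 19) (Var 21)) (Var 35)))
          (Seq (NPut 5 (Var 19) (Var 18)) (Seq (RPut 5 (Var 19) (RGet 4 (NLit 0))) (Set 19 (NAdd (Var 19) (NLit 1)))))
          Skip) t2 4 (\<lambda>t'. nmem t' 16 0 = p \<and> nmem t' 17 0 = j \<and>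
         queue l h (if ?v < n \<and> thd l < scr l ?v \<and> length acc < N1 then acc @ [?v] else acc) t0 t')"
        proof (rule runs_Cond[where T = 3])
          assume b: "bval (BAnd (RLess (RGet 6 (NLit 0)) (RGet 4 (NLit 0))) (NLess (NSub (Var 19) (Var 21)) (Var 35))) t2"
          then have bb: "thd l < scr l ?v" "length acc < N1" using t2 n2 by simp_all
          have "runs W (Seq (NPut 5 (Var 19) (Var 18)) (Seq (RPut 5 (Var 19) (RGet 4 (NLit 0))) (Set 19 (NAdd (Var 19) (NLit 1))))) t2 (Suc (Suc 1))
            (\<lambda>t'. nmem t' 16 0 = p \<and> nmem t' 17 0 = j \<and>
         queue l h (if ?v < n \<and> thd l < scr l ?v \<and> length acc < N1 then acc @ [?v] else acc) t0 t')"
            by (intro runs_Seq_NPut runs_Seq_RPut runs_NPut) (use n2 t2 w q3 bb vn acc in simp_all)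
          then show "runs W (Seq (NPut 5 (Var 19) (Var 18)) (Seq (RPut 5 (Var 19) (RGet 4 (NLit 0))) (Set 19 (NAdd (Var 19) (NLit 1))))) t2 3
            (\<lambda>t'. nmem t' 16 0 = p \<and> nmem t' 17 0 = j \<and>
         queue l h (if ?v < n \<and> thd l < scr l ?v \<and> length acc < N1 then acc @ [?v] else acc) t0 t')"
            by (simp only: numeral_3_eq_3 One_nat_def)
        next
          assume "\<not> bval (BAnd (RLess (RGet 6 (NLit 0)) (RGet 4 (NLit 0))) (NLess (NSub (Var 19) (Var 21)) (Var 35))) t2"
          then have "\<not> (thd l < scr l ?v \<and> length acc < N1)" using t2 n2 by simp
          then show "runs W Skip t2 3 (\<lambda>t'. nmem t' 16 0 = p \<and> nmem t' 17 0 = j \<and>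
             queue l h (if ?v < n \<and> thd l < scr l ?v \<and> length acc < N1 then acc @ [?v] else acc) t0 t')"
            using n2 q2 by (intro runs_Skip) auto
        qed simp
      qed simp
    qed simp
  qed
  moreover have "Suc (T_est + 7) = T_cell" by (simp add: T_cell_def)
  ultimately show ?thesis by (simp only:)
qed

definition level_state where
  "level_state l t \<longleftrightarrow> ctx t \<and> nmem t 22 0 = B * b ^ l \<and> nmem t 20 0 \<le> l * N1 \<and>
    nmem t 21 0 = nmem t 20 0 + length (cnd l) \<and> nmem t 19 0 = nmem t 21 0 \<and>
    (\<forall>i<length (cnd l). nmem t 5 (nmem t 20 0 + i) = cnd l ! i) \<and>
    (0 < l \<longrightarrow> (\<forall>i<length (cnd l). rmem t 5 (nmem t 20 0 + i) = scr (l - 1) (cnd l ! i)))"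

definition T_level where "T_level = T_probe + N1 * (b * (T_cell + 2) + 4) + 5"

lemma runs_Level:
  assumes ls: "level_state l t" and l: "nmem t 15 0 = l" "l < D"
  shows "runs W (Level_prog u npb) t T_level (\<lambda>t'. level_state (Suc l) t' \<and>
    same {5, 10, 11, 12, 13, 14, 16, 17, 18, 19, 20, 21, 22} {3, 4, 5, 6} t t')"
  unfolding Level_prog_def
proof (rule runs_Seq)
  let ?Md = "B * b ^ l" and ?lo = "nmem t 20 0" and ?m = "length (cnd l)"
  let ?h = "?lo + ?m"
  have ctx: "ctx t" using ls by (simp add: level_state_def)
  show "runs W (Probe_prog u npb) t T_probe (\<lambda>t'. rmem t' 6 0 = thd l \<and> same {10, 11, 12, 13, 14} {3, 4, 6} t t')"
    by (rule runs_Probe[OF ctx l(1)])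
  fix t0 assume t0: "rmem t0 6 0 = thd l \<and> same {10, 11, 12, 13, 14} {3, 4, 6} t t0"
  note sm0 = conjunct2[OF t0]
  have c0: "ctx t0" by (rule ctx_same[OF ctx sm0]) auto
  have n0: "nmem t0 15 0 = l" "nmem t0 20 0 = ?lo" "nmem t0 21 0 = ?h" "nmem t0 19 0 = ?h" "nmem t0 22 0 = ?Md"
    "nmem t0 5 = nmem t 5" using same_nD[OF sm0] ls l by (simp_all add: level_state_def)
  have cnd: "nmem t0 5 (?lo + i) = cnd l ! i" if "i < ?m" for i
    using that n0 ls by (simp add: level_state_def)
  let ?ch = "\<lambda>v. children n b ?Md v" and ?P = "\<lambda>v. thd l < scr l v"
  define A where "A p = take N1 (filter ?P (concat (map ?ch (take (p - ?lo) (cnd l)))))" for p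
  let ?I = "\<lambda>p t'. queue l ?h (A p) t0 t'"
  have hW: "?h + N1 \<le> W"
  proof -
    have "?h + N1 \<le> l * N1 + N1 + N1" using ls length_cnd[of l] by (simp add: level_state_def)
    also have "\<dots> = (l + 2) * N1" by simp
    also have "\<dots> \<le> (D + 1) * N1" using l by (intro mult_right_mono) auto
    finally show ?thesis using W_bounds by linarith
  qed
  show "runs W (Seq (For 16 (Var 20) (Var 21) (For 17 (NLit 0) (Var 31) (Cell_prog u npb)))
    (Seq (Set 20 (Var 21)) (Seq (Set 21 (Var 19)) (Set 22 (NMul (Var 22) (Var 31)))))) t0 (N1 * (b * (T_cell + 2) + 4) + 5)
    (\<lambda>t'. level_state (Suc l) t' \<and> same {5, 10, 11, 12, 13, 14, 16, 17, 18, 19, 20, 21, 22} {3, 4, 5, 6} t t')"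
  proof (rule runs_Seq)
    show "runs W (For 16 (Var 20) (Var 21) (For 17 (NLit 0) (Var 31) (Cell_prog u npb))) t0 (N1 * (b * (T_cell + 2) + 4) + 2) (?I ?h)"
    proof (rule runs_For[where I = ?I and l = ?lo and h = ?h and T = "b * (T_cell + 2) + 2"])
      show "?I ?lo (nput 16 0 ?lo t0)" using n0 by (simp add: queue_def A_def)
      show "(?h - ?lo) * (b * (T_cell + 2) + 2 + 2) + 2 \<le> N1 * (b * (T_cell + 2) + 4) + 2"
      proof -
        have "?h - ?lo = ?m" "b * (T_cell + 2) + 2 + 2 = b * (T_cell + 2) + 4" by simp_all
        then show ?thesis by (simp only:) (rule add_le_mono1[OF mult_le_mono1[OF length_cnd]])
      qed
      fix p t1 assume I: "?I p t1"
      have sm1: "same {5, 10, 11, 12, 13, 16, 17, 18, 19} {3, 4, 5} t0 t1" using I by (rule queue_same)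
      show "nval (Var 21) t1 = ?h" using same_nD[OF sm1] n0 by simp
      assume p: "?lo \<le> p" "p < ?h" "nmem t1 16 0 = p"
      have pm: "p - ?lo < ?m" using p by simp
      define w where "w = cnd l ! (p - ?lo)"
      have w: "nmem t0 5 p = w" using cnd[OF pm] p by (simp add: w_def)
      have wn: "w < n" using pm cnd_less[of w l] by (simp add: w_def)
      let ?X = "concat (map ?ch (take (p - ?lo) (cnd l)))"
      \<comment> \<open>The list after \<open>j\<close> children of the current parent. Appending
        while there is room agrees with cutting off the complete filtered list, by
        \<open>take_filter_snoc\<close>.\<close>
      define F where "F j = take N1 (filter ?P (?X @ filter (\<lambda>v. v < n) (map (\<lambda>j. w + j * ?Md) [0..<j])))" for j
      let ?J = "\<lambda>j t'. nmem t' 16 0 = p \<and> queue l ?h (F j) t0 t'"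
      have AS: "A (Suc p) = F b"
      proof -
        have "Suc p - ?lo = Suc (p - ?lo)" using p(1) by (rule Suc_diff_le)
        then have "take (Suc p - ?lo) (cnd l) = take (p - ?lo) (cnd l) @ [w]"
          unfolding w_def using take_Suc_conv_app_nth[OF pm] by (simp only:)
        then have "concat (map ?ch (take (Suc p - ?lo) (cnd l))) = ?X @ ?ch w" by (simp only: map_append concat_append list.map concat.simps append_Nil2)
        then show ?thesis unfolding A_def F_def children_def by (simp only:)
      qed
      show "runs W (For 17 (NLit 0) (Var 31) (Cell_prog u npb)) t1 (b * (T_cell + 2) + 2)
        (\<lambda>t'. nmem t' 16 0 = p \<and> ?I (Suc p) (nput 16 0 (Suc p) t'))"
      proof (rule runs_For[where I = ?J and l = 0 and h = b and T = T_cell])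
        have "F 0 = A p" by (simp add: A_def F_def)
        then show "?J 0 (nput 17 0 0 t1)" using p(3) I by simp
        fix j t2 assume J: "?J j t2"
        have sm2: "same {5, 10, 11, 12, 13, 16, 17, 18, 19} {3, 4, 5} t0 t2" by (rule queue_same[OF conjunct2[OF J]])
        show "nval (Var 31) t2 = b" using ctx_same[OF c0 sm2] by (simp add: ctx_def)
        assume j: "j < b" "nmem t2 17 0 = j"
        let ?v = "w + j * ?Md"
        have BS: "F (Suc j) = (if ?v < n \<and> ?P ?v \<and> length (F j) < N1 then F j @ [?v] else F j)"
        proof (cases "?v < n")
          case True
          then have "F (Suc j) = take N1 (filter ?P ((?X @ filter (\<lambda>v. v < n) (map (\<lambda>j. w + j * ?Md) [0..<j])) @ [?v]))"
            by (simp add: F_def)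
          also note take_filter_snoc
          finally show ?thesis unfolding F_def[symmetric] using True by simp
        qed (simp add: F_def)
        have vW: "?v \<le> W"
        proof -
          have "j * ?Md \<le> b * (B * b ^ D)"
            using j l b_pos by (intro mult_mono mult_left_mono power_increasing) auto
          then show ?thesis using wn W_bounds by linarith
        qed
        have "runs W (Cell_prog u npb) t2 T_cell (\<lambda>t'. nmem t' 16 0 = p \<and> nmem t' 17 0 = j \<and>
            queue l ?h (if ?v < n \<and> ?P ?v \<and> length (F j) < N1 then F j @ [?v] else F j) t0 t')"
        proof (rule runs_Cell[OF conjunct2[OF J] c0 n0(1,3) conjunct1[OF t0] n0(5) _ hW conjunct1[OF J] p(2) w j(2) vW])
          show "length (F j) \<le> N1" by (simp add: F_def)
        qed
        then show "runs W (Cell_prog u npb) t2 T_cell (\<lambda>t'. nmem t' 17 0 = j \<and> ?J (Suc j) (nput 17 0 (Suc j) t'))"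
          unfolding BS by (rule runs_post) simp
      next
        fix t2 assume "?J b t2"
        then show "nmem t2 16 0 = p \<and> ?I (Suc p) (nput 16 0 (Suc p) t2)"
          unfolding AS by simp
      qed (use W_bounds in simp_all)
    qed (use n0 hW in simp_all)
    fix t1 assume I: "?I ?h t1"
    have A: "A ?h = cnd (Suc l)" by (simp add: A_def)
    have q: "queue l ?h (cnd (Suc l)) t0 t1" using I unfolding A .
    have sm1: "same {5, 10, 11, 12, 13, 16, 17, 18, 19} {3, 4, 5} t0 t1" using q by (simp add: queue_def)
    have c1: "ctx t1" by (rule ctx_same[OF c0 sm1]) auto
    have n1: "nmem t1 21 0 = ?h" "nmem t1 22 0 = ?Md" "nmem t1 31 0 = b" "nmem t1 19 0 = ?h + length (cnd (Suc l))"
      using same_nD[OF sm1] n0 c1 q by (simp_all add: ctx_def queue_def)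
    have W1: "?h + length (cnd (Suc l)) \<le> W" using hW length_cnd[of "Suc l"] by linarith
    have W2: "?Md * b \<le> W"
    proof -
      have "?Md * b = B * b ^ Suc l" by simp
      also have "\<dots> \<le> B * b ^ D" using l b_pos by (intro mult_left_mono power_increasing) auto
      also have "\<dots> \<le> b * (B * b ^ D)" using b_pos by simp
      finally show ?thesis using W_bounds by linarith
    qed
    have sm: "same {5, 10, 11, 12, 13, 14, 16, 17, 18, 19, 20, 21, 22} {3, 4, 5, 6} t t1"
      by (rule same_trans[OF same_mono[OF sm0] same_mono[OF sm1]]) auto
    have "?h \<le> l * N1 + N1" using ls length_cnd[of l] by (simp add: level_state_def)
    then have ls': "level_state (Suc l) (nput 22 0 (?Md * b) (nput 21 0 (?h + length (cnd (Suc l))) (nput 20 0 ?h t1)))"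
      using c1 n1 q unfolding level_state_def by (simp add: ctx_def queue_def del: cnd.simps)
    have "runs W (Seq (Set 20 (Var 21)) (Seq (Set 21 (Var 19)) (Set 22 (NMul (Var 22) (Var 31))))) t1 (Suc (Suc 1))
      (\<lambda>t'. level_state (Suc l) t' \<and> same {5, 10, 11, 12, 13, 14, 16, 17, 18, 19, 20, 21, 22} {3, 4, 5, 6} t t')"
      by (intro runs_Seq_NPut runs_NPut) (use n1 W1 W2 sm ls' in \<open>simp_all del: cnd.simps\<close>)
    then show "runs W (Seq (Set 20 (Var 21)) (Seq (Set 21 (Var 19)) (Set 22 (NMul (Var 22) (Var 31))))) t1 3
      (\<lambda>t'. level_state (Suc l) t' \<and> same {5, 10, 11, 12, 13, 14, 16, 17, 18, 19, 20, 21, 22} {3, 4, 5, 6} t t')"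
      by (simp only: numeral_3_eq_3 One_nat_def)
  qed simp
qed (simp add: T_level_def)

end


section \<open>Ranks of the pivots and output of the selected candidates\<close>

definition Beats_exp :: "nexp \<Rightarrow> nexp \<Rightarrow> bexp" where
  "Beats_exp j p =
    (let ej = RGet 5 (NAdd (Var 20) j); ep = RGet 5 (NAdd (Var 20) p)
     in BAnd (BNot (RLess ej ep)) (BNot (BAnd (BNot (RLess ep ej)) (NLess p j))))"

text \<open>The rank is obtained by counting, in linear time per pivot. The best admissible rank
  starts at 0, meaning that there is none yet, because ranks start at 1.\<close>

definition Pivot_prog :: com where
  "Pivot_prog =
    Seq (Set 42 (NMod (NGet 2 (NAdd (NLit 8) (Var 45))) (Var 30)))
    (Cond (NLess (Var 42) (Var 46))
      (Seq (Set 43 (NLit 0))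
      (Seq (For 44 (NLit 0) (Var 46) (Cond (Beats_exp (Var 44) (Var 42)) (Set 43 (NAdd (Var 43) (NLit 1))) Skip))
        (Cond (BAnd (NLess (Var 41) (Var 43)) (BNot (NLess (Var 36) (Var 43))))
          (Seq (Set 40 (Var 42)) (Set 41 (Var 43))) Skip)))
      Skip)"

text \<open>The guard is an implication, written with negation and conjunction: if there are more
  than \<open>N\<close> candidates, a pivot must have been found and the present position must not
  rank below it.\<close>

definition Out_prog :: com where
  "Out_prog =
    Cond (BNot (BAnd (NLess (Var 36) (Var 46)) (BNot (BAnd (NLess (NLit 0) (Var 41)) (Beats_exp (Var 44) (Var 40))))))
      (Seq (NPut 4 (Var 3) (NGet 5 (NAdd (Var 20) (Var 44)))) (Set 3 (NAdd (Var 3) (NLit 1)))) Skip"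

definition Pick_prog :: "nat \<Rightarrow> com" where
  "Pick_prog s =
    Seq (Set 46 (NSub (Var 21) (Var 20)))
    (Seq (Set 41 (NLit 0))
    (Seq (Set 40 (NLit 0))
    (Seq (For 45 (NLit 0) (NLit s) Pivot_prog)
    (Seq (Set 3 (NLit 0)) (For 44 (NLit 0) (Var 46) Out_prog)))))"

text \<open>The second entry of column 0 encodes the value 0, so its row is exactly the block size.
  This is the modulus with which the other parameters are decoded.\<close>

definition Init_prog :: com where
  "Init_prog =
    Seq (Set 30 (NGet 2 (NLit 1)))
    (Seq (Set 31 (NMod (NGet 2 (NLit 2)) (Var 30)))
    (Seq (Set 32 (NMod (NGet 2 (NLit 3)) (Var 30)))
    (Seq (Set 33 (NMod (NGet 2 (NLit 4)) (Var 30)))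
    (Seq (Set 34 (NMod (NGet 2 (NLit 5)) (Var 30)))
    (Seq (Set 35 (NMod (NGet 2 (NLit 6)) (Var 30)))
    (Seq (Set 36 (NMod (NGet 2 (NLit 7)) (Var 30)))
    (Seq (Set 37 (NGet 1 (NLit 1)))
    (Seq (Set 38 (NGet 0 (NLit 0)))
    (Seq (Set 19 (NLit 0))
    (Seq (For 16 (NLit 0) (Var 34)
            (Cond (NLess (Var 16) (Var 38)) (Seq (NPut 5 (Var 16) (Var 16)) (Set 19 (NAdd (Var 16) (NLit 1)))) Skip))
    (Seq (Set 20 (NLit 0)) (Seq (Set 21 (Var 19)) (Set 22 (Var 34))))))))))))))"

definition Main_prog :: "nat \<Rightarrow> nat \<Rightarrow> com" where
  "Main_prog u s = Seq Init_prog (Seq (For 15 (NLit 0) (Var 32) (Level_prog u (8 + s))) (Pick_prog s))"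

lemma rnk_cong:
  assumes "\<And>j. j < m \<Longrightarrow> f j = g j" "p < m"
  shows "rnk f m p = rnk g m p" "j < m \<Longrightarrow> beats f j p = beats g j p"
proof -
  have "{j. j < m \<and> beats f j p} = {j. j < m \<and> beats g j p}" using assms by (auto simp: beats_def)
  then show "rnk f m p = rnk g m p" by (simp add: rnk_def)
  show "j < m \<Longrightarrow> beats f j p = beats g j p" using assms by (simp add: beats_def)
qed

lemma selects_cong:
  assumes fg: "\<And>j. j < m \<Longrightarrow> f j = g j" and sel: "selects f m N P J"
  shows "selects g m N P J"
proof -
  note r = rnk_cong[of m f g, OF fg]
  have b: "{j. j < m \<and> beats f j p} = {j. j < m \<and> beats g j p}" if "p < m" for p
    using r(2) that by blast
  show ?thesis
    using sel unfolding selects_def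
    by (simp only: r(1) b split: if_splits cong: conj_cong imp_cong)
qed

lemma rnk_pos: "p < m \<Longrightarrow> 1 \<le> rnk f m p"
  using rnk_bij[of f m] by (auto simp: bij_betw_def)

lemma rnk_le: "p < m \<Longrightarrow> rnk f m p \<le> m"
  using rnk_bij[of f m] by (auto simp: bij_betw_def)

definition T_pivot :: "nat \<Rightarrow> nat" where
  "T_pivot m = m * 4 + 8"

definition T_pick :: "nat \<Rightarrow> nat \<Rightarrow> nat" where
  "T_pick s m = s * (T_pivot m + 2) + m * 5 + 8"

lemma runs_Pick:
  fixes t :: memory and lo m N P s :: nat
  defines "f \<equiv> \<lambda>j. rmem t 5 (lo + j)" and "c \<equiv> \<lambda>j. nmem t 5 (lo + j)"
    and "piv \<equiv> \<lambda>i. nmem t 2 (8 + i) mod P"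
  assumes t: "nmem t 20 0 = lo" "nmem t 21 0 = lo + m" "nmem t 36 0 = N" "nmem t 30 0 = P"
    and W: "m \<le> W" "s \<le> W" "0 < P" "P \<le> W" and cW: "\<And>j. j < m \<Longrightarrow> c j \<le> W"
  shows "runs W (Pick_prog s) t (T_pick s m)
    (\<lambda>t'. \<exists>J. selects f m N (piv ` {..<s}) J \<and> output_set t' = c ` J)"
proof -
  let ?V = "{40, 41, 42, 43, 44, 45, 46} :: nat set"
  define ok where "ok i cnt p \<longleftrightarrow> (cnt = 0 \<and> (\<forall>q<i. piv q < m \<longrightarrow> N < rnk f m (piv q))) \<or>
     (0 < cnt \<and> p < m \<and> cnt = rnk f m p \<and> cnt \<le> N \<and> (\<forall>q<i. piv q < m \<and> rnk f m (piv q) \<le> N \<longrightarrow> rnk f m (piv q) \<le> cnt))"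
    for i cnt p
  have ok0: "ok 0 0 0" by (simp add: ok_def)
  have ok_skip: "ok (Suc i) cnt p" if "ok i cnt p" "\<not> piv i < m" for i cnt p
    using that unfolding ok_def less_Suc_eq by auto
  have ok_old: "ok (Suc i) cnt p" if "ok i cnt p" "\<not> (cnt < rnk f m (piv i) \<and> rnk f m (piv i) \<le> N)" for i cnt p
    using that rnk_pos[of "piv i" m f] unfolding ok_def less_Suc_eq by (elim disjE; force)
  have ok_new: "ok (Suc i) (rnk f m (piv i)) (piv i)" if "ok i cnt p" "piv i < m" "cnt < rnk f m (piv i) \<and> rnk f m (piv i) \<le> N" for i cnt p
  proof -
    have "rnk f m (piv q) \<le> rnk f m (piv i)" if q: "q < Suc i" "piv q < m" "rnk f m (piv q) \<le> N" for q
    proof (cases "q = i")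
      case False
      then have "q < i" using q by simp
      then have "rnk f m (piv q) \<le> cnt" using \<open>ok i cnt p\<close> q by (auto simp: ok_def)
      then show ?thesis using \<open>cnt < rnk f m (piv i) \<and> rnk f m (piv i) \<le> N\<close> by linarith
    qed simp
    then show ?thesis using that by (auto simp: ok_def)
  qed
  define st where "st t' \<longleftrightarrow> nmem t' 46 0 = m \<and> same ?V {} t t'" for t'
  have stD: "nmem t' 46 0 = m" "nmem t' 20 0 = lo" "nmem t' 36 0 = N" "nmem t' 30 0 = P" "nmem t' 2 = nmem t 2" "rmem t' 5 = rmem t 5"
     "nmem t' 5 = nmem t 5"
    if "st t'" for t' using that t same_nD[of ?V "{}" t t'] same_rD[of ?V "{}" t t'] by (simp_all add: st_def)
  have st_nput: "st (nput a i v t') = st t'" if "a \<in> {40, 41, 42, 43, 44, 45}" for a i v t'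
  proof -
    have "46 \<noteq> a" "a \<in> ?V" using that by auto
    then show ?thesis by (simp only: st_def nmem_nput fun_upd_other same_nput simp_thms)
  qed
  have bts: "bval (Beats_exp (Var a) (Var a')) t' \<longleftrightarrow> beats f (nmem t' a 0) (nmem t' a' 0)" if "st t'" for t' a a'
    using stD(2,6)[OF that] by (simp add: Beats_exp_def Let_def beats_def f_def)
  let ?I = "\<lambda>i t'. st t' \<and> ok i (nmem t' 41 0) (nmem t' 40 0)"
  have pivot: "runs W Pivot_prog t1 (T_pivot m) (\<lambda>t'. nmem t' 45 0 = i \<and> ?I (Suc i) (nput 45 0 (Suc i) t'))"
    if i: "i < s" and I: "?I i t1" and v: "nmem t1 45 0 = i" for i t1
  proof -
    let ?p = "piv i"
    have pe: "nval (NMod (NGet 2 (NAdd (NLit 8) (Var 45))) (Var 30)) t1 = ?p"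
      using stD[OF conjunct1[OF I]] v by (simp add: piv_def)
    have pW: "?p \<le> W" using W(3,4) mod_less_divisor[OF W(3), of "nmem t 2 (8 + i)"] unfolding piv_def by linarith
    have v0: "nval (NLit 0) t' = 0" for t' by simp
    let ?t2 = "nput 42 0 ?p t1"
    have st2: "st ?t2" using I by (simp add: st_nput)
    let ?Q = "\<lambda>t'. nmem t' 45 0 = i \<and> ?I (Suc i) (nput 45 0 (Suc i) t')"
    have "runs W Pivot_prog t1 (Suc (m * 4 + 7)) ?Q"
      unfolding Pivot_prog_def
    proof (rule runs_Seq_NPut, simp only: pe pW, unfold pe v0, rule runs_Cond[where T = "m * 4 + 6"])
      assume "\<not> bval (NLess (Var 42) (Var 46)) ?t2"
      then have "\<not> ?p < m" using stD(1)[OF st2] by simp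
      then show "runs W Skip ?t2 (m * 4 + 6) ?Q"
        using I v by (intro runs_Skip) (simp_all add: st_nput ok_skip)
    next
      assume "bval (NLess (Var 42) (Var 46)) ?t2"
      then have pm: "?p < m" using stD(1)[OF st2] by simp
      let ?t3 = "nput 43 0 0 ?t2"
      let ?K = "\<lambda>j t'. st t' \<and> nmem t' 43 0 = card {q. q < j \<and> beats f q ?p} \<and> nmem t' 42 0 = ?p \<and> nmem t' 45 0 = i \<and>
         nmem t' 41 0 = nmem t1 41 0 \<and> nmem t' 40 0 = nmem t1 40 0"
      have K0: "?K 0 (nput 44 0 0 ?t3)" using I v by (simp add: st_nput)
      have "runs W (Seq (Set 43 (NLit 0))
      (Seq (For 44 (NLit 0) (Var 46) (Cond (Beats_exp (Var 44) (Var 42)) (Set 43 (NAdd (Var 43) (NLit 1))) Skip))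
        (Cond (BAnd (NLess (Var 41) (Var 43)) (BNot (NLess (Var 36) (Var 43))))
          (Seq (Set 40 (Var 42)) (Set 41 (Var 43))) Skip))) ?t2 (Suc (m * 4 + 5)) ?Q"
      proof (rule runs_Seq_NPut, simp, unfold v0, rule runs_Seq)
        show "runs W (For 44 (NLit 0) (Var 46) (Cond (Beats_exp (Var 44) (Var 42)) (Set 43 (NAdd (Var 43) (NLit 1))) Skip)) ?t3 (m * 4 + 2) (?K m)"
        proof (rule runs_For[where I = ?K and l = 0 and h = m and T = 2])
          fix j t' assume K: "?K j t'"
          note st' = conjunct1[OF K]
          show "nval (Var 46) t' = m" using stD(1)[OF st'] by simp
          assume j: "j < m" "nmem t' 44 0 = j"
          have cle: "card {q. q < j \<and> beats f q ?p} \<le> j"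
            using card_mono[of "{..<j}" "{q. q < j \<and> beats f q ?p}"] by auto
          have set: "{q. q < Suc j \<and> beats f q ?p} = (if beats f j ?p then insert j {q. q < j \<and> beats f q ?p} else {q. q < j \<and> beats f q ?p})"
            by (auto simp: less_Suc_eq)
          have b: "bval (Beats_exp (Var 44) (Var 42)) t' \<longleftrightarrow> beats f j ?p" using bts[OF st'] K j by simp
          show "runs W (Cond (Beats_exp (Var 44) (Var 42)) (Set 43 (NAdd (Var 43) (NLit 1))) Skip) t' 2
            (\<lambda>s'. nmem s' 44 0 = j \<and> ?K (Suc j) (nput 44 0 (Suc j) s'))"
          proof (rule runs_Cond[where T = 1])
            assume "bval (Beats_exp (Var 44) (Var 42)) t'"
            then show "runs W (Set 43 (NAdd (Var 43) (NLit 1))) t' 1 (\<lambda>s'. nmem s' 44 0 = j \<and> ?K (Suc j) (nput 44 0 (Suc j) s'))"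
              unfolding b using K j cle W(1) by (intro runs_NPut) (simp_all add: set st_nput)
          next
            assume "\<not> bval (Beats_exp (Var 44) (Var 42)) t'"
            then show "runs W Skip t' 1 (\<lambda>s'. nmem s' 44 0 = j \<and> ?K (Suc j) (nput 44 0 (Suc j) s'))"
              unfolding b using K j by (intro runs_Skip) (simp_all add: set st_nput)
          qed simp
        qed (use K0 W in simp_all)
        fix t4 assume K: "?K m t4"
        note st4 = conjunct1[OF K]
        have n4: "nmem t4 43 0 = rnk f m ?p" using K by (simp add: rnk_def)
        show "runs W (Cond (BAnd (NLess (Var 41) (Var 43)) (BNot (NLess (Var 36) (Var 43))))
          (Seq (Set 40 (Var 42)) (Set 41 (Var 43))) Skip) t4 3 ?Q"
        proof (rule runs_Cond[where T = 2])
          assume "bval (BAnd (NLess (Var 41) (Var 43)) (BNot (NLess (Var 36) (Var 43)))) t4"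
          then have "nmem t1 41 0 < rnk f m ?p \<and> rnk f m ?p \<le> N" using n4 K stD(3)[OF st4] by simp
          then have "ok (Suc i) (rnk f m ?p) ?p" using I pm ok_new by blast
          then have "runs W (Seq (Set 40 (Var 42)) (Set 41 (Var 43))) t4 (Suc 1) ?Q"
            using K n4 pW rnk_le[OF pm, of f] W(1) by (intro runs_Seq_NPut runs_NPut) (simp_all add: st_nput)
          then show "runs W (Seq (Set 40 (Var 42)) (Set 41 (Var 43))) t4 2 ?Q" by (simp only: numeral_2_eq_2 One_nat_def)
        next
          assume "\<not> bval (BAnd (NLess (Var 41) (Var 43)) (BNot (NLess (Var 36) (Var 43)))) t4"
          then have "\<not> (nmem t1 41 0 < rnk f m ?p \<and> rnk f m ?p \<le> N)" using n4 K stD(3)[OF st4] by auto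
          then have "ok (Suc i) (nmem t1 41 0) (nmem t1 40 0)" using I ok_old by blast
          then show "runs W Skip t4 2 ?Q" using K by (intro runs_Skip) (simp_all add: st_nput)
        qed simp
      qed simp
      then show "runs W (Seq (Set 43 (NLit 0))
      (Seq (For 44 (NLit 0) (Var 46) (Cond (Beats_exp (Var 44) (Var 42)) (Set 43 (NAdd (Var 43) (NLit 1))) Skip))
        (Cond (BAnd (NLess (Var 41) (Var 43)) (BNot (NLess (Var 36) (Var 43))))
          (Seq (Set 40 (Var 42)) (Set 41 (Var 43))) Skip))) ?t2 (m * 4 + 6) ?Q"
        by (rule runs_conseq) simp_all
    qed simp
    then show ?thesis unfolding T_pivot_def by (rule runs_conseq) simp_all
  qed
  have loop1: "runs W (For 45 (NLit 0) (NLit s) Pivot_prog) t1 (s * (T_pivot m + 2) + 2) (?I s)" if "?I 0 t1" for t1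
    by (rule runs_For[where I = ?I and l = 0 and h = s and T = "T_pivot m"])
       (use that W pivot in \<open>simp_all add: st_nput\<close>)
  have out: "runs W (Seq (Set 3 (NLit 0)) (For 44 (NLit 0) (Var 46) Out_prog)) t1 (Suc (m * 5 + 2))
     (\<lambda>t'. \<exists>J. selects f m N (piv ` {..<s}) J \<and> output_set t' = c ` J)" if I: "?I s t1" for t1
  proof -
    define cnt b where "cnt = nmem t1 41 0" and "b = nmem t1 40 0"
    have ok: "ok s cnt b" using I by (simp add: cnt_def b_def)
    define keep where "keep j \<longleftrightarrow> m \<le> N \<or> (0 < cnt \<and> beats f j b)" for j
    let ?V' = "{3, 4, 44} :: nat set"
    let ?K = "\<lambda>j t'. nmem t' 3 0 \<le> j \<and> nmem t' 4 ` {..<nmem t' 3 0} = c ` {i. i < j \<and> keep i} \<and> same ?V' {} t1 t'"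
    have "selects f m N (piv ` {..<s}) {i. i < m \<and> keep i}"
    proof (cases "m \<le> N")
      case True
      then show ?thesis by (auto simp: selects_def keep_def)
    next
      case False
      show ?thesis
      proof (cases "cnt = 0")
        case True
        then show ?thesis using ok False by (auto simp: selects_def keep_def ok_def)
      next
        case c0: False
        then have "b < m" "rnk f m b \<le> N" "\<forall>q\<in>piv ` {..<s}. q < m \<and> rnk f m q \<le> N \<longrightarrow> rnk f m q \<le> rnk f m b"
          using ok by (auto simp: ok_def)
        moreover have "{i. i < m \<and> keep i} = {j. j < m \<and> beats f j b}" using c0 False by (auto simp: keep_def)
        ultimately show ?thesis using False unfolding selects_def by auto
      qed
    qed
    moreover have "runs W (Seq (Set 3 (NLit 0)) (For 44 (NLit 0) (Var 46) Out_prog)) t1 (Suc (m * 5 + 2)) (?K m)"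
    proof (rule runs_Seq_NPut, simp, rule runs_For[where I = ?K and l = 0 and h = m and T = 3])
      fix j t' assume K: "?K j t'"
      have sm: "same ?V' {} t1 t'" using K by blast
      have n': "nmem t' 46 0 = m" "nmem t' 36 0 = N" "nmem t' 41 0 = cnt" "nmem t' 40 0 = b" "nmem t' 20 0 = lo"
          "nmem t' 5 = nmem t 5" "rmem t' 5 = rmem t 5"
        using same_nD[OF sm] same_rD[OF sm] stD[OF conjunct1[OF I]] by (simp_all add: cnt_def b_def)
      show "nval (Var 46) t' = m" using n' by simp
      assume j: "j < m" "nmem t' 44 0 = j"
      have bb: "bval (Beats_exp (Var 44) (Var 40)) t' \<longleftrightarrow> beats f j b"
        using n' j by (simp add: Beats_exp_def Let_def beats_def f_def)
      have kp: "bval (BNot (BAnd (NLess (Var 36) (Var 46)) (BNot (BAnd (NLess (NLit 0) (Var 41)) (Beats_exp (Var 44) (Var 40)))))) t' \<longleftrightarrow> keep j"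
        using n' bb by (auto simp: keep_def)
      have set: "{i. i < Suc j \<and> keep i} = (if keep j then insert j {i. i < j \<and> keep i} else {i. i < j \<and> keep i})"
        by (auto simp: less_Suc_eq)
      show "runs W Out_prog t' 3 (\<lambda>s'. nmem s' 44 0 = j \<and> ?K (Suc j) (nput 44 0 (Suc j) s'))"
        unfolding Out_prog_def
      proof (rule runs_Cond[where T = 2])
        assume "bval (BNot (BAnd (NLess (Var 36) (Var 46)) (BNot (BAnd (NLess (NLit 0) (Var 41)) (Beats_exp (Var 44) (Var 40)))))) t'"
        then have k: "keep j" using kp by simp
        let ?L = "nmem t' 3 0"
        have cj: "nval (NGet 5 (NAdd (Var 20) (Var 44))) t' = c j" using n' j by (simp add: c_def)
        let ?t2 = "nput 4 ?L (c j) t'"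
        have im: "(nmem t' 4)(?L := c j) ` {..<Suc ?L} = insert (c j) (nmem t' 4 ` {..<?L})"
          by (auto simp: lessThan_Suc)
        have "runs W (Seq (NPut 4 (Var 3) (NGet 5 (NAdd (Var 20) (Var 44)))) (Set 3 (NAdd (Var 3) (NLit 1)))) t' (Suc 1)
          (\<lambda>s'. nmem s' 44 0 = j \<and> ?K (Suc j) (nput 44 0 (Suc j) s'))"
        proof (rule runs_Seq_NPut)
          show "nval (NGet 5 (NAdd (Var 20) (Var 44))) t' \<le> W" unfolding cj using cW j by simp
          have L: "nval (Var 3) t' = ?L" by simp
          show "runs W (Set 3 (NAdd (Var 3) (NLit 1))) (nput 4 (nval (Var 3) t') (nval (NGet 5 (NAdd (Var 20) (Var 44))) t') t') 1
             (\<lambda>s'. nmem s' 44 0 = j \<and> ?K (Suc j) (nput 44 0 (Suc j) s'))"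
            unfolding cj L
          proof (rule runs_NPut)
            show "nval (NAdd (Var 3) (NLit 1)) ?t2 \<le> W" using K j W(1) by simp
            have "(nmem t' 4)(?L := c j) ` {..<Suc ?L} = c ` {i. i < Suc j \<and> keep i}"
              unfolding im set using K k by simp
            then show "nmem (nput 3 (nval (NLit 0) ?t2) (nval (NAdd (Var 3) (NLit 1)) ?t2) ?t2) 44 0 = j \<and>
              ?K (Suc j) (nput 44 0 (Suc j) (nput 3 (nval (NLit 0) ?t2) (nval (NAdd (Var 3) (NLit 1)) ?t2) ?t2))"
              using K j by simp
          qed simp
        qed
        then show "runs W (Seq (NPut 4 (Var 3) (NGet 5 (NAdd (Var 20) (Var 44)))) (Set 3 (NAdd (Var 3) (NLit 1)))) t' 2
          (\<lambda>s'. nmem s' 44 0 = j \<and> ?K (Suc j) (nput 44 0 (Suc j) s'))"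
          by (simp only: numeral_2_eq_2 One_nat_def)
      next
        assume "\<not> bval (BNot (BAnd (NLess (Var 36) (Var 46)) (BNot (BAnd (NLess (NLit 0) (Var 41)) (Beats_exp (Var 44) (Var 40)))))) t'"
        then have "\<not> keep j" using kp by simp
        then show "runs W Skip t' 2 (\<lambda>s'. nmem s' 44 0 = j \<and> ?K (Suc j) (nput 44 0 (Suc j) s'))"
          using K j by (intro runs_Skip) (simp_all add: set)
      qed simp
    qed (use W in simp_all)
    ultimately show ?thesis
      by (elim runs_post) (auto simp: output_set_def)
  qed
  have "runs W (Pick_prog s) t (Suc (Suc (Suc ((s * (T_pivot m + 2) + 2) + Suc (m * 5 + 2)))))
     (\<lambda>t'. \<exists>J. selects f m N (piv ` {..<s}) J \<and> output_set t' = c ` J)"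
    unfolding Pick_prog_def
  proof (intro runs_Seq_NPut)
    let ?t1 = "nput 46 0 m t"
    let ?t3 = "nput 40 0 0 (nput 41 0 0 ?t1)"
    have "st ?t1" by (simp add: st_def)
    then have st3: "?I 0 ?t3" using ok0 by (simp add: st_nput)
    have e: "nval (NSub (Var 21) (Var 20)) t = m" "nval (NLit 0) t' = 0" for t' using t by simp_all
    show "nval (NSub (Var 21) (Var 20)) t \<le> W" unfolding e by (rule W(1))
    show "runs W (Seq (For 45 (NLit 0) (NLit s) Pivot_prog) (Seq (Set 3 (NLit 0)) (For 44 (NLit 0) (Var 46) Out_prog)))
      (nput 40 (nval (NLit 0) (nput 41 (nval (NLit 0) (nput 46 (nval (NLit 0) t) (nval (NSub (Var 21) (Var 20)) t) t))
         (nval (NLit 0) (nput 46 (nval (NLit 0) t) (nval (NSub (Var 21) (Var 20)) t) t))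
         (nput 46 (nval (NLit 0) t) (nval (NSub (Var 21) (Var 20)) t) t)))
        (nval (NLit 0) (nput 41 (nval (NLit 0) (nput 46 (nval (NLit 0) t) (nval (NSub (Var 21) (Var 20)) t) t))
         (nval (NLit 0) (nput 46 (nval (NLit 0) t) (nval (NSub (Var 21) (Var 20)) t) t))
         (nput 46 (nval (NLit 0) t) (nval (NSub (Var 21) (Var 20)) t) t)))
        (nput 41 (nval (NLit 0) (nput 46 (nval (NLit 0) t) (nval (NSub (Var 21) (Var 20)) t) t))
         (nval (NLit 0) (nput 46 (nval (NLit 0) t) (nval (NSub (Var 21) (Var 20)) t) t))
         (nput 46 (nval (NLit 0) t) (nval (NSub (Var 21) (Var 20)) t) t)))
      ((s * (T_pivot m + 2) + 2) + Suc (m * 5 + 2))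
      (\<lambda>t'. \<exists>J. selects f m N (piv ` {..<s}) J \<and> output_set t' = c ` J)"
      unfolding e by (rule runs_Seq[OF loop1[OF st3] out]) simp_all
  qed simp_all
  then show ?thesis by (rule runs_conseq) (simp_all add: T_pick_def)
qed

context machine
begin

lemma runs_Init:
  assumes t: "nmem t 2 = rowf" "rmem t 1 = yf" "rmem t 2 = entf" "nmem t 1 1 = S" "nmem t 0 0 = n"
    and par: "rowf 1 = P" "rowf 2 mod P = b" "rowf 3 mod P = D" "rowf 4 mod P = R" "rowf 5 mod P = B"
      "rowf 6 mod P = N1" "rowf 7 mod P = N"
    and W: "P \<le> W" "D \<le> W" "N1 \<le> W" "N \<le> W" "S \<le> W" "n \<le> W"
  shows "runs W Init_prog t (B * 5 + 15) (\<lambda>t'. level_state 0 t' \<and> nmem t' 32 0 = D \<and> nmem t' 36 0 = N)"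
proof -
  let ?I = "\<lambda>j (t'::memory). ctx t' \<and> nmem t' 32 0 = D \<and> nmem t' 36 0 = N \<and> nmem t' 19 0 = min j n \<and> (\<forall>i<min j n. nmem t' 5 i = i)"
  let ?t = "nput 19 0 0 (nput 38 0 n (nput 37 0 S (nput 36 0 N (nput 35 0 N1 (nput 34 0 B (nput 33 0 R (nput 32 0 D (nput 31 0 b (nput 30 0 P t)))))))))"
  have B: "B \<le> W" using BN1 W by simp
  have loop: "runs W (For 16 (NLit 0) (Var 34)
            (Cond (NLess (Var 16) (Var 38)) (Seq (NPut 5 (Var 16) (Var 16)) (Set 19 (NAdd (Var 16) (NLit 1)))) Skip)) ?t (B * 5 + 2) (?I B)"
  proof (rule runs_For[where I = ?I and l = 0 and h = B and T = 3])
    show "?I 0 (nput 16 0 0 ?t)" using t by (simp add: ctx_def)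
    fix j t' assume I: "?I j t'"
    show "nval (Var 34) t' = B" using I by (simp add: ctx_def)
    assume j: "j < B" "nmem t' 16 0 = j"
    have n: "nmem t' 38 0 = n" using I by (simp add: ctx_def)
    show "runs W (Cond (NLess (Var 16) (Var 38)) (Seq (NPut 5 (Var 16) (Var 16)) (Set 19 (NAdd (Var 16) (NLit 1)))) Skip) t' 3
      (\<lambda>s'. nmem s' 16 0 = j \<and> ?I (Suc j) (nput 16 0 (Suc j) s'))"
    proof (rule runs_Cond[where T = 2])
      assume "bval (NLess (Var 16) (Var 38)) t'"
      then have jn: "j < n" using n j by simp
      have c: "ctx (nput 16 0 (Suc j) (nput 19 0 (Suc j) (nput 5 j j t')))" using I by (simp add: ctx_def)
      have m: "min j n = j" "min (Suc j) n = Suc j" using jn by simp_all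
      have "runs W (Seq (NPut 5 (Var 16) (Var 16)) (Set 19 (NAdd (Var 16) (NLit 1)))) t' (Suc 1)
        (\<lambda>s'. nmem s' 16 0 = j \<and> ?I (Suc j) (nput 16 0 (Suc j) s'))"
        using I j c jn B W(6) unfolding m by (intro runs_Seq_NPut runs_NPut) (simp_all add: less_Suc_eq)
      then show "runs W (Seq (NPut 5 (Var 16) (Var 16)) (Set 19 (NAdd (Var 16) (NLit 1)))) t' 2
        (\<lambda>s'. nmem s' 16 0 = j \<and> ?I (Suc j) (nput 16 0 (Suc j) s'))"
        by (simp only: numeral_2_eq_2 One_nat_def)
    next
      assume "\<not> bval (NLess (Var 16) (Var 38)) t'"
      then have m: "min j n = n" "min (Suc j) n = n" using n j by simp_all
      have c: "ctx (nput 16 0 (Suc j) t')" using I by (simp add: ctx_def)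
      show "runs W Skip t' 2 (\<lambda>s'. nmem s' 16 0 = j \<and> ?I (Suc j) (nput 16 0 (Suc j) s'))"
        using I j c unfolding m by (intro runs_Skip) simp_all
    qed simp
  qed (use B in simp_all)
  have fin: "runs W (Seq (Set 20 (NLit 0)) (Seq (Set 21 (Var 19)) (Set 22 (Var 34)))) t' (Suc (Suc 1))
    (\<lambda>t'. level_state 0 t' \<and> nmem t' 32 0 = D \<and> nmem t' 36 0 = N)" if I: "?I B t'" for t'
  proof -
    have c: "ctx (nput 22 0 B (nput 21 0 (min B n) (nput 20 0 0 t')))" using I by (simp add: ctx_def)
    have "min B n \<le> W" using B by simp
    then show ?thesis
      using I B c by (intro runs_Seq_NPut runs_NPut) (simp_all add: level_state_def ctx_def)
  qed
  let ?rest = "Seq (For 16 (NLit 0) (Var 34)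
            (Cond (NLess (Var 16) (Var 38)) (Seq (NPut 5 (Var 16) (Var 16)) (Set 19 (NAdd (Var 16) (NLit 1)))) Skip))
    (Seq (Set 20 (NLit 0)) (Seq (Set 21 (Var 19)) (Set 22 (Var 34))))"
  have rest: "runs W ?rest ?t (B * 5 + 2 + Suc (Suc 1)) (\<lambda>t'. level_state 0 t' \<and> nmem t' 32 0 = D \<and> nmem t' 36 0 = N)"
    by (rule runs_Seq[OF loop fin]) simp_all
  have step: "runs W (Seq (Set a e) d) t1 (Suc T) Q" if "nval e t1 = v" "v \<le> W" "runs W d (nput a 0 v t1) T Q" for a e d t1 T Q v
    by (rule runs_Seq_NPut) (use that in simp_all)
  have "runs W Init_prog t (Suc (Suc (Suc (Suc (Suc (Suc (Suc (Suc (Suc (Suc (B * 5 + 2 + Suc (Suc 1)))))))))))) (\<lambda>t'. level_state 0 t' \<and> nmem t' 32 0 = D \<and> nmem t' 36 0 = N)"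
    unfolding Init_prog_def
    by (rule step[of _ _ P], use t par W in simp, use W in simp,
        rule step[of _ _ b], use t par in simp, use W_bounds in simp,
        rule step[of _ _ D], use t par in simp, use W in simp,
        rule step[of _ _ R], use t par in simp, use W_bounds in simp,
        rule step[of _ _ B], use t par in simp, use B in simp,
        rule step[of _ _ N1], use t par in simp, use W in simp,
        rule step[of _ _ N], use t par in simp, use W in simp,
        rule step[of _ _ S], use t par in simp, use W in simp,
        rule step[of _ _ n], use t par in simp, use W in simp,
        rule step[of _ _ 0], simp, simp, rule rest)
  then show ?thesis by (rule runs_conseq) simp_all
qed

definition T_main where "T_main = B * 5 + 15 + (D * (T_level + 2) + 2 + T_pick s N1)"

lemma runs_Main:
  assumes t: "nmem t 2 = rowf" "rmem t 1 = yf" "rmem t 2 = entf" "nmem t 1 1 = S" "nmem t 0 0 = n"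
    and par: "rowf 1 = P" "rowf 2 mod P = b" "rowf 3 mod P = D" "rowf 4 mod P = R" "rowf 5 mod P = B"
      "rowf 6 mod P = N1" "rowf 7 mod P = N"
    and W: "0 < P" "P \<le> W" "D \<le> W" "N1 \<le> W" "N \<le> W" "S \<le> W" "n \<le> W" "s \<le> W" and D: "0 < D"
  shows "runs W (Main_prog u s) t T_main (\<lambda>t'. \<exists>J.
    selects (\<lambda>j. scr (D - 1) (cnd D ! j)) (length (cnd D)) N ((\<lambda>i. rowf (8 + i) mod P) ` {..<s}) J \<and>
    output_set t' = (!) (cnd D) ` J)"
  unfolding Main_prog_def npb_def[symmetric]
proof (rule runs_Seq)
  show "runs W Init_prog t (B * 5 + 15) (\<lambda>t'. level_state 0 t' \<and> nmem t' 32 0 = D \<and> nmem t' 36 0 = N)"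
    by (rule runs_Init[OF t par W(2-7)])
  fix t0 :: memory assume t0: "level_state 0 t0 \<and> nmem t0 32 0 = D \<and> nmem t0 36 0 = N"
  show "runs W (Seq (For 15 (NLit 0) (Var 32) (Level_prog u npb)) (Pick_prog s)) t0 (D * (T_level + 2) + 2 + T_pick s N1)
    (\<lambda>t'. \<exists>J. selects (\<lambda>j. scr (D - 1) (cnd D ! j)) (length (cnd D)) N ((\<lambda>i. rowf (8 + i) mod P) ` {..<s}) J \<and>
    output_set t' = (!) (cnd D) ` J)"
  proof (rule runs_Seq)
    let ?I = "\<lambda>l (t'::memory). level_state l t' \<and> nmem t' 32 0 = D \<and> nmem t' 36 0 = N"
    have ls15: "level_state l (nput 15 0 v t') = level_state l t'" for l v and t' :: memory
      by (simp add: level_state_def ctx_def)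
    show "runs W (For 15 (NLit 0) (Var 32) (Level_prog u npb)) t0 (D * (T_level + 2) + 2) (?I D)"
    proof (rule runs_For[where I = ?I and l = 0 and h = D and T = T_level])
      show "?I 0 (nput 15 0 0 t0)" using t0 by (simp add: ls15)
      fix l t' assume I: "?I l t'"
      show "nval (Var 32) t' = D" using I by simp
      assume l: "l < D" "nmem t' 15 0 = l"
      show "runs W (Level_prog u npb) t' T_level (\<lambda>s'. nmem s' 15 0 = l \<and> ?I (Suc l) (nput 15 0 (Suc l) s'))"
      proof (rule runs_post[OF runs_Level[OF conjunct1[OF I] l(2,1)]])
        fix s' assume s': "level_state (Suc l) s' \<and> same {5, 10, 11, 12, 13, 14, 16, 17, 18, 19, 20, 21, 22} {3, 4, 5, 6} t' s'"
        show "nmem s' 15 0 = l \<and> ?I (Suc l) (nput 15 0 (Suc l) s')"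
          using same_nD[OF conjunct2[OF s']] s' I l by (simp add: ls15 del: cnd.simps)
      qed
    qed (use W in simp_all)
    fix t' :: memory assume I: "?I D t'"
    let ?m = "length (cnd D)" and ?lo = "nmem t' 20 0"
    have ls: "nmem t' 21 0 = ?lo + ?m" "nmem t' 30 0 = P" "nmem t' 2 = rowf"
      "\<And>i. i < ?m \<Longrightarrow> nmem t' 5 (?lo + i) = cnd D ! i" "\<And>i. i < ?m \<Longrightarrow> rmem t' 5 (?lo + i) = scr (D - 1) (cnd D ! i)"
      using I D unfolding level_state_def ctx_def by auto
    have "runs W (Pick_prog s) t' (T_pick s ?m)
      (\<lambda>t''. \<exists>J. selects (\<lambda>j. rmem t' 5 (?lo + j)) ?m N ((\<lambda>i. nmem t' 2 (8 + i) mod P) ` {..<s}) J \<and>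
         output_set t'' = (\<lambda>j. nmem t' 5 (?lo + j)) ` J)"
    proof (rule runs_Pick)
      show "?m \<le> W" using length_cnd[of D] W by linarith
      fix j assume "j < ?m"
      then have "cnd D ! j < n" by (intro cnd_less[of _ D]) simp
      then show "nmem t' 5 (?lo + j) \<le> W" using ls(4) \<open>j < ?m\<close> W by simp
    qed (use ls I W in simp_all)
    then show "runs W (Pick_prog s) t' (T_pick s N1) (\<lambda>t'. \<exists>J. selects (\<lambda>j. scr (D - 1) (cnd D ! j)) ?m N ((\<lambda>i. rowf (8 + i) mod P) ` {..<s}) J \<and>
      output_set t' = (!) (cnd D) ` J)"
    proof (rule runs_conseq)
      have "T_pivot ?m \<le> T_pivot N1" using length_cnd[of D] by (simp add: T_pivot_def)
      then show "T_pick s ?m \<le> T_pick s N1" unfolding T_pick_def using length_cnd[of D]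
        by (intro add_mono mult_le_mono) simp_all
      fix t'' assume "\<exists>J. selects (\<lambda>j. rmem t' 5 (?lo + j)) ?m N ((\<lambda>i. nmem t' 2 (8 + i) mod P) ` {..<s}) J \<and>
         output_set t'' = (\<lambda>j. nmem t' 5 (?lo + j)) ` J"
      then obtain J where J: "selects (\<lambda>j. rmem t' 5 (?lo + j)) ?m N ((\<lambda>i. nmem t' 2 (8 + i) mod P) ` {..<s}) J"
         "output_set t'' = (\<lambda>j. nmem t' 5 (?lo + j)) ` J" by blast
      have Jm: "J \<subseteq> {..<?m}" using selects_card[OF J(1)] by simp
      have "(\<lambda>j. nmem t' 5 (?lo + j)) ` J = (!) (cnd D) ` J" using Jm ls(4) by (intro image_cong) auto
      moreover have "selects (\<lambda>j. scr (D - 1) (cnd D ! j)) ?m N ((\<lambda>i. rowf (8 + i) mod P) ` {..<s}) J"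
        by (rule selects_cong[OF _ J(1)[unfolded ls(3)]]) (rule ls(5))
      ultimately show "\<exists>J. selects (\<lambda>j. scr (D - 1) (cnd D ! j)) ?m N ((\<lambda>i. rowf (8 + i) mod P) ` {..<s}) J \<and>
        output_set t'' = (!) (cnd D) ` J" using J(2) by auto
    qed
  qed simp
qed (simp add: T_main_def)

end


section \<open>Layout of the measurement matrix\<close>

lemma length_concat_uniform:
  "(\<And>j. j < n \<Longrightarrow> length (f j) = S) \<Longrightarrow> length (concat (map f [0..<n])) = n * S"
  by (induction n) auto

lemma nth_concat_uniform:
  assumes "\<And>j. j < n \<Longrightarrow> length (f j) = S" "j < n" "q < S"
  shows "concat (map f [0..<n]) ! (j * S + q) = f j ! q"
  using assms
proof (induction n)
  case (Suc n)
  have len: "length (concat (map f [0..<n])) = n * S" using Suc.prems by (intro length_concat_uniform) auto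
  show ?case
  proof (cases "j = n")
    case True
    then show ?thesis using len by (simp add: nth_append)
  next
    case False
    then have j: "j < n" using Suc.prems by simp
    have "j * S + q < Suc j * S" using Suc.prems(3) by simp
    also have "\<dots> \<le> n * S" using j by (intro mult_le_mono1) simp
    finally show ?thesis using len j Suc by (simp add: nth_append)
  qed
qed simp

locale shape =
  fixes n B a u b D N s P :: nat
begin

text \<open>
  The decoder can neither round reals nor draw random numbers. The values it needs are therefore
  stored in the sparsity pattern: each column starts with \<open>npar\<close> ones in reserved rows, and the
  offset of the one inside its block of \<open>P\<close> rows is the value.
\<close>

definition npar where "npar = 8 + s"
definition reps where "reps = D * (2 * a) * (u + 1)"
definition width where "width = npar + reps"
definition rows where "rows = npar * P + reps * B"

definition pval :: "(nat \<Rightarrow> nat) \<Rightarrow> nat \<Rightarrow> nat" where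
  "pval \<pi> q = (if q = 2 then b else if q = 3 then D else if q = 4 then 2 * a else if q = 5 then B
    else if q = 6 then 2 * B else if q = 7 then N else if 8 \<le> q then \<pi> (q - 8) else 0)"

text \<open>The blocks are numbered with the level as leading digit, then the repetition, then the
  index within the group; the decoder computes the same number.\<close>

definition lev where "lev \<rho> = \<rho> div (2 * a * (u + 1))"
definition blk :: "(nat \<Rightarrow> level) \<Rightarrow> nat \<Rightarrow> block" where
  "blk \<omega> \<rho> = \<omega> (lev \<rho>) (\<rho> div (u + 1) mod (2 * a)) (\<rho> mod (u + 1))"
definition modu where "modu \<rho> = B * b ^ Suc (lev \<rho>)"

definition pos :: "(nat \<Rightarrow> level) \<Rightarrow> (nat \<Rightarrow> nat) \<Rightarrow> nat \<Rightarrow> nat \<Rightarrow> nat" where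
  "pos \<omega> \<pi> j q = (if q < npar then q * P + pval \<pi> q
    else npar * P + (q - npar) * B + fst (blk \<omega> (q - npar)) (j mod modu (q - npar)))"

definition ent :: "(nat \<Rightarrow> level) \<Rightarrow> nat \<Rightarrow> nat \<Rightarrow> real" where
  "ent \<omega> j q = (if q < npar then 1 else snd (blk \<omega> (q - npar)) j)"

text \<open>The group of rows containing row \<open>i\<close>. It does not depend on the random
  choices, since every column has exactly one nonzero in each group.\<close>

definition qof where "qof i = (if i < npar * P then i div P else npar + (i - npar * P) div B)"

definition mat :: "(nat \<Rightarrow> level) \<times> (nat \<Rightarrow> nat) \<Rightarrow> matrix" where
  "mat z = restrict (\<lambda>(i, j). if pos (fst z) (snd z) j (qof i) = i then ent (fst z) j (qof i) else 0)
     ({..<rows} \<times> {..<n})"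

end

locale layout = scheme n B M a u b D x + shape n B a u b D N s P
  for n B M a u b D :: nat and x :: "nat \<Rightarrow> real" and N s P :: nat +
  fixes \<omega> :: "nat \<Rightarrow> level" and \<pi> :: "nat \<Rightarrow> nat"
  assumes supp: "\<omega> \<in> set_pmf all_pmf" "\<pi> \<in> set_pmf (pivot_pmf s (2 * B))"
    and P: "b < P" "D < P" "2 * a < P" "2 * B < P" "N < P" and D_pos: "0 < D"
begin

lemma set_\<omega>: "l < D \<Longrightarrow> r < 2 * a \<Longrightarrow> c \<le> u \<Longrightarrow> \<omega> l r c \<in> set_pmf block_pmf"
  using supp(1) unfolding all_pmf_def level_pmf_def group_pmf_def
  by (auto simp: set_Pi_pmf PiE_dflt_def)

lemma set_\<pi>: "t < s \<Longrightarrow> \<pi> t < 2 * B"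
  using supp(2) B_ge_2 unfolding pivot_pmf_def
  by (auto simp: set_Pi_pmf PiE_dflt_def lessThan_empty_iff)

lemma rep_split:
  assumes "\<rho> < reps"
  shows "lev \<rho> < D" "\<rho> div (u + 1) mod (2 * a) < 2 * a" "\<rho> mod (u + 1) \<le> u"
proof -
  have "\<rho> < D * (2 * a * (u + 1))" using assms by (simp only: reps_def mult.assoc)
  then show "lev \<rho> < D" unfolding lev_def by (rule less_mult_imp_div_less)
  show "\<rho> div (u + 1) mod (2 * a) < 2 * a" using a_pos by simp
  have "\<rho> mod (u + 1) < u + 1" by (rule mod_less_divisor) simp
  then show "\<rho> mod (u + 1) \<le> u" by simp
qed

lemma set_blk: "\<rho> < reps \<Longrightarrow> blk \<omega> \<rho> \<in> set_pmf block_pmf"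
  unfolding blk_def using rep_split[of \<rho>] by (intro set_\<omega>) auto

lemma pval_less: "q < npar \<Longrightarrow> pval \<pi> q < P"
proof -
  assume "q < npar"
  then have "8 \<le> q \<Longrightarrow> \<pi> (q - 8) < 2 * B" by (intro set_\<pi>) (simp add: npar_def)
  then show ?thesis using P by (auto simp: pval_def)
qed

lemma hash_less: "j < n \<Longrightarrow> \<rho> < reps \<Longrightarrow> fst (blk \<omega> \<rho>) (j mod modu \<rho>) < B"
  using set_block(1)[OF set_blk, of \<rho> "j mod modu \<rho>"] by (meson le_less_trans mod_less_eq_dividend)

lemma pos_rep: "\<rho> < reps \<Longrightarrow> pos \<omega> \<pi> j (npar + \<rho>) = npar * P + \<rho> * B + fst (blk \<omega> \<rho>) (j mod modu \<rho>)"
  by (simp add: pos_def)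

lemma qof_rep: "\<beta> < B \<Longrightarrow> qof (npar * P + \<rho> * B + \<beta>) = npar + \<rho>"
  by (simp add: qof_def)

lemma qof_pos: "j < n \<Longrightarrow> q < width \<Longrightarrow> qof (pos \<omega> \<pi> j q) = q"
proof -
  assume j: "j < n" and q: "q < width"
  show ?thesis
  proof (cases "q < npar")
    case True
    have "q * P + pval \<pi> q < Suc q * P" using pval_less[OF True] by simp
    also have "\<dots> \<le> npar * P" using True by (intro mult_le_mono1) simp
    finally show ?thesis using True pval_less[OF True] by (simp add: pos_def qof_def)
  next
    case False
    then have "q - npar < reps" using q by (simp add: width_def)
    then show ?thesis using False qof_rep[OF hash_less[OF j]] by (simp add: pos_def)
  qed
qed

lemma rep_row_less: "\<rho> < reps \<Longrightarrow> \<beta> < B \<Longrightarrow> npar * P + \<rho> * B + \<beta> < rows"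
proof -
  assume "\<rho> < reps" "\<beta> < B"
  then have "\<rho> * B + \<beta> < Suc \<rho> * B" "Suc \<rho> * B \<le> reps * B" by (simp, intro mult_le_mono1, simp)
  then show ?thesis by (simp add: rows_def)
qed

lemma pos_less: "j < n \<Longrightarrow> q < width \<Longrightarrow> pos \<omega> \<pi> j q < rows"
proof -
  assume j: "j < n" and q: "q < width"
  show ?thesis
  proof (cases "q < npar")
    case True
    have "q * P + pval \<pi> q < Suc q * P" using pval_less[OF True] by simp
    also have "\<dots> \<le> npar * P" using True by (intro mult_le_mono1) simp
    finally show ?thesis using True by (simp add: pos_def rows_def)
  next
    case False
    then have r: "q - npar < reps" using q by (simp add: width_def)
    show ?thesis using False rep_row_less[OF r hash_less[OF j r]] by (simp add: pos_def)
  qed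
qed

lemma qof_mono: "i \<le> i' \<Longrightarrow> qof i \<le> qof i'"
proof -
  assume le: "i \<le> i'"
  consider "i' < npar * P" | "i < npar * P" "\<not> i' < npar * P" | "\<not> i < npar * P" by linarith
  then show ?thesis
  proof cases
    case 1
    then show ?thesis using div_le_mono[OF le, of P] le by (simp add: qof_def)
  next
    case 2
    then show ?thesis using less_mult_imp_div_less[OF 2(1)] by (simp add: qof_def)
  next
    case 3
    then show ?thesis using div_le_mono[OF diff_le_mono[OF le], of "npar * P" B] le by (simp add: qof_def)
  qed
qed

text \<open>The compressed format lists a column by increasing row, so this monotonicity is what
  identifies the q-th stored entry with the q-th group.\<close>

lemma pos_mono: "j < n \<Longrightarrow> q < q' \<Longrightarrow> q' < width \<Longrightarrow> pos \<omega> \<pi> j q < pos \<omega> \<pi> j q'"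
proof (rule ccontr)
  assume *: "j < n" "q < q'" "q' < width" "\<not> pos \<omega> \<pi> j q < pos \<omega> \<pi> j q'"
  then have "qof (pos \<omega> \<pi> j q') \<le> qof (pos \<omega> \<pi> j q)" by (intro qof_mono) linarith
  moreover have "qof (pos \<omega> \<pi> j q') = q'" "qof (pos \<omega> \<pi> j q) = q" using * by (auto intro!: qof_pos)
  ultimately show False using *(2) by linarith
qed

lemma ent_nonzero: "j < n \<Longrightarrow> q < width \<Longrightarrow> ent \<omega> j q \<noteq> 0"
proof (cases "q < npar")
  case False
  assume "j < n" "q < width"
  then have "1 \<le> \<bar>snd (blk \<omega> (q - npar)) j\<bar>" using False by (intro set_block(3)[OF set_blk]) (simp_all add: width_def)
  then show ?thesis using False by (auto simp: ent_def)
qed (simp add: ent_def)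

abbreviation \<Phi> where "\<Phi> \<equiv> mat (\<omega>, \<pi>)"

lemma mat_eq: "i < rows \<Longrightarrow> j < n \<Longrightarrow> \<Phi> (i, j) = (if pos \<omega> \<pi> j (qof i) = i then ent \<omega> j (qof i) else 0)"
  by (simp add: mat_def)

lemma mat_pos: "j < n \<Longrightarrow> q < width \<Longrightarrow> \<Phi> (pos \<omega> \<pi> j q, j) = ent \<omega> j q"
  using pos_less[of j q] qof_pos[of j q] by (simp add: mat_eq)

lemma mat_rep:
  assumes "\<rho> < reps" "\<beta> < B" "j < n"
  shows "\<Phi> (npar * P + \<rho> * B + \<beta>, j) = (if fst (blk \<omega> \<rho>) (j mod modu \<rho>) = \<beta> then snd (blk \<omega> \<rho>) j else 0)"
  using assms mat_eq[OF rep_row_less] by (simp add: qof_rep pos_rep ent_def)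

lemma qof_less: "i < rows \<Longrightarrow> qof i < width"
proof -
  assume i: "i < rows"
  show ?thesis
  proof (cases "i < npar * P")
    case True
    then have "i div P < npar" by (rule less_mult_imp_div_less)
    then show ?thesis using True by (simp add: qof_def width_def)
  next
    case False
    then have "i - npar * P < reps * B" using i by (simp add: rows_def)
    then have "(i - npar * P) div B < reps" by (rule less_mult_imp_div_less)
    then show ?thesis using False by (simp add: qof_def width_def)
  qed
qed

lemma nonzero_rows: "j < n \<Longrightarrow> {i. i < rows \<and> \<Phi> (i, j) \<noteq> 0} = pos \<omega> \<pi> j ` {..<width}"
proof (intro equalityI subsetI)
  fix i assume j: "j < n" and "i \<in> {i. i < rows \<and> \<Phi> (i, j) \<noteq> 0}"
  then have i: "i < rows" "\<Phi> (i, j) \<noteq> 0" by auto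
  have "pos \<omega> \<pi> j (qof i) = i" by (rule ccontr) (use i mat_eq[OF i(1) j] in simp)
  moreover have "qof i \<in> {..<width}" using qof_less[OF i(1)] by simp
  ultimately show "i \<in> pos \<omega> \<pi> j ` {..<width}" by (intro image_eqI[of _ _ "qof i"]) simp_all
next
  fix i assume j: "j < n" and "i \<in> pos \<omega> \<pi> j ` {..<width}"
  then obtain q where q: "i = pos \<omega> \<pi> j q" "q < width" by auto
  then show "i \<in> {i. i < rows \<and> \<Phi> (i, j) \<noteq> 0}"
    using pos_less[OF j q(2)] ent_nonzero[OF j q(2)] mat_pos[OF j q(2)] by simp
qed

lemma inj_pos: "j < n \<Longrightarrow> inj_on (pos \<omega> \<pi> j) {..<width}"
  by (rule inj_on_inverseI[where g = qof]) (simp add: qof_pos)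

lemma column_sparsity_mat: "column_sparsity rows n \<Phi> = width"
proof -
  have "card {i. i < rows \<and> \<Phi> (i, j) \<noteq> 0} = width" if "j < n" for j
    using that by (simp add: nonzero_rows card_image inj_pos)
  then have "(\<lambda>j. card {i. i < rows \<and> \<Phi> (i, j) \<noteq> 0}) ` {..<n} = (\<lambda>j. width) ` {..<n}" by (intro image_cong) auto
  also have "\<dots> = {width}" using n_pos by auto
  finally show ?thesis by (simp add: column_sparsity_def)
qed

lemma column_nonzeros_mat: "j < n \<Longrightarrow> column_nonzeros rows \<Phi> j = map (\<lambda>q. (pos \<omega> \<pi> j q, j)) [0..<width]"
proof -
  assume j: "j < n"
  have "concat (map (\<lambda>i. if \<Phi> (i, j) \<noteq> 0 then [(i, j)] else []) xs) = map (\<lambda>i. (i, j)) (filter (\<lambda>i. \<Phi> (i, j) \<noteq> 0) xs)" for xs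
    by (induction xs) auto
  then have "column_nonzeros rows \<Phi> j = map (\<lambda>i. (i, j)) (filter (\<lambda>i. \<Phi> (i, j) \<noteq> 0) [0..<rows])"
    by (simp add: column_nonzeros_def)
  also have "filter (\<lambda>i. \<Phi> (i, j) \<noteq> 0) [0..<rows] = map (pos \<omega> \<pi> j) [0..<width]"
  proof (rule sorted_distinct_set_unique)
    show "sorted (filter (\<lambda>i. \<Phi> (i, j) \<noteq> 0) [0..<rows])" by (rule sorted_wrt_filter) simp
    show "sorted (map (pos \<omega> \<pi> j) [0..<width])"
      using pos_mono[OF j] by (auto simp: sorted_wrt_map sorted_wrt_iff_nth_less less_imp_le)
    show "distinct (map (pos \<omega> \<pi> j) [0..<width])"
      using inj_pos[OF j] by (simp add: distinct_map atLeast0LessThan)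
    show "set (filter (\<lambda>i. \<Phi> (i, j) \<noteq> 0) [0..<rows]) = set (map (pos \<omega> \<pi> j) [0..<width])"
      using nonzero_rows[OF j] by (auto simp: atLeast0LessThan)
  qed simp
  finally show ?thesis by (simp add: o_def)
qed

lemma length_nonzeros: "j \<le> n \<Longrightarrow> length (nonzeros rows j \<Phi>) = j * width"
  unfolding nonzeros_def by (intro length_concat_uniform) (simp add: column_nonzeros_mat)

lemma nth_nonzeros: "j < n \<Longrightarrow> q < width \<Longrightarrow> nonzeros rows n \<Phi> ! (j * width + q) = (pos \<omega> \<pi> j q, j)"
  unfolding nonzeros_def by (subst nth_concat_uniform) (auto simp: column_nonzeros_mat)

lemma index_less: "j < n \<Longrightarrow> q < width \<Longrightarrow> j * width + q < n * width"
proof -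
  assume "j < n" "q < width"
  then have "j * width + q < Suc j * width" "Suc j * width \<le> n * width" by (simp, intro mult_le_mono1, simp)
  then show ?thesis by linarith
qed

definition rowf where "rowf = array_of (map fst (nonzeros rows n \<Phi>))"
definition entf where "entf = array_of (map \<Phi> (nonzeros rows n \<Phi>))"
definition yf where "yf = array_of (map (matvec n \<Phi> x) [0..<rows])"

lemma rowf_eq: "j < n \<Longrightarrow> q < width \<Longrightarrow> rowf (j * width + q) = pos \<omega> \<pi> j q"
  using index_less[of j q] by (simp add: rowf_def array_of_def length_nonzeros nth_nonzeros)

lemma entf_eq: "j < n \<Longrightarrow> q < width \<Longrightarrow> entf (j * width + q) = ent \<omega> j q"
  using index_less[of j q] by (simp add: entf_def array_of_def length_nonzeros nth_nonzeros mat_pos)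

lemma yf_rep: "\<rho> < reps \<Longrightarrow> \<beta> < B \<Longrightarrow> yf (npar * P + \<rho> * B + \<beta>) = bsum (modu \<rho>) x (blk \<omega> \<rho>) \<beta>"
proof -
  assume r: "\<rho> < reps" "\<beta> < B"
  have "yf (npar * P + \<rho> * B + \<beta>) = (\<Sum>j<n. \<Phi> (npar * P + \<rho> * B + \<beta>, j) * x j)"
    using rep_row_less[OF r] by (simp add: yf_def array_of_def matvec_def)
  also have "\<dots> = bsum (modu \<rho>) x (blk \<omega> \<rho>) \<beta>"
    unfolding bsum_def using mat_rep[OF r] by (intro sum.cong) auto
  finally show ?thesis .
qed

lemma rowf_par: "q < npar \<Longrightarrow> rowf q = q * P + pval \<pi> q"
  using rowf_eq[of 0 q] n_pos by (simp add: width_def pos_def)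

lemma rep_index:
  assumes "l < D" "r < 2 * a" "c \<le> u"
  shows "(l * (2 * a) + r) * (u + 1) + c < reps" "lev ((l * (2 * a) + r) * (u + 1) + c) = l"
    "blk \<omega> ((l * (2 * a) + r) * (u + 1) + c) = \<omega> l r c"
proof -
  let ?\<rho> = "(l * (2 * a) + r) * (u + 1) + c"
  have c: "c < u + 1" using assms by simp
  have d: "?\<rho> div (u + 1) = l * (2 * a) + r"
  proof -
    have "?\<rho> div (u + 1) = (l * (2 * a) + r) + c div (u + 1)" by (rule div_mult_self3) simp
    then show ?thesis using c by (simp only: div_less add_0_right)
  qed
  have m: "?\<rho> mod (u + 1) = c"
  proof -
    have "?\<rho> mod (u + 1) = c mod (u + 1)" by (rule mod_mult_self3)
    then show ?thesis using c by (simp only: mod_less)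
  qed
  have "(l * (2 * a) + r) div (2 * a) = l" using assms a_pos by simp
  then show l: "lev ?\<rho> = l" unfolding lev_def mult.commute[of "2 * a" "u + 1"] div_mult2_eq d .
  have "?\<rho> < (l * (2 * a) + r + 1) * (u + 1)" using c by simp
  also have "\<dots> \<le> (D * (2 * a)) * (u + 1)"
  proof (rule mult_le_mono1)
    have "l * (2 * a) + r + 1 \<le> Suc l * (2 * a)" using assms by simp
    also have "\<dots> \<le> D * (2 * a)" using assms by (intro mult_le_mono1) simp
    finally show "l * (2 * a) + r + 1 \<le> D * (2 * a)" .
  qed
  finally show "?\<rho> < reps" by (simp add: reps_def)
  have "(l * (2 * a) + r) mod (2 * a) = r" using assms by simp
  then show "blk \<omega> ?\<rho> = \<omega> l r c" unfolding blk_def l d m by simp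
qed

text \<open>By induction on the level the program maintains exactly the candidates of the analysis.
  A tested node is below the modulus, hence its own residue, and so column \<open>v\<close> contains
  the hash value of node \<open>v\<close>.\<close>

lemma decoder_finds:
  assumes W: "2 * a \<le> W" "b \<le> W" "u + 1 \<le> W" "(D + 1) * (2 * B) \<le> W" "n + b * (B * b ^ D) \<le> W"
    "P \<le> W" "N \<le> W" "width \<le> W" "n \<le> W" "s \<le> W"
  shows "\<exists>t J. finds W (Main_prog u s) (input n k rows \<epsilon> C \<Phi> (matvec n \<Phi> x)) t ((!) (cands \<omega> D) ` J) \<and>
    t \<le> machine.T_main b (2 * a) B (2 * B) u D s \<and>
    selects (\<lambda>j. score (Mod D) (\<omega> (D - 1)) (cands \<omega> D ! j)) (length (cands \<omega> D)) N (\<pi> ` {..<s}) J"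
proof -
  interpret mc: machine W n b "2 * a" B "2 * B" width P u D s rowf yf entf
    using W u_pos b_pos by unfold_locales auto
  have npb: "mc.npb = npar" by (simp add: mc.npb_def npar_def)
  have rp: "mc.rp l r c = (l * (2 * a) + r) * (u + 1) + c" for l r c by (simp add: mc.rp_def)
  have val: "mc.val l v r = (ratio (Mod (Suc l)) v (\<omega> l r 0))\<^sup>2" if v: "v < n" "v < Mod (Suc l)" and l: "l < D" and r: "r < 2 * a" for l v r
  proof -
    let ?\<rho> = "mc.rp l r 0"
    have \<rho>: "?\<rho> < reps" "lev ?\<rho> = l" "blk \<omega> ?\<rho> = \<omega> l r 0" using rep_index[OF l r, of 0] by (simp_all add: rp)
    have q: "npar + ?\<rho> < width" using \<rho>(1) by (simp add: width_def)
    have md: "modu ?\<rho> = Mod (Suc l)" by (simp add: modu_def \<rho>(2) Mod_def)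
    have idx: "v * width + mc.npb + ?\<rho> = v * width + (npar + ?\<rho>)" by (simp add: npb)
    have h: "fst (\<omega> l r 0) v < B" using hash_less[OF v(1) \<rho>(1)] v(2) unfolding md \<rho>(3) by simp
    have "yf (rowf (v * width + (npar + ?\<rho>))) = bsum (Mod (Suc l)) x (\<omega> l r 0) (fst (\<omega> l r 0) v)"
      unfolding rowf_eq[OF v(1) q] pos_rep[OF \<rho>(1)] using yf_rep[OF \<rho>(1) h] v(2) unfolding md \<rho>(3) by simp
    moreover have "entf (v * width + (npar + ?\<rho>)) = snd (\<omega> l r 0) v"
      unfolding entf_eq[OF v(1) q] by (simp add: ent_def \<rho>(3))
    ultimately show ?thesis unfolding mc.val_def idx by (simp add: ratio_def)
  qed
  have scr: "mc.scr l v = score (Mod (Suc l)) (\<omega> l) v" if "v < n" "v < Mod (Suc l)" "l < D" for l v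
    unfolding mc.scr_def score_def using val that by (intro med_cong)
  have thd: "mc.thd l = thr (Mod (Suc l)) (\<omega> l)" if l: "l < D" for l
  proof -
    have "mc.prb l r = probe (Mod (Suc l)) (\<omega> l r)" if r: "r < 2 * a" for r
    proof -
      have "(yf (mc.npb * P + mc.rp l r c * B))\<^sup>2 = (bsum (Mod (Suc l)) x (\<omega> l r c) 0)\<^sup>2" if c: "c \<in> {1..u}" for c
      proof -
        have cu: "c \<le> u" using c by simp
        note ri = rep_index[OF l r cu, folded rp]
        have "modu (mc.rp l r c) = Mod (Suc l)" by (simp add: modu_def ri(2) Mod_def)
        then show ?thesis using yf_rep[OF ri(1), of 0] B_ge_2 ri(3) by (simp add: npb)
      qed
      then show ?thesis unfolding mc.prb_def probe_def by (intro arg_cong[of _ _ Max] image_cong) auto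
    qed
    then show ?thesis unfolding mc.thd_def thr_def by (intro arg_cong[of _ _ "\<lambda>z. 4 * z"] med_cong)
  qed
  have cnd: "l \<le> D \<Longrightarrow> mc.cnd l = cands \<omega> l" for l
  proof (induction l)
    case (Suc l)
    then have IH: "mc.cnd l = cands \<omega> l" and l: "l < D" by simp_all
    let ?xs = "concat (map (children n b (Mod l)) (cands \<omega> l))"
    have "filter (\<lambda>v. mc.thd l < mc.scr l v) ?xs = filter (survives l (\<omega> l)) ?xs"
    proof (rule filter_cong[OF refl])
      fix v assume "v \<in> set ?xs"
      then obtain w j where w: "w \<in> set (cands \<omega> l)" "v = w + j * Mod l" "j < b" "v < n" by (auto simp: set_children)
      have "w < Mod l" using w(1) cands_props[of \<omega> l] by auto
      then have "v < (1 + j) * Mod l" using w(2) by simp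
      also have "\<dots> \<le> b * Mod l" using w(3) by (intro mult_right_mono) auto
      finally have "v < Mod (Suc l)" by (simp add: Mod_def mult_ac)
      then show "(mc.thd l < mc.scr l v) = survives l (\<omega> l) v"
        using scr[OF w(4) _ l] thd[OF l] by (simp add: survives_def)
    qed
    then show ?case by (simp add: IH Mod_def)
  qed simp
  let ?t = "input n k rows \<epsilon> C \<Phi> (matvec n \<Phi> x)"
  have par: "rowf q mod P = pval \<pi> q" if "q < npar" for q
    using rowf_par[OF that] pval_less[OF that] by simp
  have small: "1 < npar" "2 < npar" "3 < npar" "4 < npar" "5 < npar" "6 < npar" "7 < npar" by (simp_all add: npar_def)
  have piv: "(\<lambda>i. rowf (8 + i) mod P) ` {..<s} = \<pi> ` {..<s}"
    using par by (intro image_cong) (auto simp: npar_def pval_def)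
  have n1: "nmem ?t 1 1 = width"
  proof -
    have "nmem ?t 1 1 = map (\<lambda>j. length (nonzeros rows j \<Phi>)) [0..<Suc n] ! 1"
      using n_pos by (simp add: input_def array_of_def del: upt_Suc)
    also have "\<dots> = length (nonzeros rows 1 \<Phi>)" using n_pos by (subst nth_map) (simp_all del: upt_Suc)
    finally show ?thesis using n_pos length_nonzeros[of 1] by simp
  qed
  have "runs W (Main_prog u s) ?t mc.T_main (\<lambda>t'. \<exists>J.
    selects (\<lambda>j. mc.scr (D - 1) (mc.cnd D ! j)) (length (mc.cnd D)) N ((\<lambda>i. rowf (8 + i) mod P) ` {..<s}) J \<and>
    output_set t' = (!) (mc.cnd D) ` J)"
  proof (rule mc.runs_Main)
    show "nmem ?t 2 = rowf" "rmem ?t 1 = yf" "rmem ?t 2 = entf" by (simp_all add: input_def rowf_def yf_def entf_def)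
    show "nmem ?t 0 0 = n" by (simp add: input_def array_of_def)
    show "rowf 1 = P" using rowf_par[OF small(1)] by (simp add: pval_def)
    show "rowf 2 mod P = b" "rowf 3 mod P = D" "rowf 4 mod P = 2 * a" "rowf 5 mod P = B" "rowf 6 mod P = 2 * B" "rowf 7 mod P = N"
      using small by (simp_all add: par pval_def)
  qed (use n1 W P D_pos in auto)
  then obtain t s' J where ex: "exec W (Main_prog u s) ?t t s'" "t \<le> mc.T_main"
    and sel: "selects (\<lambda>j. mc.scr (D - 1) (cands \<omega> D ! j)) (length (cands \<omega> D)) N (\<pi> ` {..<s}) J"
    and out: "output_set s' = (!) (cands \<omega> D) ` J"
    unfolding runs_def piv cnd[OF order_refl] by blast
  have "mc.scr (D - 1) (cands \<omega> D ! j) = score (Mod D) (\<omega> (D - 1)) (cands \<omega> D ! j)" if "j < length (cands \<omega> D)" for j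
  proof -
    have "cands \<omega> D ! j \<in> set (cands \<omega> D)" using that by simp
    then have "cands \<omega> D ! j < n" "cands \<omega> D ! j < Mod D" using cands_props[of \<omega> D] by blast+
    then show ?thesis using scr[of "cands \<omega> D ! j" "D - 1"] D_pos by simp
  qed
  from selects_cong[OF this sel] ex out show ?thesis unfolding finds_def by blast
qed

end


section \<open>Parameters\<close>

text \<open>Singletons are measurable in a finite product of Borel spaces, hence so is every subset
  of the finite set of possible matrices. The image of the good outcomes can thus serve as the
  event, whether or not \<open>Q\<close> is measurable.\<close>

lemma distr_pmf_matrix:
  fixes p :: "'a pmf" and f :: "'a \<Rightarrow> matrix"
  assumes fin: "finite (set_pmf p)" and ext: "\<And>z. f z \<in> extensional ({..<m} \<times> {..<n})"
  defines "\<DD> \<equiv> distr (measure_pmf p) (Pi\<^sub>M ({..<m} \<times> {..<n}) (\<lambda>_. borel :: real measure)) f"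
  shows "random_matrix m n \<DD>"
    and "(\<And>z. z \<in> set_pmf p \<Longrightarrow> Q (f z)) \<Longrightarrow> AE \<Phi> in \<DD>. Q \<Phi>"
    and "q \<le> Pr p G \<Longrightarrow> (\<And>z. z \<in> set_pmf p \<Longrightarrow> G z \<Longrightarrow> Q (f z)) \<Longrightarrow> holds_with_prob \<DD> q Q"
proof -
  let ?I = "{..<m} \<times> {..<n}"
  let ?N = "Pi\<^sub>M ?I (\<lambda>_. borel :: real measure)"
  have meas: "f \<in> measurable (measure_pmf p) ?N"
    using ext by (simp add: measurable_def space_PiM PiE_def)
  show "random_matrix m n \<DD>"
    unfolding random_matrix_def \<DD>_def using meas by (simp add: measure_pmf.prob_space_distr)
  have single: "{f z} \<in> sets ?N" for z
  proof -
    have "{f z} = PiE ?I (\<lambda>i. {f z i})" using ext[of z] by (simp add: PiE_singleton)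
    also have "\<dots> \<in> sets ?N" by (rule sets_PiM_I_finite) auto
    finally show ?thesis .
  qed
  have img: "f ` A \<in> sets ?N" if "finite A" for A
    using sets.finite_UN[OF that single] by (simp add: UNION_singleton_eq_range)
  have sp: "f ` A \<subseteq> space ?N" for A using ext by (auto simp: space_PiM PiE_def)
  {
    assume Q: "\<And>z. z \<in> set_pmf p \<Longrightarrow> Q (f z)"
    have "{x \<in> space ?N. x \<in> f ` set_pmf p} = f ` set_pmf p" using sp by auto
    then have "(AE \<Phi> in \<DD>. \<Phi> \<in> f ` set_pmf p) \<longleftrightarrow> (AE z in measure_pmf p. f z \<in> f ` set_pmf p)"
      unfolding \<DD>_def using img[OF fin] by (intro AE_distr_iff[OF meas]) simp
    then have "AE \<Phi> in \<DD>. \<Phi> \<in> f ` set_pmf p" by (simp add: AE_measure_pmf_iff)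
    then show "AE \<Phi> in \<DD>. Q \<Phi>" by (rule AE_mp) (rule AE_I2, use Q in auto)
  next
    assume q: "q \<le> Pr p G" and Q: "\<And>z. z \<in> set_pmf p \<Longrightarrow> G z \<Longrightarrow> Q (f z)"
    let ?A = "{z \<in> set_pmf p. G z}"
    have E: "f ` ?A \<in> sets ?N" using fin by (intro img) auto
    have "Pr p G \<le> Pr p (\<lambda>z. f z \<in> f ` ?A)" by (rule Pr_mono) auto
    also have "\<dots> = measure \<DD> (f ` ?A)"
      unfolding \<DD>_def using E meas by (subst measure_distr) (auto simp: Pr_def vimage_def)
    finally have "q \<le> measure \<DD> (f ` ?A)" using q by linarith
    then show "holds_with_prob \<DD> q Q"
      unfolding holds_with_prob_def using E Q by (intro bexI[of _ "f ` ?A"]) (auto simp: \<DD>_def)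
  }
qed

section \<open>Numerical bounds for time, depth and failure probability\<close>

lemma (in machine) T_main_le:
  assumes "0 < R" "0 < B" "N1 = 2 * B"
  shows "T_main \<le> (4 * u + 95) * (D * B * b * R\<^sup>2) + (18 * s + 40) * B"
proof -
  have RR: "R \<le> R\<^sup>2" "1 \<le> R\<^sup>2" using assms by (simp_all add: power2_eq_square)
  have med: "T_med R \<le> 14 * R\<^sup>2"
  proof -
    have "T_med R = 4 * R\<^sup>2 + 7 * R + 3" by (simp add: T_med_def power2_eq_square algebra_simps)
    then show ?thesis using RR by linarith
  qed
  have est: "T_est \<le> 19 * R\<^sup>2" using med RR unfolding T_est_def by linarith
  have cell: "T_cell + 2 \<le> 29 * R\<^sup>2" using est RR unfolding T_cell_def by linarith
  have b1: "R\<^sup>2 \<le> b * R\<^sup>2" using b_pos by simp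
  \<comment> \<open>The dominating cost: at most \<open>2 * B\<close> parents per level with
    \<open>b\<close> children each, and a quadratic median for every child.\<close>
  have "b * (T_cell + 2) \<le> b * (29 * R\<^sup>2)" using cell by (rule mult_le_mono2)
  then have "b * (T_cell + 2) + 4 \<le> 33 * (b * R\<^sup>2)" using b1 RR by linarith
  then have "N1 * (b * (T_cell + 2) + 4) \<le> 2 * B * (33 * (b * R\<^sup>2))" unfolding assms(3) by (rule mult_le_mono2)
  then have nodes: "N1 * (b * (T_cell + 2) + 4) \<le> 66 * (B * (b * R\<^sup>2))" by (simp add: mult_ac)
  have probe: "T_probe \<le> (4 * u + 22) * R\<^sup>2"
  proof -
    have "T_probe = 4 * u * R + 5 * R + 3 + T_med R" by (simp add: T_probe_def algebra_simps)
    also have "\<dots> \<le> 4 * u * R\<^sup>2 + 5 * R\<^sup>2 + 3 * R\<^sup>2 + 14 * R\<^sup>2" using RR med by (intro add_mono mult_le_mono2) auto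
    finally show ?thesis by (simp add: algebra_simps)
  qed
  let ?X = "B * (b * R\<^sup>2)"
  have RX: "R\<^sup>2 \<le> ?X"
  proof -
    have "b * R\<^sup>2 \<le> ?X" using assms(2) by simp
    then show ?thesis using b1 by (rule order_trans[rotated])
  qed
  have "(4 * u + 22) * R\<^sup>2 \<le> (4 * u + 22) * ?X" using RX by (rule mult_le_mono2)
  then have "T_level + 2 \<le> (4 * u + 22) * ?X + 66 * ?X + 7 * ?X"
    using probe nodes RX RR unfolding T_level_def by linarith
  then have "T_level + 2 \<le> (4 * u + 95) * ?X" by (simp add: algebra_simps)
  then have "D * (T_level + 2) \<le> D * ((4 * u + 95) * ?X)" by (rule mult_le_mono2)
  then have lev: "D * (T_level + 2) \<le> (4 * u + 95) * (D * B * b * R\<^sup>2)" by (simp only: mult_ac)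
  have pick: "T_pick s N1 \<le> 18 * (s * B) + 18 * B"
  proof -
    have "T_pick s N1 = 8 * (s * B) + 10 * s + 10 * B + 8"
      by (simp add: T_pick_def T_pivot_def assms(3) algebra_simps)
    moreover have "s \<le> s * B" using assms(2) by simp
    ultimately show ?thesis using assms(2) by linarith
  qed
  have "(18 * s + 40) * B = 18 * (s * B) + 40 * B" by (simp add: algebra_simps)
  then show ?thesis using lev pick assms(2) unfolding T_main_def by linarith
qed

text \<open>The exponent is the least \<open>a\<close> \<ge> 4 with lg \<le> 4^a. By minimality 4^a
  is below 4 lg unless \<open>a\<close> is 4, in which case lg \<ge> 4 gives the constants directly.
  The depth is lg / a rounded up, so rounding adds at most \<open>a\<close> to the product.\<close>

lemma depth_exists:
  fixes lg :: real
  assumes "4 \<le> lg"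
  obtains a D :: nat where "4 \<le> a" "0 < D" "D \<le> 4 ^ a" "lg \<le> real D * a" "real D * a \<le> lg + a" "real a \<le> lg"
    "2 ^ a * real a \<le> 16 * lg" "2 ^ a \<le> 4 * lg"
proof -
  obtain a0 :: nat where "lg < 4 ^ a0" using real_arch_pow[of 4 lg] by auto
  also have "(4::real) ^ a0 \<le> 4 ^ (a0 + 4)" by (intro power_increasing) auto
  finally have ex: "4 \<le> a0 + 4 \<and> lg \<le> 4 ^ (a0 + 4)" by simp
  define a where "a = (LEAST a. 4 \<le> a \<and> lg \<le> (4::real) ^ a)"
  have a: "4 \<le> a" "lg \<le> 4 ^ a" using LeastI[of "\<lambda>a. 4 \<le> a \<and> lg \<le> (4::real) ^ a", OF ex] by (auto simp: a_def)
  have pre: "real a \<le> lg \<and> 2 ^ a * real a \<le> 16 * lg \<and> 2 ^ a \<le> 4 * lg"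
  proof (cases "a = 4")
    case True
    then show ?thesis using assms by simp
  next
    case False
    then have a5: "5 \<le> a" using a(1) by simp
    have "\<not> (4 \<le> a - 1 \<and> lg \<le> (4::real) ^ (a - 1))"
      using not_less_Least[of "a - 1" "\<lambda>a. 4 \<le> a \<and> lg \<le> (4::real) ^ a"] a5 by (simp add: a_def[symmetric])
    then have l: "4 ^ (a - 1) < lg" using a5 by auto
    have f: "(4::real) ^ a = 4 * 4 ^ (a - 1)" using a5 by (cases a) auto
    have tw: "real a \<le> 2 ^ a" using less_exp[of a] by (metis less_imp_le of_nat_le_iff of_nat_numeral of_nat_power)
    have "2 ^ a * real a \<le> 2 ^ a * 2 ^ a" using tw by (intro mult_left_mono) auto
    also have "\<dots> = (4::real) ^ a" by (simp flip: power_mult_distrib)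
    finally have 1: "2 ^ a * real a \<le> 4 * lg" using f l by simp
    have "(2::real) ^ a \<le> 2 ^ (2 * (a - 1))" using a5 by (intro power_increasing) auto
    also have "\<dots> = 4 ^ (a - 1)" by (simp add: power_mult)
    finally have "(2::real) ^ a \<le> lg" using l by linarith
    then show ?thesis using tw 1 assms by linarith
  qed
  define D where "D = nat \<lceil>lg / a\<rceil>"
  have apos: "0 < real a" using a by simp
  have q: "0 < lg / a" using apos assms by simp
  have D1: "lg / a \<le> real D" unfolding D_def by linarith
  have D2: "real D \<le> lg / a + 1" unfolding D_def using q by linarith
  show ?thesis
  proof
    show "4 \<le> a" by (rule a(1))
    show "0 < D" using D1 q by (simp add: D_def)
    show "lg \<le> real D * a" using D1 apos by (simp add: field_simps)
    show "real D * a \<le> lg + a" using D2 apos by (simp add: field_simps)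
    have "lg / a \<le> lg / 4" using a assms by (intro divide_left_mono) auto
    then have "real D \<le> lg / 4 + 1" using D2 by linarith
    also have "\<dots> \<le> lg" using assms by simp
    finally have "real D \<le> 4 ^ a" using a(2) by linarith
    then show "D \<le> 4 ^ a" by (metis of_nat_le_iff of_nat_numeral of_nat_power)
  qed (use pre in auto)
qed

text \<open>Each of the six summands is at most 1/100. The factors \<open>D\<close> \<le> 4^a and
  \<open>b\<close> = 2^a are drawn into the a-th powers, so a constant base suffices at every
  level.\<close>

lemma (in recovery) fail_bound_le:
  assumes b: "b = 2 ^ a" and D4: "D \<le> 4 ^ a" and p1': "p1 = 1 / 2 ^ 14"
    and pt: "16 * (u * pt) \<le> 1 / 100" and M: "100 * n * (4 * (16 * \<delta> / \<kappa> + 2) + (8 * \<tau> / \<kappa> + 2)) \<le> real M"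
    and \<rho>: "4 * \<rho> \<le> 1 / 100" and \<sigma>: "4 * p0 * \<sigma> / d \<le> 1 / 10"
    and p0': "8 * p0 \<le> 1" "2 * B * (8 * p0)\<^sup>2 / (real w + 1) \<le> 1 / 100"
  shows "fail_bound \<le> 6 / 100"
proof -
  have D: "real D \<le> 4 ^ a" using D4 by (metis of_nat_le_iff of_nat_numeral of_nat_power)
  have br: "real b = 2 ^ a" using b by simp
  have a1: "1 \<le> a" "2 \<le> a" using a4 by simp_all
  have small: "real D * y ^ a \<le> 4 * y" if "0 \<le> y" "4 * y \<le> 1" for y
  proof -
    have "real D * y ^ a \<le> 4 ^ a * y ^ a" using D that by (intro mult_right_mono) auto
    also have "\<dots> = (4 * y) ^ a" by (simp add: power_mult_distrib)
    also have "\<dots> \<le> (4 * y) ^ 1" using that a1 by (intro power_decreasing) auto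
    finally show ?thesis by simp
  qed
  have t1: "D * (real (3 * b) * (40 * p1) ^ a) \<le> 1 / 100"
  proof -
    \<comment> \<open>40 / 2^14 is below 1/256; after the factors 4^a and 2^a have been absorbed,
      the base is 1/32.\<close>
    have "(40 * p1) ^ a \<le> (1 / 256) ^ a" by (intro power_mono) (simp_all add: p1')
    then have "D * (real (3 * b) * (40 * p1) ^ a) \<le> 4 ^ a * (3 * 2 ^ a * (1 / 256) ^ a)"
      using D br by (intro mult_mono) (auto simp: p1')
    also have "\<dots> = 3 * (4 * 2 * (1 / 256)) ^ a" by (simp only: power_mult_distrib mult_ac)
    also have "\<dots> \<le> 3 * (4 * 2 * (1 / 256)) ^ 4" using a4 by (intro mult_left_mono power_decreasing) auto
    also have "\<dots> \<le> 1 / 100" by (simp add: power_divide)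
    finally show ?thesis .
  qed
  have t2: "D * (4 * (real u * pt)) ^ a \<le> 1 / 100"
    using small[of "4 * (real u * pt)"] pt pt_nonneg by simp
  have t3: "n * (D * ((16 * \<delta> / \<kappa> + 2) / M) ^ a + ((8 * \<tau> / \<kappa> + 2) / M) ^ a) \<le> 1 / 100"
  proof -
    define y z where "y = 16 * \<delta> / \<kappa> + 2" and "z = 8 * \<tau> / \<kappa> + 2"
    have yz: "0 \<le> y" "0 \<le> z" using pos \<tau>_pos by (simp_all add: y_def z_def)
    have n1: "1 \<le> real n" using n_pos by simp
    have M': "100 * real n * (4 * y + z) \<le> real M" using M by (simp add: y_def z_def)
    have "1 * (4 * y + z) \<le> 100 * real n * (4 * y + z)" using yz n1 by (intro mult_right_mono) auto
    then have "1 * (4 * y + z) \<le> real M" using M' by (rule order_trans)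
    then have le: "4 * y + z \<le> real M" by (simp only: mult_1)
    have "4 * y \<le> real M" "z \<le> real M" using le yz by linarith+
    then have "4 * y / M \<le> 1" "z / M \<le> 1" using M_real by (simp_all only: divide_le_eq_1_pos)
    then have yM: "0 \<le> y / M" "4 * (y / M) \<le> 1" "0 \<le> z / M" "z / M \<le> 1" using yz by simp_all
    have "(z / M) ^ a \<le> (z / M) ^ 1" using yM a1 by (intro power_decreasing) auto
    then have "D * (y / M) ^ a + (z / M) ^ a \<le> 4 * (y / M) + z / M" using small[OF yM(1,2)] by simp
    also have "\<dots> = (4 * y + z) / M" by (simp add: add_divide_distrib)
    finally have "n * (D * (y / M) ^ a + (z / M) ^ a) \<le> n * ((4 * y + z) / M)" by (intro mult_left_mono) auto
    also have "\<dots> = (100 * real n * (4 * y + z)) / M / 100" by simp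
    also have "\<dots> \<le> 1 / 100" using M' M_real by (intro divide_right_mono) (simp_all only: divide_le_eq_1_pos)
    finally show ?thesis by (simp only: y_def z_def)
  qed
  have \<rho>0: "0 \<le> \<rho>" using pos by (simp add: \<rho>_def)
  have t4: "D * \<rho> ^ a \<le> 1 / 100" using small[OF \<rho>0] \<rho> by linarith
  have \<sigma>0: "0 \<le> 4 * p0 * \<sigma> / d" using p0_nonneg pos \<tau>_pos by (simp add: \<sigma>_def)
  have t5: "(4 * p0 * \<sigma> / d)\<^sup>2 \<le> 1 / 100"
    using power_mono[OF \<sigma> \<sigma>0, of 2] by (simp add: power_divide)
  have t6: "real (b * (2 * B)) * (4 * p0) ^ a / (real w + 1) \<le> 1 / 100"
  proof -
    have "2 ^ a * (4 * p0) ^ a = (2 * (4 * p0)) ^ a" by (simp only: power_mult_distrib)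
    then have "2 ^ a * (4 * p0) ^ a = (8 * p0) ^ a" by simp
    moreover have "real (b * (2 * B)) * (4 * p0) ^ a = 2 * B * (2 ^ a * (4 * p0) ^ a)" by (simp add: br)
    ultimately have "real (b * (2 * B)) * (4 * p0) ^ a = 2 * B * (8 * p0) ^ a" by (simp only:)
    also have "\<dots> \<le> 2 * B * (8 * p0) ^ 2" using p0_nonneg p0'(1) a1 by (intro mult_left_mono power_decreasing) simp_all
    finally have "real (b * (2 * B)) * (4 * p0) ^ a / (real w + 1) \<le> 2 * B * (8 * p0)\<^sup>2 / (real w + 1)"
      by (intro divide_right_mono) auto
    then show ?thesis using p0' by linarith
  qed
  show ?thesis unfolding fail_bound_def using t1 t2 t3 t4 t5 t6 by linarith
qed


section \<open>Concrete constants and the success probability\<close>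

lemma head_subset: "head n x k \<subseteq> {..<n}"
  unfolding head_def using set_take_subset[of k "sort_key (\<lambda>i. - \<bar>x i\<bar>) [0..<n]"] by (auto simp: atLeast0LessThan)

lemma card_head: "card (head n x k) \<le> k"
  unfolding head_def by (rule order_trans[OF card_length]) simp

lemma L2_set_tail: "L2_set (tail n x k) {..<n} = sqrt (\<Sum>i\<in>{..<n} - head n x k. (x i)\<^sup>2)"
  unfolding L2_set_def
  by (rule arg_cong[of _ _ sqrt], rule sum.mono_neutral_cong_right) (auto simp: tail_def zero_outside_def)

lemma L2_set_residual: "L2_set (\<lambda>i. x i - zero_outside T x i) {..<n} = sqrt (\<Sum>i\<in>{..<n} - T. (x i)\<^sup>2)"
  unfolding L2_set_def
  by (rule arg_cong[of _ _ sqrt], rule sum.mono_neutral_cong_right) (auto simp: zero_outside_def)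

text \<open>After the first, the conditions on \<open>CB\<close> serve: the slack \<open>w\<close>
  within the candidate capacity; the probes, where 2^30 is 1/\<delta>^2; the energy of badly
  estimated head entries; \<open>8 * p0 \<le> 1\<close>; and the number of inaccurate candidates.
  The number \<open>s\<close> makes the pivots miss with probability at most 1/100, and
  \<open>CM\<close> takes care of the huge entries.\<close>

locale design =
  fixes n k :: nat and \<epsilon> C c2 g CB :: real and u s CM a D :: nat
  assumes n: "0 < n" and k: "0 < k" and \<epsilon>: "0 < \<epsilon>" "\<epsilon> < 1" and C: "1 < C" and c2: "c2 = (C - 1) / 4"
    and g: "g = min 1 (sqrt c2) / 16"
    and u: "0 < u" "(1 - 1 / 2 ^ 14) ^ u \<le> (1 / 2 ^ 14 :: real)"
    and CB: "2 \<le> CB" "c2 \<le> CB" "1600 * u * (1 + 4 * 2 ^ 30) \<le> CB"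
      "160 * (1 + 4 / g\<^sup>2) * (8 * (1 / sqrt c2 + g) + 2 / 2 ^ 15) \<le> CB" "8 * (1 + 4 / g\<^sup>2) \<le> CB"
      "25600 * (1 + 4 / g\<^sup>2)\<^sup>2 / c2 \<le> CB"
    and s: "(1 - c2 / (4 * CB)) ^ s \<le> 1 / 100"
    and CM: "100 * (4 * 18 + (8 * (1 / sqrt c2 + g) * 2 ^ 15 + 2)) \<le> real CM"
    and a: "4 \<le> a" and D: "0 < D" "D \<le> 4 ^ a" "real n / (real k / \<epsilon>) \<le> 2 ^ (D * a)"
begin

definition K where "K = real k / \<epsilon>"
definition B where "B = nat \<lceil>CB * K\<rceil>"
definition M where "M = n * CM"
definition b where "b = (2::nat) ^ a"
definition N where "N = nat \<lfloor>C * K\<rfloor>"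
definition w where "w = nat \<lfloor>c2 * K\<rfloor>"
text \<open>Exceeds every value stored as an offset. As \<open>b\<close> will be at most 4 lg, it is
  of order K lg, so the parameter rows do not spoil the number of measurements.\<close>

definition P where "P = 2 * B + b + D + 2 * a + N + 1"

lemma c2_pos: "0 < c2"
  using C c2 by simp

lemma g_pos: "0 < g"
  unfolding g using c2_pos by simp

lemma K_ge: "real k \<le> K" "1 \<le> K"
proof -
  have "real k * \<epsilon> \<le> real k * 1" using \<epsilon> by (intro mult_left_mono) auto
  then show "real k \<le> K" using \<epsilon> by (simp add: K_def le_divide_eq)
  then show "1 \<le> K" using k by linarith
qed

lemma B_bounds: "CB * K \<le> real B" "real B \<le> 2 * CB * K" "2 \<le> B" "K \<le> real B"
proof -
  have "2 * 1 \<le> CB * K" using CB(1) K_ge by (intro mult_mono) auto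
  then show 1: "CB * K \<le> real B" "real B \<le> 2 * CB * K" unfolding B_def by linarith+
  show "2 \<le> B" using 1 \<open>2 * 1 \<le> CB * K\<close> by linarith
  have "1 * K \<le> CB * K" using CB(1) K_ge by (intro mult_right_mono) auto
  then show "K \<le> real B" using 1 by linarith
qed

lemma CM_pos: "0 < CM"
proof -
  define y where "y = 8 * (1 / sqrt c2 + g) * 2 ^ 15"
  have "0 \<le> y" using c2_pos g_pos by (simp add: y_def)
  then have "0 < 100 * (4 * 18 + (y + 2))" by simp
  also have "\<dots> \<le> real CM" unfolding y_def by (rule CM)
  finally have "0 < real CM" .
  then show ?thesis by simp
qed

lemma scheme: "scheme n B M a u b"
proof
  show "0 < n" "2 \<le> B" "0 < M" "0 < a" "0 < u" "0 < b"
    using n B_bounds CM_pos a u by (simp_all add: M_def b_def)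
qed

lemma n_le: "n \<le> B * b ^ D"
proof -
  have K0: "0 < K" using K_ge by linarith
  have "real n = K * (real n / K)" using K0 by simp
  also have "\<dots> \<le> K * 2 ^ (D * a)" using D(3) K0 by (intro mult_left_mono) (simp_all add: K_def)
  also have "\<dots> \<le> real B * 2 ^ (D * a)" using B_bounds by (intro mult_right_mono) auto
  also have "\<dots> = real (B * b ^ D)" by (simp add: b_def power_mult[symmetric] mult.commute[of a])
  finally show ?thesis by (simp only: of_nat_le_iff)
qed

text \<open>C K = K + 4 c2 K: the first summand covers the head, two of the four parts cover the
  inaccurate candidates and the slack of the pivot, and the rest is at least c2 K after
  rounding.\<close>

lemma N_w: "k + 2 * w \<le> N" "c2 * K \<le> real (N - 2 * w - k) + 1" "w + 1 \<le> 2 * B" "c2 * K \<le> real w + 1" "real N \<le> C * K"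
proof -
  have cK: "0 \<le> c2 * K" "0 \<le> C * K" using c2_pos K_ge C by simp_all
  have w: "real w \<le> c2 * K" "c2 * K \<le> real w + 1" unfolding w_def using cK by linarith+
  have N: "real N \<le> C * K" "C * K \<le> real N + 1" unfolding N_def using cK by linarith+
  have "C * K = K + 4 * (c2 * K)" by (simp add: c2 field_simps)
  then have 1: "real k + 4 * (c2 * K) \<le> C * K" using K_ge by linarith
  have "real N + 1 > real (k + 2 * w)" using 1 N w cK c2_pos K_ge mult_pos_pos[of c2 K] by (simp, linarith)
  then show kw: "k + 2 * w \<le> N" by linarith
  then have "real (N - 2 * w - k) = real N - 2 * real w - real k" by (simp add: of_nat_diff)
  then show "c2 * K \<le> real (N - 2 * w - k) + 1" using 1 N w by linarith
  have "c2 * K \<le> CB * K" using CB(2) K_ge by (intro mult_right_mono) auto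
  then have "real w + 1 \<le> 2 * real B" using w B_bounds by linarith
  then show "w + 1 \<le> 2 * B" by linarith
  show "c2 * K \<le> real w + 1" "real N \<le> C * K" by (rule w(2), rule N(1))
qed

definition Z where "Z = pair_pmf (scheme.all_pmf n B M a u D) (pivot_pmf s (2 * B))"

lemma finite_Z: "finite (set_pmf Z)"
proof -
  interpret scheme n B M a u b D "\<lambda>_. 0" by (rule scheme)
  show ?thesis unfolding Z_def using B_bounds by simp
qed

lemma layout:
  assumes "z \<in> set_pmf Z"
  shows "layout n B M a u b D N s P (fst z) (snd z)"
proof -
  interpret scheme n B M a u b D "\<lambda>_. 0" by (rule scheme)
  show ?thesis
    by unfold_locales (use assms D in \<open>auto simp: Z_def P_def\<close>)
qed

lemma inv_B_le:
  fixes y :: real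
  shows "real k / B + 4 * K / (B * y\<^sup>2) \<le> (1 + 4 / y\<^sup>2) / CB"
proof -
  have K0: "0 < K" "0 < CB" using K_ge CB by linarith+
  have pos: "0 < CB * K" using K0 by simp
  have "0 < real B" using B_bounds(4) K0 by linarith
  then have "0 < real B * (CB * K)" using pos by (rule mult_pos_pos)
  then have "K / B \<le> K / (CB * K)" using K0 by (intro divide_left_mono[OF B_bounds(1)]) simp_all
  then have q: "K / B \<le> 1 / CB" using K0 by simp
  have "real k / B + 4 * K / (B * y\<^sup>2) \<le> K / B + 4 * K / (B * y\<^sup>2)"
    using K_ge by (intro add_right_mono divide_right_mono) auto
  also have "4 * K / (B * y\<^sup>2) = 4 / y\<^sup>2 * (K / B)" by simp
  also have "K / B + 4 / y\<^sup>2 * (K / B) = (1 + 4 / y\<^sup>2) * (K / B)" by (simp only: distrib_right mult_1)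
  also have "\<dots> \<le> (1 + 4 / y\<^sup>2) * (1 / CB)" using q by (intro mult_left_mono add_nonneg_nonneg) auto
  finally show ?thesis by (simp add: mult.commute)
qed

text \<open>The failure probability is at most 6/100 for the search and 1/100 for the
  pivots.\<close>

lemma success:
  fixes x :: "nat \<Rightarrow> real"
  shows "9 / 10 \<le> Pr Z (\<lambda>z. \<forall>J.
     selects (\<lambda>j. scheme.score n a x (scheme.Mod B b D) (fst z (D - 1)) (scheme.cands n B a u b x (fst z) D ! j))
       (length (scheme.cands n B a u b x (fst z) D)) N (snd z ` {..<s}) J \<longrightarrow>
     (\<exists>T\<subseteq>(!) (scheme.cands n B a u b x (fst z) D) ` J. card T \<le> k \<and>
       L2_set (\<lambda>i. x i - zero_outside T x i) {..<n} \<le> (1 + \<epsilon>) * L2_set (tail n x k) {..<n}))"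
proof -
  let ?H = "head n x k"
  define E where "E = (\<Sum>i\<in>{..<n} - ?H. (x i)\<^sup>2)"
  define \<theta> where "\<theta> = sqrt (E / K)"
  have K0: "0 < K" using K_ge by linarith
  have CB0: "0 < CB" using CB by linarith
  have E0: "0 \<le> E" unfolding E_def by (intro sum_nonneg) auto
  have K\<theta>: "E = K * \<theta>\<^sup>2" using E0 K0 by (simp add: \<theta>_def)
  have sch: "scheme n B M a u b" by (rule scheme)
  interpret scheme n B M a u b D x by (rule sch)
  \<comment> \<open>With \<delta> and \<kappa> equal to 2^-15 this gives \<rho> = 72 / 2^15, below
    1/400, while the ignored and lost entries cost only 3/16 in the error.\<close>
  let ?d = "1 / 4 :: real" and ?\<delta> = "1 / 2 ^ 15 :: real"
  have p0b: "real k / B + 4 * K / (B * g\<^sup>2) \<le> (1 + 4 / g\<^sup>2) / CB" by (rule inv_B_le)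
  have p08: "8 * (real k / B + 4 * K / (B * g\<^sup>2)) \<le> 1"
  proof -
    have "8 * ((1 + 4 / g\<^sup>2) / CB) \<le> 1" using CB(5) CB0 by simp
    moreover have "8 * (real k / B + 4 * K / (B * g\<^sup>2)) \<le> 8 * ((1 + 4 / g\<^sup>2) / CB)"
      using p0b by (rule mult_left_mono) simp
    ultimately show ?thesis by (rule order_trans[rotated])
  qed
  have p0nn: "0 \<le> real k / B + 4 * K / (B * g\<^sup>2)" using K0 by simp
  interpret rc: recovery n B M a u b D x ?H k N w s K \<theta> ?\<delta> ?\<delta> ?d g c2 "1 / 2 ^ 14"
  proof unfold_locales
    show "?H \<subseteq> {..<n}" "card ?H \<le> k" by (rule head_subset, rule card_head)
    show "(\<Sum>i\<in>{..<n} - ?H. (x i)\<^sup>2) = K * \<theta>\<^sup>2" using K\<theta> by (simp add: E_def)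
    show "0 \<le> \<theta>" using E0 K0 by (simp add: \<theta>_def)
    show "(1 - 1 / 2 ^ 14) ^ u \<le> (1 / 2 ^ 14 :: real)" by (rule u(2))
    show "4 * (real k / real B + 4 * K / (real B * g\<^sup>2)) \<le> 1" using p08 p0nn by linarith
  qed (use K0 k g_pos c2_pos D n_le a N_w in auto)
  have fb: "rc.fail_bound \<le> 6 / 100"
  proof (rule rc.fail_bound_le)
    show "16 * (real u * rc.pt) \<le> 1 / 100"
    proof -
      have "rc.pt \<le> (1 + 4 / ?\<delta>\<^sup>2) / CB" unfolding rc.pt_def by (rule inv_B_le)
      then have "rc.pt \<le> (1 + 4 * 2 ^ 30) / CB" by (simp add: power_divide flip: power_mult)
      then have "16 * (u * rc.pt) \<le> 16 * (u * ((1 + 4 * 2 ^ 30) / CB))" by (intro mult_left_mono) auto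
      also have "\<dots> = (1600 * u * (1 + 4 * 2 ^ 30)) / CB / 100" by simp
      also have "\<dots> \<le> 1 / 100" using CB(3) CB0 by (intro divide_right_mono) (simp_all only: divide_le_eq_1_pos)
      finally show ?thesis .
    qed
    show "100 * n * (4 * (16 * ?\<delta> / ?\<delta> + 2) + (8 * rc.\<tau> / ?\<delta> + 2)) \<le> real M"
    proof -
      have "real n * (100 * (4 * 18 + (8 * (1 / sqrt c2 + g) * 2 ^ 15 + 2))) \<le> real n * real CM"
        using CM by (intro mult_left_mono) auto
      also have "real n * (100 * (4 * 18 + (8 * (1 / sqrt c2 + g) * 2 ^ 15 + 2))) =
          100 * n * (4 * (16 * ?\<delta> / ?\<delta> + 2) + (8 * rc.\<tau> / ?\<delta> + 2))"
        by (simp add: rc.\<tau>_def algebra_simps)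
      finally show ?thesis by (simp only: M_def of_nat_mult)
    qed
    show "4 * rc.\<rho> \<le> 1 / 100" unfolding rc.\<rho>_def by simp
    have p0: "rc.p0 \<le> (1 + 4 / g\<^sup>2) / CB" unfolding rc.p0_def by (rule p0b)
    have \<sigma>0: "0 \<le> rc.\<sigma>" unfolding rc.\<sigma>_def using rc.\<tau>_pos by simp
    show "4 * rc.p0 * rc.\<sigma> / ?d \<le> 1 / 10"
    proof -
      have "rc.p0 * rc.\<sigma> \<le> (1 + 4 / g\<^sup>2) / CB * rc.\<sigma>" using p0 \<sigma>0 by (rule mult_right_mono)
      then have "160 * (rc.p0 * rc.\<sigma>) \<le> 160 * ((1 + 4 / g\<^sup>2) / CB * rc.\<sigma>)" by (rule mult_left_mono) simp
      also have "\<dots> = (160 * (1 + 4 / g\<^sup>2) * rc.\<sigma>) / CB" by (simp only: times_divide_eq_left times_divide_eq_right mult.assoc)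
      also have "\<dots> \<le> 1" using CB(4) CB0 by (simp only: divide_le_eq_1_pos rc.\<sigma>_def rc.\<tau>_def) simp
      finally show ?thesis by simp
    qed
    show "8 * rc.p0 \<le> 1" unfolding rc.p0_def by (rule p08)
    show "2 * B * (8 * rc.p0)\<^sup>2 / (real w + 1) \<le> 1 / 100"
    proof -
      let ?c = "1 + 4 / g\<^sup>2"
      have cK: "0 < c2 * K" using c2_pos K0 by simp
      have "(8 * rc.p0)\<^sup>2 \<le> (8 * (?c / CB))\<^sup>2" using p0 rc.p0_nonneg by (intro power_mono mult_left_mono) auto
      then have "2 * B * (8 * rc.p0)\<^sup>2 \<le> 2 * (2 * CB * K) * (8 * (?c / CB))\<^sup>2"
        using B_bounds(2) CB0 K0 by (intro mult_mono) auto
      then have "2 * B * (8 * rc.p0)\<^sup>2 / (real w + 1) \<le> 2 * (2 * CB * K) * (8 * (?c / CB))\<^sup>2 / (c2 * K)"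
        using N_w(4) cK CB0 K0 by (intro frac_le) auto
      also have "\<dots> = (25600 * ?c\<^sup>2 / c2) / CB / 100"
        using K0 CB0 c2_pos by (simp add: field_simps power2_eq_square)
      also have "\<dots> \<le> 1 / 100" using CB(6) CB0 by (intro divide_right_mono) (simp_all only: divide_le_eq_1_pos)
      finally show ?thesis .
    qed
  qed (use D in \<open>simp_all add: b_def\<close>)
  have pv: "(1 - (real w + 1) / real (2 * B)) ^ s \<le> 1 / 100"
  proof -
    have "c2 / (4 * CB) = c2 * K / (2 * (2 * CB * K))" using K0 by simp
    also have "\<dots> \<le> (real w + 1) / real (2 * B)"
      using N_w(4) B_bounds CB0 c2_pos K0 by (intro frac_le) auto
    finally have 1: "1 - (real w + 1) / real (2 * B) \<le> 1 - c2 / (4 * CB)" by simp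
    have "real w + 1 \<le> real (2 * B)" using N_w(3) by linarith
    then have "0 \<le> 1 - (real w + 1) / real (2 * B)" using B_bounds(3) by simp
    then have "(1 - (real w + 1) / real (2 * B)) ^ s \<le> (1 - c2 / (4 * CB)) ^ s" using 1 by (intro power_mono)
    then show ?thesis using s by linarith
  qed
  \<comment> \<open>The sum is at most 3/16 + 1/4 + 1/64; the last two summands are the reason for
    the 16 in \<open>g\<close>.\<close>
  have err: "3 * ?d\<^sup>2 + 4 * g / sqrt c2 + 4 * g\<^sup>2 \<le> 1"
  proof -
    have sc: "0 < sqrt c2" using c2_pos by simp
    have g1: "16 * g \<le> 1" "16 * g \<le> sqrt c2" by (simp_all add: g)
    have "4 * g / sqrt c2 \<le> 1 / 4" using g1(2) sc by (simp add: divide_le_eq)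
    moreover have "g\<^sup>2 \<le> (1 / 16)\<^sup>2" using g1(1) g_pos by (intro power_mono) auto
    ultimately show ?thesis by (simp add: power_divide)
  qed
  have goal: "L2_set (\<lambda>i. x i - zero_outside T x i) {..<n} \<le> (1 + \<epsilon>) * L2_set (tail n x k) {..<n}"
    if T: "(\<Sum>i\<in>{..<n} - T. (x i)\<^sup>2) \<le> K * \<theta>\<^sup>2 + k * \<theta>\<^sup>2 * (3 * ?d\<^sup>2 + 4 * g / sqrt c2 + 4 * g\<^sup>2)" for T
  proof -
    have "k * \<theta>\<^sup>2 * (3 * ?d\<^sup>2 + 4 * g / sqrt c2 + 4 * g\<^sup>2) \<le> k * \<theta>\<^sup>2 * 1"
      using err by (intro mult_left_mono) auto
    \<comment> \<open>By the choice K = k / \<epsilon> and E = K \<theta>^2.\<close>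
    also have "k * \<theta>\<^sup>2 * 1 = \<epsilon> * E" using \<epsilon> by (simp add: K\<theta> K_def)
    finally have "(\<Sum>i\<in>{..<n} - T. (x i)\<^sup>2) \<le> E + \<epsilon> * E" using T K\<theta> by linarith
    also have "\<dots> \<le> (1 + \<epsilon>)\<^sup>2 * E"
    proof -
      have "0 \<le> \<epsilon> * E + \<epsilon>\<^sup>2 * E" using \<epsilon> E0 by simp
      moreover have "(1 + \<epsilon>)\<^sup>2 * E = E + \<epsilon> * E + (\<epsilon> * E + \<epsilon>\<^sup>2 * E)" by (simp add: power2_eq_square algebra_simps)
      ultimately show ?thesis by linarith
    qed
    finally have "sqrt (\<Sum>i\<in>{..<n} - T. (x i)\<^sup>2) \<le> sqrt ((1 + \<epsilon>)\<^sup>2 * E)" by (rule real_sqrt_le_mono)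
    also have "\<dots> = (1 + \<epsilon>) * sqrt E" using \<epsilon> by (simp add: real_sqrt_mult)
    finally show ?thesis by (simp add: L2_set_residual L2_set_tail E_def)
  qed
  have "9 / 10 \<le> 1 - rc.fail_bound - (1 - (real w + 1) / real (2 * B)) ^ s" using fb pv by linarith
  also note rc.recovery_probability
  also have "Pr (pair_pmf all_pmf (pivot_pmf s (2 * B))) (\<lambda>z. \<forall>J.
      selects (\<lambda>j. rc.est (fst z) (cands (fst z) D ! j)) (length (cands (fst z) D)) N (snd z ` {..<s}) J \<longrightarrow>
      (\<exists>T\<subseteq>(!) (cands (fst z) D) ` J. card T \<le> k \<and>
      (\<Sum>i\<in>{..<n} - T. (x i)\<^sup>2) \<le> K * \<theta>\<^sup>2 + k * \<theta>\<^sup>2 * (3 * ?d\<^sup>2 + 4 * g / sqrt c2 + 4 * g\<^sup>2)))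
    \<le> Pr Z (\<lambda>z. \<forall>J.
     selects (\<lambda>j. score (Mod D) (fst z (D - 1)) (cands (fst z) D ! j)) (length (cands (fst z) D)) N (snd z ` {..<s}) J \<longrightarrow>
     (\<exists>T\<subseteq>(!) (cands (fst z) D) ` J. card T \<le> k \<and>
       L2_set (\<lambda>i. x i - zero_outside T x i) {..<n} \<le> (1 + \<epsilon>) * L2_set (tail n x k) {..<n}))"
    unfolding Z_def rc.est_def by (rule Pr_mono) (use goal in meson)
  finally show ?thesis .
qed

end

locale sized_design = design +
  fixes lg :: real
  assumes lg: "4 \<le> lg" "lg \<le> real D * a" "real D * a \<le> lg + a" "real a \<le> lg" "2 ^ a * real a \<le> 16 * lg"
    "2 ^ a \<le> 4 * lg" "lg \<le> 2 * n" and powr_lg: "2 powr lg = n / K" and K_n: "K \<le> n"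
begin

definition m where "m = shape.rows B a u D s P"

lemma m_eq: "real m = (8 + real s) * P + real D * (2 * a) * (u + 1) * B"
  by (simp add: m_def shape.rows_def shape.npar_def shape.reps_def algebra_simps)

lemma Da: "real D * a \<le> 2 * lg" "real D \<le> 2 * lg"
proof -
  show 1: "real D * a \<le> 2 * lg" using lg by linarith
  have "real D * 1 \<le> real D * a" using a by (intro mult_left_mono) auto
  then show "real D \<le> 2 * lg" using 1 by linarith
qed

lemma Klg: "K \<le> K * lg" "lg \<le> K * lg" "1 \<le> K * lg"
proof -
  show 1: "K \<le> K * lg" using mult_left_mono[of 1 lg K] lg K_ge by simp
  show "lg \<le> K * lg" using mult_right_mono[of 1 K lg] lg K_ge by simp
  show "1 \<le> K * lg" using 1 K_ge by linarith
qed

lemma P_le: "real P \<le> (4 * CB + C + 11) * (K * lg)"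
proof -
  have "real P = 2 * real B + 2 ^ a + real D + 2 * real a + real N + 1" by (simp add: P_def b_def)
  also have "\<dots> \<le> 4 * (CB * K) + 8 * lg + C * K + 1"
    using B_bounds(2) lg(4,6) Da(2) N_w(5) by linarith
  also have "\<dots> = (4 * CB + C) * K + 8 * lg + 1" by (simp add: algebra_simps)
  also have "\<dots> \<le> (4 * CB + C) * (K * lg) + 8 * (K * lg) + K * lg"
    using Klg CB(1) C by (intro add_mono mult_left_mono) auto
  also have "\<dots> = (4 * CB + C + 9) * (K * lg)" by (simp add: algebra_simps)
  also have "\<dots> \<le> (4 * CB + C + 11) * (K * lg)" using Klg by (intro mult_right_mono) auto
  finally show ?thesis .
qed

lemma reps_le: "real D * (2 * a) * (u + 1) \<le> 4 * (real u + 1) * lg"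
proof -
  have "real D * (2 * a) * (u + 1) = 2 * (real u + 1) * (real D * a)" by (simp add: algebra_simps)
  also have "\<dots> \<le> 2 * (real u + 1) * (2 * lg)" using Da by (intro mult_left_mono) auto
  also have "\<dots> = 4 * (real u + 1) * lg" by (simp add: algebra_simps)
  finally show ?thesis .
qed

lemma width_le: "real (shape.width a u D s) \<le> (8 + s + 4 * (real u + 1)) * lg"
proof -
  have "real (shape.width a u D s) = (8 + real s) * 1 + real D * (2 * a) * (u + 1)"
    by (simp add: shape.width_def shape.npar_def shape.reps_def algebra_simps)
  also have "\<dots> \<le> (8 + real s) * lg + 4 * (real u + 1) * lg"
    using lg(1) reps_le by (intro add_mono mult_left_mono) auto
  finally show ?thesis by (simp add: distrib_right)
qed

lemma m_le: "real m \<le> ((8 + s) * (4 * CB + C + 11) + 8 * (real u + 1) * CB) * (K * lg)"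
proof -
  have "real D * (2 * a) * (u + 1) * B \<le> (4 * (real u + 1) * lg) * (2 * CB * K)"
    by (rule mult_mono[OF reps_le B_bounds(2)]) (use lg(1) in simp_all)
  moreover have "(8 + real s) * P \<le> (8 + real s) * ((4 * CB + C + 11) * (K * lg))"
    using P_le by (intro mult_left_mono) auto
  ultimately have "real m \<le> (8 + real s) * ((4 * CB + C + 11) * (K * lg)) + (4 * (real u + 1) * lg) * (2 * CB * K)"
    unfolding m_eq by linarith
  also have "\<dots> = ((8 + s) * (4 * CB + C + 11) + 8 * (real u + 1) * CB) * (K * lg)" by (simp add: algebra_simps)
  finally show ?thesis .
qed

text \<open>The time bound is stated with the actual number of rows, so a lower bound on it is
  required.\<close>

lemma m_ge: "K * lg \<le> real m"
proof -
  have "K * lg \<le> real B * (real D * a)" using B_bounds(4) lg K_ge by (intro mult_mono) auto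
  also have "\<dots> = 1 * (real B * (real D * a))" by simp
  also have "\<dots> \<le> (2 * (real u + 1)) * (real B * (real D * a))" by (intro mult_right_mono) simp_all
  also have "\<dots> = real D * (2 * a) * (u + 1) * B" by (simp add: algebra_simps)
  also have "\<dots> \<le> real m" unfolding m_eq by simp
  finally show ?thesis .
qed

text \<open>Up to constants the leading term is B (D a) (2^a a), and both brackets are O(lg). This
  is why the branching and the repetitions have to be balanced as in
  \<open>depth_exists\<close>.\<close>

lemma time_le:
  assumes "t \<le> (4 * u + 95) * (D * B * b * (2 * a)\<^sup>2) + (18 * s + 40) * B"
  shows "real t \<le> (256 * (4 * real u + 95) + 36 * s + 80) * CB * (real m * lg)"
proof -
  have CB0: "0 \<le> CB" using CB by simp
  have "real t \<le> real ((4 * u + 95) * (D * B * b * (2 * a)\<^sup>2) + (18 * s + 40) * B)" using assms by (rule of_nat_mono)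
  also have "\<dots> = (4 * real u + 95) * (4 * (real B * ((real D * a) * (2 ^ a * real a)))) + (18 * real s + 40) * B"
    by (simp add: b_def power2_eq_square)
  also have "\<dots> \<le> (4 * real u + 95) * (4 * ((2 * CB * K) * ((2 * lg) * (16 * lg)))) + (18 * real s + 40) * (2 * CB * K)"
  proof -
    have lg0: "0 \<le> lg" "0 \<le> CB * K" using lg K_ge CB0 by simp_all
    have "(real D * a) * (2 ^ a * real a) \<le> (2 * lg) * (16 * lg)"
      by (rule mult_mono[OF Da(1) lg(5)]) (use lg0 in simp_all)
    then have "real B * ((real D * a) * (2 ^ a * real a)) \<le> (2 * CB * K) * ((2 * lg) * (16 * lg))"
      by (rule mult_mono[OF B_bounds(2)]) (use lg0 in simp_all)
    then have "(4 * real u + 95) * (4 * (real B * ((real D * a) * (2 ^ a * real a)))) \<le>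
        (4 * real u + 95) * (4 * ((2 * CB * K) * ((2 * lg) * (16 * lg))))"
      by (intro mult_left_mono) simp_all
    moreover have "(18 * real s + 40) * B \<le> (18 * real s + 40) * (2 * CB * K)"
      by (intro mult_left_mono B_bounds) simp
    ultimately show ?thesis by (rule add_mono)
  qed
  also have "\<dots> = (256 * (4 * real u + 95)) * CB * (K * lg * lg) + (36 * real s + 80) * CB * K" by (simp add: algebra_simps)
  also have "\<dots> \<le> (256 * (4 * real u + 95)) * CB * (K * lg * lg) + (36 * real s + 80) * CB * (K * lg * lg)"
  proof (intro add_left_mono mult_left_mono)
    have "K * lg * 1 \<le> K * lg * lg" using lg K_ge by (intro mult_left_mono) auto
    then show "K \<le> K * lg * lg" using Klg(1) by linarith
  qed (use CB0 in auto)
  also have "\<dots> = (256 * (4 * real u + 95) + 36 * s + 80) * CB * (K * lg * lg)" by (simp add: algebra_simps)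
  also have "\<dots> \<le> (256 * (4 * real u + 95) + 36 * s + 80) * CB * (real m * lg)"
    using m_ge lg CB0 by (intro mult_left_mono mult_right_mono) auto
  finally show ?thesis .
qed

text \<open>Built from the fixed constants only, so one power of \<open>n\<close> will bound all
  words.\<close>

definition W0 :: nat where
  "W0 = nat \<lceil>real u + s + 20 + 40 * CB + 130 * CB + 2 * (4 * CB + C + 11) + C + 2 * (8 + s + 4 * (real u + 1))\<rceil>"

text \<open>The cube comes from the largest child number: b B b^D is O(n 4^a), because b^D is at
  most 2^a n / K, and 2^a is O(n).\<close>

lemma word_bounds:
  assumes W: "W0 * n ^ 3 \<le> W"
  shows "2 * a \<le> W" "b \<le> W" "u + 1 \<le> W" "(D + 1) * (2 * B) \<le> W" "n + b * (B * b ^ D) \<le> W"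
    "P \<le> W" "N \<le> W" "shape.width a u D s \<le> W" "n \<le> W" "s \<le> W"
proof -
  define S where "S = real u + s + 20 + 40 * CB + 130 * CB + 2 * (4 * CB + C + 11) + C + 2 * (8 + s + 4 * (real u + 1))"
  define n3 where "n3 = real n ^ 3"
  have W0: "S \<le> real W0" unfolding W0_def S_def[symmetric] by linarith
  have CB0: "0 \<le> CB" "0 \<le> C" using CB C by simp_all
  have n1: "1 \<le> real n" using n by simp
  have n3: "1 \<le> n3" "real n \<le> n3" "real n * real n \<le> n3"
    unfolding n3_def using n1 power_increasing[of 0 3 "real n"] power_increasing[of 1 3 "real n"] power_increasing[of 2 3 "real n"]
    by (simp_all add: power2_eq_square)
  have K0: "0 < K" using K_ge by linarith
  have bnd: "X \<le> W" if "real X \<le> c * n3" "c \<le> S" for X :: nat and c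
  proof -
    have "real X \<le> real W0 * n3" using that W0 n3(1) mult_right_mono[of c "real W0" n3] by linarith
    then have "real X \<le> real (W0 * n ^ 3)" by (simp add: n3_def)
    then have "X \<le> W0 * n ^ 3" by (simp only: of_nat_le_iff)
    then show ?thesis using W by (rule order_trans)
  qed
  have lin: "c * y \<le> c * n3" if "0 \<le> c" "y \<le> n3" for c y using that by (rule mult_left_mono[rotated])
  have a2: "real a \<le> 2 * n" "2 ^ a \<le> 8 * real n" "real D \<le> 4 * n" using lg Da by linarith+
  show "2 * a \<le> W" using a2(1) n3(2) CB0 by (intro bnd[of _ 4]) (auto simp: S_def)
  show "b \<le> W" using a2(2) n3(2) CB0 by (intro bnd[of _ 8]) (auto simp: S_def b_def)
  show "u + 1 \<le> W" using lin[of "real u + 1" 1] n3(1) CB0 by (intro bnd[of _ "real u + 1"]) (simp_all add: S_def algebra_simps)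
  show "s \<le> W" using lin[of "real s" 1] n3(1) CB0 by (intro bnd[of _ "real s"]) (auto simp: S_def)
  show "n \<le> W" using n3(2) CB0 by (intro bnd[of _ 1]) (auto simp: S_def)
  have Bn: "real B \<le> 2 * CB * n" using B_bounds(2) K_n mult_left_mono[of K n "2 * CB"] CB0 by linarith
  show "(D + 1) * (2 * B) \<le> W"
  proof (rule bnd)
    have "real ((D + 1) * (2 * B)) \<le> (5 * real n) * (2 * (2 * CB * n))"
      unfolding of_nat_mult using a2(3) n1 Bn by (intro mult_mono) auto
    also have "\<dots> = (20 * CB) * (real n * real n)" by simp
    also have "\<dots> \<le> (20 * CB) * n3" using CB0 n3 by (intro lin) auto
    finally show "real ((D + 1) * (2 * B)) \<le> (20 * CB) * n3" .
  qed (use CB0 in \<open>simp add: S_def\<close>)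
  show "n + b * (B * b ^ D) \<le> W"
  proof (rule bnd)
    have "real (b ^ D) = 2 powr (real D * a)" by (simp add: b_def powr_realpow[symmetric] powr_powr mult.commute)
    also have "\<dots> \<le> 2 powr (lg + a)" using lg(3) by (intro powr_mono) auto
    also have "\<dots> = n / K * 2 ^ a" by (simp add: powr_add powr_lg powr_realpow)
    finally have bD: "real (b ^ D) \<le> n / K * 2 ^ a" .
    have "real (b * (B * b ^ D)) = 2 ^ a * (real B * real (b ^ D))" by (simp add: b_def)
    also have "\<dots> \<le> 2 ^ a * ((2 * CB * K) * (n / K * 2 ^ a))"
      using bD B_bounds(2) K0 CB0 by (intro mult_left_mono mult_mono) auto
    also have "\<dots> = 2 * CB * n * (2 ^ a * 2 ^ a)" using K0 by simp
    also have "\<dots> \<le> 2 * CB * n * ((8 * real n) * (8 * real n))"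
      using a2(2) CB0 by (intro mult_left_mono mult_mono) auto
    also have "\<dots> = 128 * CB * n3" by (simp add: n3_def power3_eq_cube)
    finally have "real (b * (B * b ^ D)) \<le> 128 * CB * n3" .
    then show "real (n + b * (B * b ^ D)) \<le> (1 + 128 * CB) * n3" using n3(2) by (simp add: distrib_right)
  qed (use CB0 in \<open>simp add: S_def\<close>)
  have Kl: "K * lg \<le> 2 * (real n * real n)"
    using mult_mono[OF K_n lg(7)] lg(1) by simp
  show "P \<le> W"
  proof (rule bnd)
    have "real P \<le> (4 * CB + C + 11) * (2 * (real n * real n))"
      using P_le mult_left_mono[OF Kl, of "4 * CB + C + 11"] CB0 by linarith
    also have "\<dots> = (2 * (4 * CB + C + 11)) * (real n * real n)" by simp
    also have "\<dots> \<le> (2 * (4 * CB + C + 11)) * n3" using CB0 n3 by (intro lin) auto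
    finally show "real P \<le> (2 * (4 * CB + C + 11)) * n3" .
  qed (use CB0 in \<open>simp add: S_def\<close>)
  show "N \<le> W"
  proof (rule bnd)
    have "real N \<le> C * n" using N_w(5) mult_left_mono[OF K_n, of C] CB0 by linarith
    also have "\<dots> \<le> C * n3" using CB0 n3 by (intro lin) auto
    finally show "real N \<le> C * n3" .
  qed (use CB0 in \<open>simp add: S_def\<close>)
  show "shape.width a u D s \<le> W"
  proof (rule bnd)
    have "real (shape.width a u D s) \<le> (8 + s + 4 * (real u + 1)) * (2 * n)"
      by (rule order_trans[OF width_le mult_left_mono[OF lg(7)]]) simp
    also have "\<dots> = (2 * (8 + s + 4 * (real u + 1))) * n" by simp
    also have "\<dots> \<le> (2 * (8 + s + 4 * (real u + 1))) * n3" using n3 by (intro lin) auto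
    finally show "real (shape.width a u D s) \<le> (2 * (8 + s + 4 * (real u + 1))) * n3" .
  qed (use CB0 in \<open>simp add: S_def\<close>)
qed

lemma decoding:
  assumes z: "z \<in> set_pmf Z" and W: "W0 * n ^ 3 \<le> W"
  shows "\<exists>t J. finds W (Main_prog u s) (input n k m \<epsilon> C (shape.mat n B a u b D N s P z) (matvec n (shape.mat n B a u b D N s P z) x))
      t ((!) (scheme.cands n B a u b x (fst z) D) ` J) \<and>
    real t \<le> (256 * (4 * real u + 95) + 36 * s + 80) * CB * (real m * lg) \<and>
    selects (\<lambda>j. scheme.score n a x (scheme.Mod B b D) (fst z (D - 1)) (scheme.cands n B a u b x (fst z) D ! j))
       (length (scheme.cands n B a u b x (fst z) D)) N (snd z ` {..<s}) J \<and>
    (!) (scheme.cands n B a u b x (fst z) D) ` J \<subseteq> {..<n} \<and>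
    real (card ((!) (scheme.cands n B a u b x (fst z) D) ` J)) \<le> C * K"
proof -
  interpret ly: layout n B M a u b D x N s P "fst z" "snd z" by (rule layout[OF z])
  obtain t J where f: "finds W (Main_prog u s) (input n k ly.rows \<epsilon> C ly.\<Phi> (matvec n ly.\<Phi> x)) t ((!) (ly.cands (fst z) D) ` J)"
    and t: "t \<le> machine.T_main b (2 * a) B (2 * B) u D s"
    and sel: "selects (\<lambda>j. ly.score (ly.Mod D) (fst z (D - 1)) (ly.cands (fst z) D ! j)) (length (ly.cands (fst z) D)) N (snd z ` {..<s}) J"
    using ly.decoder_finds[of W k \<epsilon> C] word_bounds[OF W] by blast
  have J: "card J \<le> N" "J \<subseteq> {..<length (ly.cands (fst z) D)}" using selects_card[OF sel] by auto
  have "(!) (ly.cands (fst z) D) ` J \<subseteq> {..<n}"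
  proof
    fix i assume "i \<in> (!) (ly.cands (fst z) D) ` J"
    then have "i \<in> set (ly.cands (fst z) D)" using J(2) by (auto simp: set_conv_nth)
    then show "i \<in> {..<n}" using ly.cands_props[of "fst z" D] by auto
  qed
  moreover have "real (card ((!) (ly.cands (fst z) D) ` J)) \<le> C * K"
  proof -
    have "card ((!) (ly.cands (fst z) D) ` J) \<le> card J" using J(2) by (intro card_image_le) (auto intro: finite_subset)
    then have "real (card ((!) (ly.cands (fst z) D) ` J)) \<le> real N" using J(1) by linarith
    then show ?thesis using N_w(5) by linarith
  qed
  moreover have "real t \<le> (256 * (4 * real u + 95) + 36 * s + 80) * CB * (real m * lg)"
  proof (rule time_le)
    interpret mc: machine W n b "2 * a" B "2 * B" ly.width P u D s ly.rowf ly.yf ly.entf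
      using word_bounds[OF W] u(1) by unfold_locales (auto simp: b_def)
    have "mc.T_main \<le> (4 * u + 95) * (D * B * b * (2 * a)\<^sup>2) + (18 * s + 40) * B"
      using a B_bounds(3) by (intro mc.T_main_le) auto
    then show "t \<le> (4 * u + 95) * (D * B * b * (2 * a)\<^sup>2) + (18 * s + 40) * B" using t by linarith
  qed
  ultimately show ?thesis using f sel unfolding m_def by (intro exI[of _ t] exI[of _ J]) simp
qed

end


context sized_design
begin

definition law :: "matrix measure" where
  "law = distr (measure_pmf Z) (Pi\<^sub>M ({..<m} \<times> {..<n}) (\<lambda>_. borel)) (shape.mat n B a u b D N s P)"

lemma extensional_mat: "shape.mat n B a u b D N s P z \<in> extensional ({..<m} \<times> {..<n})"
  unfolding shape.mat_def m_def by simp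

lemma random_matrix_law: "random_matrix m n law"
  unfolding law_def by (rule distr_pmf_matrix(1)[OF finite_Z extensional_mat])

lemma law_column_sparsity:
  "AE \<Phi> in law. real (column_sparsity m n \<Phi>) \<le> (8 + s + 4 * (real u + 1)) * lg"
  unfolding law_def
proof (rule distr_pmf_matrix(2)[OF finite_Z extensional_mat])
  fix z assume "z \<in> set_pmf Z"
  then interpret layout n B M a u b D "\<lambda>_. 0" N s P "fst z" "snd z" by (rule layout)
  show "real (column_sparsity m n (shape.mat n B a u b D N s P z)) \<le> (8 + s + 4 * (real u + 1)) * lg"
    using column_sparsity_mat width_le by (simp add: m_def)
qed

lemma law_decoding:
  assumes W: "W0 * n ^ 3 \<le> W"
  shows "AE \<Phi> in law. \<exists>t L. finds W (Main_prog u s) (input n k m \<epsilon> C \<Phi> (matvec n \<Phi> x)) t L \<and>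
      real t \<le> (256 * (4 * real u + 95) + 36 * s + 80) * CB * (real m * lg) \<and> L \<subseteq> {..<n} \<and> real (card L) \<le> C * K"
    and "holds_with_prob law (9 / 10) (\<lambda>\<Phi>. \<exists>t L. finds W (Main_prog u s) (input n k m \<epsilon> C \<Phi> (matvec n \<Phi> x)) t L \<and>
      (\<exists>T\<subseteq>L. card T \<le> k \<and>
        L2_set (\<lambda>i. x i - zero_outside T x i) {..<n} \<le> (1 + \<epsilon>) * L2_set (tail n x k) {..<n}))"
proof -
  show "AE \<Phi> in law. \<exists>t L. finds W (Main_prog u s) (input n k m \<epsilon> C \<Phi> (matvec n \<Phi> x)) t L \<and>
      real t \<le> (256 * (4 * real u + 95) + 36 * s + 80) * CB * (real m * lg) \<and> L \<subseteq> {..<n} \<and> real (card L) \<le> C * K"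
    unfolding law_def
  proof (rule distr_pmf_matrix(2)[OF finite_Z extensional_mat], goal_cases)
    case (1 z)
    show ?case using decoding[OF 1 W, of x] by (elim exE conjE) (intro exI conjI)
  qed
  show "holds_with_prob law (9 / 10) (\<lambda>\<Phi>. \<exists>t L. finds W (Main_prog u s) (input n k m \<epsilon> C \<Phi> (matvec n \<Phi> x)) t L \<and>
      (\<exists>T\<subseteq>L. card T \<le> k \<and>
        L2_set (\<lambda>i. x i - zero_outside T x i) {..<n} \<le> (1 + \<epsilon>) * L2_set (tail n x k) {..<n}))"
    unfolding law_def
  proof (rule distr_pmf_matrix(3)[OF finite_Z extensional_mat success[of x]], goal_cases)
    case (1 z)
    obtain t J where f: "finds W (Main_prog u s) (input n k m \<epsilon> C (shape.mat n B a u b D N s P z) (matvec n (shape.mat n B a u b D N s P z) x))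
        t ((!) (scheme.cands n B a u b x (fst z) D) ` J)"
      and J: "selects (\<lambda>j. scheme.score n a x (scheme.Mod B b D) (fst z (D - 1)) (scheme.cands n B a u b x (fst z) D ! j))
       (length (scheme.cands n B a u b x (fst z) D)) N (snd z ` {..<s}) J"
      using decoding[OF 1(1) W, of x] by (elim exE conjE) (rule that)
    show ?case by (rule exI, rule exI, rule conjI, rule f, rule 1(2)[rule_format, OF J])
  qed
qed

end

section \<open>Existence of the constants and assembly of the theorem\<close>

lemma power_le_exists:
  fixes r e :: real
  assumes "0 < e" "0 \<le> r" "r < 1"
  obtains j :: nat where "r ^ j \<le> e"
  using real_arch_pow_inv[of e r] assms by (metis less_imp_le)

text \<open>There is no circularity: \<open>g\<close> depends on \<open>c2\<close> only,
  \<open>u\<close> on nothing, \<open>CB\<close> on these three, and \<open>s\<close> on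
  \<open>CB\<close> and \<open>c2\<close>.\<close>

lemma constants_exist:
  fixes C c2 :: real
  assumes C: "1 < C" and c2: "c2 = (C - 1) / 4"
  obtains g CB :: real and u s CM :: nat where
    "g = min 1 (sqrt c2) / 16" "0 < u" "(1 - 1 / 2 ^ 14) ^ u \<le> (1 / 2 ^ 14 :: real)"
    "2 \<le> CB" "c2 \<le> CB" "1600 * u * (1 + 4 * 2 ^ 30) \<le> CB"
    "160 * (1 + 4 / g\<^sup>2) * (8 * (1 / sqrt c2 + g) + 2 / 2 ^ 15) \<le> CB" "8 * (1 + 4 / g\<^sup>2) \<le> CB"
    "25600 * (1 + 4 / g\<^sup>2)\<^sup>2 / c2 \<le> CB" "(1 - c2 / (4 * CB)) ^ s \<le> 1 / 100"
    "100 * (4 * 18 + (8 * (1 / sqrt c2 + g) * 2 ^ 15 + 2)) \<le> real CM"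
proof -
  have c2p: "0 < c2" using C c2 by simp
  define g where "g = min 1 (sqrt c2) / 16"
  have gp: "0 < g" using c2p by (simp add: g_def)
  obtain u :: nat where u: "(1 - 1 / 2 ^ 14) ^ u \<le> (1 / 2 ^ 14 :: real)"
    by (rule power_le_exists[of "1 / 2 ^ 14" "1 - 1 / 2 ^ 14"]) simp_all
  have u0: "0 < u" using u by (cases u) simp_all
  define y1 y2 y3 y4 where "y1 = real (1600 * u * (1 + 4 * 2 ^ 30))"
    and "y2 = 160 * (1 + 4 / g\<^sup>2) * (8 * (1 / sqrt c2 + g) + 2 / 2 ^ 15)"
    and "y3 = 8 * (1 + 4 / g\<^sup>2)" and "y4 = 25600 * (1 + 4 / g\<^sup>2)\<^sup>2 / c2"
  have y1: "0 \<le> y1" unfolding y1_def by (rule of_nat_0_le_iff)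
  have c: "0 \<le> 1 + 4 / g\<^sup>2" by simp
  have "0 \<le> 8 * (1 / sqrt c2 + g) + 2 / 2 ^ 15" using gp c2p by simp
  then have y: "0 \<le> y2" "0 \<le> y3" "0 \<le> y4"
    unfolding y2_def y3_def y4_def using c c2p by simp_all
  define CB where "CB = 2 + c2 + y1 + y2 + y3 + y4"
  have CB: "2 \<le> CB" "c2 \<le> CB" "y1 \<le> CB" "y2 \<le> CB" "y3 \<le> CB" "y4 \<le> CB"
    using y y1 c2p unfolding CB_def by linarith+
  have q: "0 < c2 / (4 * CB)" "c2 / (4 * CB) \<le> 1" using CB(1,2) c2p by (simp_all add: divide_le_eq_1)
  obtain s :: nat where s: "(1 - c2 / (4 * CB)) ^ s \<le> 1 / 100"
    by (rule power_le_exists[of "1 / 100" "1 - c2 / (4 * CB)"]) (use q in simp_all)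
  obtain CM :: nat where CM: "100 * (4 * 18 + (8 * (1 / sqrt c2 + g) * 2 ^ 15 + 2)) \<le> real CM"
    using real_arch_simple by blast
  show ?thesis by (rule that[OF g_def u0 u CB[unfolded y1_def y2_def y3_def y4_def] s CM])
qed

lemma log_le_twice:
  assumes "1 \<le> (n::real)"
  shows "log 2 n \<le> 2 * n"
proof -
  have l2: "1 / 2 \<le> ln (2::real)" using ln2_ge_two_thirds by linarith
  have "log 2 n = ln n / ln 2" by (simp add: log_def)
  also have "\<dots> \<le> ln n / (1 / 2)" using l2 assms by (intro divide_left_mono) auto
  also have "\<dots> = 2 * ln n" by simp
  also have "\<dots> \<le> 2 * n" using ln_le_minus_one[of n] assms by simp
  finally show ?thesis .
qed

theorem theoremA1:
  fixes C\<^sub>L :: real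
  assumes "C\<^sub>L > 1"
  shows "\<exists>(P :: com) (w :: nat) (C\<^sub>1 :: real) (C\<^sub>2 :: real) (C\<^sub>3 :: real).
    \<forall>(n :: nat) (k :: nat) (\<epsilon> :: real).
      n > 0 \<and> k > 0 \<and> 0 < \<epsilon> \<and> \<epsilon> < 1 \<and> real k / \<epsilon> \<le> real n / 16 \<longrightarrow>
      (\<exists>(m :: nat) (D :: matrix measure).
        random_matrix m n D \<and>
        real m \<le> C\<^sub>1 * (real k / \<epsilon> * ln (\<epsilon> * real n / real k)) \<and>
        (AE \<Phi> in D. real (column_sparsity m n \<Phi>) \<le> C\<^sub>2 * ln (\<epsilon> * real n / real k)) \<and>
        (\<forall>x :: nat \<Rightarrow> real.
          (AE \<Phi> in D. \<exists>t L.
             finds (n ^ w) P (input n k m \<epsilon> C\<^sub>L \<Phi> (matvec n \<Phi> x)) t L \<and>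
             real t \<le> C\<^sub>3 * (real m * ln (real n / real k)) \<and>
             L \<subseteq> {..<n} \<and> real (card L) \<le> C\<^sub>L * (real k / \<epsilon>)) \<and>
          holds_with_prob D (9 / 10) (\<lambda>\<Phi>. \<exists>t L.
             finds (n ^ w) P (input n k m \<epsilon> C\<^sub>L \<Phi> (matvec n \<Phi> x)) t L \<and>
             (\<exists>T. T \<subseteq> L \<and> card T \<le> k \<and>
                L2_set (\<lambda>i. x i - zero_outside T x i) {..<n}
                  \<le> (1 + \<epsilon>) * L2_set (tail n x k) {..<n}))))"
proof -
  define c2 where "c2 = (C\<^sub>L - 1) / 4"
  obtain g CB :: real and u s CM :: nat where const:
    "g = min 1 (sqrt c2) / 16" "0 < u" "(1 - 1 / 2 ^ 14) ^ u \<le> (1 / 2 ^ 14 :: real)"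
    "2 \<le> CB" "c2 \<le> CB" "1600 * u * (1 + 4 * 2 ^ 30) \<le> CB"
    "160 * (1 + 4 / g\<^sup>2) * (8 * (1 / sqrt c2 + g) + 2 / 2 ^ 15) \<le> CB" "8 * (1 + 4 / g\<^sup>2) \<le> CB"
    "25600 * (1 + 4 / g\<^sup>2)\<^sup>2 / c2 \<le> CB" "(1 - c2 / (4 * CB)) ^ s \<le> 1 / 100"
    "100 * (4 * 18 + (8 * (1 / sqrt c2 + g) * 2 ^ 15 + 2)) \<le> real CM"
    by (rule constants_exist[OF assms c2_def])
  \<comment> \<open>Since \<open>n\<close> \<ge> 2, the constant \<open>W0\<close> is at most n^W0;
    the remaining exponent 3 is that of the word bounds.\<close>
  define w where "w = sized_design.W0 C\<^sub>L CB u s + 3"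
  define C1 where "C1 = (8 + s) * (4 * CB + C\<^sub>L + 11) + 8 * (real u + 1) * CB"
  define C2 where "C2 = 8 + s + 4 * (real u + 1)"
  define C3 where "C3 = (256 * (4 * real u + 95) + 36 * s + 80) * CB"
  show ?thesis
  \<comment> \<open>The program depends on \<open>u\<close> and \<open>s\<close> only; everything
    that varies with \<open>n\<close>, \<open>k\<close> and \<open>\<epsilon>\<close> is read from
    the input. Dividing by ln 2 passes from binary to natural logarithms.\<close>
  proof (rule exI[of _ "Main_prog u s"], rule exI[of _ w], rule exI[of _ "C1 / ln 2"],
      rule exI[of _ "C2 / ln 2"], rule exI[of _ "C3 / ln 2"], intro allI impI)
    fix n k :: nat and \<epsilon> :: real
    assume prem: "n > 0 \<and> k > 0 \<and> 0 < \<epsilon> \<and> \<epsilon> < 1 \<and> real k / \<epsilon> \<le> real n / 16"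
    define K where "K = real k / \<epsilon>"
    define lg where "lg = log 2 (n / K)"
    have K0: "0 < K" using prem by (simp add: K_def)
    have nK: "16 \<le> n / K" using prem K0 by (simp add: K_def[symmetric] le_divide_eq)
    have "real k * \<epsilon> \<le> real k * 1" using prem by (intro mult_left_mono) auto
    then have kK: "real k \<le> K" using prem by (simp add: K_def le_divide_eq)
    have k1: "1 \<le> real k" using prem by simp
    have pow: "2 powr lg = n / K" using nK by (simp add: lg_def)
    have lg4: "4 \<le> lg"
    proof -
      have "log 2 16 \<le> lg" unfolding lg_def using nK by (subst log_le_cancel_iff) auto
      moreover have "log 2 16 = (4::real)" using log_pow_cancel[of "2::real" 4] by simp
      ultimately show ?thesis by simp
    qed
    have "n / K \<le> n / k" using kK k1 by (intro divide_left_mono) auto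
    moreover have "n / k \<le> real n / 1" using k1 by (intro divide_left_mono) auto
    ultimately have nKn: "n / K \<le> n / k" "n / K \<le> real n" by simp_all
    have ln: "lg = ln (\<epsilon> * n / k) / ln 2" "lg \<le> ln (n / k) / ln 2"
    proof -
      show "lg = ln (\<epsilon> * n / k) / ln 2" by (simp add: lg_def log_def K_def mult.commute)
      have "ln (n / K) \<le> ln (n / k)" using nKn(1) nK by (subst ln_le_cancel_iff) auto
      then show "lg \<le> ln (n / k) / ln 2" by (simp add: lg_def log_def divide_right_mono)
    qed
    have lgn: "lg \<le> 2 * n"
      unfolding lg_def using log_le_twice[of "n / K"] nK nKn(2) by linarith
    obtain a D :: nat where aD: "4 \<le> a" "0 < D" "D \<le> 4 ^ a" "lg \<le> real D * a" "real D * a \<le> lg + a" "real a \<le> lg"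
      "2 ^ a * real a \<le> 16 * lg" "2 ^ a \<le> 4 * lg"
      by (rule depth_exists[OF lg4])
    have "n / K \<le> 2 powr (real D * a)" unfolding pow[symmetric] using aD(4) by (intro powr_mono) auto
    also have "\<dots> = 2 ^ (D * a)" using powr_realpow[of 2 "D * a"] by simp
    finally have nD: "n / K \<le> 2 ^ (D * a)" .
    have Kn: "K \<le> n" using nK K0 by (simp add: le_divide_eq)
    interpret ds: design n k \<epsilon> "C\<^sub>L" c2 g CB u s CM a D
      by unfold_locales (use prem assms c2_def const aD nD in \<open>simp_all only: K_def\<close>)
    have dK: "ds.K = K" by (simp add: ds.K_def K_def)
    interpret sd: sized_design n k \<epsilon> "C\<^sub>L" c2 g CB u s CM a D lg
      by unfold_locales (use lg4 aD lgn pow Kn in \<open>simp_all only: dK\<close>)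
    have W: "sd.W0 * n ^ 3 \<le> n ^ w"
    proof -
      have "2 \<le> n" using nK nKn(2) by linarith
      then have "2 ^ sd.W0 \<le> n ^ sd.W0" by (rule power_mono) simp
      then have "sd.W0 \<le> n ^ sd.W0" using less_exp[of sd.W0] by linarith
      then show ?thesis by (simp add: w_def power_add)
    qed
    have C3: "0 \<le> C3" using const(4) by (simp add: C3_def)
    show "\<exists>(m :: nat) (D :: matrix measure).
        random_matrix m n D \<and>
        real m \<le> C1 / ln 2 * (real k / \<epsilon> * ln (\<epsilon> * real n / real k)) \<and>
        (AE \<Phi> in D. real (column_sparsity m n \<Phi>) \<le> C2 / ln 2 * ln (\<epsilon> * real n / real k)) \<and>
        (\<forall>x :: nat \<Rightarrow> real.
          (AE \<Phi> in D. \<exists>t L.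
             finds (n ^ w) (Main_prog u s) (input n k m \<epsilon> C\<^sub>L \<Phi> (matvec n \<Phi> x)) t L \<and>
             real t \<le> C3 / ln 2 * (real m * ln (real n / real k)) \<and>
             L \<subseteq> {..<n} \<and> real (card L) \<le> C\<^sub>L * (real k / \<epsilon>)) \<and>
          holds_with_prob D (9 / 10) (\<lambda>\<Phi>. \<exists>t L.
             finds (n ^ w) (Main_prog u s) (input n k m \<epsilon> C\<^sub>L \<Phi> (matvec n \<Phi> x)) t L \<and>
             (\<exists>T. T \<subseteq> L \<and> card T \<le> k \<and>
                L2_set (\<lambda>i. x i - zero_outside T x i) {..<n}
                  \<le> (1 + \<epsilon>) * L2_set (tail n x k) {..<n})))"
    proof (rule exI[of _ sd.m], rule exI[of _ sd.law], intro conjI allI)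
      show "random_matrix sd.m n sd.law" by (rule sd.random_matrix_law)
      show "real sd.m \<le> C1 / ln 2 * (real k / \<epsilon> * ln (\<epsilon> * real n / real k))"
        using sd.m_le unfolding C1_def[symmetric] dK K_def ln(1) by (simp add: mult.commute)
      show "AE \<Phi> in sd.law. real (column_sparsity sd.m n \<Phi>) \<le> C2 / ln 2 * ln (\<epsilon> * real n / real k)"
        using sd.law_column_sparsity unfolding C2_def[symmetric] ln(1) by simp
      fix x :: "nat \<Rightarrow> real"
      \<comment> \<open>The analysis yields the logarithm of \<epsilon> n / k, which is at most that
        of n / k.\<close>
      have time: "real t \<le> C3 / ln 2 * (real sd.m * ln (real n / real k))"
        if "real t \<le> C3 * (real sd.m * lg)" for t
      proof -
        have "C3 * (real sd.m * lg) \<le> C3 * (real sd.m * (ln (n / k) / ln 2))"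
          using ln(2) C3 by (intro mult_left_mono) auto
        then show ?thesis using that by simp
      qed
      show "AE \<Phi> in sd.law. \<exists>t L. finds (n ^ w) (Main_prog u s) (input n k sd.m \<epsilon> C\<^sub>L \<Phi> (matvec n \<Phi> x)) t L \<and>
          real t \<le> C3 / ln 2 * (real sd.m * ln (real n / real k)) \<and>
          L \<subseteq> {..<n} \<and> real (card L) \<le> C\<^sub>L * (real k / \<epsilon>)"
        using sd.law_decoding(1)[OF W, of x] unfolding C3_def[symmetric] dK K_def
        by (rule AE_mp) (rule AE_I2, rule impI, elim exE conjE, intro exI conjI, assumption, rule time)
      show "holds_with_prob sd.law (9 / 10) (\<lambda>\<Phi>. \<exists>t L.
             finds (n ^ w) (Main_prog u s) (input n k sd.m \<epsilon> C\<^sub>L \<Phi> (matvec n \<Phi> x)) t L \<and>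
             (\<exists>T. T \<subseteq> L \<and> card T \<le> k \<and>
                L2_set (\<lambda>i. x i - zero_outside T x i) {..<n}
                  \<le> (1 + \<epsilon>) * L2_set (tail n x k) {..<n}))"
        by (rule sd.law_decoding(2)[OF W])
    qed
  qed
qed

end
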